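(* Let $\mathbb K=\mathbb C$ and $q\in\mathbb R_{>0}\setminus\{1\}$. Every simple $(\mathfrak g,K)_q$-module is equivalent to one and only one of the following simple modules: - $\mathrm{Ind}_q(\varepsilon,\lambda)$ for $\varepsilon\in\{-1,1\}$ and $\lambda\in\mathbb C^\times\setminus\{\pm q^n:n\in\mathbb Z^{-\varepsilon}\}$ such that $|\lambda|<1$; - $\mathrm{Ind}_q(1,\lambda)$ for $\lambda\in\mathbb C^\times$ such that $|\lambda|=1$ and $\mathrm{Im}\,\lambda\ge0$; - $\mathrm{Ind}_q(-1,\lambda)$ for $\lambda\in\mathbb C^\times$ such that $|\lambda|=1$ and $\mathrm{Im}\,\lambda>0$; - $D^+_{\sigma,n}$ and $D^-_{\sigma,n}$ for $n\in\mathbb Z_{\ge0}$, $\sigma\in\{-1,1\}$; - $Q_{\sigma,n}$ for $n\in\mathbb Z_{>0}$, $\sigma\in\{-1,1\}$.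
   Context: Base field $\mathbb K=\mathbb C$, $q\in\mathbb R_{>0}\setminus\{1\}$, and a fixed real square root $q^{1/2}$. Put $[n]_q=\frac{q^n-q^{-n}}{q-q^{-1}}$. $\mathbb Z^{1}$ is the set of even integers, $\mathbb Z^{-1}$ the set of odd integers. For a dual pairing between an algebra $A$ and a coalgebra $C$, put $a\triangleright c=c_{(1)}\langle a,c_{(2)}\rangle$, $c\triangleleft a=\langle a,c_{(1)}\rangle c_{(2)}$. $U_q(\mathfrak u)$ is the Hopf $*$-algebra generated by $E,F,k^{\pm1}$ with $kEk^{-1}=q^2E$, $kFk^{-1}=q^{-2}F$, $EF-FE=\frac{k-k^{-1}}{q-q^{-1}}$, $\Delta(E)=E\otimes1+k\otimes E$, $\Delta(F)=F\otimes k^{-1}+1\otimes F$, $\Delta(k)=k\otimes k$, $E^*=Fk$, $F^*=k^{-1}E$, $k^*=k$. $\mathcal O_q(U)$ is the Hopf $*$-algebra of matrix coefficients of finite dimensional type 1 $U_q(\mathfrak u)$-modules ($k$ diagonalizable with eigenvalues integer powers of $q$), with $\langle\varphi^*,x\rangle=\langle\varphi,S(x)^*\rangle^*$. It is generated by the entries of $u=(u_{\alpha\beta})_{1\le\alpha,\beta\le2}$ with $\langle u,E\rangle=\begin{pmatrix}0&q^{1/2}\\0&0\end{pmatrix}$, $\langle u,F\rangle=\begin{pmatrix}0&0\\ q^{-1/2}&0\end{pmatrix}$, $\langle u,k\rangle=\begin{pmatrix}q&0\\0&q^{-1}\end{pmatrix}$. Let $\theta=iq^{-1/2}(E-Fk)$,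 $U_q(\mathfrak k)=\mathbb K[\theta]\subset U_q(\mathfrak u)$ and $\mathcal O_q(K\backslash U)=\{y\in\mathcal O_q(U):y\triangleleft\theta=0\}$, a right coideal $*$-subalgebra generated by $X,Y,Z$ defined by $u^*\begin{pmatrix}0&-1\\1&0\end{pmatrix}u=\begin{pmatrix}iq^{-1}Z&-Y\\ X&-iqZ\end{pmatrix}$. $\mathcal O'_q(U)$ is the full linear dual of $\mathcal O_q(U)$ with the dual algebra structure, pointwise convergence topology, and $\langle\varphi,x\triangleleft y\rangle=\langle y\varphi,x\rangle$. $\mathcal O'_q(K)$ is the closure of $U_q(\mathfrak k)$ in it; $e_n\in\mathcal O'_q(K)$ is the idempotent acting on each finite dimensional type 1 module as the spectral projection of $\theta$ onto its $[n]_q$-eigenspace; $R_q(K)=\mathrm{span}(e_n:n\in\mathbb Z)$. $\mathcal O'_q(G)$ is the universal algebra containing $\mathcal O'_q(K)$ and $\mathcal O_q(K\backslash U)$ as unital subalgebras with $xy=y_{(1)}(x\triangleleft y_{(2)})$ for $y\in\mathcal O_q(K\backslash U)$, $x\in\mathcal O'_q(K)$, and $R_q(\mathfrak g,K)$ is its two-sided ideal generated by $R_q(K)$. A $(\mathfrak g,K)_q$-module is a non-degenerate $R_q(\mathfrak g,K)$-module ($R_q(\mathfrak g,K)V=V$); it is simple if $\{0\}$ is its only proper submodule. $R_q(\mathfrak p,M)\subset\mathcal O'_q(G)$ is the subalgebra generated by $\mathcal O_q(K\backslash U)$ and $(-1)_q=\sum_n(-1)^ne_n$. Let $k^{1/2}\in\mathcal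 O'_q(U)$ act on vectors of $k$-eigenvalue $q^n$ as $(q^{1/2})^n$, and let $J$ be the automorphism of $R_q(\mathfrak p,M)$ with $J((-1)_q)=(-1)_q$, $J(y)=k^{1/2}\triangleright y$ for $y\in\mathcal O_q(K\backslash U)$. For a unital $R_q(\mathfrak p,M)$-module $V$, $V_J$ is $V$ with action $x\cdot v=J(x)v$, and $\mathrm{Ind}_q(V)=R_q(\mathfrak g,K)\cdot\mathrm{Hom}_{R_q(\mathfrak p,M)}(R_q(\mathfrak g,K),V_J)$ with $(af)(a')=f(a'a)$. $\mathrm{Ind}_q(\varepsilon,\lambda)$ is $\mathrm{Ind}_q$ of the character of $R_q(\mathfrak p,M)$ with $(-1)_q\mapsto\varepsilon$, $X\mapsto\lambda$, $Y\mapsto\lambda^{-1}$, $Z\mapsto0$. It has a basis $(\zeta_n)_{n\in\mathbb Z^\varepsilon}$, where $\zeta_n$ is the unique element whose restriction to $R_q(K)$ is $e_m\mapsto\delta_{m,n}$. For $\sigma\in\{-1,1\}$ and $n\in\mathbb Z_{\ge0}$, with $\varepsilon=(-1)^{n+1}$: $D^+_{\sigma,n}=\mathrm{span}(\zeta_m:m\in\mathbb Z^\varepsilon,m>n)$ and $D^-_{\sigma,n}=\mathrm{span}(\zeta_m:m\in\mathbb Z^\varepsilon,m<-n)$, as submodules of $\mathrm{Ind}_q(\varepsilon,\sigma q^n)$; for $n>0$, $Q_{\sigma,n}=\mathrm{span}(\zeta_m:m\in\mathbb Z^\varepsilon,|m|<n)$ as a submodule of $\mathrm{Ind}_q(\varepsilon,\sigma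 q^{-n})$. *)

theory Defs
  imports
    "HOL-Analysis.Analysis"
    "HOL-Library.Poly_Mapping"
    "HOL-Library.Product_Plus"
    "HOL-Algebra.Algebra"
    "Jordan_Normal_Form.Matrix"
begin

section \<open>Free algebras\<close>

datatype 'g fmon = FMon (letters: "'g list")

instantiation fmon :: (type) monoid_add
begin
definition "0 = FMon []"
definition "v + w = FMon (letters v @ letters w)"
instance by standard (auto simp: zero_fmon_def plus_fmon_def)
end

text \<open>The free complex algebra on the generators of type \<^typ>\<open>'g\<close> is the monoid algebra of the
  free monoid (written additively). In the same way, the tensor square of that algebra is
  the monoid algebra of pairs of words.\<close>

type_synonym 'g fa = "'g fmon \<Rightarrow>\<^sub>0 complex"

definition fa_gen :: "'g \<Rightarrow> 'g fa" where
  "fa_gen g = Poly_Mapping.single (FMon [g]) 1"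

definition fa_const :: "complex \<Rightarrow> 'm::zero \<Rightarrow>\<^sub>0 complex" where
  "fa_const c = Poly_Mapping.single 0 c"

definition fa_lin :: "('k \<Rightarrow> complex) \<Rightarrow> ('k \<Rightarrow>\<^sub>0 complex) \<Rightarrow> complex" where
  "fa_lin f p = (\<Sum>w\<in>Poly_Mapping.keys p. Poly_Mapping.lookup p w * f w)"

definition fa_tensor :: "'g fa \<Rightarrow> 'g fa \<Rightarrow> ('g fmon \<times> 'g fmon) \<Rightarrow>\<^sub>0 complex" where
  "fa_tensor p r = (\<Sum>v\<in>Poly_Mapping.keys p. \<Sum>w\<in>Poly_Mapping.keys r.
     Poly_Mapping.single (v, w) (Poly_Mapping.lookup p v * Poly_Mapping.lookup r w))"

definition fa_hom :: "('g \<Rightarrow> 'm::monoid_add \<Rightarrow>\<^sub>0 complex) \<Rightarrow> 'g fa \<Rightarrow> 'm \<Rightarrow>\<^sub>0 complex" where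
  "fa_hom f p = (\<Sum>w\<in>Poly_Mapping.keys p.
     fa_const (Poly_Mapping.lookup p w) * prod_list (map f (letters w)))"

definition fa_antihom :: "('g \<Rightarrow> 'g fa) \<Rightarrow> 'g fa \<Rightarrow> 'g fa" where
  "fa_antihom f p = (\<Sum>w\<in>Poly_Mapping.keys p.
     fa_const (Poly_Mapping.lookup p w) * prod_list (map f (rev (letters w))))"

definition fa_conj_antihom :: "('g \<Rightarrow> 'g fa) \<Rightarrow> 'g fa \<Rightarrow> 'g fa" where
  "fa_conj_antihom f p = (\<Sum>w\<in>Poly_Mapping.keys p.
     fa_const (cnj (Poly_Mapping.lookup p w)) * prod_list (map f (rev (letters w))))"


section \<open>The Hopf *-algebra $U_q(\mathfrak u)$\<close>

text \<open>$U_q(\mathfrak u)$ is the quotient of the free algebra on \<^term>\<open>gE\<close>, \<^term>\<open>gF\<close>, \<^term>\<open>gK\<close>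
  $= k$, \<^term>\<open>gKi\<close> $= k^{-1}$ by the relations below. Its modules are the modules of the free
  algebra that kill the relations, and functionals on it are represented by functionals on
  the free algebra that vanish on the ideal of relations; this applies in particular to matrix
  coefficients. The Hopf *-structure is given on representatives. The antipode is the one
  determined by the comultiplication.

  Throughout, \<^term>\<open>s\<close> stands for the chosen real square root $q^{1/2}$.\<close>

datatype ugen = gE | gF | gK | gKi

type_synonym uq = "ugen fa"

abbreviation "uE \<equiv> fa_gen gE"
abbreviation "uF \<equiv> fa_gen gF"
abbreviation "uK \<equiv> fa_gen gK"
abbreviation "uKi \<equiv> fa_gen gKi"

definition uq_rels :: "real \<Rightarrow> uq set" where
  "uq_rels q =
    {uK * uKi - 1,
     uKi * uK - 1,
     uK * uE * uKi - fa_const (of_real (q powi 2)) * uE,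
     uK * uF * uKi - fa_const (of_real (q powi (-2))) * uF,
     uE * uF - uF * uE - fa_const (of_real (1 / (q - inverse q))) * (uK - uKi)}"

fun comult_gen :: "ugen \<Rightarrow> (ugen fmon \<times> ugen fmon) \<Rightarrow>\<^sub>0 complex" where
  "comult_gen gE = fa_tensor uE 1 + fa_tensor uK uE"
| "comult_gen gF = fa_tensor uF uKi + fa_tensor 1 uF"
| "comult_gen gK = fa_tensor uK uK"
| "comult_gen gKi = fa_tensor uKi uKi"

fun counit_gen :: "ugen \<Rightarrow> complex" where
  "counit_gen gE = 0"
| "counit_gen gF = 0"
| "counit_gen gK = 1"
| "counit_gen gKi = 1"

fun antipode_gen :: "ugen \<Rightarrow> uq" where
  "antipode_gen gE = - (uKi * uE)"
| "antipode_gen gF = - (uF * uK)"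
| "antipode_gen gK = uKi"
| "antipode_gen gKi = uK"

fun star_gen :: "ugen \<Rightarrow> uq" where
  "star_gen gE = uF * uK"
| "star_gen gF = uKi * uE"
| "star_gen gK = uK"
| "star_gen gKi = uKi"

definition "comult = fa_hom comult_gen"
definition "counit = fa_lin (\<lambda>w. prod_list (map counit_gen (letters w)))"
definition "antipode = fa_antihom antipode_gen"
definition "ustar = fa_conj_antihom star_gen"

definition qnum :: "real \<Rightarrow> int \<Rightarrow> real" where
  "qnum q n = (q powi n - q powi (-n)) / (q - inverse q)"

definition theta :: "real \<Rightarrow> uq" where
  "theta s = fa_const (\<i> / of_real s) * (uE - uF * uK)"

definition Uk :: "real \<Rightarrow> uq set" where
  "Uk s = {(\<Sum>i<m. fa_const (c i) * theta s ^ i) | (m::nat) c. True}"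


section \<open>Finite dimensional type 1 modules and $\mathcal O_q(U)$\<close>

text \<open>A module of dimension \<^term>\<open>n\<close> is given, in a chosen basis, by the \<^term>\<open>n\<close>-by-\<^term>\<open>n\<close>
  matrices of the generators.\<close>

definition rep_word :: "nat \<Rightarrow> (ugen \<Rightarrow> complex mat) \<Rightarrow> ugen fmon \<Rightarrow> complex mat" where
  "rep_word n \<rho> w = foldr (\<lambda>g A. \<rho> g * A) (letters w) (1\<^sub>m n)"

definition rep_mat :: "nat \<Rightarrow> (ugen \<Rightarrow> complex mat) \<Rightarrow> uq \<Rightarrow> complex mat" where
  "rep_mat n \<rho> x = Matrix.mat n n (\<lambda>(i, j). fa_lin (\<lambda>w. rep_word n \<rho> w $$ (i, j)) x)"

definition type1_module :: "real \<Rightarrow> nat \<Rightarrow> (ugen \<Rightarrow> complex mat) \<Rightarrow> bool" where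
  "type1_module q n \<rho> \<longleftrightarrow>
     (\<forall>g. \<rho> g \<in> carrier_mat n n) \<and>
     (\<forall>r\<in>uq_rels q. rep_mat n \<rho> r = 0\<^sub>m n n) \<and>
     (\<exists>D. similar_mat (\<rho> gK) D \<and> diagonal_mat D \<and>
          (\<forall>i<n. \<exists>m::int. D $$ (i, i) = of_real (q powi m)))"

type_synonym ofun = "uq \<Rightarrow> complex"

definition coef :: "nat \<Rightarrow> (ugen \<Rightarrow> complex mat) \<Rightarrow> complex Matrix.vec \<Rightarrow> complex Matrix.vec \<Rightarrow> ofun" where
  "coef n \<rho> \<phi> v = (\<lambda>x. scalar_prod \<phi> (mult_mat_vec (rep_mat n \<rho> x) v))"

definition OU :: "real \<Rightarrow> ofun set" where
  "OU q = {coef n \<rho> \<phi> v | n \<rho> \<phi> v.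
     type1_module q n \<rho> \<and> \<phi> \<in> carrier_vec n \<and> v \<in> carrier_vec n}"

text \<open>The product of $\mathcal O_q(U)$ is dual to the comultiplication of $U_q(\mathfrak u)$; its unit
  is \<^term>\<open>counit\<close>. Its coproduct $\varphi_{(1)}\otimes\varphi_{(2)}$ is characterized by
  $\varphi(ab)=\varphi_{(1)}(a)\varphi_{(2)}(b)$.\<close>

definition omult :: "ofun \<Rightarrow> ofun \<Rightarrow> ofun" where
  "omult \<phi> \<psi> = (\<lambda>x. fa_lin (\<lambda>(v, w). \<phi> (Poly_Mapping.single v 1) * \<psi> (Poly_Mapping.single w 1)) (comult x))"

definition ostar :: "ofun \<Rightarrow> ofun" where
  "ostar \<phi> = (\<lambda>x. cnj (\<phi> (ustar (antipode x))))"

fun u_rep :: "real \<Rightarrow> real \<Rightarrow> ugen \<Rightarrow> complex mat" where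
  "u_rep q s gE = mat_of_rows_list 2 [[0, of_real s], [0, 0]]"
| "u_rep q s gF = mat_of_rows_list 2 [[0, 0], [of_real (inverse s), 0]]"
| "u_rep q s gK = mat_of_rows_list 2 [[of_real q, 0], [0, of_real (inverse q)]]"
| "u_rep q s gKi = mat_of_rows_list 2 [[of_real (inverse q), 0], [0, of_real q]]"

text \<open>Indices of the entries of \<^term>\<open>u\<close> are shifted to start from 0.\<close>

definition u_entry :: "real \<Rightarrow> real \<Rightarrow> nat \<Rightarrow> nat \<Rightarrow> ofun" where
  "u_entry q s \<alpha> \<beta> = (\<lambda>x. rep_mat 2 (u_rep q s) x $$ (\<alpha>, \<beta>))"

definition uJu :: "real \<Rightarrow> real \<Rightarrow> nat \<Rightarrow> nat \<Rightarrow> ofun" where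
  "uJu q s \<alpha> \<beta> = (\<lambda>x. \<Sum>\<gamma><2. \<Sum>\<delta><2.
     mat_of_rows_list 2 [[0, -1], [1, 0]] $$ (\<gamma>, \<delta>) *
     omult (ostar (u_entry q s \<gamma> \<alpha>)) (u_entry q s \<delta> \<beta>) x)"

text \<open>\<^term>\<open>uJu q s\<close> is the matrix $u^*Ju$, where $J$ has rows $(0,-1)$ and $(1,0)$. It has
  rows $(iq^{-1}Z,-Y)$ and $(X,-iqZ)$. Three entries determine $X$, $Y$, $Z$; the lower right
  entry is then automatically as displayed.\<close>

definition oX :: "real \<Rightarrow> real \<Rightarrow> ofun" where
  "oX q s = uJu q s 1 0"

definition oY :: "real \<Rightarrow> real \<Rightarrow> ofun" where
  "oY q s = (\<lambda>x. - uJu q s 0 1 x)"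

definition oZ :: "real \<Rightarrow> real \<Rightarrow> ofun" where
  "oZ q s = (\<lambda>x. - \<i> * of_real q * uJu q s 0 0 x)"

text \<open>$(y\triangleleft\theta)(b)=y(\theta b)$.\<close>

definition OKU :: "real \<Rightarrow> real \<Rightarrow> ofun set" where
  "OKU q s = {y \<in> OU q. \<forall>b. y (theta s * b) = 0}"


section \<open>The dual algebra $\mathcal O'_q(U)$\<close>

text \<open>Elements are functions on all of \<^typ>\<open>ofun\<close>, normalized to be 0 outside of \<^term>\<open>OU q\<close>.\<close>

type_synonym dual = "ofun \<Rightarrow> complex"

definition OpU :: "real \<Rightarrow> dual set" where
  "OpU q = {x. (\<forall>\<phi>. \<phi> \<notin> OU q \<longrightarrow> x \<phi> = 0) \<and>
     (\<forall>\<phi>\<in>OU q. \<forall>\<psi>\<in>OU q. \<forall>c. x (\<lambda>a. c * \<phi> a + \<psi> a) = c * x \<phi> + x \<psi>)}"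

text \<open>\<^term>\<open>lact x \<phi>\<close> is $x\triangleright\varphi=\varphi_{(1)}\langle x,\varphi_{(2)}\rangle$.\<close>

definition lact :: "dual \<Rightarrow> ofun \<Rightarrow> ofun" where
  "lact x \<phi> = (\<lambda>a. x (\<lambda>b. \<phi> (a * b)))"

text \<open>$\langle xy,\varphi\rangle=\langle x,\varphi_{(1)}\rangle\langle y,\varphi_{(2)}\rangle=
  \langle x,y\triangleright\varphi\rangle$.\<close>

definition dmult :: "real \<Rightarrow> dual \<Rightarrow> dual \<Rightarrow> dual" where
  "dmult q x y = (\<lambda>\<phi>. if \<phi> \<in> OU q then x (lact y \<phi>) else 0)"

text \<open>The canonical map from $U_q(\mathfrak u)$ to $\mathcal O'_q(U)$; the unit is \<^term>\<open>deval q 1\<close>.\<close>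

definition deval :: "real \<Rightarrow> uq \<Rightarrow> dual" where
  "deval q a = (\<lambda>\<phi>. if \<phi> \<in> OU q then \<phi> a else 0)"

text \<open>$x\triangleleft y$, defined by $\langle\varphi,x\triangleleft y\rangle=\langle y\varphi,x\rangle$.\<close>

definition dract :: "real \<Rightarrow> dual \<Rightarrow> ofun \<Rightarrow> dual" where
  "dract q x y = (\<lambda>\<phi>. if \<phi> \<in> OU q then x (omult y \<phi>) else 0)"

text \<open>The matrix by which an element of $\mathcal O'_q(U)$ acts on a finite dimensional module.\<close>

definition dact :: "nat \<Rightarrow> (ugen \<Rightarrow> complex mat) \<Rightarrow> dual \<Rightarrow> complex mat" where
  "dact n \<rho> x = Matrix.mat n n (\<lambda>(i, j). x (coef n \<rho> (unit_vec n i) (unit_vec n j)))"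

text \<open>The closure is taken in the function type \<^typ>\<open>dual\<close>, whose topology is that of pointwise
  convergence.\<close>

definition OpK :: "real \<Rightarrow> real \<Rightarrow> dual set" where
  "OpK q s = closure (deval q ` Uk s)"

definition is_spectral_proj :: "nat \<Rightarrow> complex mat \<Rightarrow> complex \<Rightarrow> complex mat \<Rightarrow> bool" where
  "is_spectral_proj n T c P \<longleftrightarrow>
     P \<in> carrier_mat n n \<and> P * P = P \<and> P * T = T * P \<and>
     (\<forall>v\<in>carrier_vec n. mult_mat_vec P v = v \<longleftrightarrow> mult_mat_vec T v = c \<cdot>\<^sub>v v)"

definition idem_e :: "real \<Rightarrow> real \<Rightarrow> int \<Rightarrow> dual" where
  "idem_e q s n = (THE x. x \<in> OpK q s \<and>
     (\<forall>N \<rho>. type1_module q N \<rho> \<longrightarrow>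
        is_spectral_proj N (rep_mat N \<rho> (theta s)) (of_real (qnum q n)) (dact N \<rho> x)))"

definition RqK :: "real \<Rightarrow> real \<Rightarrow> dual set" where
  "RqK q s = {(\<lambda>\<phi>. \<Sum>n\<in>A. c n * idem_e q s n \<phi>) | A c. finite A}"

text \<open>$(-1)_q=\sum_n(-1)^ne_n$; evaluated at any \<^term>\<open>\<phi>\<close> the sum has only finitely many
  nonzero terms.\<close>

definition minus_one_q :: "real \<Rightarrow> real \<Rightarrow> dual" where
  "minus_one_q q s = (\<lambda>\<phi>. \<Sum>\<^sub>\<infinity>n::int. (-1) powi n * idem_e q s n \<phi>)"

definition k_half :: "real \<Rightarrow> real \<Rightarrow> dual" where
  "k_half q s = (THE x. x \<in> OpU q \<and>
     (\<forall>N \<rho>. type1_module q N \<rho> \<longrightarrow>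
        (\<forall>(n::int). \<forall>v\<in>carrier_vec N. mult_mat_vec (\<rho> gK) v = of_real (q powi n) \<cdot>\<^sub>v v \<longrightarrow>
           mult_mat_vec (dact N \<rho> x) v = of_real (s powi n) \<cdot>\<^sub>v v)))"


section \<open>The algebras $\mathcal O'_q(G)$, $R_q(\mathfrak g,K)$ and $R_q(\mathfrak p,M)$\<close>

text \<open>$\mathcal O'_q(G)$ is presented by generators and relations: one generator for each element
  of \<^term>\<open>OpK q s\<close> and of \<^term>\<open>OKU q s\<close>, the relations that make the inclusions of both
  algebras unital homomorphisms, and the exchange relation.\<close>

definition free_ring :: "'g set \<Rightarrow> 'g fa ring" where
  "free_ring G = \<lparr>carrier = {p. \<forall>w\<in>Poly_Mapping.keys p. set (letters w) \<subseteq> G},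
     mult = (*), one = 1, ring.zero = 0, add = (+)\<rparr>"

datatype ggen = GK dual | GY ofun

abbreviation "gk x \<equiv> fa_gen (GK x)"
abbreviation "gy y \<equiv> fa_gen (GY y)"

definition G_gens :: "real \<Rightarrow> real \<Rightarrow> ggen set" where
  "G_gens q s = GK ` OpK q s \<union> GY ` OKU q s"

definition unital_hom_rels ::
  "(('a \<Rightarrow> complex) \<Rightarrow> ggen fa) \<Rightarrow> ('a \<Rightarrow> complex) set \<Rightarrow>
   (('a \<Rightarrow> complex) \<Rightarrow> ('a \<Rightarrow> complex) \<Rightarrow> 'a \<Rightarrow> complex) \<Rightarrow> ('a \<Rightarrow> complex) \<Rightarrow> ggen fa set" where
  "unital_hom_rels \<iota> A m e = {\<iota> e - 1}
     \<union> {\<iota> (m x y) - \<iota> x * \<iota> y | x y. x \<in> A \<and> y \<in> A}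
     \<union> {\<iota> (\<lambda>a. c * x a + y a) - (fa_const c * \<iota> x + \<iota> y) | c x y. x \<in> A \<and> y \<in> A}"

text \<open>In the exchange relation $xy=y_{(1)}(x\triangleleft y_{(2)})$ the coproduct of \<^term>\<open>y\<close> is
  written as a finite sum $\sum_i y'_i\otimes y''_i$ in
  $\mathcal O_q(K\backslash U)\otimes\mathcal O_q(U)$.\<close>

definition exchange_rels :: "real \<Rightarrow> real \<Rightarrow> ggen fa set" where
  "exchange_rels q s =
     {gk x * gy y - (\<Sum>i<n. gy (y' i) * gk (dract q x (y'' i))) | x y (n::nat) y' y''.
        x \<in> OpK q s \<and> y \<in> OKU q s \<and> (\<forall>i<n. y' i \<in> OKU q s \<and> y'' i \<in> OU q) \<and>
        (\<forall>a b. y (a * b) = (\<Sum>i<n. y' i a * y'' i b))}"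

definition G_rels :: "real \<Rightarrow> real \<Rightarrow> ggen fa set" where
  "G_rels q s =
     unital_hom_rels gk (OpK q s) (dmult q) (deval q 1) \<union>
     unital_hom_rels gy (OKU q s) omult counit \<union>
     exchange_rels q s"

type_synonym gq = "ggen fa set"

definition G_ideal :: "real \<Rightarrow> real \<Rightarrow> ggen fa set" where
  "G_ideal q s = genideal (free_ring (G_gens q s)) (G_rels q s)"

definition OpG :: "real \<Rightarrow> real \<Rightarrow> gq ring" where
  "OpG q s = FactRing (free_ring (G_gens q s)) (G_ideal q s)"

definition g_cls :: "real \<Rightarrow> real \<Rightarrow> ggen fa \<Rightarrow> gq" where
  "g_cls q s p = a_r_coset (free_ring (G_gens q s)) (G_ideal q s) p"

definition g_const :: "real \<Rightarrow> real \<Rightarrow> complex \<Rightarrow> gq" where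
  "g_const q s c = g_cls q s (fa_const c)"

definition g_scale :: "real \<Rightarrow> real \<Rightarrow> complex \<Rightarrow> gq \<Rightarrow> gq" where
  "g_scale q s c a = g_const q s c \<otimes>\<^bsub>OpG q s\<^esub> a"

definition inK :: "real \<Rightarrow> real \<Rightarrow> dual \<Rightarrow> gq" where
  "inK q s x = g_cls q s (gk x)"

definition inY :: "real \<Rightarrow> real \<Rightarrow> ofun \<Rightarrow> gq" where
  "inY q s y = g_cls q s (gy y)"

definition RgK :: "real \<Rightarrow> real \<Rightarrow> gq set" where
  "RgK q s = genideal (OpG q s) (inK q s ` RqK q s)"

definition RpM :: "real \<Rightarrow> real \<Rightarrow> gq set" where
  "RpM q s = generate_ring (OpG q s)
     (range (g_const q s) \<union> inY q s ` OKU q s \<union> {inK q s (minus_one_q q s)})"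

abbreviation RpM_ring :: "real \<Rightarrow> real \<Rightarrow> gq ring" where
  "RpM_ring q s \<equiv> (OpG q s)\<lparr>carrier := RpM q s\<rparr>"

definition J_aut :: "real \<Rightarrow> real \<Rightarrow> gq \<Rightarrow> gq" where
  "J_aut q s = (THE j. j \<in> extensional (RpM q s) \<and>
     j \<in> ring_iso (RpM_ring q s) (RpM_ring q s) \<and>
     (\<forall>c. \<forall>a\<in>RpM q s. j (g_scale q s c a) = g_scale q s c (j a)) \<and>
     j (inK q s (minus_one_q q s)) = inK q s (minus_one_q q s) \<and>
     (\<forall>y\<in>OKU q s. j (inY q s y) = inY q s (lact (k_half q s) y)))"


section \<open>Modules\<close>

definition complex_ring :: "complex ring" where
  "complex_ring = \<lparr>carrier = UNIV, mult = (*), one = 1, ring.zero = 0, add = (+)\<rparr>"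

text \<open>A complex vector space with an action of elements of \<^typ>\<open>'r\<close>. The fields
  \<^term>\<open>mult\<close> and \<^term>\<open>one\<close> inherited from the record of rings are not used.\<close>

record ('r, 'v) amod = "(complex, 'v) module" +
  act :: "'r \<Rightarrow> 'v \<Rightarrow> 'v"

text \<open>Module over a (not necessarily unital) subalgebra \<^term>\<open>B\<close> of $\mathcal O'_q(G)$.\<close>

definition rep_of :: "real \<Rightarrow> real \<Rightarrow> gq set \<Rightarrow> (gq, 'v) amod \<Rightarrow> bool" where
  "rep_of q s B V \<longleftrightarrow> Module.module complex_ring V \<and>
     (\<forall>a\<in>B. \<forall>v\<in>carrier V. act V a v \<in> carrier V) \<and>
     (\<forall>a\<in>B. \<forall>v\<in>carrier V. \<forall>w\<in>carrier V.
        act V a (v \<oplus>\<^bsub>V\<^esub> w) = act V a v \<oplus>\<^bsub>V\<^esub> act V a w) \<and>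
     (\<forall>c. \<forall>a\<in>B. \<forall>v\<in>carrier V. act V a (c \<odot>\<^bsub>V\<^esub> v) = c \<odot>\<^bsub>V\<^esub> act V a v) \<and>
     (\<forall>a\<in>B. \<forall>b\<in>B. \<forall>v\<in>carrier V.
        act V (a \<oplus>\<^bsub>OpG q s\<^esub> b) v = act V a v \<oplus>\<^bsub>V\<^esub> act V b v) \<and>
     (\<forall>c. \<forall>a\<in>B. \<forall>v\<in>carrier V. act V (g_scale q s c a) v = c \<odot>\<^bsub>V\<^esub> act V a v) \<and>
     (\<forall>a\<in>B. \<forall>b\<in>B. \<forall>v\<in>carrier V. act V (a \<otimes>\<^bsub>OpG q s\<^esub> b) v = act V a (act V b v))"

definition span_in :: "('r, 'v) amod \<Rightarrow> 'v set \<Rightarrow> 'v set" where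
  "span_in V S = \<Inter>{W. submodule W complex_ring V \<and> S \<subseteq> W}"

definition gk_module :: "real \<Rightarrow> real \<Rightarrow> (gq, 'v) amod \<Rightarrow> bool" where
  "gk_module q s V \<longleftrightarrow> rep_of q s (RgK q s) V \<and>
     span_in V {act V a v | a v. a \<in> RgK q s \<and> v \<in> carrier V} = carrier V"

definition gk_submodule :: "real \<Rightarrow> real \<Rightarrow> 'v set \<Rightarrow> (gq, 'v) amod \<Rightarrow> bool" where
  "gk_submodule q s W V \<longleftrightarrow> submodule W complex_ring V \<and>
     (\<forall>a\<in>RgK q s. \<forall>w\<in>W. act V a w \<in> W)"

definition gk_simple :: "real \<Rightarrow> real \<Rightarrow> (gq, 'v) amod \<Rightarrow> bool" where
  "gk_simple q s V \<longleftrightarrow> gk_module q s V \<and>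
     {W. gk_submodule q s W V \<and> W \<noteq> carrier V} = {{\<zero>\<^bsub>V\<^esub>}}"

definition gk_equiv :: "real \<Rightarrow> real \<Rightarrow> (gq, 'v) amod \<Rightarrow> (gq, 'w) amod \<Rightarrow> bool" where
  "gk_equiv q s V W \<longleftrightarrow> (\<exists>h. bij_betw h (carrier V) (carrier W) \<and>
     (\<forall>v\<in>carrier V. \<forall>w\<in>carrier V. h (v \<oplus>\<^bsub>V\<^esub> w) = h v \<oplus>\<^bsub>W\<^esub> h w) \<and>
     (\<forall>c. \<forall>v\<in>carrier V. h (c \<odot>\<^bsub>V\<^esub> v) = c \<odot>\<^bsub>W\<^esub> h v) \<and>
     (\<forall>a\<in>RgK q s. \<forall>v\<in>carrier V. h (act V a v) = act W a (h v)))"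


section \<open>Induction\<close>

definition twist_J :: "real \<Rightarrow> real \<Rightarrow> (gq, 'v) amod \<Rightarrow> (gq, 'v) amod" where
  "twist_J q s V = V\<lparr>act := (\<lambda>x v. act V (J_aut q s x) v)\<rparr>"

text \<open>$\mathrm{Hom}_{R_q(\mathfrak p,M)}(R_q(\mathfrak g,K),V)$ with $(af)(a')=f(a'a)$.\<close>

definition Hom_mod :: "real \<Rightarrow> real \<Rightarrow> (gq, 'v) amod \<Rightarrow> (gq, gq \<Rightarrow> 'v) amod" where
  "Hom_mod q s V = \<lparr>
     carrier = {f \<in> RgK q s \<rightarrow>\<^sub>E carrier V.
       (\<forall>a\<in>RgK q s. \<forall>b\<in>RgK q s. f (a \<oplus>\<^bsub>OpG q s\<^esub> b) = f a \<oplus>\<^bsub>V\<^esub> f b) \<and>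
       (\<forall>c. \<forall>a\<in>RgK q s. f (g_scale q s c a) = c \<odot>\<^bsub>V\<^esub> f a) \<and>
       (\<forall>x\<in>RpM q s. \<forall>a\<in>RgK q s. f (x \<otimes>\<^bsub>OpG q s\<^esub> a) = act V x (f a))},
     mult = undefined,
     one = undefined,
     ring.zero = (\<lambda>a\<in>RgK q s. \<zero>\<^bsub>V\<^esub>),
     add = (\<lambda>f g. \<lambda>a\<in>RgK q s. f a \<oplus>\<^bsub>V\<^esub> g a),
     smult = (\<lambda>c f. \<lambda>a\<in>RgK q s. c \<odot>\<^bsub>V\<^esub> f a),
     act = (\<lambda>a f. \<lambda>a'\<in>RgK q s. f (a' \<otimes>\<^bsub>OpG q s\<^esub> a))\<rparr>"

definition Ind :: "real \<Rightarrow> real \<Rightarrow> (gq, 'v) amod \<Rightarrow> (gq, gq \<Rightarrow> 'v) amod" where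
  "Ind q s V = (let H = Hom_mod q s (twist_J q s V) in
     H\<lparr>carrier := span_in H {act H a f | a f. a \<in> RgK q s \<and> f \<in> carrier H}\<rparr>)"

definition char_RpM :: "real \<Rightarrow> real \<Rightarrow> int \<Rightarrow> complex \<Rightarrow> gq \<Rightarrow> complex" where
  "char_RpM q s \<epsilon> lam = (THE ch. ch \<in> extensional (RpM q s) \<and>
     ch \<in> Ring.ring_hom (RpM_ring q s) complex_ring \<and>
     (\<forall>c. \<forall>a\<in>RpM q s. ch (g_scale q s c a) = c * ch a) \<and>
     ch (inK q s (minus_one_q q s)) = of_int \<epsilon> \<and>
     ch (inY q s (oX q s)) = lam \<and>
     ch (inY q s (oY q s)) = inverse lam \<and>
     ch (inY q s (oZ q s)) = 0)"

definition char_mod :: "(gq \<Rightarrow> complex) \<Rightarrow> (gq, complex) amod" where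
  "char_mod ch = \<lparr>carrier = UNIV, mult = (*), one = 1, ring.zero = 0, add = (+), smult = (*),
     act = (\<lambda>x v. ch x * v)\<rparr>"

definition Ind_char :: "real \<Rightarrow> real \<Rightarrow> int \<Rightarrow> complex \<Rightarrow> (gq, gq \<Rightarrow> complex) amod" where
  "Ind_char q s \<epsilon> lam = Ind q s (char_mod (char_RpM q s \<epsilon> lam))"

text \<open>$\mathbb Z^\varepsilon$ for $\varepsilon\in\{-1,1\}$.\<close>

definition Zpar :: "int \<Rightarrow> int set" where
  "Zpar \<epsilon> = {m. if \<epsilon> = 1 then even m else odd m}"

definition zeta :: "real \<Rightarrow> real \<Rightarrow> int \<Rightarrow> complex \<Rightarrow> int \<Rightarrow> gq \<Rightarrow> complex" where
  "zeta q s \<epsilon> lam n = (THE f. f \<in> carrier (Ind_char q s \<epsilon> lam) \<and>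
     (\<forall>m. f (inK q s (idem_e q s m)) = (if m = n then 1 else 0)))"

definition zeta_span :: "real \<Rightarrow> real \<Rightarrow> int \<Rightarrow> complex \<Rightarrow> int set \<Rightarrow> (gq, gq \<Rightarrow> complex) amod" where
  "zeta_span q s \<epsilon> lam A = (Ind_char q s \<epsilon> lam)
     \<lparr>carrier := span_in (Ind_char q s \<epsilon> lam) (zeta q s \<epsilon> lam ` A)\<rparr>"

definition D_plus :: "real \<Rightarrow> real \<Rightarrow> int \<Rightarrow> nat \<Rightarrow> (gq, gq \<Rightarrow> complex) amod" where
  "D_plus q s \<sigma> n = (let \<epsilon> = (-1) ^ (n + 1) in
     zeta_span q s \<epsilon> (of_int \<sigma> * of_real (q ^ n)) {m \<in> Zpar \<epsilon>. m > int n})"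

definition D_minus :: "real \<Rightarrow> real \<Rightarrow> int \<Rightarrow> nat \<Rightarrow> (gq, gq \<Rightarrow> complex) amod" where
  "D_minus q s \<sigma> n = (let \<epsilon> = (-1) ^ (n + 1) in
     zeta_span q s \<epsilon> (of_int \<sigma> * of_real (q ^ n)) {m \<in> Zpar \<epsilon>. m < - int n})"

definition Q_mod :: "real \<Rightarrow> real \<Rightarrow> int \<Rightarrow> nat \<Rightarrow> (gq, gq \<Rightarrow> complex) amod" where
  "Q_mod q s \<sigma> n = (let \<epsilon> = (-1) ^ (n + 1) in
     zeta_span q s \<epsilon> (of_int \<sigma> * of_real (q powi (- int n))) {m \<in> Zpar \<epsilon>. \<bar>m\<bar> < int n})"


section \<open>The classification list\<close>

datatype label =
  L_Ind int complex
| L_Dplus int nat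
| L_Dminus int nat
| L_Q int nat

fun label_mod :: "real \<Rightarrow> real \<Rightarrow> label \<Rightarrow> (gq, gq \<Rightarrow> complex) amod" where
  "label_mod q s (L_Ind \<epsilon> lam) = Ind_char q s \<epsilon> lam"
| "label_mod q s (L_Dplus \<sigma> n) = D_plus q s \<sigma> n"
| "label_mod q s (L_Dminus \<sigma> n) = D_minus q s \<sigma> n"
| "label_mod q s (L_Q \<sigma> n) = Q_mod q s \<sigma> n"

definition labels :: "real \<Rightarrow> label set" where
  "labels q =
     {L_Ind \<epsilon> lam | \<epsilon> lam. \<epsilon> \<in> {-1, 1} \<and> lam \<noteq> 0 \<and>
        (\<forall>n\<in>Zpar (- \<epsilon>). lam \<noteq> of_real (q powi n) \<and> lam \<noteq> - of_real (q powi n)) \<and> cmod lam < 1}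
   \<union> {L_Ind 1 lam | lam. cmod lam = 1 \<and> Im lam \<ge> 0}
   \<union> {L_Ind (-1) lam | lam. cmod lam = 1 \<and> Im lam > 0}
   \<union> {L_Dplus \<sigma> n | \<sigma> n. \<sigma> \<in> {-1, 1}}
   \<union> {L_Dminus \<sigma> n | \<sigma> n. \<sigma> \<in> {-1, 1}}
   \<union> {L_Q \<sigma> n | \<sigma> n. \<sigma> \<in> {-1, 1} \<and> n > 0}"

end

theory Submission
  imports Defs "HOL-Computational_Algebra.Fundamental_Theorem_Algebra"
begin

text \<open>
  A simple module $V$ is the direct sum of its weight spaces $e_nV$, and the corner
  $e_nR_q(\mathfrak g,K)e_n$ consists of the polynomials in one element $\Omega$ that commutes with
  the action (the Casimir element). Hence some nonzero $v\in e_nV$ satisfies $\Omega v=\omega v$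
  (\<open>gspec_nonempty\<close>), and the annihilator of $v$, and with it $V$, depends only on the pair
  $(n,\omega)$ (\<open>annihilator_le\<close>, \<open>simple_equiv\<close>). The set of all such pairs, \<open>gspec V\<close>, is an
  invariant of $V$. The classification therefore amounts to two facts: the listed modules are
  simple, and their sets of pairs form a partition of $\mathbb Z\times\mathbb C$ (\<open>label_mod\<close>,
  \<open>label_exists\<close>, \<open>label_unique\<close>).

  The combinations $A^\pm_n$ of $X$, $Y$, $Z$ (\<open>Ap\<close>, \<open>Am\<close>) map weight $n$ to weight $n\pm2$, commute
  with $\Omega$, and the products $A^\mp_{n\pm2}A^\pm_ne_n$ are polynomials in $\Omega$; this describes
  $R_q(\mathfrak g,K)e_n$ (\<open>MM\<close>) and its corner (\<open>corner\<close>). In $\mathrm{Ind}_q(\varepsilon,\lambda)$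
  \[A^+_n\zeta_n=(q^{n+1}\lambda-q^{-n-1}\lambda^{-1})\zeta_{n+2},\quad
    A^-_n\zeta_n=(q^{1-n}\lambda-q^{n-1}\lambda^{-1})\zeta_{n-2},\quad
    \Omega\zeta_n=(\lambda+\lambda^{-1})\zeta_n.\]
  The zeros of the coefficients are the boundaries of the sets of indices of $D^\pm_{\sigma,n}$ and
  $Q_{\sigma,n}$, which gives simplicity (\<open>IM_simple\<close>) and
  \<open>gspec\<close> of a module with indices $A$ as $A\times\{\lambda+\lambda^{-1}\}$ (\<open>IM_gspec\<close>).

  Everything before that makes the objects computable. Functionals on $U_q(\mathfrak u)$ are
  functions on words with skew derivation rules for left and right translations. The theory of
  highest weights identifies $\mathcal O_q(U)$ with the span of words in the entries of $u$
  (\<open>OU_eq_WS\<close>). Such words have finite expansions in powers of the numbers $[m]_q$ on powers of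
  $\theta$, so that $\mathcal O'_q(K)$ is the algebra of all functions on $\mathbb Z$ (\<open>OpK_eq\<close>, with
  $e_n$ the indicator function of $n$), and similarly for $k$, which gives grouplike functionals
  \<open>G t\<close>. The algebra $\mathcal O_q(K\backslash U)$ is generated by $X$, $Y$, $Z$ with the relations of a
  quantum sphere (\<open>OKU_PA\<close>). That $\mathcal O'_q(G)$ is not smaller than expected is shown by
  actions on $\mathcal O_q(U)$, one for each \<open>t\<close> (\<open>pact\<close>); their matrix coefficients are
  characters of $R_q(\mathfrak p,M)$ and the elements $\zeta_n$ of the induced modules.
\<close>

abbreviation (input) iff_ascii (infixr "<->" 25) where "A <-> B \<equiv> A \<longleftrightarrow> B"
abbreviation "pm_single \<equiv> Poly_Mapping.single"
abbreviation "pm_lookup \<equiv> Poly_Mapping.lookup"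
abbreviation "pm_keys \<equiv> Poly_Mapping.keys"

section \<open>Linear functionals on monoid algebras\<close>

definition wd :: "'g list => 'g fa" where
 "wd xs = pm_single (FMon xs) 1"

lemma wd_Nil: "wd [] = 1"
 by (simp add: wd_def flip: zero_fmon_def)

lemma wd_append: "wd (xs @ ys) = wd xs * wd ys"
 by (simp add: wd_def mult_single plus_fmon_def)

lemma wd_gen: "wd [g] = fa_gen g"
 by (simp add: wd_def fa_gen_def)

lemma wd_Cons: "wd (g # xs) = fa_gen g * wd xs"
 using wd_append[of "[g]" xs] by (simp add: wd_gen)

lemma wd_snoc: "wd (xs @ [g]) = wd xs * fa_gen g"
 by (simp add: wd_append wd_gen)

lemma pm_expand: "(p :: 'k \<Rightarrow>\<^sub>0 complex) = (\<Sum>k\<in>pm_keys p. pm_single k (pm_lookup p k))"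
 by (rule poly_mapping_eqI)
  (auto simp: lookup_sum lookup_single when_def in_keys_iff sum.delta)

lemma pm_induct [case_names zero single add]:
 fixes p :: "'k \<Rightarrow>\<^sub>0 complex"
 assumes "P 0" and "!!k c. P (pm_single k c)" and "!!x y. P x ==> P y ==> P (x + y)"
 shows "P p"
proof -
 have "P (\<Sum>k\<in>A. pm_single k (pm_lookup p k))" if "finite A" for A
  using that by (induction A rule: finite_induct) (auto intro: assms)
 thus ?thesis
  using pm_expand[of p] finite_keys by metis
qed

lemma fa_const_add: "fa_const (a + b) = fa_const a + fa_const b"
 by (simp add: fa_const_def single_add)

lemma fa_const_mult: "(fa_const (a * b) :: 'm::monoid_add \<Rightarrow>\<^sub>0 complex) = fa_const a * fa_const b"
 by (simp add: fa_const_def mult_single)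

lemma fa_const_1: "(fa_const 1 :: 'm::monoid_add \<Rightarrow>\<^sub>0 complex) = 1"
 by (simp add: fa_const_def)

lemma fa_const_0: "fa_const 0 = 0"
 by (simp add: fa_const_def)

lemma fa_const_uminus: "fa_const (- a) = - fa_const a"
 by (simp add: fa_const_def single_uminus)

lemma fa_const_single: "fa_const c * pm_single (k :: 'm::monoid_add) d = pm_single k (c * d)"
 by (simp add: fa_const_def mult_single)

lemma fa_const_central: "(x :: 'm::monoid_add \<Rightarrow>\<^sub>0 complex) * fa_const c = fa_const c * x"
proof (induction x rule: pm_induct)
 case (single k d)
 thus ?case by (simp add: fa_const_def mult_single mult.commute)
qed (auto simp: algebra_simps)

lemma fa_const_left_commute: "(x :: 'm::monoid_add \<Rightarrow>\<^sub>0 complex) * (fa_const c * y) = fa_const c * (x * y)"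
 by (metis fa_const_central mult.assoc)

lemma fa_induct [case_names wd scale add]:
 fixes p :: "'g fa"
 assumes "!!xs. P (wd xs)" and "!!c x. P x ==> P (fa_const c * x)" and "!!x y. P x ==> P y ==> P (x + y)"
 shows "P p"
proof (induction p rule: pm_induct)
 case zero
 show ?case using assms(2)[OF assms(1), of 0] by (simp add: fa_const_0)
next
 case (single k c)
 show ?case using assms(2)[OF assms(1), of c "letters k"] by (simp add: wd_def fa_const_single)
qed (fact assms(3))

definition lin :: "(('m::monoid_add \<Rightarrow>\<^sub>0 complex) => complex) => bool" where
 "lin f <-> (ALL x y. f (x + y) = f x + f y) & (ALL c x. f (fa_const c * x) = c * f x)"

lemma linD: assumes "lin f"
 shows "f (x + y) = f x + f y" "f (fa_const c * x) = c * f x" "f 0 = 0" "f (- x) = - f x"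
  "f (x - y) = f x - f y" "f (fa_const c) = c * f 1" "f (x * fa_const c) = c * f x"
  "f (x * (fa_const c * z)) = c * f (x * z)"
proof -
 have add: "f (x + y) = f x + f y" for x y using assms by (auto simp: lin_def)
 have sc: "f (fa_const c * x) = c * f x" for c x using assms by (auto simp: lin_def)
 show "f (x + y) = f x + f y" "f (fa_const c * x) = c * f x" using add sc by auto
 show "f 0 = 0" using sc[of 0 1] by (simp add: fa_const_0)
 have neg: "f (- x) = - f x" for x
  using sc[of "-1" x] by (simp add: fa_const_uminus fa_const_1)
 thus "f (- x) = - f x" .
 show "f (x - y) = f x - f y" using add[of x "- y"] neg by simp
 show "f (fa_const c) = c * f 1" using sc[of c 1] by simp
 show "f (x * fa_const c) = c * f x" "f (x * (fa_const c * z)) = c * f (x * z)"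
  by (simp_all add: fa_const_central fa_const_left_commute sc)
qed

lemma lin_sum: "lin f ==> f (sum g A) = (\<Sum>a\<in>A. f (g a))"
 by (induction A rule: infinite_finite_induct) (auto simp: linD)

lemma lin_single: "lin f ==> f (pm_single k c) = c * f (pm_single k 1)"
 using linD(2)[of f c "pm_single k 1"] by (simp add: fa_const_single)

lemma fa_lin_superset:
 assumes "finite A" "pm_keys p <= A"
 shows "fa_lin f p = (\<Sum>w\<in>A. pm_lookup p w * f w)"
 unfolding fa_lin_def by (rule sum.mono_neutral_left) (use assms in "auto simp: in_keys_iff")

lemma fa_lin_add: "fa_lin f (x + y) = fa_lin f x + fa_lin f y"
proof -
 let ?A = "pm_keys x \<union> pm_keys y"
 have "fa_lin f (x + y) = (\<Sum>w\<in>?A. pm_lookup (x + y) w * f w)"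
  by (rule fa_lin_superset) (use keys_add[of x y] in auto)
 also have "... = fa_lin f x + fa_lin f y"
  by (simp add: fa_lin_superset[of ?A] lookup_add algebra_simps sum.distrib)
 finally show ?thesis .
qed

lemma fa_lin_0 [simp]: "fa_lin f 0 = 0"
 by (simp add: fa_lin_def)

lemma fa_lin_single [simp]: "fa_lin f (pm_single k c) = c * f k"
 by (simp add: fa_lin_def)

lemma lin_fa_lin: "lin (fa_lin f)"
 unfolding lin_def
proof (intro conjI allI fa_lin_add)
 fix c x show "fa_lin f (fa_const c * x) = c * fa_lin f x"
  by (induction x rule: pm_induct) (auto simp: fa_const_single fa_lin_add distrib_left)
qed

lemma fa_lin_fun: "fa_lin (%w. c * f w + g w) p = c * fa_lin f p + fa_lin g p"
 by (simp add: fa_lin_def algebra_simps sum.distrib sum_distrib_left)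

lemma fa_lin_sum_fun: "fa_lin (%w. \<Sum>i\<in>A. f i w) p = (\<Sum>i\<in>A. fa_lin (f i) p)"
 unfolding fa_lin_def by (simp add: sum_distrib_left) (rule sum.swap)

lemma lin_eqI: "lin f ==> lin g ==> (!!k. f (pm_single k 1) = g (pm_single k 1)) ==> f = g"
proof
 fix x assume a: "lin f" "lin g" "!!k. f (pm_single k 1) = g (pm_single k 1)"
 show "f x = g x"
 proof (induction x rule: pm_induct)
  case (single k c)
  show ?case using lin_single[OF a(1), of k c] lin_single[OF a(2), of k c] a(3)[of k] by presburger
 qed (use a in "auto simp: linD")
qed

lemma lin_eq_wdI:
 fixes f g :: "'g fa => complex"
 assumes "lin f" "lin g" "!!xs. f (wd xs) = g (wd xs)"
 shows "f = g"
proof (rule lin_eqI[OF assms(1,2)])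
 fix k :: "'g fmon"
 show "f (pm_single k 1) = g (pm_single k 1)"
  using assms(3)[of "letters k"] by (simp add: wd_def)
qed

lemma lin_as_fa_lin: "lin f ==> fa_lin (%w. f (pm_single w 1)) x = f x"
 by (rule fun_cong[where x = x], rule lin_eqI) (auto simp: lin_fa_lin)

lemma lin_comb: "lin f ==> lin g ==> lin (%a. c * f a + g a)"
 by (simp add: lin_def algebra_simps)

lemma lin_zero: "lin (%a. 0)"
 by (simp add: lin_def)

lemma lin_sumf: "(!!i. i : A ==> lin (f i)) ==> lin (%a. \<Sum>i\<in>A. f i a)"
 by (simp add: lin_def sum.distrib sum_distrib_left)

lemma lin_scale: "lin f ==> lin (%a. c * f a)"
 by (simp add: lin_def algebra_simps)

text \<open>The two commuting actions of an algebra on functions on it: \<open>rtr x f\<close> is $x\triangleright f$ and \<open>ltr x f\<close> is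
  $f\triangleleft x$.\<close>

definition rtr :: "'a::times => ('a => 'c) => 'a => 'c" where
 "rtr x f = (%b. f (b * x))"

definition ltr :: "'a::times => ('a => 'c) => 'a => 'c" where
 "ltr x f = (%b. f (x * b))"

lemma lin_rtr: "lin f ==> lin (rtr x f)"
 by (auto simp: lin_def rtr_def algebra_simps)

lemma lin_ltr: "lin f ==> lin (ltr x f)"
 by (auto simp: lin_def ltr_def algebra_simps fa_const_left_commute)

lemma rtr_rtr: "rtr x (rtr y f) = rtr (x * y) (f :: 'a::semigroup_mult => 'c)"
 by (simp add: rtr_def mult.assoc)

lemma ltr_ltr: "ltr x (ltr y f) = ltr (y * x) (f :: 'a::semigroup_mult => 'c)"
 by (simp add: ltr_def mult.assoc)

lemma rtr_ltr: "rtr x (ltr y f) = ltr y (rtr x (f :: 'a::semigroup_mult => 'c))"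
 by (simp add: ltr_def rtr_def mult.assoc)

lemma rtr_1 [simp]: "rtr 1 f = (f :: 'a::monoid_mult => 'c)"
 by (simp add: rtr_def)

lemma ltr_1 [simp]: "ltr 1 f = (f :: 'a::monoid_mult => 'c)"
 by (simp add: ltr_def)

lemma rtr_comb: "rtr x (%a. c * f a + g a) = (%a. c * rtr x f a + rtr x g a)"
 by (simp add: rtr_def)

lemma ltr_comb: "ltr x (%a. c * f a + g a) = (%a. c * ltr x f a + ltr x g a)"
 by (simp add: ltr_def)

section \<open>Homomorphisms out of free algebras\<close>

text \<open>The common form of the three ways of extending a map of generators.\<close>

definition ksum :: "(complex => complex) => ('k => 'm::monoid_add \<Rightarrow>\<^sub>0 complex) => ('k \<Rightarrow>\<^sub>0 complex) => 'm \<Rightarrow>\<^sub>0 complex" where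
 "ksum sg g p = (\<Sum>w\<in>pm_keys p. fa_const (sg (pm_lookup p w)) * g w)"

lemma ksum_superset:
 assumes "finite A" "pm_keys p <= A" "sg 0 = 0"
 shows "ksum sg g p = (\<Sum>w\<in>A. fa_const (sg (pm_lookup p w)) * g w)"
 unfolding ksum_def by (rule sum.mono_neutral_left) (use assms in "auto simp: in_keys_iff fa_const_0")

lemma ksum_single: "sg 0 = 0 ==> ksum sg g (pm_single k c) = fa_const (sg c) * g k"
 by (simp add: ksum_def fa_const_0)

lemma ksum_add:
 assumes "sg 0 = 0" "!!a b. sg (a + b) = sg a + sg b"
 shows "ksum sg g (x + y) = ksum sg g x + ksum sg g y"
proof -
 let ?A = "pm_keys x \<union> pm_keys y"
 have "ksum sg g (x + y) = (\<Sum>w\<in>?A. fa_const (sg (pm_lookup (x + y) w)) * g w)"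
  by (rule ksum_superset) (use keys_add[of x y] assms in auto)
 also have "... = ksum sg g x + ksum sg g y"
  using assms by (simp add: ksum_superset[of ?A] lookup_add algebra_simps sum.distrib fa_const_add)
 finally show ?thesis .
qed

lemma ksum_scale:
 fixes x :: "'k::monoid_add \<Rightarrow>\<^sub>0 complex"
 assumes "sg 0 = 0" "!!a b. sg (a + b) = sg a + sg b" "!!a b. sg (a * b) = sg a * sg b"
 shows "ksum sg g (fa_const c * x) = fa_const (sg c) * ksum sg g x"
proof (induction x rule: pm_induct)
 case (single k d)
 show ?case
  using assms by (simp add: fa_const_single ksum_single fa_const_mult mult.assoc)
next
 case (add x y)
 thus ?case using assms by (simp add: ksum_add distrib_left)
qed (simp add: ksum_def)

lemma fa_hom_ksum: "fa_hom f = ksum (%c. c) (%w. prod_list (map f (letters w)))"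
 by (rule ext) (simp add: fa_hom_def ksum_def)

lemma fa_antihom_ksum: "fa_antihom f = ksum (%c. c) (%w. prod_list (map f (rev (letters w))))"
 by (rule ext) (simp add: fa_antihom_def ksum_def)

lemma fa_conj_antihom_ksum: "fa_conj_antihom f = ksum cnj (%w. prod_list (map f (rev (letters w))))"
 by (rule ext) (simp add: fa_conj_antihom_def ksum_def)

lemma fa_hom_simps:
 "fa_hom f (x + y) = fa_hom f x + fa_hom f y"
 "fa_hom f (fa_const c * x) = fa_const c * fa_hom f x"
 "fa_hom f (wd xs) = prod_list (map f xs)"
 by (simp_all add: fa_hom_ksum ksum_add ksum_scale wd_def ksum_single fa_const_1)

lemma fa_antihom_simps:
 "fa_antihom f (x + y) = fa_antihom f x + fa_antihom f y"
 "fa_antihom f (fa_const c * x) = fa_const c * fa_antihom f x"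
 "fa_antihom f (wd xs) = prod_list (map f (rev xs))"
 by (simp_all add: fa_antihom_ksum ksum_add ksum_scale wd_def ksum_single fa_const_1)

lemma fa_conj_antihom_simps:
 "fa_conj_antihom f (x + y) = fa_conj_antihom f x + fa_conj_antihom f y"
 "fa_conj_antihom f (fa_const c * x) = fa_const (cnj c) * fa_conj_antihom f x"
 "fa_conj_antihom f (wd xs) = prod_list (map f (rev xs))"
 by (simp_all add: fa_conj_antihom_ksum ksum_add ksum_scale wd_def ksum_single fa_const_1)

lemma fa_hom_mult: "fa_hom f (x * y) = fa_hom f x * fa_hom f y"
proof (induction x rule: fa_induct)
 case (wd xs)
 show ?case
  by (induction y rule: fa_induct)
   (simp_all add: fa_hom_simps flip: wd_append, simp_all add: fa_hom_simps fa_const_left_commute distrib_left)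
qed (simp_all add: fa_hom_simps distrib_right mult.assoc)

lemma fa_antihom_mult: "fa_antihom f (x * y) = fa_antihom f y * fa_antihom f x"
proof (induction x rule: fa_induct)
 case (wd xs)
 show ?case
  by (induction y rule: fa_induct)
   (simp_all add: fa_antihom_simps flip: wd_append, simp_all add: fa_antihom_simps fa_const_left_commute distrib_left distrib_right mult.assoc)
qed (simp_all add: fa_antihom_simps distrib_right distrib_left mult.assoc fa_const_left_commute)

lemma fa_conj_antihom_mult: "fa_conj_antihom f (x * y) = fa_conj_antihom f y * fa_conj_antihom f x"
proof (induction x rule: fa_induct)
 case (wd xs)
 show ?case
  by (induction y rule: fa_induct)
   (simp_all add: fa_conj_antihom_simps flip: wd_append, simp_all add: fa_conj_antihom_simps fa_const_left_commute distrib_left distrib_right mult.assoc)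
qed (simp_all add: fa_conj_antihom_simps distrib_right distrib_left mult.assoc fa_const_left_commute)

lemma fa_hom_gen: "fa_hom f (fa_gen g) = f g"
 using fa_hom_simps(3)[of f "[g]"] by (simp add: wd_gen)

section \<open>The product of functionals\<close>

definition ev2 :: "('g fa => complex) => ('g fa => complex) => (('g fmon \<times> 'g fmon) \<Rightarrow>\<^sub>0 complex) => complex" where
 "ev2 ph py = fa_lin (%(v, w). ph (pm_single v 1) * py (pm_single w 1))"

lemma lin_ev2: "lin (ev2 ph py)"
 by (simp add: ev2_def lin_fa_lin)

lemma ev2_mult_tensor:
 assumes "lin ph" "lin py"
 shows "ev2 ph py (T * fa_tensor p r) = ev2 (rtr p ph) (rtr r py) T"
proof (induction T rule: pm_induct)
 case (single k c)
 obtain v w where k: "k = (v, w)" by force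
 have p: "ph (pm_single v 1 * p) = (\<Sum>x\<in>pm_keys p. pm_lookup p x * ph (pm_single (v + x) 1))"
  using lin_as_fa_lin[OF lin_ltr[OF assms(1)], of "pm_single v 1" p]
  by (simp add: ltr_def fa_lin_def mult_single)
 have r: "py (pm_single w 1 * r) = (\<Sum>x\<in>pm_keys r. pm_lookup r x * py (pm_single (w + x) 1))"
  using lin_as_fa_lin[OF lin_ltr[OF assms(2)], of "pm_single w 1" r]
  by (simp add: ltr_def fa_lin_def mult_single)
 have lhs: "ev2 ph py (pm_single k c * fa_tensor p r) =
   (\<Sum>x\<in>pm_keys p. \<Sum>y\<in>pm_keys r.
    c * (pm_lookup p x * pm_lookup r y) * (ph (pm_single (v + x) 1) * py (pm_single (w + y) 1)))"
  by (simp add: k fa_tensor_def sum_distrib_left sum_distrib_right mult_single lin_sum[OF lin_ev2])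
   (simp add: ev2_def mult_ac)
 have rhs: "ev2 (rtr p ph) (rtr r py) (pm_single k c) =
   c * ((\<Sum>x\<in>pm_keys p. pm_lookup p x * ph (pm_single (v + x) 1)) *
    (\<Sum>x\<in>pm_keys r. pm_lookup r x * py (pm_single (w + x) 1)))"
  by (simp add: k ev2_def rtr_def p r)
 show ?case
  unfolding lhs rhs sum_product by (simp add: sum_distrib_left mult_ac)
qed (auto simp: linD[OF lin_ev2] distrib_right)

lemma ev2_tensor_mult:
 assumes "lin ph" "lin py"
 shows "ev2 ph py (fa_tensor p r * T) = ev2 (ltr p ph) (ltr r py) T"
proof (induction T rule: pm_induct)
 case (single k c)
 obtain v w where k: "k = (v, w)" by force
 have p: "ph (p * pm_single v 1) = (\<Sum>x\<in>pm_keys p. pm_lookup p x * ph (pm_single (x + v) 1))"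
  using lin_as_fa_lin[OF lin_rtr[OF assms(1)], of "pm_single v 1" p]
  by (simp add: rtr_def fa_lin_def mult_single)
 have r: "py (r * pm_single w 1) = (\<Sum>x\<in>pm_keys r. pm_lookup r x * py (pm_single (x + w) 1))"
  using lin_as_fa_lin[OF lin_rtr[OF assms(2)], of "pm_single w 1" r]
  by (simp add: rtr_def fa_lin_def mult_single)
 have lhs: "ev2 ph py (fa_tensor p r * pm_single k c) =
   (\<Sum>x\<in>pm_keys p. \<Sum>y\<in>pm_keys r.
    c * (pm_lookup p x * pm_lookup r y) * (ph (pm_single (x + v) 1) * py (pm_single (y + w) 1)))"
  by (simp add: k fa_tensor_def sum_distrib_left sum_distrib_right mult_single lin_sum[OF lin_ev2])
   (simp add: ev2_def mult_ac)
 have rhs: "ev2 (ltr p ph) (ltr r py) (pm_single k c) =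
   c * ((\<Sum>x\<in>pm_keys p. pm_lookup p x * ph (pm_single (x + v) 1)) *
    (\<Sum>x\<in>pm_keys r. pm_lookup r x * py (pm_single (x + w) 1)))"
  by (simp add: k ev2_def ltr_def p r)
 show ?case
  unfolding lhs rhs sum_product by (simp add: sum_distrib_left mult_ac)
qed (auto simp: linD[OF lin_ev2] distrib_left)

lemma omult_ev2: "omult ph py x = ev2 ph py (comult x)"
 by (simp add: omult_def ev2_def)

lemma comult_simps:
 "comult (x + y) = comult x + comult y" "comult (fa_const c * x) = fa_const c * comult x"
 by (simp_all add: comult_def fa_hom_simps)

lemma comult_mult: "comult (x * y) = comult x * comult y"
 by (simp add: comult_def fa_hom_mult)

lemma comult_1: "comult 1 = 1"
 using fa_hom_simps(3)[of comult_gen "[]"] by (simp add: comult_def wd_Nil)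

lemma comult_gen_eq: "comult (fa_gen g) = comult_gen g"
 by (simp add: comult_def fa_hom_gen)

lemma lin_omult [simp, intro]: "lin (omult ph py)"
 by (simp add: lin_def omult_ev2 comult_simps linD[OF lin_ev2])

lemma omult_1 [simp]: "omult ph py 1 = ph 1 * py 1"
proof -
 have "ev2 ph py (pm_single 0 1) = ph (pm_single 0 1) * py (pm_single 0 1)"
  by (simp add: ev2_def zero_prod_def del: single_one)
 thus ?thesis by (simp add: omult_ev2 comult_1)
qed

lemma omult_comb_left: "omult (%a. c * f a + g a) h = (%a. c * omult f h a + omult g h a)"
 by (rule ext, simp add: omult_def flip: fa_lin_fun, rule arg_cong[where f = "%f. fa_lin f _"])
  (auto simp: algebra_simps)

lemma omult_comb_right: "omult h (%a. c * f a + g a) = (%a. c * omult h f a + omult h g a)"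
 by (rule ext, simp add: omult_def flip: fa_lin_fun, rule arg_cong[where f = "%f. fa_lin f _"])
  (auto simp: algebra_simps)

lemma omult_zero [simp]: "omult (%a. 0) h = (%a. 0)" "omult h (%a. 0) = (%a. 0)"
 by (simp_all add: omult_def fa_lin_def fun_eq_iff case_prod_beta)

lemma omult_add: "omult (%a. f a + g a) h = (%a. omult f h a + omult g h a)"
 "omult h (%a. f a + g a) = (%a. omult h f a + omult h g a)"
 using omult_comb_left[of 1 f g h] omult_comb_right[of h 1 f g] by simp_all

lemma omult_scale: "omult (%a. c * f a) h = (%a. c * omult f h a)"
 "omult h (%a. c * f a) = (%a. c * omult h f a)"
 using omult_comb_left[of c f "%_. 0" h] omult_comb_right[of h c f "%_. 0"] by simp_all

lemma omult_sum: "omult (%a. \<Sum>i\<in>A. f i a) h = (%a. \<Sum>i\<in>A. omult (f i) h a)"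
 "omult h (%a. \<Sum>i\<in>A. f i a) = (%a. \<Sum>i\<in>A. omult h (f i) a)"
proof -
 show "omult (%a. \<Sum>i\<in>A. f i a) h = (%a. \<Sum>i\<in>A. omult (f i) h a)"
  by (induction A rule: infinite_finite_induct) (auto simp: omult_add)
 show "omult h (%a. \<Sum>i\<in>A. f i a) = (%a. \<Sum>i\<in>A. omult h (f i) a)"
  by (induction A rule: infinite_finite_induct) (auto simp: omult_add)
qed

text \<open>Translations are skew derivations of the product, because the comultiplication of a
  generator has at most two terms.\<close>

lemma rtr_omult:
 assumes "lin f" "lin g"
 shows "rtr uE (omult f g) = (%a. omult (rtr uE f) g a + omult (rtr uK f) (rtr uE g) a)"
  "rtr uF (omult f g) = (%a. omult (rtr uF f) (rtr uKi g) a + omult f (rtr uF g) a)"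
  "rtr uK (omult f g) = omult (rtr uK f) (rtr uK g)"
  "rtr uKi (omult f g) = omult (rtr uKi f) (rtr uKi g)"
 by (simp_all add: fun_eq_iff rtr_def[of _ "omult f g"] omult_ev2 comult_simps comult_mult comult_gen_eq distrib_left
  linD[OF lin_ev2] ev2_mult_tensor assms)

lemma ltr_omult:
 assumes "lin f" "lin g"
 shows "ltr uE (omult f g) = (%a. omult (ltr uE f) g a + omult (ltr uK f) (ltr uE g) a)"
  "ltr uF (omult f g) = (%a. omult (ltr uF f) (ltr uKi g) a + omult f (ltr uF g) a)"
  "ltr uK (omult f g) = omult (ltr uK f) (ltr uK g)"
  "ltr uKi (omult f g) = omult (ltr uKi f) (ltr uKi g)"
 by (simp_all add: fun_eq_iff ltr_def[of _ "omult f g"] omult_ev2 comult_simps comult_mult comult_gen_eq distrib_right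
  linD[OF lin_ev2] ev2_tensor_mult assms)

lemma omult_assoc:
 assumes "lin f" "lin g" "lin h"
 shows "omult (omult f g) h = omult f (omult g h)"
proof (rule lin_eq_wdI)
 fix xs
 show "omult (omult f g) h (wd xs) = omult f (omult g h) (wd xs)"
  using assms
 proof (induction xs arbitrary: f g h rule: rev_induct)
  case Nil
  thus ?case by (simp add: wd_Nil)
 next
  case (snoc x xs)
  have "omult (omult f g) h (wd (xs @ [x])) = rtr (fa_gen x) (omult (omult f g) h) (wd xs)"
   "omult f (omult g h) (wd (xs @ [x])) = rtr (fa_gen x) (omult f (omult g h)) (wd xs)"
   by (simp_all add: rtr_def wd_snoc)
  moreover have "rtr (fa_gen x) (omult (omult f g) h) (wd xs) = rtr (fa_gen x) (omult f (omult g h)) (wd xs)"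
   by (cases x) (simp_all add: rtr_omult snoc lin_rtr omult_add)
  ultimately show ?case by simp
 qed
qed auto

lemma prod_list_counit_append: "counit (wd (xs @ ys)) = counit (wd xs) * counit (wd ys)"
 by (simp add: counit_def wd_def)

lemma lin_counit [simp, intro]: "lin counit"
 by (simp add: counit_def lin_fa_lin)

lemma counit_gen_eq [simp]: "counit (fa_gen g) = counit_gen g"
 by (simp add: counit_def fa_gen_def)

lemma counit_1 [simp]: "counit 1 = 1"
 by (simp add: counit_def wd_def flip: wd_Nil)

lemma counit_mult: "counit (x * y) = counit x * counit y"
proof (induction x rule: fa_induct)
 case (wd xs)
 show ?case
  by (induction y rule: fa_induct)
   (simp_all add: prod_list_counit_append linD[OF lin_counit] fa_const_left_commute algebra_simps flip: wd_append)
qed (simp_all add: linD[OF lin_counit] distrib_right mult.assoc)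

lemma rtr_counit [simp]: "rtr x counit = (%a. counit x * counit a)"
 "ltr x counit = (%a. counit x * counit a)"
 by (simp_all add: rtr_def ltr_def counit_mult mult.commute)

lemma omult_counit:
 assumes "lin f" shows "omult counit f = f" "omult f counit = f"
proof -
 show "omult counit f = f"
 proof (rule lin_eq_wdI)
  fix xs
  show "omult counit f (wd xs) = f (wd xs)"
   using assms
  proof (induction xs arbitrary: f rule: rev_induct)
   case (snoc x xs)
   have "omult counit f (wd (xs @ [x])) = rtr (fa_gen x) (omult counit f) (wd xs)"
    by (simp add: rtr_def wd_snoc)
   also have "... = rtr (fa_gen x) f (wd xs)"
    by (cases x) (simp_all add: rtr_omult snoc lin_rtr omult_scale)
   finally show ?case by (simp add: rtr_def wd_snoc)
  qed (simp add: wd_Nil)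
 qed (use assms in auto)
 show "omult f counit = f"
 proof (rule lin_eq_wdI)
  fix xs
  show "omult f counit (wd xs) = f (wd xs)"
   using assms
  proof (induction xs arbitrary: f rule: rev_induct)
   case (snoc x xs)
   have "omult f counit (wd (xs @ [x])) = rtr (fa_gen x) (omult f counit) (wd xs)"
    by (simp add: rtr_def wd_snoc)
   also have "... = rtr (fa_gen x) f (wd xs)"
    by (cases x) (simp_all add: rtr_omult snoc lin_rtr omult_scale)
   finally show ?case by (simp add: rtr_def wd_snoc)
  qed (simp add: wd_Nil)
 qed (use assms in auto)
qed

text \<open>The product of functionals is compatible with the coproduct: a decomposition of
  \<open>f (x * y)\<close> and one of \<open>g (x * y)\<close> multiply.\<close>

lemma omult_coprod:
 assumes "finite A" "finite B" "lin f" "lin g"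
  and "!!i. i : A ==> lin (f1 i) & lin (f2 i)" "!!j. j : B ==> lin (g1 j) & lin (g2 j)"
  and "!!x y. f (x * y) = (\<Sum>i\<in>A. f1 i x * f2 i y)"
  and "!!x y. g (x * y) = (\<Sum>j\<in>B. g1 j x * g2 j y)"
 shows "omult f g (x * y) = (\<Sum>i\<in>A. \<Sum>j\<in>B. omult (f1 i) (g1 j) x * omult (f2 i) (g2 j) y)"
proof -
 have "omult f g (x * wd ys) = (\<Sum>i\<in>A. \<Sum>j\<in>B. omult (f1 i) (g1 j) x * omult (f2 i) (g2 j) (wd ys))" for ys
  using assms(3-)
 proof (induction ys arbitrary: f g f2 g2 rule: rev_induct)
  case Nil
  have f: "f = (%x. \<Sum>i\<in>A. f2 i 1 * f1 i x)" using Nil(5)[of _ 1] by (simp add: fun_eq_iff mult.commute)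
  have g: "g = (%x. \<Sum>j\<in>B. g2 j 1 * g1 j x)" using Nil(6)[of _ 1] by (simp add: fun_eq_iff mult.commute)
  show ?case
   by (subst f, subst g) (simp add: omult_sum omult_scale wd_Nil, simp add: sum_distrib_left mult_ac)
 next
  case (snoc h ys)
  have st: "omult f' g' (x * wd ys) = (\<Sum>i\<in>A. \<Sum>j\<in>B. omult (f1 i) (g1 j) x * omult (f2' i) (g2' j) (wd ys))"
   if "f' = rtr z f" "f2' = (%i. rtr z (f2 i))" "g' = rtr z' g" "g2' = (%i. rtr z' (g2 i))" for f' g' z z' f2' g2'
   unfolding that
  proof (rule snoc.IH)
   show "lin (rtr z f)" "lin (rtr z' g)" using snoc.prems by (auto intro: lin_rtr)
   show "lin (f1 i) & lin (rtr z (f2 i))" if "i : A" for i using snoc.prems that by (auto intro: lin_rtr)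
   show "lin (g1 i) & lin (rtr z' (g2 i))" if "i : B" for i using snoc.prems that by (auto intro: lin_rtr)
   show "rtr z f (x * y) = (\<Sum>i\<in>A. f1 i x * rtr z (f2 i) y)" for x y
    using snoc.prems(5)[of x "y * z"] by (simp add: rtr_def mult.assoc)
   show "rtr z' g (x * y) = (\<Sum>i\<in>B. g1 i x * rtr z' (g2 i) y)" for x y
    using snoc.prems(6)[of x "y * z'"] by (simp add: rtr_def mult.assoc)
  qed
  have st': "omult (rtr z f) (rtr z' g) (x * wd ys) = (\<Sum>i\<in>A. \<Sum>j\<in>B. omult (f1 i) (g1 j) x * omult (rtr z (f2 i)) (rtr z' (g2 j)) (wd ys))" for z z'
   by (rule st) auto
  have one: "rtr 1 u = u" for u :: ofun by simp
  have "omult f g (x * wd (ys @ [h])) = rtr (fa_gen h) (omult f g) (x * wd ys)"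
   by (simp add: rtr_def wd_snoc mult.assoc)
  also have "... = (\<Sum>i\<in>A. \<Sum>j\<in>B. omult (f1 i) (g1 j) x * rtr (fa_gen h) (omult (f2 i) (g2 j)) (wd ys))"
   using st'[of "fa_gen h" 1] st'[of 1 "fa_gen h"] snoc.prems
   by (cases h) (simp_all add: rtr_omult st' distrib_left sum.distrib)
  finally show ?case by (simp add: rtr_def wd_snoc)
 qed
 hence w: "omult f g (x * wd ys) = (\<Sum>i\<in>A. \<Sum>j\<in>B. omult (f1 i) (g1 j) x * omult (f2 i) (g2 j) (wd ys))" for ys .
 show ?thesis
  by (induction y rule: fa_induct)
   (simp_all add: w linD[OF lin_omult] distrib_left sum.distrib sum_distrib_left mult_ac fa_const_left_commute)
qed

section \<open>Functionals on $U_q(\mathfrak u)$\<close>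

locale quantum =
 fixes q s :: real
 assumes q_pos: "q > 0" and q_ne1: "q ~= 1" and s2: "s ^ 2 = q"
begin

abbreviation cq :: complex where "cq \<equiv> of_real q"
abbreviation cs :: complex where "cs \<equiv> of_real s"

definition qp :: "int => complex" where "qp m = of_real (q powi m)"
definition nu :: "int => complex" where "nu m = of_real (qnum q m)"
definition hq :: complex where "hq = 1 / (cq - inverse cq)"

lemma q_ne0 [simp]: "q ~= 0" using q_pos by simp
lemma cq_ne0 [simp]: "cq ~= 0" by simp
lemma s_ne0 [simp]: "s ~= 0" using s2 q_pos by auto
lemma cs2: "cs * cs = cq" using s2 by (metis of_real_mult power2_eq_square)

lemma q_sq_ne1: "q * q ~= 1"
 using q_pos q_ne1 by (metis abs_of_pos mult_1 power2_eq_square real_sqrt_abs real_sqrt_one)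

lemma cq_sq_ne1: "cq * cq ~= 1"
 using q_sq_ne1 by (metis of_real_1 of_real_eq_iff of_real_mult)

lemma q_diff_ne0: "q - inverse q ~= 0"
 using q_sq_ne1 q_pos by (auto simp: field_simps)

lemma cq_diff_ne0: "cq - inverse cq ~= 0"
 using cq_sq_ne1 by (auto simp: field_simps)

lemma qp_0 [simp]: "qp 0 = 1" by (simp add: qp_def)
lemma qp_1 [simp]: "qp 1 = cq" by (simp add: qp_def)
lemma qp_ne0 [simp]: "qp m ~= 0" using q_pos by (simp add: qp_def)
lemma qp_add: "qp (m + n) = qp m * qp n" by (simp add: qp_def power_int_add)
lemma qp_minus: "qp (- m) = inverse (qp m)" by (simp add: qp_def power_int_minus)
lemma qp_2: "qp 2 = cq * cq" using qp_add[of 1 1] by simp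
lemma qp_diff: "qp (m - n) = qp m / qp n" using qp_add[of m "- n"] by (simp add: qp_minus divide_inverse)

lemma q_powi_inj: "q powi m = q powi n ==> m = n"
proof (rule ccontr)
 assume a: "q powi m = q powi n" and ne: "m ~= n"
 show False
 proof (cases "q > 1")
  case True
  show False using a ne power_int_strict_increasing[OF _ True] by (metis linorder_neq_iff)
 next
  case False
  hence "q < 1" using q_ne1 by simp
  thus False using a ne q_pos power_int_strict_decreasing[of _ _ q] by (metis linorder_neq_iff)
 qed
qed

lemma qp_inj [simp]: "qp m = qp n <-> m = n"
 using q_powi_inj by (metis of_real_eq_iff qp_def)

lemma qp_nat: "qp (int n) = cq ^ n" by (simp add: qp_def)

lemma nu_eq: "nu m = hq * (qp m - inverse (qp m))"
 by (simp add: nu_def qnum_def qp_def hq_def power_int_minus)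

lemma nu_0 [simp]: "nu 0 = 0" by (simp add: nu_eq)
lemma nu_minus: "nu (- m) = - nu m" by (simp add: nu_eq qp_minus algebra_simps)

lemma nu_inj [simp]: "nu m = nu n <-> m = n"
proof
 assume "nu m = nu n"
 hence "qnum q m = qnum q n" by (simp add: nu_def)
 hence "q powi m - inverse (q powi m) = q powi n - inverse (q powi n)"
  using q_diff_ne0 by (simp add: qnum_def power_int_minus)
 moreover have p: "q powi m > 0" "q powi n > 0" using q_pos by auto
 ultimately have "(q powi m - q powi n) * (q powi m * q powi n + 1) = 0"
  by (simp add: field_simps)
 moreover have "q powi m * q powi n + 1 > 0" using p by (simp add: add_pos_pos)
 ultimately show "m = n" using q_powi_inj by auto
qed auto

lemma nu_eq_0 [simp]: "nu m = 0 <-> m = 0"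
 using nu_inj[of m 0] by simp

text \<open>Functionals on the free algebra that descend to $U_q(\mathfrak u)$.\<close>

definition AD :: "ofun => bool" where
 "AD f <-> lin f & (ALL r:uq_rels q. ALL a b. f (a * r * b) = 0)"

lemma AD_lin [simp]: "AD f ==> lin f" by (simp add: AD_def)

lemma AD_rtr [simp]: "AD f ==> AD (rtr x f)"
 by (auto simp: AD_def lin_rtr) (simp add: rtr_def mult.assoc)

lemma AD_ltr [simp]: "AD f ==> AD (ltr x f)"
 by (auto simp: AD_def lin_ltr) (simp add: ltr_def flip: mult.assoc)

lemma AD_comb: "AD f ==> AD g ==> AD (%a. c * f a + g a)"
 by (auto simp: AD_def lin_comb)

lemma AD_zero: "AD (%a. 0)"
 by (auto simp: AD_def lin_zero)

lemma AD_sum: "(!!i. i : A ==> AD (f i)) ==> AD (%a. \<Sum>i\<in>A. f i a)"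
 by (auto simp: AD_def lin_sumf)

lemma AD_scale: "AD f ==> AD (%a. c * f a)"
 using AD_comb[of f "%_. 0" c] AD_zero by simp

lemma AD_rels:
 assumes "AD f"
 shows "f (a * uK * uKi * b) = f (a * b)" "f (a * uKi * uK * b) = f (a * b)"
  "f (a * uK * uE * b) = qp 2 * f (a * uE * uK * b)"
  "f (a * uK * uF * b) = qp (-2) * f (a * uF * uK * b)"
  "f (a * uE * uF * b) = f (a * uF * uE * b) + hq * (f (a * uK * b) - f (a * uKi * b))"
  "f (a * uKi * uE * b) = qp (-2) * f (a * uE * uKi * b)"
  "f (a * uKi * uF * b) = qp 2 * f (a * uF * uKi * b)"
proof -
 note l = linD[OF AD_lin[OF assms]]
 have R: "f (a * r * b) = 0" if "r : uq_rels q" for r a b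
  using assms that by (auto simp: AD_def)
 show k1: "f (a * uK * uKi * b) = f (a * b)" for a b
  using R[of "uK * uKi - 1" a b] by (simp add: uq_rels_def algebra_simps l)
 show k2: "f (a * uKi * uK * b) = f (a * b)" for a b
  using R[of "uKi * uK - 1" a b] by (simp add: uq_rels_def algebra_simps l)
 show e: "f (a * uK * uE * b) = qp 2 * f (a * uE * uK * b)" for a b
  using R[of "uK * uE * uKi - fa_const (of_real (q powi 2)) * uE" a "uK * b"] k2[of "a * uK * uE" b]
  by (simp add: uq_rels_def algebra_simps l fa_const_left_commute qp_def)
 show e': "f (a * uK * uF * b) = qp (-2) * f (a * uF * uK * b)" for a b
  using R[of "uK * uF * uKi - fa_const (of_real (q powi -2)) * uF" a "uK * b"] k2[of "a * uK * uF" b]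
  by (simp add: uq_rels_def algebra_simps l fa_const_left_commute qp_def)
 show "f (a * uE * uF * b) = f (a * uF * uE * b) + hq * (f (a * uK * b) - f (a * uKi * b))"
  using R[of "uE * uF - uF * uE - fa_const (of_real (1 / (q - inverse q))) * (uK - uKi)" a b]
  by (simp add: uq_rels_def algebra_simps l fa_const_left_commute hq_def)
 show "f (a * uKi * uE * b) = qp (-2) * f (a * uE * uKi * b)"
  using e[of "a * uKi" "uKi * b"] k1[of "a * uKi * uE" b] k2[of a "uE * uKi * b"]
  by (simp add: mult.assoc qp_minus field_simps)
 show "f (a * uKi * uF * b) = qp 2 * f (a * uF * uKi * b)"
  using e'[of "a * uKi" "uKi * b"] k1[of "a * uKi * uF" b] k2[of a "uF * uKi * b"]
  by (simp add: mult.assoc qp_minus field_simps)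
qed

lemma AD_rtr_rels:
 assumes "AD f"
 shows "rtr uK (rtr uKi f) = f" "rtr uKi (rtr uK f) = f"
  "rtr uK (rtr uE f) = (%a. qp 2 * rtr uE (rtr uK f) a)"
  "rtr uK (rtr uF f) = (%a. qp (-2) * rtr uF (rtr uK f) a)"
  "rtr uE (rtr uF f) = (%a. rtr uF (rtr uE f) a + hq * (rtr uK f a - rtr uKi f a))"
  "rtr uKi (rtr uE f) = (%a. qp (-2) * rtr uE (rtr uKi f) a)"
  "rtr uKi (rtr uF f) = (%a. qp 2 * rtr uF (rtr uKi f) a)"
 using AD_rels[OF assms, of _ 1] by (simp_all add: rtr_def fun_eq_iff)

lemma rtr_add: "rtr x (%a. f a + g a) = (%a. rtr x f a + rtr x g a)" by (simp add: rtr_def)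
lemma rtr_scale: "rtr x (%a. c * f a) = (%a. c * rtr x f a)" by (simp add: rtr_def)
lemma rtr_sum: "rtr x (%a. \<Sum>i\<in>A. f i a) = (%a. \<Sum>i\<in>A. rtr x (f i) a)" by (simp add: rtr_def)
lemma ltr_add: "ltr x (%a. f a + g a) = (%a. ltr x f a + ltr x g a)" by (simp add: ltr_def)
lemma ltr_scale: "ltr x (%a. c * f a) = (%a. c * ltr x f a)" by (simp add: ltr_def)

lemma omult_minus: "omult (%a. f a - g a) h = (%a. omult f h a - omult g h a)"
 "omult h (%a. f a - g a) = (%a. omult h f a - omult h g a)"
 using omult_comb_left[of "-1" g f h] omult_comb_right[of h "-1" g f] by (simp_all add: algebra_simps)

lemma AD_omult [simp]:
 assumes "AD f" "AD g"
 shows "AD (omult f g)"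
proof -
 have rel: "omult f g (a * r) = 0" if "r : uq_rels q" "AD f" "AD g" for r a f g
 proof -
  note [simp] = that(2,3)
  let ?h = "omult f g"
  note l = linD[OF lin_omult[of f g]]
  have e: "?h (a * (x * y)) = rtr x (rtr y ?h) a" "?h (a * x) = rtr x ?h a" for x y
   by (simp_all add: rtr_def mult.assoc)
  have e3: "?h (a * (x * (y * z))) = rtr x (rtr y (rtr z ?h)) a" for x y z
   by (simp add: rtr_def mult.assoc)
  note S = rtr_omult AD_rtr_rels omult_scale omult_add rtr_add rtr_scale omult_minus
  from that(1) consider "r = uK * uKi - 1" | "r = uKi * uK - 1"
   | "r = uK * uE * uKi - fa_const (of_real (q powi 2)) * uE"
   | "r = uK * uF * uKi - fa_const (of_real (q powi (-2))) * uF"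
   | "r = uE * uF - uF * uE - fa_const (of_real (1 / (q - inverse q))) * (uK - uKi)"
   unfolding uq_rels_def by blast
  thus ?thesis
  proof cases
   case 1
   have "?h (a * r) = ?h (a * (uK * uKi)) - ?h a"
    by (simp add: 1 right_diff_distrib l)
   thus ?thesis unfolding e(1)[of uK uKi] by (simp add: S)
  next
   case 2
   have "?h (a * r) = ?h (a * (uKi * uK)) - ?h a"
    by (simp add: 2 right_diff_distrib l)
   thus ?thesis unfolding e(1)[of uKi uK] by (simp add: S)
  next
   case 3
   have "?h (a * r) = ?h (a * (uK * (uE * uKi))) - qp 2 * ?h (a * uE)"
    by (simp add: 3 right_diff_distrib l qp_def mult.assoc)
   thus ?thesis unfolding e(2)[of uE] e3[of uK uE uKi] by (simp add: S distrib_left)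
  next
   case 4
   have "?h (a * r) = ?h (a * (uK * (uF * uKi))) - qp (-2) * ?h (a * uF)"
    by (simp add: 4 right_diff_distrib l qp_def mult.assoc)
   thus ?thesis unfolding e(2)[of uF] e3[of uK uF uKi] by (simp add: S distrib_left)
  next
   case 5
   have "?h (a * r) = ?h (a * (uE * uF)) - ?h (a * (uF * uE)) - hq * (?h (a * uK) - ?h (a * uKi))"
    by (simp add: 5 right_diff_distrib l hq_def mult.assoc)
   thus ?thesis unfolding e(1)[of uE uF] e(1)[of uF uE] e(2)[of uK] e(2)[of uKi]
    by (simp add: S distrib_left algebra_simps)
  qed
 qed
 have "omult f g (a * r * wd ys) = 0" if "r : uq_rels q" for r a ys
  using assms
 proof (induction ys arbitrary: f g rule: rev_induct)
  case Nil
  thus ?case using rel[OF that] by (simp add: wd_Nil)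
 next
  case (snoc x ys)
  have "omult f g (a * r * wd (ys @ [x])) = rtr (fa_gen x) (omult f g) (a * r * wd ys)"
   by (simp add: rtr_def wd_snoc mult.assoc)
  also have "... = 0"
   by (cases x) (simp_all add: rtr_omult snoc)
  finally show ?case .
 qed
 hence "omult f g (a * r * b) = 0" if "r : uq_rels q" for r a b
  by (induction b rule: fa_induct) (simp_all add: that linD[OF lin_omult] distrib_left)
 thus ?thesis by (simp add: AD_def)
qed

lemma AD_counit [simp]: "AD counit"
proof -
 have "counit r = 0" if "r : uq_rels q" for r
  using that by (auto simp: uq_rels_def linD[OF lin_counit] counit_mult)
 thus ?thesis by (simp add: AD_def counit_mult)
qed

section \<open>Matrix coefficients\<close>

definition frep :: "nat => (nat => nat => ofun) => bool" where
 "frep n M <-> (ALL i<n. ALL j<n. AD (M i j) & M i j 1 = (if i = j then 1 else 0) &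
   (ALL x y. M i j (x * y) = (\<Sum>k<n. M i k x * M k j y)))"

definition cf :: "nat => (nat => nat => ofun) => (nat => complex) => (nat => complex) => ofun" where
 "cf n M al be = (%x. \<Sum>i<n. \<Sum>j<n. al i * M i j x * be j)"

definition rmat :: "nat => (ugen => complex mat) => nat => nat => ofun" where
 "rmat n rh i j = (%x. fa_lin (%w. rep_word n rh w $$ (i, j)) x)"

lemma rep_mat_index: "i < n ==> j < n ==> rep_mat n rh x $$ (i, j) = rmat n rh i j x"
 by (simp add: rep_mat_def rmat_def)

lemma rep_mat_carrier [simp]: "rep_mat n rh x : carrier_mat n n"
 by (simp add: rep_mat_def)

lemma coef_cf:
 assumes "ph : carrier_vec n" "v : carrier_vec n"
 shows "coef n rh ph v = cf n (rmat n rh) (%i. ph $ i) (%j. v $ j)"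
 using assms
 by (auto simp: coef_def cf_def fun_eq_iff scalar_prod_def mult_mat_vec_def rep_mat_def rmat_def
   sum_distrib_left mult.assoc atLeast0LessThan intro!: sum.cong)

lemma rep_word_carrier:
 assumes "!!g. rh g : carrier_mat n n" shows "rep_word n rh w : carrier_mat n n"
proof -
 have "foldr (%g A. rh g * A) xs (1\<^sub>m n) : carrier_mat n n" for xs
  by (induction xs) (auto intro!: mult_carrier_mat assms)
 thus ?thesis by (simp add: rep_word_def)
qed

lemma rep_word_Cons: "rep_word n rh (FMon (g # xs)) = rh g * rep_word n rh (FMon xs)"
 by (simp add: rep_word_def)

lemma rep_word_append:
 assumes "!!g. rh g : carrier_mat n n"
 shows "rep_word n rh (FMon (xs @ ys)) = rep_word n rh (FMon xs) * rep_word n rh (FMon ys)"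
proof (induction xs)
 case Nil
 thus ?case by (simp add: rep_word_def[of _ _ "FMon []"] left_mult_one_mat[OF rep_word_carrier[OF assms]])
next
 case (Cons g xs)
 thus ?case
  using rep_word_carrier[of rh n] assms by (simp add: rep_word_Cons assoc_mult_mat[of _ n n _ n _ n])
qed

lemma lin_rmat: "lin (rmat n rh i j)"
 by (simp add: rmat_def lin_fa_lin)

lemma rmat_wd: "rmat n rh i j (wd xs) = rep_word n rh (FMon xs) $$ (i, j)"
 by (simp add: rmat_def wd_def)

lemma rmat_mult:
 assumes "!!g. rh g : carrier_mat n n" "i < n" "j < n"
 shows "rmat n rh i j (x * y) = (\<Sum>k<n. rmat n rh i k x * rmat n rh k j y)"
proof (induction x rule: fa_induct)
 case (wd xs)
 show ?case
 proof (induction y rule: fa_induct)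
  case (wd ys)
  have c: "rep_word n rh w : carrier_mat n n" for w by (rule rep_word_carrier) (fact assms)
  have d: "dim_row (rep_word n rh w) = n" "dim_col (rep_word n rh w) = n" for w using c[of w] by auto
  show ?case
   using assms(2,3)
   by (simp add: rmat_wd rep_word_append[OF assms(1)] scalar_prod_def atLeast0LessThan d flip: wd_append)
 qed (simp_all add: linD[OF lin_rmat] algebra_simps sum.distrib sum_distrib_left)
qed (simp_all add: linD[OF lin_rmat] algebra_simps sum.distrib sum_distrib_left)

lemma rmat_1: "i < n ==> j < n ==> rmat n rh i j 1 = (if i = j then 1 else 0)"
 using rmat_wd[of n rh i j "[]"] by (simp add: wd_Nil rep_word_def)

lemma rmat_gen:
 assumes "!!g. rh g : carrier_mat n n" "i < n" "j < n"
 shows "rmat n rh i j (fa_gen g) = rh g $$ (i, j)"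
 using rmat_wd[of n rh i j "[g]"] assms by (simp add: wd_gen rep_word_def right_mult_one_mat[OF assms(1)])

lemma rmat_frep:
 assumes "type1_module q n rh"
 shows "frep n (rmat n rh)"
 unfolding frep_def
proof (intro allI impI conjI)
 fix i j assume ij: "i < n" "j < n"
 have c: "!!g. rh g : carrier_mat n n" using assms by (simp add: type1_module_def)
 show "rmat n rh i j 1 = (if i = j then 1 else 0)" by (rule rmat_1[OF ij])
 show "rmat n rh i j (x * y) = (\<Sum>k<n. rmat n rh i k x * rmat n rh k j y)" for x y
  by (rule rmat_mult[OF c ij])
 have z: "rmat n rh i j r = 0" if "r : uq_rels q" "i < n" "j < n" for r i j
  using assms that rep_mat_index[of i n j rh r] by (simp add: type1_module_def)
 have "rmat n rh i j (a * r * b) = 0" if "r : uq_rels q" for r a b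
  by (simp add: rmat_mult[OF c] ij that z)
 thus "AD (rmat n rh i j)" by (simp add: AD_def lin_rmat)
qed

lemma frep_AD_cf: "frep n M ==> AD (cf n M al be)"
 unfolding cf_def
 by (intro AD_sum) (auto simp: frep_def mult.assoc mult.commute[of _ "be _"] intro!: AD_scale)

lemma cf_rtr:
 assumes "frep n M"
 shows "rtr x (cf n M al be) = cf n M al (%j. \<Sum>l<n. M j l x * be l)"
proof
 fix b
 have "rtr x (cf n M al be) b = (\<Sum>i<n. \<Sum>l<n. \<Sum>j<n. al i * M i j b * (M j l x * be l))"
  using assms by (simp add: rtr_def cf_def frep_def sum_distrib_left sum_distrib_right mult_ac)
 also have "... = (\<Sum>i<n. \<Sum>j<n. \<Sum>l<n. al i * M i j b * (M j l x * be l))"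
  by (intro sum.cong refl sum.swap)
 also have "... = cf n M al (%j. \<Sum>l<n. M j l x * be l) b"
  by (simp add: cf_def sum_distrib_left mult_ac)
 finally show "rtr x (cf n M al be) b = cf n M al (%j. \<Sum>l<n. M j l x * be l) b" .
qed

lemma cf_ltr:
 assumes "frep n M"
 shows "ltr x (cf n M al be) = cf n M (%i. \<Sum>l<n. al l * M l i x) be"
proof
 fix b
 have "ltr x (cf n M al be) b = (\<Sum>l<n. \<Sum>j<n. \<Sum>i<n. al l * M l i x * M i j b * be j)"
  using assms by (simp add: ltr_def cf_def frep_def sum_distrib_left sum_distrib_right mult_ac)
 also have "... = (\<Sum>l<n. \<Sum>i<n. \<Sum>j<n. al l * M l i x * M i j b * be j)"
  by (intro sum.cong refl sum.swap)
 also have "... = (\<Sum>i<n. \<Sum>l<n. \<Sum>j<n. al l * M l i x * M i j b * be j)"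
  by (rule sum.swap)
 also have "... = (\<Sum>i<n. \<Sum>j<n. \<Sum>l<n. al l * M l i x * M i j b * be j)"
  by (intro sum.cong refl sum.swap)
 also have "... = cf n M (%i. \<Sum>l<n. al l * M l i x) be b"
  by (simp add: cf_def sum_distrib_left sum_distrib_right mult_ac)
 finally show "ltr x (cf n M al be) b = cf n M (%i. \<Sum>l<n. al l * M l i x) be b" .
qed

lemma cf_comb: "cf n M al (%j. c * be j + be' j) = (%x. c * cf n M al be x + cf n M al be' x)"
 by (simp add: cf_def fun_eq_iff algebra_simps sum.distrib sum_distrib_left)

lemma cf_sum: "cf n M al (%j. \<Sum>l\<in>A. c l * be l j) = (%x. \<Sum>l\<in>A. c l * cf n M al (be l) x)"
proof (induction A rule: infinite_finite_induct)
 case (insert l A)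
 thus ?case by (simp add: cf_comb)
qed (simp_all add: cf_def)

lemma cf_cong: "(!!j. j < n ==> be j = be' j) ==> (!!j. j < n ==> al j = al' j) ==> cf n M al be = cf n M al' be'"
 by (simp add: cf_def)

lemma cf_coprod:
 assumes "frep n M"
 shows "cf n M al be (x * y) = (\<Sum>k<n. cf n M al (%j. if j = k then 1 else 0) x * cf n M (%i. if i = k then 1 else 0) be y)"
proof -
 have z: "(\<Sum>j<n. (if i = k then 1 else 0) * M i j y * be j) = (if i = k then \<Sum>j<n. M k j y * be j else 0)" for i k
  by simp
 have d: "cf n M (%i. if i = k then 1 else 0) be y = (\<Sum>l<n. M k l y * be l)" if "k < n" for k
  using that by (simp add: cf_def z)
 have "cf n M al be (x * y) = rtr y (cf n M al be) x" by (simp add: rtr_def)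
 also have "... = cf n M al (%j. \<Sum>k<n. cf n M (%i. if i = k then 1 else 0) be y * (if j = k then 1 else 0)) x"
  unfolding cf_rtr[OF assms]
  by (rule fun_cong[of _ _ x], rule cf_cong) (auto simp: d if_distrib cong: if_cong)
 finally show ?thesis unfolding cf_sum by (simp add: mult.commute)
qed

lemma OU_E:
 assumes "f : OU q"
 obtains n rh al be w m where "type1_module q n rh" "frep n (rmat n rh)" "f = cf n (rmat n rh) al be"
  "!!be'. EX c. ALL j<n. be' j = (\<Sum>l<n. c l * w l j)"
  "!!l i. l < n ==> i < n ==> (\<Sum>j<n. rmat n rh i j uK * w l j) = qp (m l) * w l i"
proof -
 from assms obtain n rh ph v where t: "type1_module q n rh" "ph : carrier_vec n" "v : carrier_vec n"
  "f = coef n rh ph v" by (auto simp: OU_def)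
 then obtain D where D: "similar_mat (rh gK) D" "diagonal_mat D" "!!i. i < n ==> EX m::int. D $$ (i, i) = of_real (q powi m)"
  and c: "!!g. rh g : carrier_mat n n"
  by (auto simp: type1_module_def)
 then obtain P Q' where PQ: "similar_mat_wit (rh gK) D P Q'" by (auto simp: similar_mat_def)
 note w = similar_mat_witD2[OF c PQ]
 from D(3) obtain m where m: "!!i. i < n ==> D $$ (i, i) = qp (m i)" by (metis qp_def)
 have KP: "rh gK * P = P * D"
  using w by (simp add: assoc_mult_mat[of _ n n _ n _ n])
 show ?thesis
 proof (rule that[of n rh "%i. ph $ i" "%j. v $ j" "%l j. P $$ (j, l)" m])
  show "type1_module q n rh" "frep n (rmat n rh)" using t rmat_frep by auto
  show "f = cf n (rmat n rh) (($) ph) (($) v)" using t coef_cf by simp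
  show "EX c. ALL j<n. be' j = (\<Sum>l<n. c l * P $$ (j, l))" for be'
  proof (intro exI allI impI)
   fix j assume j: "j < n"
   have "P * Q' = 1\<^sub>m n" using w by simp
   hence d: "(\<Sum>l<n. P $$ (j, l) * Q' $$ (l, k)) = (if j = k then 1 else 0)" if "k < n" for k
    using w j that by (auto simp: scalar_prod_def atLeast0LessThan dest!: arg_cong[where f = "%A. A $$ (j, k)"])
   have "(\<Sum>l<n. (\<Sum>k<n. Q' $$ (l, k) * be' k) * P $$ (j, l)) = (\<Sum>k<n. (\<Sum>l<n. P $$ (j, l) * Q' $$ (l, k)) * be' k)"
    by (simp add: sum_distrib_left sum_distrib_right mult_ac) (rule sum.swap)
   also have "... = (\<Sum>k<n. if j = k then be' k else 0)"
    by (intro sum.cong) (auto simp: d)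
   finally show "be' j = (\<Sum>l<n. (\<Sum>k<n. Q' $$ (l, k) * be' k) * P $$ (j, l))"
    using j by simp
  qed
  fix l i assume li: "l < n" "i < n"
  have "(\<Sum>j<n. rmat n rh i j uK * P $$ (j, l)) = (rh gK * P) $$ (i, l)"
   using li c[of gK] w rmat_gen[OF c, where g = gK] by (auto simp: scalar_prod_def atLeast0LessThan intro!: sum.cong)
  also have "... = (\<Sum>j<n. P $$ (i, j) * D $$ (j, l))"
   unfolding KP using li w by (auto simp: scalar_prod_def atLeast0LessThan)
  also have "... = (\<Sum>j<n. if j = l then P $$ (i, l) * D $$ (l, l) else 0)"
   using D(2) li w by (intro sum.cong) (auto simp: diagonal_mat_def)
  also have "... = qp (m l) * P $$ (i, l)" using li m by (simp add: mult.commute)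
  finally show "(\<Sum>j<n. rmat n rh i j uK * P $$ (j, l)) = qp (m l) * P $$ (i, l)" .
 qed
qed

lemma OU_I:
 assumes "frep n M" "!!i j. i < n ==> j < n ==> M i j uK = (if i = j then qp (m i) else 0)"
 shows "cf n M al be : OU q"
proof -
 let ?rh = "%g. Matrix.mat n n (%(i, j). M i j (fa_gen g))"
 have w: "rep_word n ?rh (FMon xs) = Matrix.mat n n (%(i, j). M i j (wd xs))" for xs
 proof (induction xs)
  case Nil
  show ?case by (rule eq_matI) (use assms in "auto simp: rep_word_def frep_def wd_Nil")
 next
  case (Cons g xs)
  show ?case
   by (rule eq_matI) (use assms in "auto simp: rep_word_Cons Cons wd_Cons frep_def scalar_prod_def atLeast0LessThan")
 qed
 have r: "rmat n ?rh i j = M i j" if "i < n" "j < n" for i j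
  by (rule lin_eq_wdI[OF lin_rmat]) (use assms that in "auto simp: frep_def rmat_wd w")
 have "type1_module q n ?rh"
  unfolding type1_module_def
 proof (intro conjI allI ballI)
  fix x assume "x : uq_rels q"
  have "M i j x = 0" if "i < n" "j < n" for i j
  proof -
   have "M i j (1 * x * 1) = 0"
    using assms(1) that `x : uq_rels q` unfolding frep_def AD_def by blast
   thus ?thesis by simp
  qed
  thus "rep_mat n ?rh x = 0\<^sub>m n n"
   by (intro eq_matI) (use rep_mat_index[of _ n _ ?rh x] carrier_matD[OF rep_mat_carrier[of n ?rh x]] in "auto simp: r")
 next
  show "EX D. similar_mat (?rh gK) D & diagonal_mat D & (ALL i<n. EX m. D $$ (i, i) = complex_of_real (q powi m))"
   by (rule exI[of _ "?rh gK"]) (use assms(2) in "auto simp: similar_mat_refl[of _ n] diagonal_mat_def qp_def")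
 qed auto
 moreover have "cf n M al be = coef n ?rh (Matrix.vec n al) (Matrix.vec n be)"
  by (auto simp: coef_cf fun_eq_iff cf_def r intro!: sum.cong)
 ultimately show ?thesis by (force simp: OU_def)
qed

lemma OU_AD: "f : OU q ==> AD f"
 by (erule OU_E) (auto intro: frep_AD_cf)

end

section \<open>Generation by highest weight vectors\<close>

definition csub :: "('a => complex) set => bool" where
 "csub S <-> (%_. 0) : S & (ALL c. ALL f:S. ALL g:S. (%a. c * f a + g a) : S)"

lemma csubD:
 assumes "csub S"
 shows "(%_. 0) : S" "f : S ==> g : S ==> (%a. c * f a + g a) : S" "f : S ==> (%a. c * f a) : S"
  "f : S ==> g : S ==> (%a. f a + g a) : S" "f : S ==> g : S ==> (%a. f a - g a) : S"
proof -
 show z: "(%_. 0) : S" and "f : S ==> g : S ==> (%a. c * f a + g a) : S"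
  using assms by (auto simp: csub_def)
 have C: "(%a. c * f a + g a) : S" if "f : S" "g : S" for c f g using assms that by (auto simp: csub_def)
 show "f : S ==> (%a. c * f a) : S" using C[of f "%_. 0" c] z by simp
 show "f : S ==> g : S ==> (%a. f a + g a) : S" using C[of f g 1] by simp
 show "f : S ==> g : S ==> (%a. f a - g a) : S" using C[of g f "-1"] by simp
qed

lemma csub_sum:
 assumes "csub S" "!!i. i : A ==> f i : S"
 shows "(%a. \<Sum>i\<in>A. f i a) : S"
 using assms(2) by (induction A rule: infinite_finite_induct) (auto intro: csubD[OF assms(1)])

lemma csub_Int: "csub S ==> csub T ==> csub (S \<inter> T)"
 by (auto simp: csub_def)

lemma csub_unscale:
 assumes "csub S" "(%a. c * f a) : S" "c ~= 0" shows "f : S"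
 using csubD(3)[OF assms(1,2), of "inverse c"] assms(3) by (simp add: field_simps)

text \<open>Eigencomponents for distinct eigenvalues lie in every invariant subspace that contains
  their sum.\<close>

lemma eigencomponents_in:
 fixes L :: "('a => complex) => 'a => complex"
 assumes "csub S" "!!f. f : S ==> L f : S" "finite B" "inj_on r B"
  and L: "!!c f g. L (%a. c * f a + g a) = (%a. c * L f a + L g a)"
  and "!!m. m : B ==> L (f m) = (%a. r m * f m a)" "(%a. \<Sum>m\<in>B. f m a) : S" "m : B"
 shows "f m : S"
 using assms(3,4,6-8)
proof (induction B arbitrary: f m rule: finite_induct)
 case (insert m0 B)
 note S = csubD[OF assms(1)]
 have L0: "L (%a. 0) = (%a. 0)" using L[of "-1" "%_. 0" "%_. 0"] by (simp add: fun_eq_iff)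
 have Ls: "L (%a. c * f a) = (%a. c * L f a)" for c f using L[of c f "%_. 0"] L0 by simp
 have Lsum: "L (%a. \<Sum>m\<in>A. g m a) = (%a. \<Sum>m\<in>A. L (g m) a)" for A and g :: "'b => _"
 proof (induction A rule: infinite_finite_induct)
  case (insert x A)
  thus ?case using L[of 1 "g x" "%a. \<Sum>m\<in>A. g m a"] by simp
 qed (simp_all add: L0)
 let ?F = "%a. \<Sum>m\<in>insert m0 B. f m a"
 have LF: "L ?F = (%a. \<Sum>m\<in>insert m0 B. r m * f m a)"
  unfolding Lsum using insert.prems(2) by (intro ext sum.cong) auto
 have "(%a. (- r m0) * ?F a + L ?F a) : S"
  by (intro S assms(2) insert.prems)
 also have "(%a. (- r m0) * ?F a + L ?F a) = (%a. \<Sum>m\<in>B. (r m - r m0) * f m a)"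
  unfolding LF using insert.hyps by (simp add: fun_eq_iff algebra_simps sum_distrib_left sum_subtractf sum_negf)
 finally have *: "(%a. \<Sum>m\<in>B. (r m - r m0) * f m a) : S" .
 have in_B: "f m : S" if "m : B" for m
 proof (rule csub_unscale[OF assms(1)])
  show "(%a. (r m - r m0) * f m a) : S"
   by (rule insert.IH[where f = "%m a. (r m - r m0) * f m a"])
    (use insert.prems * that in "auto simp: Ls")
  show "r m - r m0 ~= 0" using insert.prems(1) insert.hyps that by (auto simp: inj_on_def)
 qed
 have "(%a. ?F a - (\<Sum>m\<in>B. f m a)) : S"
  by (intro S csub_sum[OF assms(1)] in_B insert.prems) auto
 hence "f m0 : S" using insert.hyps by simp
 thus ?case using in_B insert.prems by auto
qed simp

locale sl2_operators = quantum +
 fixes e f :: "('a => complex) => 'a => complex" and Wt :: "int => ('a => complex) set"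
 assumes Wt_csub: "csub (Wt m)"
  and e_lin: "e (%a. c * x a + y a) = (%a. c * e x a + e y a)"
  and f_lin: "f (%a. c * x a + y a) = (%a. c * f x a + f y a)"
  and e_Wt: "x : Wt m ==> e x : Wt (m + 2)"
  and f_Wt: "x : Wt m ==> f x : Wt (m - 2)"
  and ef: "x : Wt m ==> e (f x) = (%a. f (e x) a + nu m * x a)"
begin

lemma e_0 [simp]: "e (%a. 0) = (%a. 0)"
 using e_lin[of "-1" "%_. 0" "%_. 0"] by (simp add: fun_eq_iff)

lemma f_0 [simp]: "f (%a. 0) = (%a. 0)"
 using f_lin[of "-1" "%_. 0" "%_. 0"] by (simp add: fun_eq_iff)

lemma e_scale: "e (%a. c * x a) = (%a. c * e x a)" using e_lin[of c x "%_. 0"] by simp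
lemma f_scale: "f (%a. c * x a) = (%a. c * f x a)" using f_lin[of c x "%_. 0"] by simp

lemma epow_lin: "(e ^^ j) (%a. c * x a + y a) = (%a. c * (e ^^ j) x a + (e ^^ j) y a)"
 by (induction j) (simp_all add: e_lin)

lemma epow_scale: "(e ^^ j) (%a. c * x a) = (%a. c * (e ^^ j) x a)"
 by (induction j) (simp_all add: e_scale)

lemma epow_Wt: "x : Wt m ==> (e ^^ j) x : Wt (m + 2 * int j)"
proof (induction j)
 case (Suc j)
 thus ?case using e_Wt[of "(e ^^ j) x" "m + 2 * int j"] by (simp add: algebra_simps)
qed simp

lemma fpow_Wt: "x : Wt m ==> (f ^^ j) x : Wt (m - 2 * int j)"
proof (induction j)
 case (Suc j)
 thus ?case using f_Wt[of "(f ^^ j) x" "m - 2 * int j"] by (simp add: algebra_simps)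
qed simp

lemma nu_identity: "nu (i + 1) * nu (l - 1) = nu i * nu l + nu (l - i - 1)"
proof -
 have qq: "cq * cq - 1 ~= 0" using cq_sq_ne1 by simp
 have hq': "hq = cq / (cq * cq - 1)" by (simp add: hq_def field_simps)
 have D: "qp (i + 1) = qp i * cq" "qp (l - 1) = qp l / cq" "qp (l - i - 1) = qp l / (qp i * cq)"
  by (simp_all add: qp_add qp_diff)
 have ne: "qp i ~= 0" "qp l ~= 0" by auto
 show ?thesis
  unfolding nu_eq D hq' using ne qq by (simp add: divide_simps) (simp add: algebra_simps power2_eq_square)
qed

lemma e_fpow:
 assumes "w : Wt l" "e w = (%a. 0)"
 shows "e ((f ^^ Suc j) w) = (%a. nu (int j + 1) * nu (l - int j) * (f ^^ j) w a)"
proof (induction j)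
 case 0
 show ?case using ef[OF assms(1)] assms(2) by (simp add: nu_eq hq_def cq_diff_ne0)
next
 case (Suc j)
 have "e ((f ^^ Suc (Suc j)) w) = (%a. f (e ((f ^^ Suc j) w)) a + nu (l - 2 * int (Suc j)) * (f ^^ Suc j) w a)"
  using ef[OF fpow_Wt[OF assms(1)], of "Suc j"] by simp
 also have "... = (%a. (nu (int j + 1) * nu (l - int j) + nu (l - 2 * int (Suc j))) * (f ^^ Suc j) w a)"
  unfolding Suc f_scale by (simp add: algebra_simps)
 also have "nu (int j + 1) * nu (l - int j) + nu (l - 2 * int (Suc j)) = nu (int (Suc j) + 1) * nu (l - int (Suc j))"
  using nu_identity[of "int j + 1" "l - int j"] by (simp add: algebra_simps)
 finally show ?case .
qed

text \<open>Raising undoes lowering up to a scalar: the scalars $[i]_q[l-i+1]_q$ do not vanish within the string.\<close>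

lemma epow_fpow:
 assumes "w : Wt l" "e w = (%a. 0)" "int j <= l"
 shows "EX c. c ~= 0 & (e ^^ j) ((f ^^ j) w) = (%a. c * w a)"
 using assms(3)
proof (induction j)
 case 0
 show ?case by (rule exI[of _ 1]) simp
next
 case (Suc j)
 then obtain c where c: "c ~= 0" "(e ^^ j) ((f ^^ j) w) = (%a. c * w a)" by auto
 have "(e ^^ Suc j) ((f ^^ Suc j) w) = (e ^^ j) (e ((f ^^ Suc j) w))"
  by (simp only: funpow_Suc_right o_apply)
 also have "... = (%a. nu (int j + 1) * nu (l - int j) * (c * w a))"
  unfolding e_fpow[OF assms(1,2)] epow_scale c(2) ..
 finally show ?case
  using c(1) Suc.prems by (intro exI[of _ "nu (int j + 1) * nu (l - int j) * c"]) (auto simp: mult_ac)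
qed

end

locale sl2_bounded = sl2_operators +
 fixes B :: int
 assumes bound: "x : Wt m ==> \<bar>m\<bar> > B ==> x = (%a. 0)"
begin

lemma highest_weight_nonneg:
 assumes "w : Wt l" "e w = (%a. 0)" "w ~= (%a. 0)"
 shows "l \<ge> 0"
proof (rule ccontr)
 assume l: "~ l \<ge> 0"
 have "(f ^^ j) w ~= (%a. 0)" for j
 proof (induction j)
  case (Suc j)
  show ?case
  proof
   assume "(f ^^ Suc j) w = (%a. 0)"
   hence "(%a. nu (int j + 1) * nu (l - int j) * (f ^^ j) w a) = (%a. 0)"
    using e_fpow[OF assms(1,2), of j] by simp
   moreover have "nu (int j + 1) * nu (l - int j) ~= 0" using l by simp
   ultimately show False using Suc by (simp add: fun_eq_iff)
  qed
 qed (use assms in simp)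
 moreover have "(f ^^ nat (\<bar>B\<bar> + 1)) w = (%a. 0)"
  by (rule bound[OF fpow_Wt[OF assms(1)]]) (use l in linarith)
 ultimately show False by blast
qed

text \<open>The weight $-l-2$ vector at the end of the string is killed by \<open>e\<close>, hence it would be a highest
  weight vector of negative weight.\<close>

lemma fpow_highest:
 assumes "w : Wt (int l)" "e w = (%a. 0)"
 shows "(f ^^ Suc l) w = (%a. 0)"
proof (rule ccontr)
 assume a: "(f ^^ Suc l) w ~= (%a. 0)"
 have "e ((f ^^ Suc l) w) = (%a. 0)" using e_fpow[OF assms, of l] by simp
 from highest_weight_nonneg[OF fpow_Wt[OF assms(1)] this a] show False by simp
qed

text \<open>Induction on the number of applications of \<open>e\<close> that kill \<open>x\<close>: the last nonzero one is a highest
  weight vector, and a multiple of its image under the same power of \<open>f\<close> can be subtracted from \<open>x\<close>.\<close>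

lemma generated_nonneg:
 assumes "csub S" "!!x. x : S ==> f x : S"
  and hw: "!!w l. w : Wt (int l) ==> e w = (%a. 0) ==> w : S"
  and "x : Wt m" "m \<ge> 0"
 shows "x : S"
proof -
 note S = csubD[OF assms(1)]
 have "ALL x:Wt m. (e ^^ j) x = (%a. 0) --> x : S" for j
 proof (induction j)
  case 0
  thus ?case using S by auto
 next
  case (Suc j)
  show ?case
  proof (intro ballI impI)
   fix x assume x: "x : Wt m" "(e ^^ Suc j) x = (%a. 0)"
   let ?w = "(e ^^ j) x"
   have w: "?w : Wt (m + 2 * int j)" "e ?w = (%a. 0)" using x epow_Wt by auto
   obtain c where c: "c ~= 0" "(e ^^ j) ((f ^^ j) ?w) = (%a. c * ?w a)"
    using epow_fpow[OF w, of j] assms(5) by auto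
   have "?w : S" using hw[of ?w "nat (m + 2 * int j)"] w assms(5) by simp
   have "(f ^^ i) u : S" if "u : S" for i u using that by (induction i) (auto intro: assms(2))
   with `?w : S` have fw: "(f ^^ j) ?w : S" by blast
   have fw': "(f ^^ j) ?w : Wt m" using fpow_Wt[OF w(1), of j] by simp
   let ?y = "%a. (- inverse c) * (f ^^ j) ?w a + x a"
   have "?y : Wt m" by (intro csubD(2)[OF Wt_csub] fw' x)
   moreover have "(e ^^ j) ?y = (%a. 0)" unfolding epow_lin c(2) using c(1) by (simp add: fun_eq_iff field_simps)
   ultimately have y: "?y : S" using Suc by blast
   have "(%a. inverse c * (f ^^ j) ?w a + ?y a) : S" by (rule S(2)[OF fw y])
   moreover have "(%a. inverse c * (f ^^ j) ?w a + ?y a) = x" by (simp add: fun_eq_iff)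
   ultimately show "x : S" by (simp only:)
  qed
 qed
 moreover have "(e ^^ nat (\<bar>B\<bar> + 1)) x = (%a. 0)"
  by (rule bound[OF epow_Wt[OF assms(4)]]) (use assms(5) in linarith)
 ultimately show ?thesis using assms(4) by blast
qed

end

lemma (in sl2_bounded) swapped: "sl2_bounded q s f e (%m. Wt (- m)) B"
proof unfold_locales
 fix x m assume "x : Wt (- m)"
 thus "f (e x) = (%a. e (f x) a + nu m * x a)"
  using ef[of x "- m"] by (simp add: nu_minus)
next
 fix x m assume "x : Wt (- m)" thus "f x : Wt (- (m + 2))" using f_Wt[of x "- m"] by simp
next
 fix x m assume "x : Wt (- m)" thus "e x : Wt (- (m - 2))" using e_Wt[of x "- m"] by simp
qed (auto simp: e_lin f_lin Wt_csub intro: bound)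

context sl2_bounded
begin

lemma generated:
 assumes "csub S" "!!x. x : S ==> f x : S" "!!x. x : S ==> e x : S"
  and hw: "!!w l. w : Wt (int l) ==> e w = (%a. 0) ==> w : S"
  and x: "x : Wt m"
 shows "x : S"
proof (cases "m \<ge> 0")
 case True
 show ?thesis by (rule generated_nonneg[OF assms(1,2) hw x True])
next
 case False
 interpret sw: sl2_bounded q s f e "%m. Wt (- m)" B by (rule swapped)
 show ?thesis
 proof (rule sw.generated_nonneg[where m = "- m"])
  fix w l assume w: "w : Wt (- int l)" "f w = (%a. 0)"
  have "(e ^^ l) w : Wt (int l)" using epow_Wt[OF w(1), of l] by simp
  moreover have "e ((e ^^ l) w) = (%a. 0)" using sw.fpow_highest[OF w] by simp
  ultimately have "(e ^^ l) w : S" by (rule hw)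
  hence "(f ^^ j) ((e ^^ l) w) : S" for j by (induction j) (auto intro: assms(2))
  moreover obtain c where "c ~= 0" "(f ^^ l) ((e ^^ l) w) = (%a. c * w a)"
   using sw.epow_fpow[OF w, of l] by auto
  ultimately show "w : S" using csub_unscale[OF assms(1)] by metis
 qed (use assms False in auto)
qed

end

context quantum
begin

lemma rtr_zero [simp]: "rtr x (%_. 0) = (%_. 0)"
 by (simp add: rtr_def)

lemma rtr_weight:
 assumes "AD x" "rtr uK x = (%a. qp m * x a)"
 shows "rtr uKi x = (%a. qp (- m) * x a)"
  "rtr uK (rtr uE x) = (%a. qp (m + 2) * rtr uE x a)"
  "rtr uK (rtr uF x) = (%a. qp (m - 2) * rtr uF x a)"
  "rtr uE (rtr uF x) = (%a. rtr uF (rtr uE x) a + nu m * x a)"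
proof -
 have "rtr uKi (%a. qp m * x a) = x" using AD_rtr_rels(2)[OF assms(1)] assms(2) by simp
 hence "(%a. qp m * rtr uKi x a) = x" unfolding rtr_scale .
 from fun_cong[OF this] show k: "rtr uKi x = (%a. qp (- m) * x a)"
  by (simp add: qp_minus fun_eq_iff field_simps)
 show "rtr uK (rtr uE x) = (%a. qp (m + 2) * rtr uE x a)"
  unfolding AD_rtr_rels(3)[OF assms(1)] assms(2) rtr_scale by (simp add: qp_add mult_ac)
 show "rtr uK (rtr uF x) = (%a. qp (m - 2) * rtr uF x a)"
  unfolding AD_rtr_rels(4)[OF assms(1)] assms(2) rtr_scale by (simp add: qp_diff qp_minus field_simps)
 show "rtr uE (rtr uF x) = (%a. rtr uF (rtr uE x) a + nu m * x a)"
  using AD_rtr_rels(5)[OF assms(1)] assms(2) k by (simp add: nu_eq qp_minus algebra_simps)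
qed

lemma ltr_weight:
 assumes "AD x" "ltr uK x = (%a. qp m * x a)"
 shows "ltr uKi x = (%a. qp (- m) * x a)"
  "ltr uK (ltr uF x) = (%a. qp (m + 2) * ltr uF x a)"
  "ltr uK (ltr uE x) = (%a. qp (m - 2) * ltr uE x a)"
  "ltr uF (ltr uE x) = (%a. ltr uE (ltr uF x) a + nu m * x a)"
proof -
 have K: "x (uK * b) = qp m * x b" for b using assms(2) by (simp add: ltr_def fun_eq_iff)
 note r = AD_rels[OF assms(1), of 1, simplified]
 have k: "x (uKi * b) = qp (- m) * x b" for b
  using K[of "uKi * b"] r(1)[of b] by (simp add: mult.assoc qp_minus field_simps)
 show "ltr uKi x = (%a. qp (- m) * x a)" by (simp add: ltr_def fun_eq_iff k)
 show "ltr uK (ltr uF x) = (%a. qp (m + 2) * ltr uF x a)"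
  using r(4) K by (simp add: ltr_def fun_eq_iff mult.assoc qp_minus qp_add field_simps)
 show "ltr uK (ltr uE x) = (%a. qp (m - 2) * ltr uE x a)"
  using r(3) K by (simp add: ltr_def fun_eq_iff mult.assoc qp_minus qp_diff field_simps)
 show "ltr uF (ltr uE x) = (%a. ltr uE (ltr uF x) a + nu m * x a)"
  using r(5) K k by (simp add: ltr_def fun_eq_iff mult.assoc qp_minus nu_eq algebra_simps)
qed

lemma OU_cf: "type1_module q n rh ==> cf n (rmat n rh) al be : OU q"
proof -
 assume t: "type1_module q n rh"
 have "cf n (rmat n rh) al be = coef n rh (Matrix.vec n al) (Matrix.vec n be)"
  by (simp add: coef_cf cf_def)
 thus ?thesis using t by (force simp: OU_def)
qed

lemma OU_rtr: "f : OU q ==> rtr x f : OU q"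
 by (erule OU_E) (simp add: cf_rtr OU_cf)

lemma OU_ltr: "f : OU q ==> ltr x f : OU q"
 by (erule OU_E) (simp add: cf_ltr OU_cf)

lemma OU_coprod:
 assumes "f : OU q"
 obtains n f1 f2 where "!!i. i < n ==> f1 i : OU q" "!!i. i < n ==> f2 i : OU q"
  "!!x y. f (x * y) = (\<Sum>i<(n::nat). f1 i x * f2 i y)"
 using assms
proof (rule OU_E)
 fix m rh al be w k
 assume t: "type1_module q m rh" "frep m (rmat m rh)" "f = cf m (rmat m rh) al be"
 show thesis
  by (rule that[of m "%k. cf m (rmat m rh) al (%j. if j = k then 1 else 0)" "%k. cf m (rmat m rh) (%i. if i = k then 1 else 0) be"])
   (use t cf_coprod[OF t(2)] OU_cf in auto)
qed

text \<open>A subspace closed under the action of \<^term>\<open>uE\<close> and \<^term>\<open>uF\<close> that contains the highest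
  weight vectors of an invariant subspace contains the part of the latter in \<^term>\<open>OU q\<close>.\<close>

lemma highest_weight_generation:
 assumes "csub T" "!!x. x : T ==> rtr uE x : T" "!!x. x : T ==> rtr uF x : T" "!!x. x : T ==> rtr uK x : T"
  and "csub S" "!!x. x : S ==> rtr uE x : S" "!!x. x : S ==> rtr uF x : S"
  and hw: "!!w l. w : OU q ==> w : T ==> rtr uE w = (%a. 0) ==> rtr uK w = (%a. qp (int l) * w a) ==>
   (rtr uF ^^ Suc l) w = (%a. 0) ==> w : S"
  and x: "x : OU q" "x : T"
 shows "x : S"
 using x(1)
proof (rule OU_E)
 fix n rh al be w m
 assume t: "type1_module q n rh" and fr: "frep n (rmat n rh)" and xe: "x = cf n (rmat n rh) al be"
  and span: "!!be'. EX c. ALL j<n. be' j = (\<Sum>l<n. c l * w l j)"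
  and wt: "!!l i. l < n ==> i < n ==> (\<Sum>j<n. rmat n rh i j uK * w l j) = qp (m l) * w l i"
 let ?C = "cf n (rmat n rh) al"
 define h where "h l = ?C (w l)" for l
 have h: "rtr uK (h l) = (%a. qp (m l) * h l a)" if "l < n" for l
 proof -
  have "rtr uK (h l) = ?C (%j. qp (m l) * w l j)"
   unfolding h_def cf_rtr[OF fr] by (rule cf_cong) (use wt that in auto)
  thus ?thesis using cf_comb[of n _ al "qp (m l)" "w l" "%_. 0"] by (simp add: h_def, simp add: cf_def)
 qed
 have ex: "EX c. ?C be' = (%a. \<Sum>l<n. c l * h l a)" for be'
 proof -
  from span obtain c where "ALL j<n. be' j = (\<Sum>l<n. c l * w l j)" by blast
  hence "?C be' = ?C (%j. \<Sum>l<n. c l * w l j)" by (intro cf_cong) auto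
  thus ?thesis unfolding cf_sum h_def by blast
 qed
 define D where "D = range ?C"
 have Dc: "csub D"
  unfolding csub_def D_def
 proof (intro conjI allI ballI)
  show "(%_. 0) : range ?C" by (rule range_eqI[of _ _ "%_. 0"]) (simp add: cf_def)
  fix c f g assume "f : range ?C" "g : range ?C"
  thus "(%a. c * f a + g a) : range ?C" by (auto simp: cf_comb[symmetric])
 qed
 have Dr: "rtr y g : D" if "g : D" for y g using that by (auto simp: D_def cf_rtr[OF fr])
 have DO: "g : OU q" if "g : D" for g using that OU_cf[OF t] by (auto simp: D_def)
 have hD: "h l : D" for l by (simp add: h_def D_def)
 define Bd where "Bd = Max (insert 0 ((%l. \<bar>m l\<bar>) ` {..<n}))"
 have mB: "\<bar>m l\<bar> <= Bd" if "l < n" for l unfolding Bd_def by (rule Max_ge) (use that in auto)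
 let ?Wt = "%k. {g : D \<inter> T. rtr uK g = (%a. qp k * g a)}"
 have bound0: "g = (%a. 0)" if "finite A" "!!l. l : A ==> rtr uK (g' l) = (%a. qp (m l) * g' l a)"
  "g = (%a. \<Sum>l\<in>A. g' l a)" "rtr uK g = (%a. qp k * g a)" "k ~: m ` A" for g g' A k
  using that
 proof (induction A arbitrary: g g' rule: finite_induct)
  case (insert l A)
  let ?g = "%a. (qp k - qp (m l)) * g a"
  have "?g = (%a. \<Sum>i\<in>A. (qp (m i) - qp (m l)) * g' i a)"
  proof
   fix a
   have "?g a = rtr uK g a - qp (m l) * g a" using insert.prems(3) by (simp add: algebra_simps)
   also have "... = (\<Sum>i\<in>insert l A. rtr uK (g' i) a) - qp (m l) * (\<Sum>i\<in>insert l A. g' i a)"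
    unfolding insert.prems(2) by (simp add: rtr_sum)
   also have "... = (\<Sum>i\<in>A. (qp (m i) - qp (m l)) * g' i a)"
    using insert.hyps insert.prems(1) by (simp add: algebra_simps sum_distrib_left sum_subtractf sum_negf)
   finally show "?g a = (\<Sum>i\<in>A. (qp (m i) - qp (m l)) * g' i a)" .
  qed
  moreover have "rtr uK (%a. (qp (m i) - qp (m l)) * g' i a) = (%a. qp (m i) * ((qp (m i) - qp (m l)) * g' i a))" if "i : A" for i
   unfolding rtr_scale using insert.prems(1)[of i] that by (simp add: fun_eq_iff)
  moreover have "rtr uK ?g = (%a. qp k * ?g a)"
   unfolding rtr_scale using insert.prems(3) by (simp add: fun_eq_iff)
  ultimately have "?g = (%a. 0)"
   by (intro insert.IH[where g' = "%i a. (qp (m i) - qp (m l)) * g' i a"]) (use insert.prems(4) in auto)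
  moreover have "qp k - qp (m l) ~= 0" using insert.prems(4) by auto
  ultimately show ?case by (simp add: fun_eq_iff)
 qed simp
 interpret sl2_bounded q s "rtr uE" "rtr uF" ?Wt Bd
 proof unfold_locales
  have "csub {g. rtr uK g = (%a. qp k * g a)}" for k
   unfolding csub_def by (auto simp: rtr_def fun_eq_iff algebra_simps)
  hence "csub (D \<inter> T \<inter> {g. rtr uK g = (%a. qp k * g a)})" for k
   by (intro csub_Int Dc assms(1))
  moreover have "?Wt k = D \<inter> T \<inter> {g. rtr uK g = (%a. qp k * g a)}" for k by auto
  ultimately show "csub (?Wt k)" for k by simp
  fix x k assume x: "x : ?Wt k"
  hence "AD x" using DO OU_AD by blast
  from rtr_weight[OF this, of k] x
  show "rtr uE x : ?Wt (k + 2)" "rtr uF x : ?Wt (k - 2)" "rtr uE (rtr uF x) = (%a. rtr uF (rtr uE x) a + nu k * x a)"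
   using assms(2,3) Dr by auto
 next
  fix x k assume x: "x : ?Wt k" and k: "Bd < \<bar>k\<bar>"
  then obtain be' where "x = ?C be'" by (auto simp: D_def)
  with ex[of be'] obtain c where c: "x = (%a. \<Sum>l<n. c l * h l a)" by blast
  show "x = (%a. 0)"
   by (rule bound0[of "{..<n}" "%l a. c l * h l a" _ k])
    (use c x k mB h in "force simp: rtr_scale mult_ac")+
 qed (simp_all add: rtr_comb)
 have gen: "g : S" if "g : ?Wt k" for g k
 proof (rule generated[OF assms(5) _ _ _ that])
  fix w l assume w: "w : ?Wt (int l)" "rtr uE w = (%a. 0)"
  show "w : S" by (rule hw[of w l]) (use w fpow_highest[OF w] DO in auto)
 qed (use assms in auto)
 from ex[of be] obtain c where c: "x = (%a. \<Sum>l<n. c l * h l a)" unfolding xe by blast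
 define p where "p k = (%a. \<Sum>l | l < n & m l = k. c l * h l a)" for k
 have xs: "x = (%a. \<Sum>k\<in>m ` {..<n}. p k a)"
  unfolding c p_def
  by (rule ext, subst sum.image_gen[of "{..<n}" _ m]) auto
 have pk: "rtr uK (p k) = (%a. qp k * p k a)" for k
  unfolding p_def rtr_sum using h by (auto simp: rtr_scale sum_distrib_left mult_ac intro!: sum.cong)
 have pD: "p k : D" for k unfolding p_def
  by (intro csub_sum[OF Dc] csubD[OF Dc] hD)
 have pT: "p k : T" if "k : m ` {..<n}" for k
  by (rule eigencomponents_in[where L = "rtr uK" and B = "m ` {..<n}" and r = qp and f = p])
   (use assms(1,4) x(2) xs pk that in "auto simp: rtr_comb inj_on_def")
 show "x : S"
  unfolding xs by (rule csub_sum[OF assms(5)], rule gen[of _ k for k]) (use pD pT pk in auto)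
qed

lemma highest_weight_zero:
 assumes "AD f" "rtr uE f = (%a. 0)" "rtr uK f = (%a. qp m * f a)" "!!i. f (uF ^ i) = 0"
 shows "f = (%a. 0)"
proof -
 define g where "g i = (rtr uF ^^ i) f" for i
 have g: "AD (g i)" "rtr uK (g i) = (%a. qp (m - 2 * int i) * g i a)" "g i 1 = 0" for i
 proof -
  show a: "AD (g i)" for i by (induction i) (simp_all add: g_def assms)
  show "rtr uK (g i) = (%a. qp (m - 2 * int i) * g i a)"
  proof (induction i)
   case (Suc i)
   have "m - 2 * int (Suc i) = m - 2 * int i - 2" by simp
   thus ?case using rtr_weight(3)[OF a Suc.IH] by (simp only: g_def funpow.simps o_apply)
  qed (simp add: g_def assms)
  have "g i b = f (b * uF ^ i)" for b i
   by (induction i arbitrary: b) (simp_all add: g_def rtr_def power_commutes mult.assoc)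
  from this[of i 1] show "g i 1 = 0" using assms(4) by simp
 qed
 have e: "EX c j. rtr uE (g i) = (%a. c * g j a)" for i
 proof (induction i)
  case 0
  show ?case by (rule exI[of _ 0]) (simp add: g_def assms)
 next
  case (Suc i)
  have e1: "rtr uE (g (Suc i)) = (%a. rtr uF (rtr uE (g i)) a + nu (m - 2 * int i) * g i a)"
   using rtr_weight(4)[OF g(1,2), of i] by (simp add: g_def)
  show ?case
  proof (cases i)
   case 0
   thus ?thesis using e1 assms(2)
    by (intro exI[of _ "nu m"] exI[of _ 0]) (simp add: g_def)
  next
   case (Suc k)
   have "EX c. rtr uE (g (Suc k)) = (%a. c * g k a)" for k
   proof (induction k)
    case 0
    show ?case using rtr_weight(4)[OF g(1,2), of 0] assms(2)
     by (intro exI[of _ "nu m"]) (simp add: g_def)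
   next
    case (Suc k)
    then obtain c where c: "rtr uE (g (Suc k)) = (%a. c * g k a)" by blast
    have "rtr uE (g (Suc (Suc k))) = (%a. rtr uF (rtr uE (g (Suc k))) a + nu (m - 2 * int (Suc k)) * g (Suc k) a)"
     using rtr_weight(4)[OF g(1,2), of "Suc k"] by (simp add: g_def)
    also have "... = (%a. (c + nu (m - 2 * int (Suc k))) * g (Suc k) a)"
     unfolding c by (simp add: rtr_scale g_def algebra_simps)
    finally show ?case by blast
   qed
   thus ?thesis by blast
  qed
 qed
 have st: "EX c j. rtr (fa_gen h) (g i) = (%a. c * g j a)" for h i
 proof (cases h)
  case gF
  thus ?thesis by (intro exI[of _ 1] exI[of _ "Suc i"]) (simp add: g_def)
 qed (use e g(2)[of i] rtr_weight(1)[OF g(1,2), of i] in blast)+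
 have "g i (wd xs) = 0" for i xs
 proof (induction xs arbitrary: i rule: rev_induct)
  case Nil
  show ?case by (simp add: wd_Nil g(3))
 next
  case (snoc x xs)
  obtain c j where "rtr (fa_gen x) (g i) = (%a. c * g j a)" using st by blast
  hence "rtr (fa_gen x) (g i) (wd xs) = 0" using snoc by simp
  thus ?case by (simp add: wd_snoc rtr_def)
 qed
 hence "g 0 = (%a. 0)" by (intro lin_eq_wdI) (use g(1)[of 0] in "auto simp: lin_zero")
 thus ?thesis by (simp add: g_def)
qed
section \<open>$\mathcal O_q(U)$ is spanned by words in the entries of $u$\<close>

definition uu :: "nat => nat => ofun" where "uu al be = rmat 2 (u_rep q s) al be"

lemma u_rep_carrier: "u_rep q s g : carrier_mat 2 2"
 by (cases g) (auto simp: mat_of_rows_list_def)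

lemma u_entry_uu: "al < 2 ==> be < 2 ==> u_entry q s al be = uu al be"
 by (simp add: u_entry_def uu_def rep_mat_index fun_eq_iff)

lemma lin_uu [simp]: "lin (uu al be)"
 by (simp add: uu_def lin_rmat)

lemma uu_1: "al < 2 ==> be < 2 ==> uu al be 1 = (if al = be then 1 else 0)"
 by (simp add: uu_def rmat_1)

lemma uu_mult: "al < 2 ==> be < 2 ==> uu al be (x * y) = uu al 0 x * uu 0 be y + uu al (Suc 0) x * uu (Suc 0) be y"
 unfolding uu_def by (subst rmat_mult[OF u_rep_carrier]) (auto simp: numeral_2_eq_2)

lemma uu_gen:
 "uu 0 0 uE = 0" "uu 0 (Suc 0) uE = cs" "uu (Suc 0) 0 uE = 0" "uu (Suc 0) (Suc 0) uE = 0"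
 "uu 0 0 uF = 0" "uu 0 (Suc 0) uF = 0" "uu (Suc 0) 0 uF = inverse cs" "uu (Suc 0) (Suc 0) uF = 0"
 "uu 0 0 uK = cq" "uu 0 (Suc 0) uK = 0" "uu (Suc 0) 0 uK = 0" "uu (Suc 0) (Suc 0) uK = inverse cq"
 "uu 0 0 uKi = inverse cq" "uu 0 (Suc 0) uKi = 0" "uu (Suc 0) 0 uKi = 0" "uu (Suc 0) (Suc 0) uKi = cq"
 unfolding uu_def by (simp_all add: rmat_gen[OF u_rep_carrier] mat_of_rows_list_def)

lemma less_2: "(i::nat) < 2 <-> i = 0 \<or> i = Suc 0" by auto

lemma frep_uu: "frep 2 uu"
proof -
 have "uu i j r = 0" if "r : uq_rels q" "i < 2" "j < 2" for r i j
 proof -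
  have e: "complex_of_real (1 / (q - inverse q)) * (cq - inverse cq) = 1"
   using cq_diff_ne0 by simp
  have [simp]: "cs * inverse cs = 1" "inverse cs * cs = 1" by simp_all
  from that(2,3) consider "i = 0" "j = 0" | "i = 0" "j = Suc 0" | "i = Suc 0" "j = 0" | "i = Suc 0" "j = Suc 0" by (auto simp: less_2)
  thus ?thesis
  proof cases
   case 1 thus ?thesis using that(1) e
    by (auto simp: uq_rels_def linD[OF lin_uu] uu_mult uu_gen uu_1 power_int_minus right_diff_distrib)
  next
   case 2 thus ?thesis using that(1)
    by (auto simp: uq_rels_def linD[OF lin_uu] uu_mult uu_gen uu_1 power_int_minus power2_eq_square)
  next
   case 3 thus ?thesis using that(1)
    by (auto simp: uq_rels_def linD[OF lin_uu] uu_mult uu_gen uu_1 power_int_minus power2_eq_square)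
  next
   case 4
   have "inverse cq / (cq - inverse cq) - cq / (cq - inverse cq) = - 1"
    using cq_diff_ne0 by (simp add: diff_divide_distrib[symmetric] divide_eq_eq)
   from this[symmetric] 4 show ?thesis using that(1)
    by (auto simp: uq_rels_def linD[OF lin_uu] uu_mult uu_gen uu_1 power_int_minus right_diff_distrib)
  qed
 qed
 hence "uu i j (a * r * b) = 0" if "r : uq_rels q" "i < 2" "j < 2" for r i j a b
  using that by (simp add: uu_mult)
 thus ?thesis
  by (auto simp: frep_def AD_def uu_1 uu_mult numeral_2_eq_2)
qed

lemma AD_uu [simp]: "al < 2 ==> be < 2 ==> AD (uu al be)"
 using frep_uu by (simp add: frep_def)

lemma rtr_uu:
 assumes "al < 2"
 shows "rtr uE (uu al 0) = (%_. 0)" "rtr uE (uu al (Suc 0)) = (%a. cs * uu al 0 a)"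
  "rtr uF (uu al 0) = (%a. inverse cs * uu al (Suc 0) a)" "rtr uF (uu al (Suc 0)) = (%_. 0)"
  "rtr uK (uu al 0) = (%a. cq * uu al 0 a)" "rtr uK (uu al (Suc 0)) = (%a. inverse cq * uu al (Suc 0) a)"
  "rtr uKi (uu al 0) = (%a. inverse cq * uu al 0 a)" "rtr uKi (uu al (Suc 0)) = (%a. cq * uu al (Suc 0) a)"
 using assms by (simp_all add: rtr_def uu_mult uu_gen fun_eq_iff)

lemma ltr_uu:
 assumes "be < 2"
 shows "ltr uE (uu 0 be) = (%a. cs * uu (Suc 0) be a)" "ltr uE (uu (Suc 0) be) = (%_. 0)"
  "ltr uF (uu 0 be) = (%_. 0)" "ltr uF (uu (Suc 0) be) = (%a. inverse cs * uu 0 be a)"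
  "ltr uK (uu 0 be) = (%a. cq * uu 0 be a)" "ltr uK (uu (Suc 0) be) = (%a. inverse cq * uu (Suc 0) be a)"
  "ltr uKi (uu 0 be) = (%a. inverse cq * uu 0 be a)" "ltr uKi (uu (Suc 0) be) = (%a. cq * uu (Suc 0) be a)"
 using assms by (simp_all add: ltr_def uu_mult uu_gen fun_eq_iff)

fun wf :: "(nat \<times> nat) list => ofun" where
 "wf [] = counit"
| "wf (p # ps) = omult (uu (fst p) (snd p)) (wf ps)"

abbreviation sq :: "(nat \<times> nat) set" where "sq \<equiv> {..<2} \<times> {..<2}"

lemma AD_wf: "set ps <= sq ==> AD (wf ps)"
 by (induction ps) auto

lemma lin_wf [simp]: "lin (wf ps)"
 by (cases ps) auto

lemma wf_append: "wf (ps @ qs) = omult (wf ps) (wf qs)"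
 by (induction ps) (simp_all add: omult_counit omult_assoc)

text \<open>The span of the words whose length modulo 2 belongs to \<open>e\<close>. Keeping track of the parity is what
  determines $(-1)_q$.\<close>

inductive_set WS :: "nat set => ofun set" for e where
 zero: "(%_. 0) : WS e"
| step: "f : WS e ==> set ps <= sq ==> length ps mod 2 : e ==> (%a. c * wf ps a + f a) : WS e"

lemma WS_comb: "f : WS e ==> g : WS e ==> (%a. c * f a + g a) : WS e"
proof (induction rule: WS.induct)
 case (step f ps c')
 hence "(%a. c * c' * wf ps a + (c * f a + g a)) : WS e" by (intro WS.step) auto
 thus ?case by (simp add: algebra_simps)
qed simp

lemma WS_csub: "csub (WS e)"
 unfolding csub_def by (auto intro: WS.zero WS_comb)

lemmas WSD = csubD[OF WS_csub]

lemma WS_wf: "set ps <= sq ==> length ps mod 2 : e ==> wf ps : WS e"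
 using WS.step[OF WS.zero, of ps e 1] by simp

lemma WS_mono: "f : WS e ==> e <= e' ==> f : WS e'"
 by (induction rule: WS.induct) (auto intro: WS.intros)

lemma WS_AD: "f : WS e ==> AD f"
 by (induction rule: WS.induct) (auto intro: AD_zero AD_comb AD_wf)

lemma WS_omult_wf: "f : WS e ==> set ps <= sq ==> (!!k. k : e ==> (length ps + k) mod 2 : e') ==> omult (wf ps) f : WS e'"
proof (induction rule: WS.induct)
 case (step f qs c)
 have "(%a. c * wf (ps @ qs) a + omult (wf ps) f a) : WS e'"
  using step by (intro WS.step) (auto, metis mod_add_right_eq)
 thus ?case by (simp add: omult_comb_right wf_append)
qed (simp add: WS.zero)

lemma WS_omult_uu:
 assumes "f : WS e" "al < 2" "be < 2" "!!k. k : e ==> Suc k mod 2 : e'"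
 shows "omult (uu al be) f : WS e'"
 using WS_omult_wf[OF assms(1), of "[(al, be)]" e'] assms by (simp add: omult_counit)

lemma WS_omult:
 assumes "f : WS e" "g : WS e'" "!!k l. k : e ==> l : e' ==> (k + l) mod 2 : e''"
 shows "omult f g : WS e''"
 using assms(1)
proof (induction rule: WS.induct)
 case (step f ps c)
 have "omult (wf ps) g : WS e''"
  by (rule WS_omult_wf[OF assms(2) step(2)]) (use assms(3)[OF step(3)] in "auto simp: mod_simps")
 with step show ?case by (simp add: omult_comb_left WS_comb)
qed (simp add: WS.zero)

lemma wf_translates:
 assumes "set ps <= sq" "length ps mod 2 = e"
 shows "rtr (fa_gen h) (wf ps) : WS {e} & ltr (fa_gen h) (wf ps) : WS {e}"
 using assms
proof (induction ps arbitrary: e h)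
 case Nil
 have "(%a. c * counit a) : WS {e}" for c using WSD(3)[OF WS_wf[of "[]" "{e}"]] Nil by auto
 thus ?case by simp
next
 case (Cons p ps)
 obtain al be where p: "p = (al, be)" "al < 2" "be < 2" using Cons by (cases p) auto
 let ?e = "length ps mod 2"
 have IH: "rtr (fa_gen h) (wf ps) : WS {?e}" "ltr (fa_gen h) (wf ps) : WS {?e}" for h using Cons by auto
 have e: "Suc ?e mod 2 = e" using Cons by (simp add: mod_Suc_eq)
 have w: "wf ps : WS {?e}" using Cons by (intro WS_wf) auto
 have m: "omult (uu i j) f : WS {e}" if "f : WS {?e}" "i < 2" "j < 2" for i j f
  by (rule WS_omult_uu[OF that]) (use e in auto)
 have m': "omult (%a. c * uu i j a) f : WS {e}" if "f : WS {?e}" "i < 2" "j < 2" for i j f c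
  unfolding omult_scale by (intro WSD m that)
 from p(2,3) consider "al = 0" "be = 0" | "al = 0" "be = Suc 0" | "al = Suc 0" "be = 0" | "al = Suc 0" "be = Suc 0" by (auto simp: less_2)
 thus ?case
  by cases (cases h; simp add: p rtr_omult ltr_omult rtr_uu ltr_uu;
    intro conjI WSD m m' IH w WS.zero; simp)+
qed

lemma WS_translates:
 assumes "f : WS e" shows "rtr (fa_gen h) f : WS e" "ltr (fa_gen h) f : WS e"
 using assms
proof (induction rule: WS.induct)
 case zero
 { case 1 thus ?case by (simp add: WS.zero) }
 { case 2 thus ?case by (simp add: WS.zero ltr_def) }
next
 case (step f ps c)
 { case 1 thus ?case unfolding rtr_comb
   using step wf_translates[of ps "length ps mod 2" h] by (auto intro!: WS_comb intro: WS_mono) }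
 { case 2 thus ?case unfolding ltr_comb
   using step wf_translates[of ps "length ps mod 2" h] by (auto intro!: WS_comb intro: WS_mono) }
qed

text \<open>The words \<open>wf (zip xs ys)\<close> are the matrix coefficients of the tensor powers of the
  fundamental module.\<close>

definition bits :: "nat => nat list set" where
 "bits n = {xs. length xs = n & set xs <= {..<2}}"

lemma finite_bits [simp]: "finite (bits n)"
 unfolding bits_def using finite_lists_length_eq[of "{..<2::nat}" n] by (simp add: conj_commute)

lemma bits_0: "bits 0 = {[]}" by (auto simp: bits_def)

lemma sum_bits_Suc: "(\<Sum>zs\<in>bits (Suc n). f zs) = (\<Sum>z<2. \<Sum>zs\<in>bits n. f (z # zs))"
proof -
 have "(\<Sum>zs\<in>bits (Suc n). f zs) = (\<Sum>p\<in>{..<2} \<times> bits n. f (fst p # snd p))"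
  by (rule sum.reindex_bij_witness[of _ "%p. fst p # snd p" "%zs. (hd zs, tl zs)"])
   (auto simp: bits_def length_Suc_conv)
 thus ?thesis by (simp add: sum.cartesian_product case_prod_beta)
qed

lemma set_zip_bits: "xs : bits n ==> ys : bits n ==> set (zip xs ys) <= sq"
 unfolding bits_def by (auto dest: set_zip_leftD set_zip_rightD)

lemma wf_zip_mult:
 assumes "xs : bits n" "zs : bits n"
 shows "wf (zip xs zs) (x * y) = (\<Sum>ys\<in>bits n. wf (zip xs ys) x * wf (zip ys zs) y)"
 using assms
proof (induction n arbitrary: xs zs x y)
 case 0
 thus ?case by (simp add: bits_0 counit_mult)
next
 case (Suc n)
 then obtain a xs' b zs' where e: "xs = a # xs'" "zs = b # zs'" "a < 2" "b < 2" "xs' : bits n" "zs' : bits n"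
  by (auto simp: bits_def length_Suc_conv)
 have "omult (uu a b) (wf (zip xs' zs')) (x * y) =
  (\<Sum>i<2. \<Sum>ys\<in>bits n. omult (uu a i) (wf (zip xs' ys)) x * omult (uu i b) (wf (zip ys zs')) y)"
  by (rule omult_coprod) (use e Suc.IH in "auto simp: uu_mult numeral_2_eq_2")
 thus ?case by (simp add: e sum_bits_Suc)
qed

lemma wf_zip_1: "xs : bits n ==> ys : bits n ==> wf (zip xs ys) 1 = (if xs = ys then 1 else 0)"
proof (induction n arbitrary: xs ys)
 case (Suc n)
 then obtain a xs' b zs' where e: "xs = a # xs'" "ys = b # zs'" "a < 2" "b < 2" "xs' : bits n" "zs' : bits n"
  by (auto simp: bits_def length_Suc_conv)
 thus ?case by (simp add: uu_1 Suc.IH)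
qed (simp add: bits_def)

lemma omult_uK: "lin f ==> lin g ==> omult f g uK = f uK * g uK"
 using fun_cong[OF rtr_omult(3), of f g 1] by (simp add: rtr_def)

lemma wf_zip_K:
 assumes "xs : bits n" "ys : bits n"
 shows "wf (zip xs ys) uK = (if xs = ys then qp (\<Sum>x\<leftarrow>xs. if x = 0 then 1 else - 1) else 0)"
 using assms
proof (induction n arbitrary: xs ys)
 case (Suc n)
 then obtain a xs' b zs' where e: "xs = a # xs'" "ys = b # zs'" "a < 2" "b < 2" "xs' : bits n" "zs' : bits n"
  by (auto simp: bits_def length_Suc_conv)
 from e(3,4) consider "a = 0" "b = 0" | "a = 0" "b = Suc 0" | "a = Suc 0" "b = 0" | "a = Suc 0" "b = Suc 0" by (auto simp: less_2)
 thus ?case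
  by cases (use e in "simp_all add: omult_uK Suc.IH uu_gen qp_add qp_diff divide_inverse")
qed (simp add: bits_def)

lemma OU_I_indexed:
 fixes M :: "'i => 'i => ofun"
 assumes "finite I" "!!i j. i : I ==> j : I ==> AD (M i j)"
  "!!i j. i : I ==> j : I ==> M i j 1 = (if i = j then 1 else 0)"
  "!!i j x y. i : I ==> j : I ==> M i j (x * y) = (\<Sum>k\<in>I. M i k x * M k j y)"
  "!!i j. i : I ==> j : I ==> M i j uK = (if i = j then qp (m i) else 0)"
 shows "(%x. \<Sum>i\<in>I. \<Sum>j\<in>I. al i * M i j x * be j) : OU q"
proof -
 obtain h where h: "bij_betw h {..<card I} I"
  using ex_bij_betw_nat_finite[OF assms(1)] by (auto simp: atLeast0LessThan)
 have r: "(\<Sum>i\<in>I. g i) = (\<Sum>i<card I. g (h i))" for g :: "'i => complex"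
  using sum.reindex_bij_betw[OF h, of g] by simp
 have hI: "h i : I" if "i < card I" for i using h that by (auto simp: bij_betw_def)
 have hi: "h i = h j <-> i = j" if "i < card I" "j < card I" for i j
  using h that by (auto simp: bij_betw_def inj_on_def)
 have "cf (card I) (%i j. M (h i) (h j)) (%i. al (h i)) (%j. be (h j)) : OU q"
  by (rule OU_I[where m = "%i. m (h i)"])
   (auto simp: frep_def assms hI hi r)
 thus ?thesis by (simp add: cf_def r)
qed

lemma WS_list: "f : WS e ==> EX N c P. (ALL i<(N::nat). set (P i) <= sq) & f = (%a. \<Sum>i<N. c i * wf (P i) a)"
proof (induction rule: WS.induct)
 case zero
 show ?case by (rule exI[of _ 0]) simp
next
 case (step f ps c)
 then obtain N c' P where "ALL i<(N::nat). set (P i) <= sq" "f = (%a. \<Sum>i<N. c' i * wf (P i) a)" by blast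
 thus ?case using step
  by (intro exI[of _ "Suc N"] exI[of _ "c'(N := c)"] exI[of _ "P(N := ps)"]) (auto simp: less_Suc_eq)
qed

lemma WS_subset_OU: "f : WS e ==> f : OU q"
proof -
 assume "f : WS e"
 from WS_list[OF this] obtain N c P where P': "ALL i<(N::nat). set (P i) <= sq" and f: "f = (%a. \<Sum>i<N. c i * wf (P i) a)"
  by blast
 have P: "set (P i) <= sq" if "i < N" for i using P' that by blast
 let ?I = "SIGMA i:{..<N}. bits (length (P i))"
 let ?M = "%(i, xs) (j, ys). if i = j then wf (zip xs ys) else (%_. 0)"
 let ?m = "%(i::nat, xs::nat list). (\<Sum>x\<leftarrow>xs. if x = 0 then 1 else - 1 :: int)"
 have b: "map fst (P i) : bits (length (P i))" "map snd (P i) : bits (length (P i))" if "i < N" for i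
  using P[OF that] by (auto simp: bits_def)
 have "(%x. \<Sum>i\<in>?I. \<Sum>j\<in>?I. (if snd i = map fst (P (fst i)) then c (fst i) else 0) * ?M i j x *
   (if snd j = map snd (P (fst j)) then 1 else 0)) : OU q"
 proof (rule OU_I_indexed[where m = ?m])
  show "finite ?I" by auto
  fix i j assume ij: "i : ?I" "j : ?I"
  obtain i1 xs j1 ys where e: "i = (i1, xs)" "j = (j1, ys)" by force
  show "AD (?M i j)" using ij e by (auto simp: AD_zero intro!: AD_wf dest: set_zip_bits[THEN subsetD])
  show "?M i j 1 = (if i = j then 1 else 0)" using ij e by (auto simp: wf_zip_1)
  show "?M i j uK = (if i = j then qp (?m i) else 0)" using ij e by (auto simp: wf_zip_K)
  show "?M i j (x * y) = (\<Sum>k\<in>?I. ?M i k x * ?M k j y)" for x y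
  proof -
   have "(\<Sum>k\<in>?I. ?M i k x * ?M k j y) = (\<Sum>k<N. \<Sum>zs\<in>bits (length (P k)). ?M i (k, zs) x * ?M (k, zs) j y)"
    by (subst sum.Sigma) (auto intro!: sum.cong)
   also have "... = (\<Sum>k<N. if k = i1 then \<Sum>zs\<in>bits (length (P k)). ?M i (k, zs) x * ?M (k, zs) j y else 0)"
    by (rule sum.cong) (auto simp: e)
   also have "... = ?M i j (x * y)"
    using ij e by (auto simp: wf_zip_mult)
   finally show ?thesis by simp
  qed
 qed
 also have "(%x. \<Sum>i\<in>?I. \<Sum>j\<in>?I. (if snd i = map fst (P (fst i)) then c (fst i) else 0) * ?M i j x *
   (if snd j = map snd (P (fst j)) then 1 else 0)) = f"
 proof
  fix x
  have in1: "(\<Sum>j\<in>?I. ?M (k, xs) j x * (if snd j = map snd (P (fst j)) then 1 else 0)) =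
   wf (zip xs (map snd (P k))) x" if "k < N" for k xs
  proof -
   have "(\<Sum>j\<in>?I. ?M (k, xs) j x * (if snd j = map snd (P (fst j)) then 1 else 0)) =
    (\<Sum>j\<in>?I. if j = (k, map snd (P k)) then wf (zip xs (map snd (P k))) x else 0)"
    by (rule sum.cong) (auto split: if_splits)
   thus ?thesis using b that by (simp add: sum.delta)
  qed
  have "(\<Sum>i\<in>?I. \<Sum>j\<in>?I. (if snd i = map fst (P (fst i)) then c (fst i) else 0) * ?M i j x *
   (if snd j = map snd (P (fst j)) then 1 else 0)) =
   (\<Sum>i\<in>?I. (if snd i = map fst (P (fst i)) then c (fst i) else 0) * wf (zip (snd i) (map snd (P (fst i)))) x)"
  proof (rule sum.cong[OF refl])
   fix i assume i: "i : ?I"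
   obtain k xs where e: "i = (k, xs)" by force
   have "(\<Sum>j\<in>?I. (if snd i = map fst (P (fst i)) then c (fst i) else 0) * ?M i j x *
    (if snd j = map snd (P (fst j)) then 1 else 0)) =
    (if snd i = map fst (P (fst i)) then c (fst i) else 0) * (\<Sum>j\<in>?I. ?M i j x *
    (if snd j = map snd (P (fst j)) then 1 else 0))"
    by (simp only: sum_distrib_left mult.assoc)
   also have "(\<Sum>j\<in>?I. ?M i j x * (if snd j = map snd (P (fst j)) then 1 else 0)) = wf (zip xs (map snd (P k))) x"
    unfolding e by (rule in1) (use i e in auto)
   finally show "(\<Sum>j\<in>?I. (if snd i = map fst (P (fst i)) then c (fst i) else 0) * ?M i j x *
    (if snd j = map snd (P (fst j)) then 1 else 0)) =
    (if snd i = map fst (P (fst i)) then c (fst i) else 0) * wf (zip (snd i) (map snd (P (fst i)))) x"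
    by (simp only: e fst_conv snd_conv)
  qed
  also have "... = (\<Sum>k<N. \<Sum>xs\<in>bits (length (P k)). if xs = map fst (P k) then c k * wf (zip xs (map snd (P k))) x else 0)"
   by (subst sum.Sigma) (auto intro!: sum.cong)
  also have "... = (\<Sum>k<N. c k * wf (zip (map fst (P k)) (map snd (P k))) x)"
   by (rule sum.cong) (use b in "auto simp: sum.delta'")
  also have "... = f x" by (simp add: f zip_map_fst_snd)
  finally show "(\<Sum>i\<in>?I. \<Sum>j\<in>?I. (if snd i = map fst (P (fst i)) then c (fst i) else 0) * ?M i j x *
   (if snd j = map snd (P (fst j)) then 1 else 0)) = f x" .
 qed
 finally show ?thesis .
qed

text \<open>The highest weight vectors of weight \<open>l\<close> form the \<^term>\<open>l + 1\<close> dimensional space spanned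
  by the left translates of \<open>a\<^sup>l\<close>.\<close>

definition apow :: "nat => ofun" where "apow l = wf (replicate l (0, 0))"

lemma apow_props:
 "AD (apow l)" "rtr uE (apow l) = (%_. 0)" "rtr uK (apow l) = (%a. qp (int l) * apow l a)"
 "ltr uF (apow l) = (%_. 0)" "ltr uK (apow l) = (%a. qp (int l) * apow l a)" "apow l 1 = 1"
 "apow l : WS {l mod 2}"
proof -
 show "AD (apow l)" "apow l : WS {l mod 2}" unfolding apow_def by (intro AD_wf WS_wf; auto)+
 show "rtr uE (apow l) = (%_. 0)"
  by (induction l) (simp_all add: apow_def rtr_omult rtr_uu)
 show "rtr uK (apow l) = (%a. qp (int l) * apow l a)"
  by (induction l) (simp_all add: apow_def rtr_omult rtr_uu omult_scale qp_add mult_ac)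
 show "ltr uF (apow l) = (%_. 0)"
  by (induction l) (simp_all add: apow_def ltr_omult ltr_uu)
 show "ltr uK (apow l) = (%a. qp (int l) * apow l a)"
  by (induction l) (simp_all add: apow_def ltr_omult ltr_uu omult_scale qp_add mult_ac)
 show "apow l 1 = 1"
  by (induction l) (simp_all add: apow_def uu_1)
qed

text \<open>A highest weight vector \<open>w\<close> of weight \<open>l\<close> is determined by the numbers \<open>w (uF ^ i)\<close>, and those
  with \<open>i > l\<close> vanish. The left translates of \<open>apow l\<close> realize every choice of the remaining numbers.\<close>

lemma highest_weight_in_WS:
 assumes w: "AD w" "rtr uE w = (%a. 0)" "rtr uK w = (%a. qp (int l) * w a)" "(rtr uF ^^ Suc l) w = (%a. 0)"
 shows "w : WS {l mod 2}"
proof -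
 let ?Wt = "%m. {x. AD x & ltr uK x = (%a. qp m * x a)}"
 interpret sl2_operators q s "ltr uF" "ltr uE" ?Wt
 proof unfold_locales
  have "csub {x. AD x}" unfolding csub_def by (auto simp: AD_zero AD_comb)
  moreover have "csub {x. ltr uK x = (%a. qp m * x a)}" for m
   unfolding csub_def by (auto simp: ltr_def fun_eq_iff algebra_simps)
  ultimately have "csub ({x. AD x} \<inter> {x. ltr uK x = (%a. qp m * x a)})" for m by (rule csub_Int)
  thus "csub (?Wt m)" for m by (simp add: Collect_conj_eq)
  fix x m assume "x : ?Wt m"
  thus "ltr uF x : ?Wt (m + 2)" "ltr uE x : ?Wt (m - 2)"
   "ltr uF (ltr uE x) = (%a. ltr uE (ltr uF x) a + nu m * x a)"
   using ltr_weight[of x m] by auto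
 qed (simp_all add: ltr_comb)
 define v where "v j = (ltr uE ^^ j) (apow l)" for j
 have v: "v j : ?Wt (int l - 2 * int j)" for j
  unfolding v_def by (rule fpow_Wt) (simp add: apow_props)
 have vr: "rtr uE (v j) = (%a. 0)" "rtr uK (v j) = (%a. qp (int l) * v j a)" "v j : WS {l mod 2}" for j
  by (induction j) (simp_all add: v_def apow_props rtr_ltr WS_translates(2), simp_all add: ltr_def)
 have F: "ltr uK (ltr (uF ^ i) g) = (%a. qp (m + 2 * int i) * ltr (uF ^ i) g a)" if "g : ?Wt m" for g i m
 proof -
  have "(ltr uF ^^ i) g = ltr (uF ^ i) g" by (induction i) (simp_all add: ltr_ltr power_commutes)
  thus ?thesis using epow_Wt[OF that, of i] by simp
 qed
 have FK: "g (uF ^ i) = 0" if "AD g" "rtr uK g = (%a. qp (int l) * g a)" "g : ?Wt m" "m + 2 * int i ~= int l" for g m i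
 proof -
  have "g (uF ^ i * uK) = qp (m + 2 * int i) * g (uF ^ i)"
  proof -
   have "ltr (uF ^ i) g uK = qp (m + 2 * int i) * ltr (uF ^ i) g 1"
    using fun_cong[OF F[OF that(3), of i], of 1] by (simp add: ltr_def)
   thus ?thesis by (simp add: ltr_def)
  qed
  moreover have "g (uF ^ i * uK) = qp (int l) * g (uF ^ i)"
   using fun_cong[OF that(2), of "uF ^ i"] by (simp add: rtr_def)
  ultimately have "(qp (m + 2 * int i) - qp (int l)) * g (uF ^ i) = 0" by (metis left_diff_distrib right_minus_eq)
  moreover have "qp (m + 2 * int i) - qp (int l) ~= 0" using that(4) qp_inj by (metis right_minus_eq)
  ultimately show ?thesis by (metis mult_eq_0_iff)
 qed
 have vz: "v j (uF ^ i) = 0" if "i ~= j" for i j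
  by (rule FK[of _ "int l - 2 * int j"]) (use v[of j] vr that in auto)
 have vnz: "v j (uF ^ j) ~= 0" if "j <= l" for j
 proof -
  have "apow l : ?Wt (int l)" using apow_props by simp
  from epow_fpow[OF this apow_props(4), of j] that
  obtain c where c: "c ~= 0" "(ltr uF ^^ j) ((ltr uE ^^ j) (apow l)) = (%a. c * apow l a)"
   by force
  have "(ltr uF ^^ i) g = ltr (uF ^ i) g" for i and g :: ofun
   by (induction i) (simp_all add: ltr_ltr power_commutes)
  hence "v j (uF ^ j) = c" using c(2) by (simp add: v_def fun_eq_iff ltr_def apow_props) (metis apow_props(6) mult_1_right)
  thus ?thesis using c(1) by simp
 qed
 define w' where "w' = (%a. \<Sum>j\<le>l. (w (uF ^ j) / v j (uF ^ j)) * v j a)"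
 have w': "AD w'" "w' : WS {l mod 2}" "rtr uE w' = (%a. 0)" "rtr uK w' = (%a. qp (int l) * w' a)"
 proof -
  show "AD w'" unfolding w'_def by (intro AD_sum AD_scale) (use v in auto)
  show "w' : WS {l mod 2}" unfolding w'_def by (intro csub_sum[OF WS_csub] WSD(3) vr)
  show "rtr uE w' = (%a. 0)" unfolding w'_def rtr_sum rtr_scale by (simp add: vr)
  show "rtr uK w' = (%a. qp (int l) * w' a)" unfolding w'_def rtr_sum rtr_scale by (simp add: vr sum_distrib_left mult_ac)
 qed
 have "(%a. w a - w' a) = (%a. 0)"
 proof (rule highest_weight_zero[of _ "int l"])
  show "AD (%a. w a - w' a)" using AD_comb[OF w'(1) w(1), of "-1"] by simp
  show "rtr uE (%a. w a - w' a) = (%a. 0)" using rtr_comb[of uE "-1" w' w] w' w by simp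
  show "rtr uK (%a. w a - w' a) = (%a. qp (int l) * (w a - w' a))"
   using rtr_comb[of uK "-1" w' w] w' w by (simp add: algebra_simps)
  show "w (uF ^ i) - w' (uF ^ i) = 0" for i
  proof (cases "i <= l")
   case True
   have "w' (uF ^ i) = (\<Sum>j\<le>l. if j = i then w (uF ^ i) else 0)"
    unfolding w'_def by (rule sum.cong) (use vz vnz in auto)
   thus ?thesis using True by simp
  next
   case False
   have p: "(rtr uF ^^ i) g = rtr (uF ^ i) g" for i and g :: ofun
    by (induction i) (simp_all add: rtr_rtr)
   have "(rtr uF ^^ i) w = (rtr uF ^^ (i - Suc l)) ((rtr uF ^^ Suc l) w)"
    using False by (simp only: funpow_add[symmetric, THEN fun_cong, unfolded o_apply]) simp
   also have "... = (%a. 0)" unfolding w(4) by (induction "i - Suc l") (simp_all add: p)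
   finally have "w (uF ^ i) = 0" unfolding p by (simp add: rtr_def fun_eq_iff) (metis mult_1_left)
   moreover have "w' (uF ^ i) = 0" unfolding w'_def using False vz by auto
   ultimately show ?thesis by simp
  qed
 qed
 hence "w = w'" by (simp add: fun_eq_iff)
 thus ?thesis using w' by simp
qed

text \<open>One inclusion is the construction of tensor powers of the fundamental module, the other holds
  because a module is generated by its highest weight vectors and these are words.\<close>

theorem OU_eq_WS: "OU q = WS {0, 1}"
proof
 show "WS {0, 1} <= OU q" using WS_subset_OU by blast
 show "OU q <= WS {0, 1}"
 proof
  fix x assume "x : OU q"
  thus "x : WS {0, 1}"
  proof (rule highest_weight_generation[of UNIV "WS {0, 1}", rotated 8])
   fix w l assume "w : OU q" "rtr uE w = (%a. 0)" "rtr uK w = (%a. qp (int l) * w a)" "(rtr uF ^^ Suc l) w = (%a. 0)"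
   hence "w : WS {l mod 2}" by (intro highest_weight_in_WS OU_AD)
   thus "w : WS {0, 1}" by (rule WS_mono) auto
  qed (auto simp: csub_def WS_csub[unfolded csub_def] WS_translates)
 qed
qed

lemma OU_csub: "csub (OU q)" by (simp add: OU_eq_WS WS_csub)
lemmas OUD = csubD[OF OU_csub]

lemma OU_omult: "f : OU q ==> g : OU q ==> omult f g : OU q"
 unfolding OU_eq_WS by (rule WS_omult) auto

lemma OU_counit: "counit : OU q"
 unfolding OU_eq_WS using WS_wf[of "[]" "{0, 1}"] by simp

lemma OU_uu: "al < 2 ==> be < 2 ==> uu al be : OU q"
 unfolding OU_eq_WS using WS_wf[of "[(al, be)]" "{0, 1}"] by (simp add: omult_counit)

lemma OU_lin: "f : OU q ==> lin f" using OU_AD by simp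

end

section \<open>Exponential sums with given nodes\<close>

definition nexp :: "(int => complex) => (nat => complex) => (int \<Rightarrow>\<^sub>0 complex) => bool" where
 "nexp r f ka <-> (ALL j. f j = fa_lin (%m. r m ^ j) ka)"

lemma nexp_poly:
 assumes "nexp r f ka"
 shows "fa_lin (%m. poly p (r m)) ka = (\<Sum>i\<le>Polynomial.degree p. Polynomial.coeff p i * f i)"
proof -
 have s: "fa_lin (%m. c * g m) ka = c * fa_lin g ka" for c g
  using fa_lin_fun[of c g "%_. 0" ka] by (simp add: fa_lin_def)
 show ?thesis using assms by (simp add: poly_altdef fa_lin_sum_fun s nexp_def)
qed

lemma node_interpolation:
 fixes r :: "int => complex"
 assumes "inj r" "finite A" shows "EX p. ALL m:A. poly p (r m) = c m"
 using assms(2)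
proof (induction A rule: finite_induct)
 case (insert m0 A)
 then obtain p where p: "ALL m:A. poly p (r m) = c m" by blast
 define w where "w = (\<Prod>m\<in>A. [:- r m, 1:])"
 have w: "poly w (r m) = 0 <-> m : A" for m
  using insert.hyps assms(1) by (auto simp: w_def poly_prod inj_def)
 show ?case
  by (rule exI[of _ "p + Polynomial.smult ((c m0 - poly p (r m0)) / poly w (r m0)) w"])
   (use p w insert.hyps in auto)
qed simp

lemma nexp_unique:
 assumes "inj r" "nexp r f ka" "nexp r f ka'" shows "ka = ka'"
proof -
 let ?d = "ka - ka'"
 have d: "nexp r (%_. 0) ?d" using assms(2,3) by (simp add: nexp_def linD[OF lin_fa_lin])
 have "pm_lookup ?d m0 = 0" for m0
 proof -
  obtain p where p: "ALL m:insert m0 (pm_keys ?d). poly p (r m) = (if m = m0 then 1 else 0)"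
   using node_interpolation[OF assms(1), of "insert m0 (pm_keys ?d)" "%m. if m = m0 then 1 else 0"] by auto
  have "0 = fa_lin (%m. poly p (r m)) ?d" using nexp_poly[OF d, of p] by simp
  also have "... = (\<Sum>w\<in>pm_keys ?d. if w = m0 then pm_lookup ?d w else 0)"
   unfolding fa_lin_def by (rule sum.cong) (use p in auto)
  finally show ?thesis by (auto simp: sum.delta in_keys_iff split: if_splits)
 qed
 hence "?d = 0" by (intro poly_mapping_eqI) (simp del: lookup_minus)
 thus ?thesis by simp
qed

lemma nexp_comb: "nexp r f ka ==> nexp r g ka' ==> nexp r (%j. c * f j + g j) (fa_const c * ka + ka')"
 by (simp add: nexp_def linD[OF lin_fa_lin])

lemma nexp_single: "nexp r (%j. r m ^ j * c) (pm_single m c)"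
 by (simp add: nexp_def)

lemma nexp_0: "nexp r (%j. 0) 0"
 by (simp add: nexp_def)

lemma fa_lin_mult:
 assumes "!!m n. h (m + n) = h m * h n"
 shows "fa_lin h (ka * ka') = fa_lin h ka * fa_lin h (ka' :: int \<Rightarrow>\<^sub>0 complex)"
proof (induction ka rule: pm_induct)
 case (single k c)
 show ?case
  by (induction ka' rule: pm_induct) (simp_all add: mult_single assms fa_lin_add algebra_simps)
qed (simp_all add: fa_lin_add distrib_right)

section \<open>Evaluation on $\theta$ and on $k$\<close>

context quantum
begin

abbreviation th :: uq where "th \<equiv> theta s"

lemma inj_nu: "inj nu" by (simp add: inj_def)
lemma inj_qp: "inj qp" by (simp add: inj_def)

lemma rtr_th:
 assumes "lin f" shows "rtr th f = (%a. \<i> / cs * (rtr uE f a - rtr uF (rtr uK f) a))"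
 by (simp add: rtr_def theta_def fun_eq_iff linD[OF assms] algebra_simps fa_const_left_commute)

lemma ltr_th:
 assumes "lin f" shows "ltr th f = (%a. \<i> / cs * (ltr uE f a - ltr uK (ltr uF f) a))"
 by (simp add: ltr_def theta_def fun_eq_iff linD[OF assms] algebra_simps fa_const_left_commute)

lemma rtr_th_omult:
 assumes "AD f" "AD g"
 shows "rtr th (omult f g) = (%a. omult (rtr th f) g a + omult (rtr uK f) (rtr th g) a)"
proof -
 have "omult (rtr th f) g = (%a. \<i> / cs * (omult (rtr uE f) g a - omult (rtr uF (rtr uK f)) g a))"
  unfolding rtr_th[OF AD_lin[OF assms(1)]] omult_scale omult_minus ..
 moreover have "omult (rtr uK f) (rtr th g) = (%a. \<i> / cs * (omult (rtr uK f) (rtr uE g) a - omult (rtr uK f) (rtr uF (rtr uK g)) a))"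
  unfolding rtr_th[OF AD_lin[OF assms(2)]] omult_scale omult_minus ..
 ultimately show ?thesis using assms
  by (simp only:) (simp add: rtr_th[OF lin_omult] rtr_omult AD_rtr_rels rtr_add algebra_simps add_divide_distrib diff_divide_distrib)
qed

lemma ltr_th_omult:
 assumes "AD f" "AD g"
 shows "ltr th (omult f g) = (%a. omult (ltr th f) g a + omult (ltr uK f) (ltr th g) a)"
proof -
 have [simp]: "ltr uK (ltr uKi g) = g"
  using AD_rels(2)[OF assms(2), of 1] by (simp add: ltr_def fun_eq_iff mult.assoc)
 have "omult (ltr th f) g = (%a. \<i> / cs * (omult (ltr uE f) g a - omult (ltr uK (ltr uF f)) g a))"
  unfolding ltr_th[OF AD_lin[OF assms(1)]] omult_scale omult_minus ..
 moreover have "omult (ltr uK f) (ltr th g) = (%a. \<i> / cs * (omult (ltr uK f) (ltr uE g) a - omult (ltr uK f) (ltr uK (ltr uF g)) a))"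
  unfolding ltr_th[OF AD_lin[OF assms(2)]] omult_scale omult_minus ..
 ultimately show ?thesis using assms
  by (simp only:) (simp add: ltr_th[OF lin_omult] ltr_omult AD_rtr_rels ltr_add algebra_simps add_divide_distrib diff_divide_distrib)
qed

lemma omult_uminus: "omult (%a. - f a) g = (%a. - omult f g a)"
 using omult_scale(1)[of "-1" f g] by simp

lemma rtr_th_uu:
 "al < 2 ==> rtr th (uu al 0) = (%a. - \<i> * uu al (Suc 0) a)"
 "al < 2 ==> rtr th (uu al (Suc 0)) = (%a. \<i> * uu al 0 a)"
proof -
 have e: "cq / (cs * cs) = 1" "cs * cs = cq" using cs2 by simp_all
 show "al < 2 ==> rtr th (uu al 0) = (%a. - \<i> * uu al (Suc 0) a)"
  by (simp add: rtr_th rtr_uu rtr_scale, simp add: fun_eq_iff field_simps e)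
 show "al < 2 ==> rtr th (uu al (Suc 0)) = (%a. \<i> * uu al 0 a)"
  by (simp add: rtr_th rtr_uu rtr_scale)
qed

lemma counit_th [simp]: "counit th = 0"
 by (simp add: theta_def linD[OF lin_counit] counit_mult)

lemma qp_sum_ne0: "qp n + inverse (qp n) ~= 0"
proof -
 have "q powi n + inverse (q powi n) > 0" using q_pos by (simp add: add_pos_pos)
 hence "complex_of_real (q powi n + inverse (q powi n)) ~= 0" by (metis less_irrefl of_real_eq_0_iff)
 thus ?thesis by (simp add: qp_def)
qed

text \<open>Multiplication by the entries of a row of \<open>u\<close> moves $\theta$-eigenvalues from $[n]_q$ to
  $[n\pm1]_q$. Starting from the unit, this yields eigenfunctions for all \<open>n\<close>.\<close>

lemma theta_shift:
 assumes "AD f" "rtr th f = (%a. nu n * f a)" "al < 2"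
 defines "x \<equiv> omult (uu al 0) f" and "y \<equiv> omult (uu al (Suc 0)) f"
 shows "rtr th (%a. - \<i> * inverse (qp n) * y a + x a) = (%a. nu (n + 1) * (- \<i> * inverse (qp n) * y a + x a))"
  "rtr th (%a. \<i> * qp n * y a + x a) = (%a. nu (n - 1) * (\<i> * qp n * y a + x a))"
proof -
 have x: "rtr th x = (%a. - \<i> * y a + cq * nu n * x a)"
  using assms by (simp add: rtr_th_omult rtr_th_uu rtr_uu omult_uminus omult_scale mult.assoc)
 have y: "rtr th y = (%a. \<i> * x a + inverse cq * nu n * y a)"
  using assms by (simp add: rtr_th_omult rtr_th_uu rtr_uu omult_uminus omult_scale mult.assoc)
 have qq: "cq * cq - 1 ~= 0" using cq_sq_ne1 by simp
 have hq': "hq = cq / (cq * cq - 1)" by (simp add: hq_def field_simps)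
 have ne: "qp n ~= 0" by simp
 show "rtr th (%a. - \<i> * inverse (qp n) * y a + x a) = (%a. nu (n + 1) * (- \<i> * inverse (qp n) * y a + x a))"
  unfolding rtr_comb x y nu_eq hq' qp_add qp_1 using ne qq
  by (simp add: fun_eq_iff divide_simps) (simp add: algebra_simps power2_eq_square)
 show "rtr th (%a. \<i> * qp n * y a + x a) = (%a. nu (n - 1) * (\<i> * qp n * y a + x a))"
  unfolding rtr_comb x y nu_eq hq' qp_diff qp_1 using ne qq
  by (simp add: fun_eq_iff divide_simps) (simp add: algebra_simps power2_eq_square)
qed

text \<open>Sums of $\theta$-eigenfunctions whose eigenvalues \<open>[m]\<close> have the parity of \<open>m\<close> fixed.\<close>

inductive_set TH :: "nat => ofun set" for e where
 zero: "(%_. 0) : TH e"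
| step: "f : TH e ==> g : WS {e} ==> rtr th g = (%a. nu m * g a) ==> m mod 2 = int e ==> (%a. g a + f a) : TH e"

lemma TH_comb: "f : TH e ==> g : TH e ==> (%a. c * f a + g a) : TH e"
proof (induction rule: TH.induct)
 case (step f h m)
 have "(%a. c * h a + (c * f a + g a)) : TH e"
  by (rule TH.step[of _ _ _ m]) (use step in "auto intro: WSD simp: rtr_scale mult_ac")
 thus ?case by (simp add: algebra_simps)
qed simp

lemma TH_csub: "csub (TH e)"
 by (auto simp: csub_def intro: TH.zero TH_comb)

lemma TH_uu:
 assumes "f : TH e" "e < 2" "al < 2" "be < 2"
 shows "omult (uu al be) f : TH (1 - e)"
 using assms(1)
proof (induction rule: TH.induct)
 case zero
 thus ?case by (simp add: TH.zero)
next
 case (step f g n)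
 have g: "AD g" using step WS_AD by blast
 let ?x = "omult (uu al 0) g" and ?y = "omult (uu al (Suc 0)) g"
 have W: "omult (uu al i) g : WS {1 - e}" if "i < 2" for i
  by (rule WS_omult_uu[OF step.hyps(2) assms(3) that]) (use assms(2) in "auto simp: less_2")
 note sh = theta_shift[OF g step.hyps(3) assms(3)]
 have par: "(n + 1) mod 2 = int (1 - e)" "(n - 1) mod 2 = int (1 - e)"
  using step.hyps(4) assms(2) by (auto simp: less_2) presburger+
 have single: "h : TH (1 - e)" if "h : WS {1 - e}" "rtr th h = (%a. nu m * h a)" "m mod 2 = int (1 - e)" for h m
  using TH.step[OF TH.zero that] by simp
 let ?p = "%a. - \<i> * inverse (qp n) * ?y a + ?x a" and ?m = "%a. \<i> * qp n * ?y a + ?x a"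
 have pm: "?p : TH (1 - e)" "?m : TH (1 - e)"
  by (rule single[OF _ sh(1) par(1)] single[OF _ sh(2) par(2)]; intro WSD(2) W; simp)+
 let ?d = "qp n + inverse (qp n)"
 have x: "?x = (%a. qp n / ?d * ?p a + inverse (qp n) / ?d * ?m a)"
  and y: "?y = (%a. (\<i> / ?d) * ?p a + (- \<i> / ?d) * ?m a)"
 proof -
  have ne: "qp n ~= 0" "?d ~= 0" using qp_sum_ne0 by auto
  have e1: "u / ?d * A + v / ?d * B = (u * A + v * B) / ?d" for u v A B
   by (simp add: add_divide_distrib)
  have e2: "qp n * (- \<i> * inverse (qp n) * Y + Xa) + inverse (qp n) * (\<i> * qp n * Y + Xa) = ?d * Xa" for Xa Y
   using ne(1) by (simp add: algebra_simps)
  have e3: "\<i> * (- \<i> * inverse (qp n) * Y + Xa) + - \<i> * (\<i> * qp n * Y + Xa) = ?d * Y" for Xa Y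
   by (simp add: algebra_simps)
  show "?x = (%a. qp n / ?d * ?p a + inverse (qp n) / ?d * ?m a)"
   unfolding e1 e2 using ne(2) by simp
  show "?y = (%a. (\<i> / ?d) * ?p a + (- \<i> / ?d) * ?m a)"
   unfolding e1 e3 using ne(2) by simp
 qed
 have "?x : TH (1 - e)" by (subst x) (intro csubD(2,3)[OF TH_csub] pm)
 moreover have "?y : TH (1 - e)" by (subst y) (intro csubD(2,3)[OF TH_csub] pm)
 ultimately have "omult (uu al be) g : TH (1 - e)" using assms(4) by (auto simp: less_2)
 thus ?case using step.IH by (simp add: omult_add csubD(4)[OF TH_csub])
qed

lemma TH_wf: "set ps <= sq ==> wf ps : TH (length ps mod 2)"
proof (induction ps)
 case Nil
 have "(%a. counit a + 0) : TH 0"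
  by (rule TH.step[OF TH.zero, of _ _ 0]) (use WS_wf[of "[]" "{0}"] in auto)
 thus ?case by simp
next
 case (Cons p ps)
 have "omult (uu (fst p) (snd p)) (wf ps) : TH (1 - length ps mod 2)"
  by (rule TH_uu) (use Cons in auto)
 moreover have "1 - length ps mod 2 = Suc (length ps) mod 2" by presburger
 ultimately show ?case by simp
qed

lemma WS_TH: "f : WS {e} ==> f : TH e"
proof (induction rule: WS.induct)
 case (step f ps c)
 thus ?case using TH_wf[of ps] by (auto intro: TH_comb)
qed (rule TH.zero)

lemma th_pow:
 fixes f :: ofun
 shows "rtr th f = (%a. c * f a) ==> f (b * th ^ j) = c ^ j * f b"
proof (induction j)
 case (Suc j)
 have "f (b * th ^ Suc j) = rtr th f (b * th ^ j)" by (simp only: rtr_def power_Suc2 mult.assoc)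
 also have "... = c * f (b * th ^ j)" unfolding Suc.prems ..
 finally show ?case using Suc by (simp only: power_Suc mult.assoc)
qed simp

lemma TH_nexp: "f : TH e ==> EX ka. nexp nu (%j. f (th ^ j)) ka & (ALL m:pm_keys ka. m mod 2 = int e)"
proof (induction rule: TH.induct)
 case zero
 show ?case by (rule exI[of _ 0]) (simp add: nexp_0)
next
 case (step f g m)
 then obtain ka where ka: "nexp nu (%j. f (th ^ j)) ka" "ALL m:pm_keys ka. m mod 2 = int e" by blast
 have g: "(%j. g (th ^ j)) = (%j. nu m ^ j * g 1)" using th_pow[OF step.hyps(3), of 1] by simp
 have "nexp nu (%j. g (th ^ j) + f (th ^ j)) (pm_single m (g 1) + ka)"
  using nexp_comb[OF nexp_single ka(1), of 1 m "g 1"] g by (simp add: fa_const_1 fun_eq_iff)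
 moreover have "ALL m':pm_keys (pm_single m (g 1) + ka). m' mod 2 = int e"
  using keys_add[of "pm_single m (g 1)" ka] ka(2) step.hyps(4) by (auto split: if_splits)
 ultimately show ?case by blast
qed

lemma OU_split: "f : OU q ==> EX g h. g : WS {0} & h : WS {1} & f = (%a. g a + h a)"
 unfolding OU_eq_WS
proof (induction rule: WS.induct)
 case zero
 show ?case by (intro exI conjI, rule WS.zero, rule WS.zero) simp
next
 case (step f ps c)
 then obtain g h where gh: "g : WS {0}" "h : WS {1}" "f = (%a. g a + h a)" by blast
 have "length ps mod 2 = 0 \<or> length ps mod 2 = 1" by presburger
 thus ?case
 proof
  assume "length ps mod 2 = 0"
  thus ?thesis using gh step
   by (intro exI[of _ "%a. c * wf ps a + g a"] exI[of _ h]) (auto intro: WS.step)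
 next
  assume "length ps mod 2 = 1"
  thus ?thesis using gh step
   by (intro exI[of _ g] exI[of _ "%a. c * wf ps a + h a"]) (auto intro: WS.step)
 qed
qed

lemma OU_nexp_th: "f : OU q ==> EX ka. nexp nu (%j. f (th ^ j)) ka"
proof -
 assume "f : OU q"
 then obtain g h where "g : WS {0}" "h : WS {1}" and f: "f = (%a. g a + h a)" using OU_split by blast
 then obtain ka ka' where "nexp nu (%j. g (th ^ j)) ka" "nexp nu (%j. h (th ^ j)) ka'"
  using TH_nexp WS_TH by metis
 from nexp_comb[OF this, of 1] show ?thesis by (auto simp: f)
qed

definition kth :: "ofun => int \<Rightarrow>\<^sub>0 complex" where
 "kth f = (THE ka. nexp nu (%j. f (th ^ j)) ka)"

lemma kth_eq: "nexp nu (%j. f (th ^ j)) ka ==> kth f = ka"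
 unfolding kth_def using nexp_unique[OF inj_nu] by (intro the_equality)

lemma kth_nexp: "f : OU q ==> nexp nu (%j. f (th ^ j)) (kth f)"
 using OU_nexp_th kth_eq by metis

lemma kth_comb: "f : OU q ==> g : OU q ==> kth (%a. c * f a + g a) = fa_const c * kth f + kth g"
 by (rule kth_eq, rule nexp_comb; erule kth_nexp)

lemma kth_eigen: "rtr th f = (%a. nu m * f a) ==> kth f = pm_single m (f 1)"
 by (rule kth_eq) (use th_pow[of f "nu m" 1] nexp_single[of nu m "f 1"] in auto)

lemma kth_parity: "f : WS {e} ==> m : pm_keys (kth f) ==> m mod 2 = int e"
 using TH_nexp[OF WS_TH] kth_eq by metis

text \<open>For every \<open>n\<close> there is a function that restricts to the character \<open>n\<close> of the quantum
  subgroup attached to $\theta$.\<close>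

lemma psi_exists: "EX f. f : WS {nat (n mod 2)} & rtr th f = (%a. nu n * f a) & f 1 = 1"
proof (induction n rule: int_induct[where k = 0])
 case base
 show ?case by (rule exI[of _ counit]) (use WS_wf[of "[]" "{0}"] in auto)
next
 case (step1 n)
 then obtain f where f: "f : WS {nat (n mod 2)}" "rtr th f = (%a. nu n * f a)" "f 1 = 1" by blast
 have W: "omult (uu 0 i) f : WS {nat ((n + 1) mod 2)}" if "i < 2" for i
 proof (rule WS_omult_uu[OF f(1) _ that])
  have "n mod 2 = 0 & (n + 1) mod 2 = 1 \<or> n mod 2 = 1 & (n + 1) mod 2 = 0" by presburger
  thus "Suc k mod 2 : {nat ((n + 1) mod 2)}" if "k : {nat (n mod 2)}" for k
   using that by auto
 qed simp
 let ?g = "%a. - \<i> * inverse (qp n) * omult (uu 0 (Suc 0)) f a + omult (uu 0 0) f a"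
 have "?g : WS {nat ((n + 1) mod 2)}" by (rule WSD(2)) (rule W, simp)+
 moreover have "rtr th ?g = (%a. nu (n + 1) * ?g a)"
  by (rule theta_shift(1)[OF WS_AD[OF f(1)] f(2)]) simp
 moreover have "?g 1 = 1" by (simp add: uu_1 f)
 ultimately show ?case by blast
next
 case (step2 n)
 then obtain f where f: "f : WS {nat (n mod 2)}" "rtr th f = (%a. nu n * f a)" "f 1 = 1" by blast
 have W: "omult (uu 0 i) f : WS {nat ((n - 1) mod 2)}" if "i < 2" for i
 proof (rule WS_omult_uu[OF f(1) _ that])
  have "n mod 2 = 0 & (n - 1) mod 2 = 1 \<or> n mod 2 = 1 & (n - 1) mod 2 = 0" by presburger
  thus "Suc k mod 2 : {nat ((n - 1) mod 2)}" if "k : {nat (n mod 2)}" for k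
   using that by auto
 qed simp
 let ?g = "%a. \<i> * qp n * omult (uu 0 (Suc 0)) f a + omult (uu 0 0) f a"
 have "?g : WS {nat ((n - 1) mod 2)}" by (rule WSD(2)) (rule W, simp)+
 moreover have "rtr th ?g = (%a. nu (n - 1) * ?g a)"
  by (rule theta_shift(2)[OF WS_AD[OF f(1)] f(2)]) simp
 moreover have "?g 1 = 1" by (simp add: uu_1 f)
 ultimately show ?case by blast
qed

definition psi :: "int => ofun" where
 "psi n = (SOME f. f : WS {nat (n mod 2)} & rtr th f = (%a. nu n * f a) & f 1 = 1)"

lemma psi: "psi n : WS {nat (n mod 2)}" "rtr th (psi n) = (%a. nu n * psi n a)" "psi n 1 = 1"
 using someI_ex[OF psi_exists[of n]] by (auto simp: psi_def)

lemma psi_OU: "psi n : OU q" using psi(1) WS_subset_OU by blast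
lemma psi_AD [simp]: "AD (psi n)" using psi_OU OU_AD by blast
lemma kth_psi: "kth (psi n) = pm_single n 1" using kth_eigen[OF psi(2)] psi(3) by simp

section \<open>The algebra $\mathcal O'_q(K)$\<close>

definition D :: "(int => complex) => dual" where
 "D c = (%f. if f : OU q then fa_lin c (kth f) else 0)"

lemma D_OpU: "D c : OpU q"
 by (auto simp: OpU_def D_def OUD kth_comb linD[OF lin_fa_lin])

lemma D_psi: "D c (psi n) = c n"
 by (simp add: D_def psi_OU kth_psi)

definition pth :: "complex poly => uq" where
 "pth p = (\<Sum>i<Suc (Polynomial.degree p). fa_const (Polynomial.coeff p i) * th ^ i)"

lemma pth_alt: "pth p = (\<Sum>i\<le>Polynomial.degree p. fa_const (Polynomial.coeff p i) * th ^ i)"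
 by (simp add: pth_def lessThan_Suc_atMost del: sum.lessThan_Suc)

lemma pth_Uk: "pth p : Uk s" unfolding pth_def Uk_def by blast

lemma Uk_pth: "a : Uk s ==> EX p. a = pth p"
proof -
 assume "a : Uk s"
 then obtain m c where a: "a = (\<Sum>i<(m::nat). fa_const (c i) * th ^ i)" by (auto simp: Uk_def)
 define p where "p = (\<Sum>i<m. Polynomial.monom (c i) i)"
 have c: "Polynomial.coeff p i = (if i < m then c i else 0)" for i
  by (auto simp: p_def coeff_sum sum.delta)
 have "pth p = (\<Sum>i<max m (Suc (Polynomial.degree p)). fa_const (Polynomial.coeff p i) * th ^ i)"
  unfolding pth_def by (rule sum.mono_neutral_left) (auto simp: coeff_eq_0 fa_const_0)
 also have "... = (\<Sum>i<m. fa_const (Polynomial.coeff p i) * th ^ i)"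
  by (rule sum.mono_neutral_right) (auto simp: c fa_const_0)
 also have "... = a" unfolding a by (rule sum.cong) (auto simp: c)
 finally have "a = pth p" by simp
 thus ?thesis by blast
qed

lemma pth_commute: "pth p * th = th * pth p" "pth p * pth r = pth r * pth p"
proof -
 have t: "pth p * th ^ j = th ^ j * pth p" for j p
  by (simp add: pth_alt sum_distrib_left sum_distrib_right mult.assoc fa_const_left_commute flip: power_add)
   (simp add: add.commute)
 show "pth p * th = th * pth p" using t[of p 1] by simp
 have "pth p * pth r = (\<Sum>i\<le>Polynomial.degree r. fa_const (Polynomial.coeff r i) * (pth p * th ^ i))"
  by (simp add: pth_alt[of r] sum_distrib_left fa_const_left_commute)
 moreover have "pth r * pth p = (\<Sum>i\<le>Polynomial.degree r. fa_const (Polynomial.coeff r i) * (th ^ i * pth p))"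
  by (simp add: pth_alt[of r] sum_distrib_right mult.assoc)
 ultimately show "pth p * pth r = pth r * pth p" by (simp add: t)
qed

lemma lin_pth: "lin f ==> f (b * pth p) = (\<Sum>i\<le>Polynomial.degree p. Polynomial.coeff p i * f (b * th ^ i))"
 by (simp add: pth_alt sum_distrib_left lin_sum linD)

lemma OU_pth: "f : OU q ==> f (pth p) = fa_lin (%m. poly p (nu m)) (kth f)"
 using lin_pth[OF OU_lin, of f 1 p] nexp_poly[OF kth_nexp, of f p] by simp

lemma deval_pth: "deval q (pth p) = D (%m. poly p (nu m))"
 by (auto simp: deval_def D_def OU_pth)

lemma fa_lin_cong: "(!!m. m : pm_keys ka ==> f m = g m) ==> fa_lin f ka = fa_lin g ka"
 by (simp add: fa_lin_def)

lemma D_interpolate: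
 assumes "finite F" "F <= OU q"
 shows "EX p. (ALL f:F. D c f = f (pth p)) & (ALL m:A. finite A --> poly p (nu m) = c m) &
   (ALL f:F. ALL m:pm_keys (kth f). poly p (nu m) = c m)"
proof -
 let ?K = "(\<Union>f\<in>F. pm_keys (kth f)) \<union> (if finite A then A else {})"
 have "finite ?K" using assms(1) by auto
 from node_interpolation[OF inj_nu this, of c] obtain p where p: "ALL m:?K. poly p (nu m) = c m" by blast
 show ?thesis
 proof (intro exI[of _ p] conjI ballI impI)
  fix f assume f: "f : F"
  thus "D c f = f (pth p)"
   using assms(2) p by (auto simp: D_def OU_pth intro!: fa_lin_cong p[rule_format, symmetric])
 qed (use p in auto)
qed

lemma closure_funI:
 fixes x :: "'a => complex"
 assumes "!!F. finite F ==> EX y:S. ALL i:F. y i = x i"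
 shows "x : closure S"
 unfolding closure_iff_nhds_not_empty
proof (intro allI impI)
 fix A V assume "x : V" "V <= A" "open V"
 have "openin (product_topology (%_. euclidean) UNIV) V"
  using `open V` by (simp add: euclidean_product_topology)
 from product_topology_open_contains_basis[OF this `x : V`]
 have "EX U. x : PiE UNIV U & (ALL i. openin euclidean (U i)) & finite {i. U i ~= topspace euclidean} & PiE UNIV U <= V"
  by simp
 then obtain Xa where Xa: "x : PiE UNIV Xa" "finite {i. Xa i ~= UNIV}" "PiE UNIV Xa <= V"
  by auto
 obtain y where y: "y : S" "ALL i:{i. Xa i ~= UNIV}. y i = x i" using assms[OF Xa(2)] by blast
 have "y i : Xa i" for i using y(2) Xa(1) by (cases "Xa i = UNIV") (auto simp: PiE_def)
 hence "y : PiE UNIV Xa" by (auto simp: PiE_def)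
 thus "S \<inter> A ~= {}" using Xa(3) y(1) `V <= A` by blast
qed

text \<open>Finitely many functions involve finitely many eigenvalues, and on these every function of \<open>m\<close>
  is a polynomial in $[m]_q$. So each \<open>D c\<close> is a limit of polynomials in $\theta$; conversely a limit of
  such polynomials is determined by its values on the functions \<open>psi m\<close>.\<close>

lemma OpK_eq: "OpK q s = range D"
proof
 show "range D <= OpK q s"
 proof
  fix x assume "x : range D"
  then obtain c where x: "x = D c" by auto
  show "x : OpK q s"
   unfolding OpK_def
  proof (rule closure_funI)
   fix F :: "ofun set" assume F: "finite F"
   obtain p where p: "ALL f:F \<inter> OU q. D c f = f (pth p)"
    using D_interpolate[of "F \<inter> OU q" c "{}"] F by auto
   have "ALL f:F. deval q (pth p) f = x f" using p by (auto simp: deval_def x D_def)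
   thus "EX y:deval q ` Uk s. ALL f:F. y f = x f" using pth_Uk by blast
  qed
 qed
 show "OpK q s <= range D"
 proof
  fix x assume x: "x : OpK q s"
  have cont: "continuous_on UNIV (%x::dual. x f)" for f
   by (rule continuous_on_product_coordinates)
  have cl: "x : C" if "closed C" "deval q ` Uk s <= C" for C
   using x closure_minimal[OF that(2,1)] by (auto simp: OpK_def)
  have "x f = D (%n. x (psi n)) f" for f
  proof (cases "f : OU q")
   case True
   have "x : {x. x f = (\<Sum>w\<in>pm_keys (kth f). pm_lookup (kth f) w * x (psi w))}"
   proof (rule cl)
    show "closed {x::dual. x f = (\<Sum>w\<in>pm_keys (kth f). pm_lookup (kth f) w * x (psi w))}"
     by (intro closed_Collect_eq continuous_intros cont)
    show "deval q ` Uk s <= {x. x f = (\<Sum>w\<in>pm_keys (kth f). pm_lookup (kth f) w * x (psi w))}"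
    proof clarify
     fix a assume "a : Uk s"
     then obtain p where "a = pth p" using Uk_pth by blast
     thus "deval q a f = (\<Sum>w\<in>pm_keys (kth f). pm_lookup (kth f) w * deval q a (psi w))"
      by (simp add: deval_pth D_psi) (simp add: D_def True fa_lin_def)
    qed
   qed
   thus ?thesis by (simp add: D_def True fa_lin_def)
  next
   case False
   have "x : {x. x f = 0}"
    by (rule cl, intro closed_Collect_eq continuous_intros cont) (use False in "auto simp: deval_def")
   thus ?thesis using False by (simp add: D_def)
  qed
  thus "x : range D" by blast
 qed
qed

lemma OpU_lin:
 assumes "x : OpU q"
 shows "f : OU q ==> g : OU q ==> x (%a. c * f a + g a) = c * x f + x g"
  "f : OU q ==> x (%a. c * f a) = c * x f" "x (%_. 0) = 0"
  "f : OU q ==> g : OU q ==> x (%a. f a + g a) = x f + x g"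
proof -
 have L: "x (%a. c * f a + g a) = c * x f + x g" if "f : OU q" "g : OU q" for c f g
  using assms that by (auto simp: OpU_def)
 thus "f : OU q ==> g : OU q ==> x (%a. c * f a + g a) = c * x f + x g" .
 show z: "x (%_. 0) = 0" using L[of "%_. 0" "%_. 0" 1] OUD(1) by simp
 show "f : OU q ==> x (%a. c * f a) = c * x f" using L[of f "%_. 0" c] OUD(1) z by simp
 show "f : OU q ==> g : OU q ==> x (%a. f a + g a) = x f + x g" using L[of f g 1] by simp
qed

lemma OpU_sum:
 assumes "x : OpU q" "!!i. i : A ==> f i : OU q"
 shows "x (%a. \<Sum>i\<in>A. c i * f i a) = (\<Sum>i\<in>A. c i * x (f i))"
 using assms(2)
proof (induction A rule: infinite_finite_induct)
 case (insert i A)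
 have "(%a. \<Sum>i\<in>A. c i * f i a) : OU q" using insert by (intro csub_sum[OF OU_csub] OUD(3)) auto
 thus ?case using insert OpU_lin(1)[OF assms(1)] by simp
qed (simp_all add: OpU_lin[OF assms(1)])

lemma OpU_sum':
 assumes "x : OpU q" "!!i. i : A ==> f i : OU q"
 shows "x (%a. \<Sum>i\<in>A. f i a) = (\<Sum>i\<in>A. x (f i))"
 using OpU_sum[OF assms(1), of A f "%_. 1"] assms(2) by simp

lemma lact_coprod:
 assumes "x : OpU q" "!!i. i : A ==> f2 i : OU q" "!!a b. f (a * b) = (\<Sum>i\<in>A. f1 i a * f2 i b)"
 shows "lact x f = (%a. \<Sum>i\<in>A. x (f2 i) * f1 i a)"
 unfolding lact_def assms(3) using OpU_sum[OF assms(1,2), of A "%i. i" "%i. f1 i a" for a] by (simp add: mult.commute)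

lemma lact_OU: "x : OpU q ==> f : OU q ==> lact x f : OU q"
proof -
 assume x: "x : OpU q" and "f : OU q"
 from this(2) obtain n f1 f2 where f: "!!i. i < n ==> f1 i : OU q" "!!i. i < n ==> f2 i : OU q"
  "!!x y. f (x * y) = (\<Sum>i<(n::nat). f1 i x * f2 i y)" by (rule OU_coprod) blast
 show ?thesis
  by (subst lact_coprod[OF x, of "{..<n}" f2 f f1]) (use f in "auto intro!: csub_sum[OF OU_csub] OUD(3)")
qed

lemma lact_comb: "x : OpU q ==> f : OU q ==> g : OU q ==> lact x (%a. c * f a + g a) = (%a. c * lact x f a + lact x g a)"
 unfolding lact_def using OpU_lin(1)[of x "ltr a f" "ltr a g" c for a] OU_ltr by (simp add: ltr_def)

lemma kth_lact: 
 assumes "f : OU q" shows "nexp nu (%j. lact (D d) f (th ^ j)) (Abs_poly_mapping (%m. d m * pm_lookup (kth f) m))"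
  "fa_lin c (Abs_poly_mapping (%m. d m * pm_lookup (kth f) m)) = fa_lin (%m. c m * d m) (kth f)"
proof -
 let ?ka = "Abs_poly_mapping (%m. d m * pm_lookup (kth f) m)"
 have fin: "finite {m. d m * pm_lookup (kth f) m ~= 0}"
  by (rule finite_subset[OF _ finite_keys[of "kth f"]]) (auto simp: in_keys_iff)
 have lk: "pm_lookup ?ka m = d m * pm_lookup (kth f) m" for m
  using lookup_Abs_poly_mapping[OF fin] by simp
 show red: "fa_lin c ?ka = fa_lin (%m. c m * d m) (kth f)" for c
 proof -
  have "fa_lin c ?ka = (\<Sum>m\<in>pm_keys (kth f). pm_lookup ?ka m * c m)"
   by (rule fa_lin_superset) (auto simp: in_keys_iff lk)
  thus ?thesis by (simp add: fa_lin_def lk mult_ac)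
 qed
 show "nexp nu (%j. lact (D d) f (th ^ j)) ?ka"
  unfolding nexp_def
 proof
  fix j
  have "nexp nu (%i. ltr (th ^ j) f (th ^ i)) (Abs_poly_mapping (%m. nu m ^ j * pm_lookup (kth f) m))"
  proof -
   have fin': "finite {m. nu m ^ j * pm_lookup (kth f) m ~= 0}"
    by (rule finite_subset[OF _ finite_keys[of "kth f"]]) (auto simp: in_keys_iff)
   have lk': "pm_lookup (Abs_poly_mapping (%m. nu m ^ j * pm_lookup (kth f) m)) m = nu m ^ j * pm_lookup (kth f) m" for m
    using lookup_Abs_poly_mapping[OF fin'] by simp
   have "fa_lin (%m. nu m ^ i) (Abs_poly_mapping (%m. nu m ^ j * pm_lookup (kth f) m)) = fa_lin (%m. nu m ^ (j + i)) (kth f)" for i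
    by (subst fa_lin_superset[of "pm_keys (kth f)"]) (auto simp: in_keys_iff lk' fa_lin_def power_add intro!: sum.cong)
   thus ?thesis
    using kth_nexp[OF assms] by (simp add: nexp_def ltr_def flip: power_add)
  qed
  hence k: "kth (ltr (th ^ j) f) = Abs_poly_mapping (%m. nu m ^ j * pm_lookup (kth f) m)" by (rule kth_eq)
  have "lact (D d) f (th ^ j) = fa_lin d (kth (ltr (th ^ j) f))"
   using OU_ltr[OF assms] by (simp add: lact_def D_def ltr_def)
  also have "... = fa_lin (%m. nu m ^ j * d m) (kth f)"
   unfolding k
  proof -
   have fin': "finite {m. nu m ^ j * pm_lookup (kth f) m ~= 0}"
    by (rule finite_subset[OF _ finite_keys[of "kth f"]]) (auto simp: in_keys_iff)
   show "fa_lin d (Abs_poly_mapping (%m. nu m ^ j * pm_lookup (kth f) m)) = fa_lin (%m. nu m ^ j * d m) (kth f)"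
    by (subst fa_lin_superset[of "pm_keys (kth f)"]) (auto simp: in_keys_iff lookup_Abs_poly_mapping[OF fin'] fa_lin_def intro!: sum.cong)
  qed
  finally show "lact (D d) f (th ^ j) = fa_lin (%m. nu m ^ j) ?ka" by (simp add: red)
 qed
qed

lemma dmult_D: "dmult q (D c) (D d) = D (%m. c m * d m)"
proof
 fix f show "dmult q (D c) (D d) f = D (%m. c m * d m) f"
  using lact_OU[OF D_OpU, of f d] kth_lact(2)[where f = f and d = d and c = c] kth_eq[OF kth_lact(1)[of f d]]
  by (auto simp: dmult_def D_def)
qed

lemma deval_1: "deval q 1 = D (%_. 1)"
 using deval_pth[of 1] by (simp add: pth_def fa_const_1)

lemma D_comb: "(%f. z * D c f + D d f) = D (%m. z * c m + d m)"
 by (auto simp: D_def fa_lin_fun)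

lemma omult_th_pow:
 assumes "AD y"
 shows "EX al. ALL f. AD f --> omult y f (th ^ j) = (\<Sum>i\<le>j. al i * f (th ^ i))"
 using assms
proof (induction j arbitrary: y)
 case 0
 show ?case by (rule exI[of _ "%_. y 1"]) simp
next
 case (Suc j)
 obtain al where al: "AD f ==> omult (rtr th y) f (th ^ j) = (\<Sum>i\<le>j. al i * f (th ^ i))" for f
  using Suc.IH[of "rtr th y"] Suc.prems by auto
 obtain be where be: "AD f ==> omult (rtr uK y) f (th ^ j) = (\<Sum>i\<le>j. be i * f (th ^ i))" for f
  using Suc.IH[of "rtr uK y"] Suc.prems by auto
 show ?case
 proof (intro exI[of _ "%i. (if i <= j then al i else 0) + (if i = 0 then 0 else be (i - 1))"] allI impI)
  fix f assume f: "AD f"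
  have "omult y f (th ^ Suc j) = rtr th (omult y f) (th ^ j)"
   by (simp only: rtr_def power_Suc2)
  also have "... = (\<Sum>i\<le>j. al i * f (th ^ i)) + (\<Sum>i\<le>j. be i * rtr th f (th ^ i))"
   using Suc.prems f by (simp add: rtr_th_omult al be)
  also have "(\<Sum>i\<le>j. al i * f (th ^ i)) = (\<Sum>i\<le>Suc j. (if i <= j then al i else 0) * f (th ^ i))"
   by simp
  also have "(\<Sum>i\<le>j. be i * rtr th f (th ^ i)) = (\<Sum>i\<le>Suc j. (if i = 0 then 0 else be (i - 1)) * f (th ^ i))"
   by (subst sum.atMost_Suc_shift) (simp add: rtr_def power_commutes)
  finally show "omult y f (th ^ Suc j) = (\<Sum>i\<le>Suc j. ((if i <= j then al i else 0) + (if i = 0 then 0 else be (i - 1))) * f (th ^ i))"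
   by (simp only: distrib_right sum.distrib)
 qed
qed

text \<open>The right-hand side is forced by the value at \<open>psi m\<close>; that $x\triangleleft y$ lies in
  $\mathcal O'_q(K)$ at all follows from $\Delta(\theta)=\theta\otimes1+k\otimes\theta$.\<close>

lemma dract_D:
 assumes y: "y : OU q"
 shows "dract q (D c) y = D (%m. D c (omult y (psi m)))"
proof
 fix f
 show "dract q (D c) y f = D (%m. D c (omult y (psi m))) f"
 proof (cases "f : OU q")
  case True
  let ?g = "%a. \<Sum>m\<in>pm_keys (kth f). pm_lookup (kth f) m * omult y (psi m) a"
  have g: "?g : OU q" by (intro csub_sum[OF OU_csub] OUD(3) OU_omult psi_OU y)
  have "omult y f (th ^ j) = ?g (th ^ j)" for j
  proof -
   obtain al where al: "AD f ==> omult y f (th ^ j) = (\<Sum>i\<le>j. al i * f (th ^ i))" for f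
    using omult_th_pow[OF OU_AD[OF y]] by blast
   have p: "psi m (th ^ i) = nu m ^ i" for m i using th_pow[OF psi(2), of m 1 i] psi(3) by simp
   have "omult y f (th ^ j) = (\<Sum>i\<le>j. al i * (\<Sum>m\<in>pm_keys (kth f). pm_lookup (kth f) m * nu m ^ i))"
    using al[OF OU_AD[OF True]] kth_nexp[OF True] by (simp add: nexp_def fa_lin_def)
   also have "... = (\<Sum>m\<in>pm_keys (kth f). \<Sum>i\<le>j. al i * (pm_lookup (kth f) m * nu m ^ i))"
    unfolding sum_distrib_left by (rule sum.swap)
   also have "... = ?g (th ^ j)"
    by (simp add: al p sum_distrib_left mult_ac)
   finally show ?thesis .
  qed
  hence "kth (omult y f) = kth ?g" by (simp only: kth_def)
  hence "D c (omult y f) = D c ?g" using g OU_omult[OF y True] by (simp add: D_def)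
  also have "... = (\<Sum>m\<in>pm_keys (kth f). pm_lookup (kth f) m * D c (omult y (psi m)))"
   by (rule OpU_sum[OF D_OpU]) (intro OU_omult psi_OU y)
  finally show ?thesis using True by (simp add: dract_def D_def[of "%m. D c (omult y (psi m))"] fa_lin_def)
 qed (simp add: dract_def D_def)
qed

definition dl :: "int => int => complex" where "dl n = (%m. if m = n then 1 else 0)"

lemma fa_lin_dl: "fa_lin (dl n) ka = pm_lookup ka n"
proof -
 have "fa_lin (dl n) ka = (\<Sum>w\<in>pm_keys ka. if w = n then pm_lookup ka w else 0)"
  unfolding fa_lin_def by (rule sum.cong) (auto simp: dl_def)
 thus ?thesis by (auto simp: sum.delta in_keys_iff)
qed

lemma dact_index: "i < N ==> j < N ==> dact N rh x $$ (i, j) = x (rmat N rh i j)"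
proof -
 assume ij: "i < N" "j < N"
 have "coef N rh (unit_vec N i) (unit_vec N j) = rmat N rh i j"
 proof
  fix a
  have "(\<Sum>i'<N. \<Sum>j'<N. unit_vec N i $ i' * rmat N rh i' j' a * unit_vec N j $ j') = (\<Sum>i'<N. \<Sum>j'<N. if j' = j then (if i' = i then rmat N rh i' j' a else 0) else 0)"
   by (intro sum.cong) (use ij in auto)
  thus "coef N rh (unit_vec N i) (unit_vec N j) a = rmat N rh i j a"
   using ij by (simp add: coef_cf cf_def)
 qed
 thus ?thesis using ij by (simp add: dact_def)
qed

lemma dact_carrier [simp]: "dact N rh x : carrier_mat N N" by (simp add: dact_def)

lemma rmat_OU: "type1_module q N rh ==> i < N ==> j < N ==> rmat N rh i j : OU q"
proof -
 assume t: "type1_module q N rh" and ij: "i < N" "j < N"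
 have "(\<Sum>i'<N. \<Sum>j'<N. (if i' = i then 1 else 0) * rmat N rh i' j' a * (if j' = j then 1 else 0)) =
  (\<Sum>i'<N. \<Sum>j'<N. if j' = j then (if i' = i then rmat N rh i' j' a else 0) else 0)" for a
  by (intro sum.cong) auto
 hence "cf N (rmat N rh) (%k. if k = i then 1 else 0) (%k. if k = j then 1 else 0) = rmat N rh i j"
  using ij by (simp add: cf_def fun_eq_iff)
 thus ?thesis using OU_cf[OF t] by metis
qed

lemma OpU_cf:
 assumes "type1_module q N rh" "x : OpU q"
 shows "x (cf N (rmat N rh) al be) = (\<Sum>i<N. \<Sum>j<N. al i * x (rmat N rh i j) * be j)"
proof -
 have e: "cf N (rmat N rh) al be = (%a. \<Sum>i<N. al i * (\<Sum>j<N. be j * rmat N rh i j a))"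
  by (simp add: cf_def sum_distrib_left mult_ac)
 have "x (cf N (rmat N rh) al be) = (\<Sum>i<N. al i * x (%a. \<Sum>j<N. be j * rmat N rh i j a))"
  unfolding e by (rule OpU_sum[OF assms(2)]) (auto intro!: csub_sum[OF OU_csub] OUD(3) rmat_OU[OF assms(1)])
 also have "... = (\<Sum>i<N. al i * (\<Sum>j<N. be j * x (rmat N rh i j)))"
  by (intro sum.cong refl arg_cong2[where f = "(*)"] OpU_sum[OF assms(2)]) (auto intro: rmat_OU[OF assms(1)])
 finally show ?thesis by (simp add: sum_distrib_left mult_ac)
qed

lemma dact_D:
 assumes t: "type1_module q N rh" and A: "finite A"
 shows "EX p. dact N rh (D c) = rep_mat N rh (pth p) & (ALL m:A. poly p (nu m) = c m) &
  (ALL i<N. ALL j<N. ALL m:pm_keys (kth (rmat N rh i j)). poly p (nu m) = c m)"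
proof -
 let ?F = "(%(i, j). rmat N rh i j) ` ({..<N} \<times> {..<N})"
 have fs: "finite ?F" "?F <= OU q" using rmat_OU[OF t] by auto
 from D_interpolate[OF fs, of c A]
 obtain p where p: "ALL f:?F. D c f = f (pth p)" "ALL m:A. finite A --> poly p (nu m) = c m"
  "ALL f:?F. ALL m:pm_keys (kth f). poly p (nu m) = c m"
  by blast
 have "dact N rh (D c) = rep_mat N rh (pth p)"
  by (rule eq_matI) (use p(1) in "auto simp: dact_index rep_mat_index carrier_matD[OF dact_carrier] carrier_matD[OF rep_mat_carrier]")
 thus ?thesis using p(2,3) A by auto
qed

lemma rep_mat_mult: "type1_module q N rh ==> rep_mat N rh (x * y) = rep_mat N rh x * rep_mat N rh y"
proof (rule eq_matI)
 assume t: "type1_module q N rh"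
 hence c: "!!g. rh g : carrier_mat N N" by (simp add: type1_module_def)
 fix i j assume "i < dim_row (rep_mat N rh x * rep_mat N rh y)" "j < dim_col (rep_mat N rh x * rep_mat N rh y)"
 hence ij: "i < N" "j < N" by (auto simp: rep_mat_def)
 thus "rep_mat N rh (x * y) $$ (i, j) = (rep_mat N rh x * rep_mat N rh y) $$ (i, j)"
  using carrier_matD[OF rep_mat_carrier[of N rh]]
  by (simp add: rep_mat_index rmat_mult[OF c] scalar_prod_def atLeast0LessThan)
qed (simp_all add: rep_mat_def)

lemma dact_dl:
 assumes t: "type1_module q N rh"
 shows "is_spectral_proj N (rep_mat N rh th) (of_real (qnum q n)) (dact N rh (D (dl n)))"
proof -
 obtain p where p: "dact N rh (D (dl n)) = rep_mat N rh (pth p)" "poly p (nu n) = 1"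
  "!!i j m. i < N ==> j < N ==> m : pm_keys (kth (rmat N rh i j)) ==> poly p (nu m) = dl n m"
  using dact_D[OF t, of "{n}" "dl n"] by (auto simp: dl_def)
 let ?T = "rep_mat N rh th" and ?P = "rep_mat N rh (pth p)"
 have dims [simp]: "dim_row (rep_mat N rh x) = N" "dim_col (rep_mat N rh x) = N" for x by (auto simp: rep_mat_def)
 have ev: "rmat N rh i j (pth p * pth r) = fa_lin (%m. poly p (nu m) * poly r (nu m)) (kth (rmat N rh i j))" if "i < N" "j < N" for i j r
 proof -
  have pr: "f (pth p * pth r) = f (pth (p * r))" if f: "f : OU q" for f
  proof -
   have "f (pth p * pth r) = lact (deval q (pth r)) f (pth p)" using OU_ltr[OF f] by (simp add: lact_def deval_def ltr_def)
   also have "... = dmult q (deval q (pth p)) (deval q (pth r)) f"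
   proof -
    have "lact (deval q (pth r)) f : OU q" using f by (simp add: deval_pth lact_OU D_OpU)
    thus ?thesis using f by (simp add: dmult_def deval_def[of q "pth p"])
   qed
   also have "... = D (%m. poly (p * r) (nu m)) f" by (simp add: deval_pth dmult_D)
   finally show ?thesis by (simp add: D_def f OU_pth)
  qed
  show ?thesis using rmat_OU[OF t that] by (simp add: pr OU_pth)
 qed
 have PP: "?P * ?P = ?P"
 proof (rule eq_matI)
  fix i j assume ij: "i < dim_row ?P" "j < dim_col ?P"
  thus "(?P * ?P) $$ (i, j) = ?P $$ (i, j)"
   using p(3) rmat_OU[OF t, of i j]
   by (auto simp: rep_mat_mult[OF t, symmetric] rep_mat_index ev OU_pth dl_def intro!: fa_lin_cong)
 qed auto
 have pX: "pth [:0, 1:] = th" by (simp add: pth_def fa_const_0 fa_const_1)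
 have TP: "?T * ?P = nu n \<cdot>\<^sub>m ?P"
 proof (rule eq_matI)
  fix i j assume ij: "i < dim_row (nu n \<cdot>\<^sub>m ?P)" "j < dim_col (nu n \<cdot>\<^sub>m ?P)"
  have "rmat N rh i j (pth p * th) = nu n * rmat N rh i j (pth p)"
   using ev[of i j "[:0, 1:]"] ij p(3) rmat_OU[OF t, of i j]
   by (auto simp: pX OU_pth dl_def fa_lin_def sum_distrib_left intro!: sum.cong)
  thus "(?T * ?P) $$ (i, j) = (nu n \<cdot>\<^sub>m ?P) $$ (i, j)"
   using ij by (simp add: rep_mat_mult[OF t, symmetric] pth_commute(1)[symmetric] rep_mat_index)
 qed auto
 show ?thesis
  unfolding is_spectral_proj_def p(1)
 proof (intro conjI ballI)
  show "?P * ?T = ?T * ?P" by (simp add: rep_mat_mult[OF t, symmetric] pth_commute)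
  fix v :: "complex vec" assume v: "v : carrier_vec N"
  show "?P *\<^sub>v v = v <-> ?T *\<^sub>v v = of_real (qnum q n) \<cdot>\<^sub>v v"
  proof
   assume a: "?P *\<^sub>v v = v"
   have "?T *\<^sub>v v = ?T *\<^sub>v (?P *\<^sub>v v)" by (simp only: a)
   also have "... = (?T * ?P) *\<^sub>v v"
    by (rule assoc_mult_mat_vec[symmetric, of _ N N _ N]) (use v in auto)
   also have "... = nu n \<cdot>\<^sub>v (?P *\<^sub>v v)"
    unfolding TP by (rule eq_vecI) (use v in "auto simp: scalar_prod_def sum_distrib_left mult_ac")
   finally show "?T *\<^sub>v v = of_real (qnum q n) \<cdot>\<^sub>v v" using a by (simp add: nu_def)
  next
   assume a: "?T *\<^sub>v v = of_real (qnum q n) \<cdot>\<^sub>v v"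
   show "?P *\<^sub>v v = v"
   proof (rule eq_vecI)
    fix i assume "i < dim_vec v"
    hence i: "i < N" using v by auto
    define f where "f = cf N (rmat N rh) (%k. if k = i then 1 else 0) (%j. v $ j)"
    have fv: "f x = (rep_mat N rh x *\<^sub>v v) $ i" for x
    proof -
     have "f x = (\<Sum>k<N. if k = i then \<Sum>j<N. rmat N rh k j x * v $ j else 0)"
      unfolding f_def cf_def by (rule sum.cong) auto
     thus ?thesis using i v by (simp add: scalar_prod_def atLeast0LessThan rep_mat_index)
    qed
    have "rtr th f = (%a. nu n * f a)"
    proof -
     have "(\<Sum>l<N. rmat N rh j l th * v $ l) = nu n * v $ j" if "j < N" for j
      using arg_cong[OF a, of "%u. u $ j"] that v
      by (simp add: scalar_prod_def atLeast0LessThan rep_mat_index nu_def)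
     hence "rtr th f = cf N (rmat N rh) (%k. if k = i then 1 else 0) (%j. nu n * v $ j)"
      unfolding f_def cf_rtr[OF rmat_frep[OF t]] by (intro cf_cong) auto
     thus ?thesis using cf_comb[of N _ _ "nu n" "%j. v $ j" "%_. 0"] by (simp add: f_def) (simp add: cf_def)
    qed
    moreover have "f : OU q" unfolding f_def by (rule OU_cf[OF t])
    ultimately have "f (pth p) = f 1" using p(2) by (simp add: OU_pth kth_eigen)
    moreover have "(rep_mat N rh 1 *\<^sub>v v) $ i = v $ i"
    proof -
     have "rep_mat N rh 1 = 1\<^sub>m N" by (rule eq_matI) (auto simp: rep_mat_index rmat_1)
     thus ?thesis using v by simp
    qed
    ultimately show "(?P *\<^sub>v v) $ i = v $ i" by (simp add: fv)
   qed (use v in auto)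
  qed
 qed (use PP in auto)
qed

lemma idem_e_D: "idem_e q s n = D (dl n)"
 unfolding idem_e_def
proof (rule the_equality)
 show "D (dl n) : OpK q s & (ALL N rh. type1_module q N rh -->
    is_spectral_proj N (rep_mat N rh (theta s)) (of_real (qnum q n)) (dact N rh (D (dl n))))"
  using dact_dl by (auto simp: OpK_eq)
 fix x assume x: "x : OpK q s & (ALL N rh. type1_module q N rh -->
    is_spectral_proj N (rep_mat N rh (theta s)) (of_real (qnum q n)) (dact N rh x))"
 then obtain c where c: "x = D c" by (auto simp: OpK_eq)
 show "x = D (dl n)"
 proof
  fix f
  show "x f = D (dl n) f"
  proof (cases "f : OU q")
   case True
   thus ?thesis
   proof (rule OU_E)
    fix N rh al be w m
    assume t: "type1_module q N rh" and f: "f = cf N (rmat N rh) al be"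
    let ?P = "dact N rh x" and ?P' = "dact N rh (D (dl n))"
    have sp: "is_spectral_proj N (rep_mat N rh th) (of_real (qnum q n)) ?P"
     "is_spectral_proj N (rep_mat N rh th) (of_real (qnum q n)) ?P'"
     using x t dact_dl by auto
    obtain p where p: "?P = rep_mat N rh (pth p)" using dact_D[OF t, of "{}" c] c by auto
    obtain p' where p': "?P' = rep_mat N rh (pth p')" using dact_D[OF t, of "{}" "dl n"] by auto
    have prod: "A * B = B" if A: "is_spectral_proj N (rep_mat N rh th) (of_real (qnum q n)) A"
     and B: "is_spectral_proj N (rep_mat N rh th) (of_real (qnum q n)) B" for A B
    proof -
     have c: "A : carrier_mat N N" "B : carrier_mat N N" "B * B = B"
      using A B by (auto simp: is_spectral_proj_def)
     have "col (A * B) j = col B j" if "j < N" for j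
     proof -
      have "col B j : carrier_vec N" using c by auto
      moreover have "B *\<^sub>v col B j = col B j"
       using c that col_mult2[of B N N B N j] by simp
      ultimately have "A *\<^sub>v col B j = col B j" using A B by (auto simp: is_spectral_proj_def)
      thus ?thesis using c that col_mult2[of A N N B N j] by simp
     qed
     thus ?thesis using c by (intro mat_col_eqI) auto
    qed
    have "?P' * ?P = ?P * ?P'"
     unfolding p p' by (simp add: rep_mat_mult[OF t, symmetric] pth_commute)
    hence "?P = ?P'" using prod[OF sp] prod[OF sp(2,1)] by simp
    hence "x (rmat N rh i j) = D (dl n) (rmat N rh i j)" if "i < N" "j < N" for i j
     using dact_index that by metis
    moreover have "x : OpU q" using c D_OpU by simp
    ultimately show "x f = D (dl n) f" unfolding f by (simp add: OpU_cf[OF t] D_OpU)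
   qed
  qed (simp add: c D_def)
 qed
qed

lemma minus_one_q_D: "minus_one_q q s = D (%m. (-1) powi m)"
proof
 fix f
 show "minus_one_q q s f = D (%m. (-1) powi m) f"
 proof (cases "f : OU q")
  case True
  let ?g = "%n. (-1) powi n * idem_e q s n f"
  have e: "idem_e q s n f = pm_lookup (kth f) n" for n
   unfolding idem_e_D using True by (simp add: D_def fa_lin_dl)
  have "infsum ?g UNIV = infsum ?g (pm_keys (kth f))"
   by (rule infsum_cong_neutral) (auto simp: e in_keys_iff)
  also have "... = D (%m. (-1) powi m) f"
   using True by (simp add: D_def fa_lin_def e mult.commute)
  finally show ?thesis by (simp add: minus_one_q_def)
 qed (simp add: minus_one_q_def idem_e_D D_def)
qed
section \<open>Weights\<close>

lemma K_pow:
 fixes f :: ofun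
 shows "rtr uK f = (%a. c * f a) ==> f (b * uK ^ j) = c ^ j * f b"
proof (induction j)
 case (Suc j)
 have "f (b * uK ^ Suc j) = rtr uK f (b * uK ^ j)" by (simp only: rtr_def power_Suc2 mult.assoc)
 also have "... = c * f (b * uK ^ j)" unfolding Suc.prems ..
 finally show ?case using Suc by (simp only: power_Suc mult.assoc)
qed simp

lemma omult_K_pow: "lin f ==> lin g ==> omult f g (uK ^ j) = f (uK ^ j) * g (uK ^ j)"
proof (induction j arbitrary: f g)
 case (Suc j)
 have "omult f g (uK ^ Suc j) = rtr uK (omult f g) (uK ^ j)" by (simp only: rtr_def power_Suc2)
 also have "... = rtr uK f (uK ^ j) * rtr uK g (uK ^ j)" using Suc by (simp add: rtr_omult lin_rtr)
 finally show ?case by (simp only: rtr_def power_Suc2)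
qed simp

lemma nexp_K_mult:
 assumes "nexp qp f ka" "nexp qp g ka'"
 shows "nexp qp (%j. f j * g j) (ka * ka')"
 using assms by (simp add: nexp_def fa_lin_mult qp_add power_mult_distrib)

lemma nexp_K_weight: "rtr uK f = (%a. qp m * f a) ==> nexp qp (%j. f (uK ^ j)) (pm_single m (f 1))"
 using K_pow[of f "qp m" 1] nexp_single[of qp m "f 1"] by auto

lemma wf_nexp_K: "set ps <= sq ==> EX ka. nexp qp (%j. wf ps (uK ^ j)) ka"
proof (induction ps)
 case Nil
 show ?case using nexp_K_weight[of counit 0] by auto
next
 case (Cons p ps)
 then obtain ka where ka: "nexp qp (%j. wf ps (uK ^ j)) ka" by auto
 have "EX m. rtr uK (uu (fst p) (snd p)) = (%a. qp m * uu (fst p) (snd p) a)"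
 proof (cases "snd p = 0")
  case True
  thus ?thesis using Cons.prems by (intro exI[of _ 1]) (auto simp: rtr_uu)
 next
  case False
  thus ?thesis using Cons.prems by (intro exI[of _ "-1"]) (auto simp: rtr_uu less_2 qp_minus)
 qed
 then obtain m where "rtr uK (uu (fst p) (snd p)) = (%a. qp m * uu (fst p) (snd p) a)" by blast
 from nexp_K_mult[OF nexp_K_weight[OF this] ka] show ?case by (auto simp: omult_K_pow)
qed

lemma OU_nexp_K: "f : OU q ==> EX ka. nexp qp (%j. f (uK ^ j)) ka"
 unfolding OU_eq_WS
proof (induction rule: WS.induct)
 case zero
 show ?case using nexp_0 by blast
next
 case (step f ps c)
 thus ?case using wf_nexp_K[of ps] nexp_comb by blast
qed

definition kwt :: "ofun => int \<Rightarrow>\<^sub>0 complex" where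
 "kwt f = (THE ka. nexp qp (%j. f (uK ^ j)) ka)"

lemma kwt_eq: "nexp qp (%j. f (uK ^ j)) ka ==> kwt f = ka"
 unfolding kwt_def using nexp_unique[OF inj_qp] by (intro the_equality)

lemma kwt_nexp: "f : OU q ==> nexp qp (%j. f (uK ^ j)) (kwt f)"
 using OU_nexp_K kwt_eq by metis

text \<open>\<open>G t\<close> is the grouplike functional that acts on vectors of weight \<open>m\<close> as \<open>t\<^sup>m\<close>.\<close>

definition G :: "complex => dual" where
 "G t = (%f. if f : OU q then fa_lin (%m. t powi m) (kwt f) else 0)"

lemma G_OpU: "G t : OpU q"
proof -
 have "kwt (%a. c * f a + g a) = fa_const c * kwt f + kwt g" if "f : OU q" "g : OU q" for c f g
  by (rule kwt_eq, rule nexp_comb) (use that kwt_nexp in auto)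
 thus ?thesis by (auto simp: OpU_def G_def OUD linD[OF lin_fa_lin])
qed

lemma G_weight: "f : OU q ==> rtr uK f = (%a. qp m * f a) ==> G t f = t powi m * f 1"
 by (simp add: G_def kwt_eq[OF nexp_K_weight] mult.commute)

lemma G_counit: "G t counit = 1"
 using G_weight[OF OU_counit, of 0] by simp

lemma G_omult:
 assumes "t ~= 0" "f : OU q" "g : OU q"
 shows "G t (omult f g) = G t f * G t g"
proof -
 have "kwt (omult f g) = kwt f * kwt g"
  by (rule kwt_eq) (use nexp_K_mult[OF kwt_nexp[OF assms(2)] kwt_nexp[OF assms(3)]] assms in "simp add: omult_K_pow OU_lin")
 thus ?thesis using assms by (simp add: G_def OU_omult fa_lin_mult power_int_add)
qed

lemma G_1: "f : OU q ==> G 1 f = f 1"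
proof -
 assume f: "f : OU q"
 hence "f (uK ^ 0) = fa_lin (%m. qp m ^ 0) (kwt f)"
  using kwt_nexp unfolding nexp_def by blast
 moreover have "(powi) 1 = (%m. 1 :: complex)" by (simp add: fun_eq_iff)
 ultimately show ?thesis using f by (simp add: G_def)
qed

lemma OU_coprod_ex:
 assumes "f : OU q"
 shows "EX n f1 f2. (ALL i<n. f1 i : OU q) & (ALL i<n. f2 i : OU q) & (ALL x y. f (x * y) = (\<Sum>i<(n::nat). f1 i x * f2 i y))"
proof (rule OU_coprod[OF assms])
 fix n f1 f2
 assume a: "!!i. i < n ==> f1 i : OU q" "!!i. i < n ==> f2 i : OU q"
  "!!x y. f (x * y) = (\<Sum>i<(n::nat). f1 i x * f2 i y)"
 show ?thesis
  by (rule exI[of _ n], rule exI[of _ f1], rule exI[of _ f2]) (intro conjI allI impI a)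
qed

lemma lact_G_omult:
 assumes "t ~= 0" "f : OU q" "g : OU q"
 shows "lact (G t) (omult f g) = omult (lact (G t) f) (lact (G t) g)"
proof -
 from OU_coprod_ex[OF assms(2)] obtain n f1 f2 where f': "(ALL i<n. f1 i : OU q) & (ALL i<n. f2 i : OU q) &
  (ALL x y. f (x * y) = (\<Sum>i<(n::nat). f1 i x * f2 i y))" by blast
 have f: "f1 i : OU q" "f2 i : OU q" if "i < n" for i using f' that by auto
 have fc: "f (x * y) = (\<Sum>i<n. f1 i x * f2 i y)" for x y using f' by blast
 from OU_coprod_ex[OF assms(3)] obtain m g1 g2 where g': "(ALL i<m. g1 i : OU q) & (ALL i<m. g2 i : OU q) &
  (ALL x y. g (x * y) = (\<Sum>i<(m::nat). g1 i x * g2 i y))" by blast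
 have g: "g1 i : OU q" "g2 i : OU q" if "i < m" for i using g' that by auto
 have gc: "g (x * y) = (\<Sum>i<m. g1 i x * g2 i y)" for x y using g' by blast
 have fg: "omult f g (x * y) = (\<Sum>i<n. \<Sum>j<m. omult (f1 i) (g1 j) x * omult (f2 i) (g2 j) y)" for x y
  by (rule omult_coprod) (use f g fc gc assms in "auto simp: OU_lin")
 have "lact (G t) (omult f g) = (%a. \<Sum>p\<in>{..<n} \<times> {..<m}. G t (omult (f2 (fst p)) (g2 (snd p))) * omult (f1 (fst p)) (g1 (snd p)) a)"
  by (rule lact_coprod[OF G_OpU]) (use f g fg in "auto simp: OU_omult sum.cartesian_product case_prod_beta")
 also have "... = (%a. \<Sum>i<n. \<Sum>j<m. (G t (f2 i) * G t (g2 j)) * omult (f1 i) (g1 j) a)"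
  using f g by (auto simp: sum.cartesian_product case_prod_beta G_omult[OF assms(1)] intro!: sum.cong)
 also have "... = omult (lact (G t) f) (lact (G t) g)"
 proof -
  have "lact (G t) f = (%a. \<Sum>i<n. G t (f2 i) * f1 i a)" by (rule lact_coprod[OF G_OpU]) (use f fc in auto)
  moreover have "lact (G t) g = (%a. \<Sum>i<m. G t (g2 i) * g1 i a)" by (rule lact_coprod[OF G_OpU]) (use g gc in auto)
  ultimately show ?thesis by (simp add: omult_sum omult_scale) (simp add: sum_distrib_left mult_ac)
 qed
 finally show ?thesis .
qed

definition ract :: "complex => ofun => ofun" where
 "ract t f = (%a. G t (rtr a f))"

lemma ract_coprod:
 assumes "!!i. i : A ==> f1 i : OU q" "!!a b. f (a * b) = (\<Sum>i\<in>A. f1 i a * f2 i b)"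
 shows "ract t f = (%a. \<Sum>i\<in>A. G t (f1 i) * f2 i a)"
 unfolding ract_def rtr_def assms(2)
 using OpU_sum[OF G_OpU[of t], of A f1 "%i. f2 i a" for a] assms(1) by (simp add: mult.commute)

lemma ract_OU: "f : OU q ==> ract t f : OU q"
proof -
 assume "f : OU q"
 from this obtain n f1 f2 where f: "!!i. i < n ==> f1 i : OU q" "!!i. i < n ==> f2 i : OU q"
  "!!x y. f (x * y) = (\<Sum>i<(n::nat). f1 i x * f2 i y)" by (rule OU_coprod) blast
 show ?thesis
  by (subst ract_coprod[of "{..<n}" f1 f f2]) (use f in "auto intro!: csub_sum[OF OU_csub] OUD(3)")
qed

lemma ract_omult:
 assumes "t ~= 0" "f : OU q" "g : OU q"
 shows "ract t (omult f g) = omult (ract t f) (ract t g)"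
proof -
 from OU_coprod_ex[OF assms(2)] obtain n f1 f2 where f': "(ALL i<n. f1 i : OU q) & (ALL i<n. f2 i : OU q) &
  (ALL x y. f (x * y) = (\<Sum>i<(n::nat). f1 i x * f2 i y))" by blast
 have f: "f1 i : OU q" "f2 i : OU q" if "i < n" for i using f' that by auto
 have fc: "f (x * y) = (\<Sum>i<n. f1 i x * f2 i y)" for x y using f' by blast
 from OU_coprod_ex[OF assms(3)] obtain m g1 g2 where g': "(ALL i<m. g1 i : OU q) & (ALL i<m. g2 i : OU q) &
  (ALL x y. g (x * y) = (\<Sum>i<(m::nat). g1 i x * g2 i y))" by blast
 have g: "g1 i : OU q" "g2 i : OU q" if "i < m" for i using g' that by auto
 have gc: "g (x * y) = (\<Sum>i<m. g1 i x * g2 i y)" for x y using g' by blast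
 have fg: "omult f g (x * y) = (\<Sum>i<n. \<Sum>j<m. omult (f1 i) (g1 j) x * omult (f2 i) (g2 j) y)" for x y
  by (rule omult_coprod) (use f g fc gc assms in "auto simp: OU_lin")
 have "ract t (omult f g) = (%a. \<Sum>p\<in>{..<n} \<times> {..<m}. G t (omult (f1 (fst p)) (g1 (snd p))) * omult (f2 (fst p)) (g2 (snd p)) a)"
  by (rule ract_coprod) (use f g fg in "auto simp: OU_omult sum.cartesian_product case_prod_beta")
 also have "... = (%a. \<Sum>i<n. \<Sum>j<m. (G t (f1 i) * G t (g1 j)) * omult (f2 i) (g2 j) a)"
  using f g by (auto simp: sum.cartesian_product case_prod_beta G_omult[OF assms(1)] intro!: sum.cong)
 also have "... = omult (ract t f) (ract t g)"
 proof -
  have "ract t f = (%a. \<Sum>i<n. G t (f1 i) * f2 i a)" by (rule ract_coprod) (use f fc in auto)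
  moreover have "ract t g = (%a. \<Sum>i<m. G t (g1 i) * g2 i a)" by (rule ract_coprod) (use g gc in auto)
  ultimately show ?thesis by (simp add: omult_sum omult_scale) (simp add: sum_distrib_left mult_ac)
 qed
 finally show ?thesis .
qed

lemma ract_comb: "f : OU q ==> g : OU q ==> ract t (%a. c * f a + g a) = (%a. c * ract t f a + ract t g a)"
 unfolding ract_def rtr_comb using OpU_lin(1)[OF G_OpU] OU_rtr by auto

lemma ract_counit: "ract t counit = counit"
 using OpU_lin(2)[OF G_OpU OU_counit] by (simp add: ract_def G_counit)

lemma ract_at_1: "ract t f 1 = G t f" by (simp add: ract_def)

lemma ract_1: "f : OU q ==> ract 1 f = f"
 by (simp add: ract_def fun_eq_iff G_1 OU_rtr) (simp add: rtr_def)

lemma ract_of_coprod: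
 assumes "f : OU q" "!!i. i : A ==> f1 i : OU q" "!!a b. f (a * b) = (\<Sum>i\<in>A. f1 i a * f2 i b)"
 shows "ract t f (a * b) = (\<Sum>i\<in>A. ract t (f1 i) a * f2 i b)"
proof -
 have "rtr (a * b) f = (%c. \<Sum>i\<in>A. f2 i b * rtr a (f1 i) c)"
  by (simp add: rtr_def fun_eq_iff assms(3) mult.commute flip: mult.assoc)
 thus ?thesis using OpU_sum[OF G_OpU, of A "%i. rtr a (f1 i)" t "%i. f2 i b"] assms(2) OU_rtr
  by (simp add: ract_def mult.commute)
qed

lemma k_half_G: "k_half q s = G cs"
 unfolding k_half_def
proof (rule the_equality)
 have cond: "G cs (cf N (rmat N rh) al (%j. v $ j)) = of_real (s powi n) * (\<Sum>i<N. al i * v $ i)"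
  if t: "type1_module q N rh" and v: "v : carrier_vec N" and K: "mult_mat_vec (rh gK) v = of_real (q powi n) \<cdot>\<^sub>v v"
  for N rh n v al
 proof -
  have c: "!!g. rh g : carrier_mat N N" using t by (simp add: type1_module_def)
  have "(\<Sum>l<N. rmat N rh j l uK * v $ l) = qp n * v $ j" if "j < N" for j
   using arg_cong[OF K, of "%u. u $ j"] that v c[of gK]
   by (simp add: scalar_prod_def atLeast0LessThan rmat_gen[OF c] qp_def)
  hence "rtr uK (cf N (rmat N rh) al (%j. v $ j)) = cf N (rmat N rh) al (%j. qp n * v $ j)"
   unfolding cf_rtr[OF rmat_frep[OF t]] by (intro cf_cong) auto
  hence "rtr uK (cf N (rmat N rh) al (%j. v $ j)) = (%a. qp n * cf N (rmat N rh) al (%j. v $ j) a)"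
   using cf_comb[of N _ al "qp n" "%j. v $ j" "%_. 0"] by simp (simp add: cf_def)
  from G_weight[OF OU_cf[OF t] this, of cs]
  have "G cs (cf N (rmat N rh) al (%j. v $ j)) = cs powi n * cf N (rmat N rh) al (%j. v $ j) 1" .
  also have "cf N (rmat N rh) al (%j. v $ j) 1 = (\<Sum>i<N. \<Sum>j<N. if j = i then al i * v $ i else 0)"
   unfolding cf_def by (intro sum.cong) (auto simp: rmat_1)
  also have "... = (\<Sum>i<N. al i * v $ i)" by simp
  finally show ?thesis by simp
 qed
 show "G cs : OpU q & (ALL N rh. type1_module q N rh -->
    (ALL (n::int). ALL v:carrier_vec N. mult_mat_vec (rh gK) v = of_real (q powi n) \<cdot>\<^sub>v v -->
      mult_mat_vec (dact N rh (G cs)) v = of_real (s powi n) \<cdot>\<^sub>v v))"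
 proof (intro conjI allI impI ballI G_OpU)
  fix N rh and n :: int and v :: "complex Matrix.vec"
  assume a: "type1_module q N rh" "v : carrier_vec N" "mult_mat_vec (rh gK) v = of_real (q powi n) \<cdot>\<^sub>v v"
  show "mult_mat_vec (dact N rh (G cs)) v = of_real (s powi n) \<cdot>\<^sub>v v"
  proof (rule eq_vecI)
   fix i assume "i < dim_vec (of_real (s powi n) \<cdot>\<^sub>v v)"
   hence i: "i < N" using a by simp
   have ind: "(\<Sum>k<N. (if k = i then 1 else 0) * g k) = g i" for g :: "nat => complex"
   proof -
    have "(\<Sum>k<N. (if k = i then 1 else 0) * g k) = (\<Sum>k<N. if k = i then g k else 0)" by (rule sum.cong) auto
    thus ?thesis using i by simp
   qed
   have "G cs (cf N (rmat N rh) (%k. if k = i then 1 else 0) (%j. v $ j)) =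
    (\<Sum>k<N. (if k = i then 1 else 0) * (\<Sum>j<N. G cs (rmat N rh k j) * v $ j))"
    by (simp add: OpU_cf[OF a(1) G_OpU] sum_distrib_left mult.assoc)
   hence "(\<Sum>j<N. G cs (rmat N rh i j) * v $ j) = of_real (s powi n) * v $ i"
    using cond[OF a, of "%k. if k = i then 1 else 0"] by (simp only: ind)
   thus "mult_mat_vec (dact N rh (G cs)) v $ i = (of_real (s powi n) \<cdot>\<^sub>v v) $ i"
    using i a(2) carrier_matD[OF dact_carrier[of N rh "G cs"]]
    by (simp add: scalar_prod_def atLeast0LessThan dact_index)
  qed (use a carrier_matD[OF dact_carrier[of N rh "G cs"]] in auto)
 qed
 fix x
 assume x: "x : OpU q & (ALL N rh. type1_module q N rh -->
    (ALL (n::int). ALL v:carrier_vec N. mult_mat_vec (rh gK) v = of_real (q powi n) \<cdot>\<^sub>v v -->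
      mult_mat_vec (dact N rh x) v = of_real (s powi n) \<cdot>\<^sub>v v))"
 show "x = G cs"
 proof
  fix f
  show "x f = G cs f"
  proof (cases "f : OU q")
   case True
   thus ?thesis
   proof (rule OU_E)
    fix N rh al be w m
    assume t: "type1_module q N rh" and f: "f = cf N (rmat N rh) al be"
     and span: "!!be'. EX c. ALL j<N. be' j = (\<Sum>l<N. c l * w l j)"
     and wt: "!!l i. l < N ==> i < N ==> (\<Sum>j<N. rmat N rh i j uK * w l j) = qp (m l) * w l i"
    have c: "!!g. rh g : carrier_mat N N" using t by (simp add: type1_module_def)
    have eq: "x (cf N (rmat N rh) al (w l)) = G cs (cf N (rmat N rh) al (w l))" if l: "l < N" for l
    proof -
     let ?v = "Matrix.vec N (w l)"
     have K: "mult_mat_vec (rh gK) ?v = of_real (q powi (m l)) \<cdot>\<^sub>v ?v"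
      by (rule eq_vecI) (use wt[OF l] c[of gK] in "auto simp: scalar_prod_def atLeast0LessThan rmat_gen[OF c] qp_def")
     with x t have xv: "mult_mat_vec (dact N rh x) ?v = of_real (s powi (m l)) \<cdot>\<^sub>v ?v" by auto
     have e: "(\<Sum>j<N. x (rmat N rh i j) * w l j) = of_real (s powi (m l)) * w l i" if "i < N" for i
      using arg_cong[OF xv, of "%u. u $ i"] that carrier_matD[OF dact_carrier[of N rh x]]
      by (simp add: scalar_prod_def atLeast0LessThan dact_index)
     have "x (cf N (rmat N rh) al (w l)) = (\<Sum>i<N. al i * (\<Sum>j<N. x (rmat N rh i j) * w l j))"
      using x by (simp add: OpU_cf[OF t] sum_distrib_left mult.assoc)
     also have "... = (\<Sum>i<N. al i * (of_real (s powi (m l)) * w l i))" using e by simp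
     also have "... = of_real (s powi (m l)) * (\<Sum>i<N. al i * w l i)" by (simp add: sum_distrib_left mult_ac)
     also have "... = G cs (cf N (rmat N rh) al (%j. ?v $ j))"
      using cond[OF t _ K, of al] by simp
     also have "cf N (rmat N rh) al (%j. ?v $ j) = cf N (rmat N rh) al (w l)" by (rule cf_cong) auto
     finally show ?thesis .
    qed
    obtain d where "ALL j<N. be j = (\<Sum>l<N. d l * w l j)" using span by blast
    hence "f = cf N (rmat N rh) al (%j. \<Sum>l<N. d l * w l j)" unfolding f by (intro cf_cong) auto
    hence fe: "f = (%a. \<Sum>l<N. d l * cf N (rmat N rh) al (w l) a)" by (simp add: cf_sum)
    have yf: "y f = (\<Sum>l<N. d l * y (cf N (rmat N rh) al (w l)))" if "y : OpU q" for y
     unfolding fe by (rule OpU_sum[OF that]) (rule OU_cf[OF t])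
    show "x f = G cs f" unfolding yf[OF conjunct1[OF x]] yf[OF G_OpU] by (simp add: eq)
   qed
  next
   case False
   thus ?thesis using x by (auto simp: OpU_def G_def)
  qed
 qed
qed

text \<open>A word of length \<open>e\<close> has both $k$-weights and $\theta$-eigenvalues of the parity of \<open>e\<close>. This is why
  $(-1)_q$ is grouplike.\<close>

lemma G_minus_one: "f : WS {e} ==> G (-1) f = (-1) ^ e * f 1" "f : WS {e} ==> D (%m. (-1) powi m) f = (-1) ^ e * f 1"
proof -
 have w: "G (-1) (wf ps) = (-1) ^ length ps * wf ps 1" if "set ps <= sq" for ps
  using that
 proof (induction ps)
  case Nil
  show ?case by (simp add: G_counit)
 next
  case (Cons p ps)
  obtain al be where p: "p = (al, be)" "al < 2" "be < 2" using Cons.prems by (cases p) auto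
  have "G (-1) (uu al be) = - uu al be 1"
  proof (cases "be = 0")
   case True
   thus ?thesis using G_weight[of "uu al be" 1 "-1"] p by (simp add: rtr_uu OU_uu)
  next
   case False
   thus ?thesis using G_weight[of "uu al be" "-1" "-1"] p by (auto simp: rtr_uu OU_uu less_2 qp_minus power_int_minus)
  qed
  thus ?case using Cons p WS_subset_OU[OF WS_wf[of ps UNIV]] by (simp add: G_omult OU_uu)
 qed
 show "f : WS {e} ==> G (-1) f = (-1) ^ e * f 1"
 proof (induction rule: WS.induct)
  case zero
  show ?case using OpU_lin(3)[OF G_OpU] by simp
 next
  case (step f ps c)
  have p: "(-1) ^ length ps = ((-1) ^ e :: complex)"
   using step(3) minus_one_power_iff[of e, where 'a = complex] minus_one_power_iff[of "length ps", where 'a = complex] by (auto simp: even_iff_mod_2_eq_zero)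
  have "G (-1) (%a. c * wf ps a + f a) = c * G (-1) (wf ps) + G (-1) f"
   by (rule OpU_lin(1)[OF G_OpU]) (use step WS_wf[of ps UNIV] WS_subset_OU in auto)
  thus ?case using step by (simp add: w p algebra_simps)
 qed
 show "f : WS {e} ==> D (%m. (-1) powi m) f = (-1) ^ e * f 1"
 proof -
  assume f: "f : WS {e}"
  hence fO: "f : OU q" by (rule WS_subset_OU)
  have "(-1) powi m = ((-1) ^ e :: complex)" if "m : pm_keys (kth f)" for m
   using kth_parity[OF f that] by (auto simp: power_int_minus_left minus_one_power_iff) presburger+
  hence "D (%m. (-1) powi m) f = fa_lin (%m. (-1) ^ e) (kth f)"
   using fO by (auto simp: D_def intro!: fa_lin_cong)
  also have "... = (-1) ^ e * fa_lin (%m. nu m ^ 0) (kth f)"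
   by (simp add: fa_lin_def sum_distrib_left mult.commute)
  also have "fa_lin (%m. nu m ^ 0) (kth f) = f (th ^ 0)"
   using kth_nexp[OF fO] unfolding nexp_def by metis
  finally show ?thesis by simp
 qed
qed

lemma minus_one_q_G: "minus_one_q q s = G (-1)"
proof
 fix f
 show "minus_one_q q s f = G (-1) f"
 proof (cases "f : OU q")
  case True
  then obtain g h where gh: "g : WS {0}" "h : WS {1}" and f: "f = (%a. g a + h a)" using OU_split by blast
  have O: "g : OU q" "h : OU q" using gh WS_subset_OU by auto
  show ?thesis
   unfolding minus_one_q_D f OpU_lin(4)[OF D_OpU O] OpU_lin(4)[OF G_OpU O] G_minus_one[OF gh(1)] G_minus_one[OF gh(2)] ..
 qed (simp add: minus_one_q_D D_def G_def)
qed

section \<open>The coordinate algebra $\mathcal O_q(K\backslash U)$\<close>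

lemma omult_uminus2: "omult g (%a. - f a) = (%a. - omult g f a)"
 using omult_scale(2)[of g "-1" f] by simp

lemma antipode_lin:
 "antipode (x + y) = antipode x + antipode y" "antipode (fa_const c * x) = fa_const c * antipode x"
 by (simp_all add: antipode_def fa_antihom_simps)

lemma antipode_simps:
 "antipode (x * y) = antipode y * antipode x" "antipode (fa_gen g) = antipode_gen g" "antipode 1 = 1"
 using fa_antihom_simps(3)[of antipode_gen "[g]"] fa_antihom_simps(3)[of antipode_gen "[]"]
 by (simp_all add: antipode_def fa_antihom_mult wd_gen wd_Nil)

lemma ustar_lin:
 "ustar (x + y) = ustar x + ustar y" "ustar (fa_const c * x) = fa_const (cnj c) * ustar x"
 by (simp_all add: ustar_def fa_conj_antihom_simps)

lemma ustar_simps: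
 "ustar (x * y) = ustar y * ustar x" "ustar (fa_gen g) = star_gen g" "ustar 1 = 1" "ustar (- x) = - ustar x"
proof -
 show "ustar (- x) = - ustar x" using ustar_lin(2)[of "-1" x] by (simp add: fa_const_uminus fa_const_1)
qed (use fa_conj_antihom_simps(3)[of star_gen "[g]"] fa_conj_antihom_simps(3)[of star_gen "[]"]
  in "simp_all add: ustar_def fa_conj_antihom_mult wd_gen wd_Nil")

lemma lin_ostar: "lin f ==> lin (ostar f)"
 by (simp add: lin_def ostar_def antipode_lin ustar_lin)

lemma qp_cancel [simp]: "qp m * (inverse (qp m) * x) = x" "inverse (qp m) * (qp m * x) = x"
 by (simp_all flip: mult.assoc)

lemma cq_cancel [simp]: "cq * (inverse cq * x) = x" "inverse cq * (cq * x) = x"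
 by (simp_all flip: mult.assoc)

lemma ostar_uu_wd:
 "ostar (uu 0 0) (wd xs) = uu (Suc 0) (Suc 0) (wd xs) & ostar (uu 0 (Suc 0)) (wd xs) = - cq * uu (Suc 0) 0 (wd xs) &
  ostar (uu (Suc 0) 0) (wd xs) = - inverse cq * uu 0 (Suc 0) (wd xs) & ostar (uu (Suc 0) (Suc 0)) (wd xs) = uu 0 0 (wd xs)"
proof (induction xs rule: rev_induct)
 case Nil
 show ?case by (simp add: wd_Nil ostar_def antipode_simps ustar_simps uu_1)
next
 case (snoc h xs)
 have m: "ostar (uu i j) (x * y) = ostar (uu i 0) x * ostar (uu 0 j) y + ostar (uu i (Suc 0)) x * ostar (uu (Suc 0) j) y"
  if "i < 2" "j < 2" for i j x y
  using that by (simp add: ostar_def antipode_simps ustar_simps uu_mult)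
 have e: "inverse cs = inverse cq * cs" "cs = cq * inverse cs"
  using cs2 by (simp_all add: field_simps)
 have g: "ostar (uu 0 0) (fa_gen h) = uu (Suc 0) (Suc 0) (fa_gen h)" "ostar (uu 0 (Suc 0)) (fa_gen h) = - cq * uu (Suc 0) 0 (fa_gen h)"
  "ostar (uu (Suc 0) 0) (fa_gen h) = - inverse cq * uu 0 (Suc 0) (fa_gen h)" "ostar (uu (Suc 0) (Suc 0)) (fa_gen h) = uu 0 0 (fa_gen h)"
  by (cases h; simp add: ostar_def antipode_simps ustar_simps linD[OF lin_uu] uu_mult uu_gen; simp add: e(1) | simp add: e(2)[symmetric])+
 show ?case
  using snoc by (simp add: wd_snoc m g uu_mult algebra_simps)
qed

lemma ostar_uu:
 "ostar (uu 0 0) = uu (Suc 0) (Suc 0)" "ostar (uu 0 (Suc 0)) = (%a. - cq * uu (Suc 0) 0 a)"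
 "ostar (uu (Suc 0) 0) = (%a. - inverse cq * uu 0 (Suc 0) a)" "ostar (uu (Suc 0) (Suc 0)) = uu 0 0"
 by (rule lin_eq_wdI; (intro lin_ostar lin_scale lin_uu)?; simp add: ostar_uu_wd)+

text \<open>\<open>GG\<close> is the matrix $\sum_\alpha q^{\alpha-1}u_{\alpha\beta}u_{\alpha\delta}$; it transforms
  under right translation like the tensor square of the fundamental module.\<close>

definition GG :: "nat => nat => ofun" where
 "GG be de = (%a. omult (uu 0 be) (uu 0 de) a + cq * omult (uu (Suc 0) be) (uu (Suc 0) de) a)"

abbreviation "oXX \<equiv> oX q s"
abbreviation "oYY \<equiv> oY q s"
abbreviation "oZZ \<equiv> oZ q s"

lemma XYZ_GG: "oXX = GG 0 0" "oYY = (%a. inverse cq * GG (Suc 0) (Suc 0) a)" "oZZ = (%a. \<i> * GG (Suc 0) 0 a)"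
 by (simp_all add: oX_def oY_def oZ_def uJu_def u_entry_uu ostar_uu GG_def mat_of_rows_list_def numeral_2_eq_2 fun_eq_iff
   omult_scale omult_uminus algebra_simps)

lemma ab_commute:
 assumes "al < 2"
 shows "omult (uu al 0) (uu al (Suc 0)) = (%a. cq * omult (uu al (Suc 0)) (uu al 0) a)"
proof -
 let ?f = "%a. - cq * omult (uu al (Suc 0)) (uu al 0) a + omult (uu al 0) (uu al (Suc 0)) a"
 have F: "rtr uF ?f = (%a. 0)"
  unfolding rtr_comb using assms by (simp add: rtr_omult rtr_uu omult_scale)
 have Fi: "?f (uF ^ i) = 0" for i
 proof (cases i)
  case 0
  thus ?thesis using assms by (simp add: uu_1)
 next
  case (Suc k)
  have "?f (uF ^ k * uF) = rtr uF ?f (uF ^ k)" by (simp add: rtr_def)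
  thus ?thesis unfolding F Suc by (simp add: power_commutes)
 qed
 have "?f = (%a. 0)"
 proof (rule highest_weight_zero[where m = 0])
  show "AD ?f" by (intro AD_comb AD_omult AD_uu assms) auto
  show "rtr uE ?f = (%a. 0)"
   unfolding rtr_comb using assms by (simp add: rtr_omult rtr_uu omult_scale)
  show "rtr uK ?f = (%a. qp 0 * ?f a)"
   unfolding rtr_comb using assms by (simp add: rtr_omult rtr_uu omult_scale)
  show "?f (uF ^ i) = 0" for i by (rule Fi)
 qed
 thus ?thesis by (simp add: fun_eq_iff)
qed

lemma GG_01: "GG 0 (Suc 0) = (%a. cq * GG (Suc 0) 0 a)"
 by (simp add: GG_def ab_commute fun_eq_iff algebra_simps)

lemma GG_props:
 assumes "be < 2" "de < 2"
 shows "GG be de : OU q" "AD (GG be de)" "GG be de : WS {0}"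
  "ltr th (GG be de) = (%a. 0)"
  "GG be de (x * y) = (\<Sum>i<2. \<Sum>j<2. GG i j x * omult (uu i be) (uu j de) y)"
proof -
 have "(%a. cq * wf [(Suc 0, be), (Suc 0, de)] a + wf [(0, be), (0, de)] a) : WS {0}"
  by (intro WSD(2) WS_wf) (use assms in auto)
 thus W: "GG be de : WS {0}" by (simp add: GG_def omult_counit add.commute)
 thus "GG be de : OU q" "AD (GG be de)" using WS_subset_OU WS_AD by auto
 have z: "ltr uK (%_. 0) = (%_. 0 :: complex)" by (simp add: ltr_def)
 have t1: "ltr th (uu 0 be) = (%a. \<i> * uu (Suc 0) be a)" if "be < 2" for be
  using that by (simp add: ltr_th ltr_uu z)
 have t2: "ltr th (uu (Suc 0) be) = (%a. - \<i> * uu 0 be a)" if "be < 2" for be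
  using that by (simp add: ltr_th ltr_uu ltr_scale) (simp add: fun_eq_iff field_simps cs2)
 note t = t1 t2
 show "ltr th (GG be de) = (%a. 0)"
  unfolding GG_def ltr_add ltr_scale using assms
  by (simp add: ltr_th_omult t ltr_uu omult_scale omult_uminus omult_uminus2) (simp add: fun_eq_iff algebra_simps)
 have c: "omult (uu al be) (uu al de) (x * y) = (\<Sum>i<2. \<Sum>j<2. omult (uu al i) (uu al j) x * omult (uu i be) (uu j de) y)"
  if "al < 2" for al
  by (rule omult_coprod) (use that assms in "auto simp: uu_mult numeral_2_eq_2")
 show "GG be de (x * y) = (\<Sum>i<2. \<Sum>j<2. GG i j x * omult (uu i be) (uu j de) y)"
  by (simp add: GG_def c sum_distrib_left sum.distrib algebra_simps)
qed

abbreviation KU where "KU \<equiv> OKU q s"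

lemma OKU_iff: "y : KU <-> y : OU q & ltr th y = (%a. 0)"
 by (auto simp: OKU_def ltr_def fun_eq_iff)

lemma OKU_OU: "y : KU ==> y : OU q" by (simp add: OKU_iff)
lemma OKU_AD: "y : KU ==> AD y" by (simp add: OKU_iff OU_AD)

lemma OKU_csub: "csub (KU)"
proof -
 have "KU = OU q \<inter> {y. ltr th y = (%a. 0)}" by (auto simp: OKU_iff)
 moreover have "csub {y. ltr th y = (%a. 0)}"
  unfolding csub_def by (auto simp: ltr_def fun_eq_iff)
 ultimately show ?thesis using csub_Int[OF OU_csub] by simp
qed

lemmas OKUD = csubD[OF OKU_csub]

lemma OKU_omult: "f : KU ==> g : KU ==> omult f g : KU"
 by (simp add: OKU_iff OU_omult ltr_th_omult OU_AD)

lemma OKU_counit: "counit : KU"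
 by (simp add: OKU_iff OU_counit)

lemma OKU_lact: "x : OpU q ==> f : KU ==> lact x f : KU"
 by (simp add: OKU_iff lact_OU) (simp add: fun_eq_iff ltr_def lact_def OpU_lin(3) mult.assoc)

lemma GG_OKU: "be < 2 ==> de < 2 ==> GG be de : KU"
 by (simp add: OKU_iff GG_props)

lemma XYZ_OKU: "oXX : KU" "oYY : KU" "oZZ : KU"
 unfolding XYZ_GG by (intro GG_OKU OKUD(3); simp)+

lemma XYZ_AD [simp]: "AD oXX" "AD oYY" "AD oZZ"
 using XYZ_OKU OKU_AD by auto

lemma XYZ_1: "oXX 1 = 1" "oYY 1 = 1" "oZZ 1 = 0"
 unfolding XYZ_GG GG_def by (simp_all add: uu_1)

abbreviation hh :: complex where "hh \<equiv> cq + inverse cq"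

lemma rtr_GG:
 "rtr uE (GG 0 0) = (%a. 0)" "rtr uE (GG (Suc 0) 0) = (%a. cs * GG 0 0 a)" "rtr uE (GG (Suc 0) (Suc 0)) = (%a. cs * hh * GG (Suc 0) 0 a)"
 "rtr uF (GG 0 0) = (%a. inverse cs * hh * GG (Suc 0) 0 a)" "rtr uF (GG (Suc 0) 0) = (%a. inverse cs * GG (Suc 0) (Suc 0) a)"
 "rtr uF (GG (Suc 0) (Suc 0)) = (%a. 0)"
 "rtr uK (GG 0 0) = (%a. qp 2 * GG 0 0 a)" "rtr uK (GG (Suc 0) 0) = GG (Suc 0) 0"
 "rtr uK (GG (Suc 0) (Suc 0)) = (%a. qp (-2) * GG (Suc 0) (Suc 0) a)"
 unfolding GG_def rtr_add rtr_scale
 by (simp_all add: rtr_omult rtr_uu omult_scale qp_2 qp_minus ab_commute, simp_all add: fun_eq_iff algebra_simps)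

definition eZ :: complex where "eZ = \<i> * cs"
definition eY :: complex where "eY = - \<i> * cs * inverse cq * hh"
definition fX :: complex where "fX = - \<i> * inverse cs * hh"
definition fZ :: complex where "fZ = \<i> * inverse cs * cq"

lemma rtr_XYZ:
 "rtr uE oXX = (%a. 0)" "rtr uE oZZ = (%a. eZ * oXX a)" "rtr uE oYY = (%a. eY * oZZ a)"
 "rtr uF oXX = (%a. fX * oZZ a)" "rtr uF oZZ = (%a. fZ * oYY a)" "rtr uF oYY = (%a. 0)"
 "rtr uK oXX = (%a. qp 2 * oXX a)" "rtr uK oZZ = (%a. qp 0 * oZZ a)" "rtr uK oYY = (%a. qp (-2) * oYY a)"
 unfolding XYZ_GG rtr_scale rtr_GG eZ_def eY_def fX_def fZ_def by (simp_all add: fun_eq_iff field_simps)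

lemma rtr_Ki_XYZ:
 "rtr uKi oXX = (%a. qp (-2) * oXX a)" "rtr uKi oZZ = oZZ" "rtr uKi oYY = (%a. qp 2 * oYY a)"
 using rtr_weight(1)[OF XYZ_AD(1) rtr_XYZ(7)] rtr_weight(1)[OF XYZ_AD(3) rtr_XYZ(8)] rtr_weight(1)[OF XYZ_AD(2) rtr_XYZ(9)]
 by simp_all

lemma sl2_rtr: "sl2_operators q s (rtr uE) (rtr uF) (%m. {x. AD x & rtr uK x = (%a. qp m * x a)})"
proof unfold_locales
 fix m
 have "csub {x. AD x}" unfolding csub_def by (auto simp: AD_zero AD_comb)
 moreover have "csub {x. rtr uK x = (%a. qp m * x a)}"
  unfolding csub_def by (auto simp: rtr_def fun_eq_iff algebra_simps)
 ultimately have "csub ({x. AD x} \<inter> {x. rtr uK x = (%a. qp m * x a)})" by (rule csub_Int)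
 thus "csub {x. AD x & rtr uK x = (%a. qp m * x a)}" by (simp add: Collect_conj_eq)
next
 fix x m assume "x : {x. AD x & rtr uK x = (%a. qp m * x a)}"
 thus "rtr uE x : {x. AD x & rtr uK x = (%a. qp (m + 2) * x a)}"
  "rtr uF x : {x. AD x & rtr uK x = (%a. qp (m - 2) * x a)}"
  "rtr uE (rtr uF x) = (%a. rtr uF (rtr uE x) a + nu m * x a)"
  using rtr_weight[of x m] by auto
qed (simp_all add: rtr_comb)

text \<open>A highest weight vector of \<^term>\<open>OKU q s\<close> is determined by its value at 1: it
  satisfies \<open>f (uF * uK * b) = f (uE * b)\<close>, which makes it possible to replace factors \<^term>\<open>uF\<close>
  on the left by factors \<^term>\<open>uE\<close>, and these can be moved to the right.\<close>

lemma OKU_highest_weight_zero: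
 assumes f: "AD f" "ltr th f = (%a. 0)" and hw: "rtr uE f = (%a. 0)" "rtr uK f = (%a. qp m * f a)" and 1: "f 1 = 0"
 shows "f = (%a. 0)"
proof (rule highest_weight_zero[OF f(1) hw])
 interpret sl2_operators q s "rtr uE" "rtr uF" "%m. {x. AD x & rtr uK x = (%a. qp m * x a)}" by (rule sl2_rtr)
 have fW: "f : {x. AD x & rtr uK x = (%a. qp m * x a)}" using f hw by simp
 have p: "(rtr uF ^^ i) f = rtr (uF ^ i) f" for i by (induction i) (simp_all add: rtr_rtr)
 have EF: "f (uE * b) = f (uF * uK * b)" for b
  using fun_cong[OF f(2), of b] f(1) by (simp add: ltr_def theta_def linD[OF AD_lin[OF f(1)]] algebra_simps)
 show "f (uF ^ i) = 0" for i
 proof (induction i rule: less_induct)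
  case (less i)
  show ?case
  proof (cases i)
   case 0
   thus ?thesis using 1 by simp
  next
   case (Suc k)
   let ?g = "rtr (uF ^ k) f"
   have g: "AD ?g" "rtr uK ?g = (%a. qp (m - 2 * int k) * ?g a)" using fpow_Wt[OF fW, of k] by (simp_all add: p)
   have "f (uF ^ Suc k) = f (uF * uK * (uKi * uF ^ k))"
    using AD_rels(1)[OF f(1), of uF "uF ^ k"] by (simp add: mult.assoc)
   also have "... = rtr uKi ?g uE" by (simp only: EF[symmetric]) (simp add: rtr_def mult.assoc)
   also have "... = qp (- (m - 2 * int k)) * rtr uE ?g 1"
    unfolding rtr_weight(1)[OF g] by (simp add: rtr_def)
   also have "rtr uE ?g 1 = 0"
   proof (cases k)
    case 0
    thus ?thesis by (simp add: hw)
   next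
    case (Suc l)
    have "rtr uE ?g = (%a. nu (int l + 1) * nu (m - int l) * rtr (uF ^ l) f a)"
     using e_fpow[OF fW hw(1), of l] unfolding p Suc .
    thus ?thesis using less[of l] `i = Suc k` Suc by (simp add: rtr_def)
   qed
   finally show ?thesis using Suc by simp
  qed
 qed
qed

lemma XZ_rel: "omult oXX oZZ = (%a. cq * cq * omult oZZ oXX a)"
proof -
 let ?f = "%a. - (cq * cq) * omult oZZ oXX a + omult oXX oZZ a"
 have "?f : KU" by (intro OKUD(2) OKU_omult XYZ_OKU)
 hence "AD ?f" "ltr th ?f = (%a. 0)" by (simp_all only: OKU_AD) (simp_all only: OKU_iff)
 moreover have "rtr uE ?f = (%a. 0)"
  unfolding rtr_comb by (simp add: rtr_omult rtr_XYZ omult_scale qp_2)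
 moreover have "rtr uK ?f = (%a. qp 2 * ?f a)"
  unfolding rtr_comb by (simp add: rtr_omult rtr_XYZ omult_scale) (simp add: algebra_simps)
 ultimately have "?f = (%a. 0)" by (rule OKU_highest_weight_zero) (simp add: XYZ_1)
 thus ?thesis by (simp add: fun_eq_iff)
qed

lemma XY_rel: "omult oXX oYY = (%a. counit a - cq * cq * omult oZZ oZZ a)"
proof -
 let ?f = "%a. cq * cq * omult oZZ oZZ a + (- 1 * counit a + omult oXX oYY a)"
 have "?f : KU" by (intro OKUD(2) OKU_omult XYZ_OKU OKU_counit)
 hence "AD ?f" "ltr th ?f = (%a. 0)" by (simp_all only: OKU_AD) (simp_all only: OKU_iff)
 moreover have "rtr uE ?f = (%a. 0)"
  unfolding rtr_comb by (simp add: rtr_omult rtr_XYZ omult_scale qp_2 XZ_rel) (simp add: fun_eq_iff field_simps eZ_def eY_def)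
 moreover have "rtr uK ?f = (%a. qp 0 * ?f a)"
  unfolding rtr_comb by (simp add: rtr_omult rtr_XYZ omult_scale qp_minus)
 ultimately have "?f = (%a. 0)" by (rule OKU_highest_weight_zero) (simp add: XYZ_1)
 thus ?thesis by (simp add: fun_eq_iff) (simp add: algebra_simps add_eq_0_iff)
qed

lemma YX_rel: "omult oYY oXX = (%a. counit a - inverse (cq * cq) * omult oZZ oZZ a)"
proof -
 let ?f = "%a. inverse (cq * cq) * omult oZZ oZZ a + (- 1 * counit a + omult oYY oXX a)"
 have "?f : KU" by (intro OKUD(2) OKU_omult XYZ_OKU OKU_counit)
 hence "AD ?f" "ltr th ?f = (%a. 0)" by (simp_all only: OKU_AD) (simp_all only: OKU_iff)
 moreover have "rtr uE ?f = (%a. 0)"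
  unfolding rtr_comb by (simp add: rtr_omult rtr_XYZ omult_scale qp_2 XZ_rel) (simp add: fun_eq_iff field_simps eZ_def eY_def)
 moreover have "rtr uK ?f = (%a. qp 0 * ?f a)"
  unfolding rtr_comb by (simp add: rtr_omult rtr_XYZ omult_scale qp_minus)
 ultimately have "?f = (%a. 0)" by (rule OKU_highest_weight_zero) (simp add: XYZ_1)
 thus ?thesis by (simp add: fun_eq_iff) (simp add: algebra_simps add_eq_0_iff)
qed

lemma ZY_rel: "omult oZZ oYY = (%a. cq * cq * omult oYY oZZ a)"
proof
 fix a
 have "rtr uF (omult oXX oYY) a = rtr uF (%a. counit a - cq * cq * omult oZZ oZZ a) a" by (simp add: XY_rel)
 also have "(%a. counit a - cq * cq * omult oZZ oZZ a) = (%a. (- (cq * cq)) * omult oZZ oZZ a + counit a)" by (simp add: fun_eq_iff)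
 finally have "hh * (cq * cq) * omult oZZ oYY a = cq * (cq * cq) * (omult oYY oZZ a + omult oZZ oYY a)"
  unfolding rtr_comb by (simp add: rtr_omult rtr_XYZ rtr_Ki_XYZ omult_scale qp_2 XZ_rel) (simp add: fX_def fZ_def field_simps)
 thus "omult oZZ oYY a = cq * cq * omult oYY oZZ a"
  by (simp add: field_simps)
qed

text \<open>The algebra generated by $X$, $Y$, $Z$.\<close>

inductive_set PA :: "ofun set" where
 zero: "(%a. 0) : PA"
| one: "counit : PA"
| comb: "f : PA ==> g : PA ==> (%a. c * f a + g a) : PA"
| mX: "f : PA ==> omult oXX f : PA"
| mY: "f : PA ==> omult oYY f : PA"
| mZ: "f : PA ==> omult oZZ f : PA"

lemma PA_csub: "csub PA" by (simp add: csub_def PA.zero PA.comb)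
lemmas PAD = csubD[OF PA_csub]

lemma PA_OKU: "f : PA ==> f : KU"
 by (induction rule: PA.induct) (auto intro: OKUD OKU_counit OKU_omult XYZ_OKU)

lemma PA_AD: "f : PA ==> AD f" using PA_OKU OKU_AD by blast

lemma PA_rtr: "f : PA ==> rtr (fa_gen h) f : PA"
proof (induction arbitrary: h rule: PA.induct)
 case one
 thus ?case using PAD(3)[OF PA.one] by simp
next
 case (comb f g c)
 thus ?case by (simp add: rtr_comb PA.comb)
next
 case (mX f)
 thus ?case using PA_AD[OF mX.hyps]
  by (cases h) (simp_all add: rtr_omult rtr_XYZ rtr_Ki_XYZ omult_scale omult_uminus; intro PAD PA.intros mX; simp)+
next
 case (mY f)
 thus ?case using PA_AD[OF mY.hyps]
  by (cases h) (simp_all add: rtr_omult rtr_XYZ rtr_Ki_XYZ omult_scale omult_uminus; intro PAD PA.intros mY; simp)+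
next
 case (mZ f)
 thus ?case using PA_AD[OF mZ.hyps]
  by (cases h) (simp_all add: rtr_omult rtr_XYZ rtr_Ki_XYZ omult_scale omult_uminus; intro PAD PA.intros mZ; simp)+
qed (simp add: PA.zero)

text \<open>A highest weight vector of weight $2k$ is its value at 1 times $X^k$.\<close>

lemma OKU_PA: "y : KU ==> y : PA"
proof (rule highest_weight_generation[of "{y. ltr th y = (%a. 0)}" PA])
 show "csub {y. ltr th y = (%a. 0)}" unfolding csub_def by (auto simp: ltr_def fun_eq_iff)
 fix w l
 assume w: "w : OU q" "w : {y. ltr th y = (%a. 0)}" "rtr uE w = (%a. 0)" "rtr uK w = (%a. qp (int l) * w a)"
  "(rtr uF ^^ Suc l) w = (%a. 0)"
 show "w : PA"
 proof (cases "even l")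
  case True
  then obtain k where l: "l = 2 * k" by blast
  define p where "p = (omult oXX ^^ k) counit"
  have p: "p : PA" "rtr uE p = (%a. 0)" "rtr uK p = (%a. qp (int l) * p a)" "p 1 = 1"
   unfolding p_def l
  proof (induction k)
   case (Suc k)
   note A = PA_AD[OF Suc(1)]
   { case 1 thus ?case using Suc by (simp add: PA.mX) }
   { case 2 thus ?case using Suc A by (simp add: rtr_omult rtr_XYZ) }
   { case 3 thus ?case using Suc A by (simp add: rtr_omult rtr_XYZ omult_scale) (simp add: qp_add[symmetric] fun_eq_iff) }
   { case 4 thus ?case using Suc by (simp add: XYZ_1) }
  qed (simp_all add: PA.one)
  let ?f = "%a. (- w 1) * p a + w a"
  have h: "?f = (%a. 0)"
  proof (rule OKU_highest_weight_zero)
   have "?f : KU" using w by (intro OKUD(2)[OF PA_OKU[OF p(1)]]) (simp add: OKU_iff)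
   thus "AD ?f" "ltr th ?f = (%a. 0)" by (simp_all only: OKU_AD) (simp_all only: OKU_iff)
   show "rtr uE ?f = (%a. 0)" unfolding rtr_comb using p w by simp
   show "rtr uK ?f = (%a. qp (int l) * ?f a)" unfolding rtr_comb using p w by (simp add: algebra_simps)
  qed (simp add: p)
  have "w a = w 1 * p a" for a using fun_cong[OF h, of a] by (simp add: algebra_simps)
  hence "w = (%a. w 1 * p a)" by (rule ext)
  thus ?thesis using PAD(3)[OF p(1), of "w 1"] by (simp only:)
 next
  case False
  hence "l mod 2 = 1" by presburger
  hence "w : WS {1}" using highest_weight_in_WS[OF OU_AD[OF w(1)] w(3,4,5)] by simp
  moreover have "nexp nu (%j. w (th ^ j)) (pm_single 0 (w 1))"
  proof -
   have "w (th ^ j) = nu 0 ^ j * w 1" for j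
    using w(2) by (cases j) (simp_all add: ltr_def fun_eq_iff)
   thus ?thesis using nexp_single[of nu 0 "w 1"] by simp
  qed
  ultimately have "w 1 = 0" using kth_parity[of w 1 0] kth_eq by (cases "w 1 = 0") auto
  hence "w = (%a. 0)" using w by (intro OKU_highest_weight_zero[of w "int l"] OU_AD) auto
  thus ?thesis by (simp add: PA.zero)
 qed
qed (auto simp: OKU_iff PA_csub PA_rtr rtr_ltr[symmetric])

end

section \<open>The algebra $\mathcal O'_q(G)$\<close>

lemma letters_add: "letters (v + w) = letters v @ letters w"
 by (simp add: plus_fmon_def)

lemma free_ring_carrier_iff: "p : carrier (free_ring G) <-> (ALL w:pm_keys p. set (letters w) <= G)"
 by (simp add: free_ring_def)

lemma free_ring_ops [simp]: "mult (free_ring G) = (*)" "one (free_ring G) = 1" "ring.zero (free_ring G) = 0" "add (free_ring G) = (+)"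
 by (simp_all add: free_ring_def)

lemma free_ring_closed:
 "x : carrier (free_ring G) ==> y : carrier (free_ring G) ==> x + y : carrier (free_ring G)"
 "x : carrier (free_ring G) ==> y : carrier (free_ring G) ==> x * y : carrier (free_ring G)"
 "x : carrier (free_ring G) ==> - x : carrier (free_ring G)"
 "fa_const c : carrier (free_ring G)" "0 : carrier (free_ring G)" "1 : carrier (free_ring G)"
 "g : G ==> fa_gen g : carrier (free_ring G)"
proof -
 show "x : carrier (free_ring G) ==> y : carrier (free_ring G) ==> x + y : carrier (free_ring G)"
  using keys_add[of x y] by (auto simp: free_ring_carrier_iff)
 show "x : carrier (free_ring G) ==> y : carrier (free_ring G) ==> x * y : carrier (free_ring G)"
  using keys_mult[of x y] by (fastforce simp: free_ring_carrier_iff letters_add)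
 show "x : carrier (free_ring G) ==> - x : carrier (free_ring G)"
  by (auto simp: free_ring_carrier_iff in_keys_iff)
 show "fa_const c : carrier (free_ring G)" by (simp add: free_ring_carrier_iff fa_const_def zero_fmon_def)
 show "0 : carrier (free_ring G)" by (simp add: free_ring_carrier_iff)
 show "1 : carrier (free_ring G)" by (simp add: free_ring_carrier_iff zero_fmon_def)
 show "g : G ==> fa_gen g : carrier (free_ring G)" by (simp add: free_ring_carrier_iff fa_gen_def)
qed

lemma free_ring_minus_closed: "x : carrier (free_ring G) ==> y : carrier (free_ring G) ==> x - y : carrier (free_ring G)"
 using free_ring_closed(1)[of x G "- y"] free_ring_closed(3)[of y G] by simp

lemma free_ring_sum_closed: "(!!i. i : A ==> f i : carrier (free_ring G)) ==> sum f A : carrier (free_ring G)"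
 by (induction A rule: infinite_finite_induct) (auto intro: free_ring_closed)

lemma free_ring_power_closed: "x : carrier (free_ring G) ==> x ^ n : carrier (free_ring G)"
 by (induction n) (auto intro: free_ring_closed)

lemmas fr_closed = free_ring_closed free_ring_minus_closed free_ring_sum_closed free_ring_power_closed

lemma free_ring_induct [consumes 1, case_names one gen scale add]:
 assumes "p : carrier (free_ring G)"
  and one: "P 1" and gen: "!!g x. g : G ==> x : carrier (free_ring G) ==> P x ==> P (fa_gen g * x)"
  and scale: "!!c x. x : carrier (free_ring G) ==> P x ==> P (fa_const c * x)"
  and add: "!!x y. x : carrier (free_ring G) ==> y : carrier (free_ring G) ==> P x ==> P y ==> P (x + y)"
 shows "P p"
proof -
 have w: "P (wd xs) & wd xs : carrier (free_ring G)" if "set xs <= G" for xs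
  using that
  by (induction xs) (auto simp: wd_Nil wd_Cons intro: one gen free_ring_closed)
 have z: "P 0" using scale[OF _ one, of 0] by (simp add: fa_const_0 free_ring_closed)
 have k: "P (pm_single v c) & pm_single v c : carrier (free_ring G)" if "set (letters v) <= G" for v c
  using scale[of "wd (letters v)" c] w[OF that] free_ring_closed(2)[OF free_ring_closed(4)[of c G], of "wd (letters v)"]
  by (simp add: wd_def fa_const_single)
 have "P (\<Sum>v\<in>A. pm_single v (pm_lookup p v)) &
   (\<Sum>v\<in>A. pm_single v (pm_lookup p v)) : carrier (free_ring G)"
  if "finite A" "A <= pm_keys p" for A
  using that
 proof (induction A rule: finite_induct)
  case (insert v A)
  thus ?case
   using k[of v "pm_lookup p v"] assms(1)
   by (auto simp: free_ring_carrier_iff[of p] intro!: add free_ring_closed)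
 qed (simp add: z free_ring_closed)
 from this[of "pm_keys p"] show ?thesis using pm_expand[of p] by simp
qed

lemma ring_free_ring: "ring (free_ring G)"
proof (rule ringI)
 show "abelian_group (free_ring G)"
 proof (rule abelian_groupI)
  fix x assume "x : carrier (free_ring G)"
  thus "EX y:carrier (free_ring G). y \<oplus>\<^bsub>free_ring G\<^esub> x = \<zero>\<^bsub>free_ring G\<^esub>"
   by (intro bexI[of _ "- x"]) (auto intro: free_ring_closed)
 qed (auto intro: free_ring_closed)
 show "Group.monoid (free_ring G)"
  by (rule Group.monoidI) (auto intro: free_ring_closed simp: mult.assoc)
qed (auto simp: distrib_left distrib_right)

lemma free_ring_a_minus:
 assumes "x : carrier (free_ring G)" "y : carrier (free_ring G)"
 shows "x \<ominus>\<^bsub>free_ring G\<^esub> y = x - y"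
proof -
 interpret ring "free_ring G" by (rule ring_free_ring)
 have "\<ominus>\<^bsub>free_ring G\<^esub> y = - y"
  by (rule minus_equality) (use assms in "auto intro: free_ring_closed")
 thus ?thesis by (simp add: a_minus_def)
qed

context quantum
begin

abbreviation FR :: "ggen fa ring" where "FR \<equiv> free_ring (G_gens q s)"
abbreviation gS :: "ggen fa set" where "gS \<equiv> carrier FR"
abbreviation gI :: "ggen fa set" where "gI \<equiv> G_ideal q s"

abbreviation gD :: "(int => complex) => ggen fa" where "gD c \<equiv> gk (D c)"

lemma gD_S: "gD c : gS"
 by (rule free_ring_closed) (auto simp: G_gens_def OpK_eq)

lemma gy_S: "y : KU ==> gy y : gS"
 by (rule free_ring_closed) (auto simp: G_gens_def)

lemmas S_closed = fr_closed[where G = "G_gens q s"] gD_S gy_S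

lemma G_rels_S: "G_rels q s <= gS"
proof
 fix p assume "p : G_rels q s"
 then consider "p : unital_hom_rels gk (OpK q s) (dmult q) (deval q 1)"
  | "p : unital_hom_rels gy (KU) omult counit" | "p : exchange_rels q s"
  by (auto simp: G_rels_def)
 thus "p : gS"
 proof cases
  case 1
  thus ?thesis
   unfolding unital_hom_rels_def OpK_eq
   by (elim UnE CollectE exE conjE singletonE imageE) (auto simp: deval_1 dmult_D D_comb intro!: S_closed)
 next
  case 2
  thus ?thesis
   unfolding unital_hom_rels_def
   by (elim UnE CollectE exE conjE singletonE) (auto intro!: S_closed OKU_counit OKU_omult OKUD(2))
 next
  case 3
  thus ?thesis
   unfolding exchange_rels_def OpK_eq
   by (elim CollectE exE conjE imageE) (auto simp: dract_D intro!: S_closed)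
 qed
qed

lemma ideal_gI: "ideal gI FR"
 unfolding G_ideal_def by (rule ring.genideal_ideal[OF ring_free_ring G_rels_S])

lemma rels_gI: "p : G_rels q s ==> p : gI"
 unfolding G_ideal_def using ring.genideal_self[OF ring_free_ring G_rels_S] by blast

lemma gI_props:
 "x : gI ==> x : gS" "x : gI ==> y : gI ==> x + y : gI" "0 : gI"
 "x : gI ==> a : gS ==> a * x : gI" "x : gI ==> a : gS ==> x * a : gI"
 "x : gI ==> fa_const c * x : gI"
proof -
 interpret ideal gI FR by (rule ideal_gI)
 show "x : gI ==> x : gS" using a_subset by auto
 show "x : gI ==> y : gI ==> x + y : gI" using additive_subgroup.a_closed[OF is_additive_subgroup, of x y] by simp
 show "0 : gI" using additive_subgroup.zero_closed[OF is_additive_subgroup] by simp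
 show "x : gI ==> a : gS ==> a * x : gI" using I_l_closed[of x a] by simp
 show "x : gI ==> a : gS ==> x * a : gI" using I_r_closed[of x a] by simp
 show "x : gI ==> fa_const c * x : gI" using I_l_closed[of x "fa_const c"] S_closed(4) by simp
qed

text \<open>Equality in $\mathcal O'_q(G)$ is tested by the linear functionals that vanish on the ideal
  of relations. This turns computations in the algebra into computations with complex numbers.\<close>

definition FF :: "(ggen fa => complex) set" where
 "FF = {F. lin F & (ALL i:gI. F i = 0)}"

lemma FF_lin: "F : FF ==> lin F" by (simp add: FF_def)

lemma FF_ltr: "F : FF ==> a : gS ==> ltr a F : FF"
 by (auto simp: FF_def lin_ltr) (simp add: ltr_def gI_props)

lemma FF_rtr: "F : FF ==> a : gS ==> rtr a F : FF"
 by (auto simp: FF_def lin_rtr) (simp add: rtr_def gI_props)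

end

text \<open>A basis of the subspace can be extended by the vector outside of it.\<close>

lemma functional_extension:
 fixes N :: "('m::monoid_add \<Rightarrow>\<^sub>0 complex) set"
 assumes "0 : N" "!!x y. x : N ==> y : N ==> x + y : N" "!!c x. x : N ==> fa_const c * x : N" "v ~: N"
 shows "EX F. lin F & (ALL x:N. F x = 0) & F v = 1"
proof -
 interpret A: vector_space "%c (x :: 'm \<Rightarrow>\<^sub>0 complex). fa_const c * x"
  by standard (simp_all add: algebra_simps fa_const_add fa_const_mult fa_const_1 mult.assoc)
 interpret B: vector_space "%c (x :: complex). c * x" by standard (simp_all add: algebra_simps)
 interpret P: vector_space_pair "%c (x :: 'm \<Rightarrow>\<^sub>0 complex). fa_const c * x" "%c (x :: complex). c * x" ..
 have sub: "A.subspace N" using assms by (auto simp: A.subspace_def)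
 obtain B where B: "B <= N" "A.independent B" "N <= A.span B" using A.maximal_independent_subset by blast
 have "A.span B <= N" using B(1) sub by (rule A.span_minimal)
 hence "A.independent (insert v B)" using assms(4) B(2) by (auto simp: A.independent_insert)
 from P.linear_independent_extend[OF this, of "%x. if x = v then 1 else 0"]
 obtain g where g: "Vector_Spaces.linear (%c x. fa_const c * x) (%c x. c * x) g" "ALL x:insert v B. g x = (if x = v then 1 else 0)"
  by blast
 interpret g: Vector_Spaces.linear "%c (x :: 'm \<Rightarrow>\<^sub>0 complex). fa_const c * x" "%c (x :: complex). c * x" g by (rule g(1))
 have "lin g" by (simp add: lin_def g.add g.scale)
 moreover have "g x = 0" if "x : N" for x
 proof (rule P.linear_eq_0_on_span[OF g(1)])
  show "x : A.span B" using that B(3) by blast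
  show "g y = 0" if "y : B" for y using g(2) that B(1) assms(4) by auto
 qed
 ultimately show ?thesis using g(2) by auto
qed

context quantum
begin

definition eqv :: "ggen fa => ggen fa => bool" (infix "~~" 50) where
 "x ~~ y <-> x : gS & y : gS & x - y : gI"

lemma eqvI:
 assumes "x : gS" "y : gS" "!!F. F : FF ==> F x = F y"
 shows "x ~~ y"
proof (rule ccontr)
 assume "~ x ~~ y"
 hence "x - y ~: gI" using assms by (simp add: eqv_def)
 then obtain F where F: "lin F" "ALL x:gI. F x = 0" "F (x - y) = 1"
  using functional_extension[of gI "x - y"] gI_props by auto
 hence "F : FF" by (simp add: FF_def)
 hence "F x = F y" by (rule assms(3))
 thus False using F by (simp add: linD)
qed

lemma eqvD: "x ~~ y ==> F : FF ==> F x = F y"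
 by (auto simp: eqv_def FF_def) (metis linD(5) right_minus_eq)

lemma eqv_S: "x ~~ y ==> x : gS" "x ~~ y ==> y : gS"
 by (simp_all add: eqv_def)

lemma eqvDc: "x ~~ y ==> F : FF ==> a : gS ==> F (a * x) = F (a * y)"
 "x ~~ y ==> F : FF ==> b : gS ==> F (x * b) = F (y * b)"
 using eqvD[of x y "ltr a F"] eqvD[of x y "rtr b F"] FF_ltr FF_rtr by (auto simp: ltr_def rtr_def)

lemma eqv_refl: "x : gS ==> x ~~ x" by (simp add: eqv_def gI_props)

lemma eqv_sym: "x ~~ y ==> y ~~ x"
 by (rule eqvI) (auto simp: eqv_S eqvD)

lemma eqv_trans [trans]: "x ~~ y ==> y ~~ z ==> x ~~ z"
 by (rule eqvI) (auto simp: eqv_S eqvD)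

lemma eqv_mult: "x ~~ y ==> x' ~~ y' ==> x * x' ~~ y * y'"
 by (rule eqvI) (auto simp: eqv_S eqvDc intro: S_closed)

lemma eqv_multl: "x ~~ y ==> a : gS ==> a * x ~~ a * y"
 by (rule eqv_mult[OF eqv_refl])

lemma eqv_multr: "x ~~ y ==> a : gS ==> x * a ~~ y * a"
 by (rule eqv_mult[OF _ eqv_refl])

lemma eqv_add: "x ~~ y ==> x' ~~ y' ==> x + x' ~~ y + y'"
 by (rule eqvI) (auto simp: eqv_S eqvD linD[OF FF_lin] intro: S_closed)

lemma eqv_scale: "x ~~ y ==> fa_const c * x ~~ fa_const c * y"
 by (rule eqv_multl) (auto intro: S_closed)

lemma eqv_sum: "(!!i. i : A ==> x i ~~ y i) ==> sum x A ~~ sum y A"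
 by (induction A rule: infinite_finite_induct) (auto intro: eqv_add eqv_refl S_closed)

lemma rel_eqv: "x - y : G_rels q s ==> x : gS ==> y : gS ==> x ~~ y"
 by (simp add: eqv_def rels_gI)

lemma gD_rels:
 "gD (%_. 1) ~~ 1" "gD c * gD d ~~ gD (%m. c m * d m)"
 "gD (%m. z * c m + d m) ~~ fa_const z * gD c + gD d"
proof -
 have in_K: "D c : OpK q s" for c by (simp add: OpK_eq)
 show "gD (%_. 1) ~~ 1"
  by (rule rel_eqv) (auto intro: S_closed simp: G_rels_def unital_hom_rels_def deval_1)
 have "gk (dmult q (D c) (D d)) - gD c * gD d : G_rels q s"
  unfolding G_rels_def unital_hom_rels_def using in_K by blast
 thus "gD c * gD d ~~ gD (%m. c m * d m)"
  by (intro eqv_sym[OF rel_eqv]) (auto intro: S_closed simp: dmult_D)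
 have "gk (%a. z * D c a + D d a) - (fa_const z * gD c + gD d) : G_rels q s"
  unfolding G_rels_def unital_hom_rels_def using in_K by blast
 thus "gD (%m. z * c m + d m) ~~ fa_const z * gD c + gD d"
  by (intro rel_eqv) (auto intro: S_closed simp: D_comb)
qed

lemma gy_rels:
 "gy counit ~~ 1" "f : KU ==> g : KU ==> gy (omult f g) ~~ gy f * gy g"
 "f : KU ==> g : KU ==> gy (%a. z * f a + g a) ~~ fa_const z * gy f + gy g"
proof -
 show "gy counit ~~ 1"
  by (rule rel_eqv) (auto intro: S_closed OKU_counit simp: G_rels_def unital_hom_rels_def)
 show "f : KU ==> g : KU ==> gy (omult f g) ~~ gy f * gy g"
 proof (rule rel_eqv)
  assume a: "f : KU" "g : KU"
  thus "gy (omult f g) - gy f * gy g : G_rels q s" unfolding G_rels_def unital_hom_rels_def by blast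
 qed (auto intro!: S_closed OKU_omult)
 show "f : KU ==> g : KU ==> gy (%a. z * f a + g a) ~~ fa_const z * gy f + gy g"
 proof (rule rel_eqv)
  assume a: "f : KU" "g : KU"
  thus "gy (%a. z * f a + g a) - (fa_const z * gy f + gy g) : G_rels q s" unfolding G_rels_def unital_hom_rels_def by blast
 qed (auto intro!: S_closed OKUD(2))
qed

lemma gD_zero: "gD (%_. 0) ~~ 0"
proof (rule eqvI)
 fix F assume F: "F : FF"
 have "F (gD (%m. (-1) * 0 + 0)) = F (fa_const (-1) * gD (%_. 0) + gD (%_. 0))"
  using eqvD[OF gD_rels(3) F, of "-1" "%_. 0" "%_. 0"] .
 thus "F (gD (%_. 0)) = F 0" using FF_lin[OF F] by (simp add: linD)
qed (auto intro: S_closed)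

lemma gy_zero: "gy (%_. 0) ~~ 0"
proof (rule eqvI)
 fix F assume F: "F : FF"
 have "F (gy (%m. (-1) * 0 + 0)) = F (fa_const (-1) * gy (%_. 0) + gy (%_. 0))"
  using eqvD[OF gy_rels(3)[OF OKUD(1) OKUD(1)] F, of "-1"] .
 thus "F (gy (%_. 0)) = F 0" using FF_lin[OF F] by (simp add: linD)
qed (auto intro: S_closed OKUD)

lemma gy_scale: "f : KU ==> gy (%a. z * f a) ~~ fa_const z * gy f"
 using eqv_trans[OF gy_rels(3)[of f "%_. 0" z] eqv_add[OF eqv_refl gy_zero]] OKUD(1) by (simp add: S_closed)

abbreviation gX :: "ggen fa" where "gX \<equiv> gy oXX"
abbreviation gY :: "ggen fa" where "gY \<equiv> gy oYY"
abbreviation gZ :: "ggen fa" where "gZ \<equiv> gy oZZ"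
abbreviation gt :: "ggen fa" where "gt \<equiv> gD nu"
abbreviation ge :: "int => ggen fa" where "ge n \<equiv> gD (dl n)"
abbreviation gm :: "ggen fa" where "gm \<equiv> gk (minus_one_q q s)"

lemma XYZ_S [simp]: "gX : gS" "gY : gS" "gZ : gS" "gt : gS" "ge n : gS" "gm : gS"
 by (auto intro: S_closed XYZ_OKU simp: minus_one_q_D)

lemma exchange:
 assumes "be < 2" "de < 2"
 shows "gD c * gy (GG be de) ~~ (\<Sum>i<2. \<Sum>j<2. gy (GG i j) * gk (dract q (D c) (omult (uu i be) (uu j de))))"
proof -
 let ?i = "%k::nat. k div 2" and ?j = "%k::nat. k mod 2"
 have four: "(\<Sum>k<4. f (k div 2) (k mod 2)) = (\<Sum>i<2. \<Sum>j<2. f i j)" for f :: "nat => nat => 'b::comm_monoid_add"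
 proof -
  have "{..<4::nat} = {0, 1, 2, 3}" "{..<2::nat} = {0, 1}" by auto
  thus ?thesis by (simp add: add.assoc)
 qed
 have "gD c * gy (GG be de) - (\<Sum>k<4. gy (GG (?i k) (?j k)) * gk (dract q (D c) (omult (uu (?i k) be) (uu (?j k) de)))) : exchange_rels q s"
  unfolding exchange_rels_def
 proof (intro CollectI exI conjI)
  show "D c : OpK q s" by (simp add: OpK_eq)
  show "GG be de : KU" by (rule GG_OKU[OF assms])
  show "ALL k<4. GG (?i k) (?j k) : KU & omult (uu (?i k) be) (uu (?j k) de) : OU q"
   using assms by (auto intro!: GG_OKU OU_omult OU_uu)
  show "ALL a b. GG be de (a * b) = (\<Sum>k<4. GG (?i k) (?j k) a * omult (uu (?i k) be) (uu (?j k) de) b)"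
   using GG_props(5)[OF assms] four[of "%i j. GG i j a * omult (uu i be) (uu j de) b" for a b] by simp
 qed (rule refl)
 thus ?thesis
  unfolding four[of "%i j. gy (GG i j) * gk (dract q (D c) (omult (uu i be) (uu j de)))"]
  using assms by (intro rel_eqv) (auto simp: G_rels_def dract_D OU_omult OU_uu intro!: S_closed GG_OKU)
qed

lemma dract_nu:
 assumes "ph : OU q"
 shows "dract q (D nu) ph = D (%m. ph uK * nu m + ph th)"
proof
 fix f
 show "dract q (D nu) ph f = D (%m. ph uK * nu m + ph th) f"
 proof (cases "f : OU q")
  case True
  have n: "D nu g = g th" "fa_lin (%_. 1) (kth g) = g 1" if "g : OU q" for g
  proof -
   have "g (th ^ 1) = fa_lin (%m. nu m ^ 1) (kth g)" "g (th ^ 0) = fa_lin (%m. nu m ^ 0) (kth g)"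
    using kth_nexp[OF that] unfolding nexp_def by blast+
   thus "D nu g = g th" "fa_lin (%_. 1) (kth g) = g 1" using that by (simp_all add: D_def)
  qed
  have "dract q (D nu) ph f = omult ph f th" using True assms by (simp add: dract_def n OU_omult)
  also have "... = rtr th (omult ph f) 1" by (simp add: rtr_def)
  also have "... = ph th * f 1 + ph uK * f th"
   using True assms by (simp add: rtr_th_omult OU_AD) (simp add: rtr_def)
  also have "... = D (%m. ph uK * nu m + ph th) f"
  proof -
   have "fa_lin (%m. ph uK * nu m + ph th * 1) (kth f) = ph uK * fa_lin nu (kth f) + fa_lin (%_. ph th * 1) (kth f)"
    by (rule fa_lin_fun)
   also have "fa_lin (%_. ph th * 1) (kth f) = ph th * fa_lin (%_. 1) (kth f)"
    using fa_lin_fun[of "ph th" "%_. 1" "%_. 0" "kth f"] by (simp add: fa_lin_def)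
   finally show ?thesis using n[OF True] True by (simp add: D_def)
  qed
  finally show ?thesis .
 qed (simp add: dract_def D_def)
qed

lemma uu_th: "uu 0 0 th = 0" "uu 0 (Suc 0) th = \<i>" "uu (Suc 0) 0 th = - \<i>" "uu (Suc 0) (Suc 0) th = 0"
 using fun_cong[OF rtr_th_uu(1)[of 0], of 1] fun_cong[OF rtr_th_uu(2)[of 0], of 1]
  fun_cong[OF rtr_th_uu(1)[of "Suc 0"], of 1] fun_cong[OF rtr_th_uu(2)[of "Suc 0"], of 1]
 by (simp_all add: rtr_def uu_1)

lemma gy_GG: "gy (GG 0 0) = gX" "gy (GG (Suc 0) (Suc 0)) ~~ fa_const cq * gY"
 "gy (GG (Suc 0) 0) ~~ fa_const (- \<i>) * gZ" "gy (GG 0 (Suc 0)) ~~ fa_const (- \<i> * cq) * gZ"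
proof -
 have "GG (Suc 0) (Suc 0) = (%a. cq * oYY a)" "GG (Suc 0) 0 = (%a. - \<i> * oZZ a)" "GG 0 (Suc 0) = (%a. (- \<i> * cq) * oZZ a)"
  by (simp_all add: XYZ_GG GG_01 fun_eq_iff algebra_simps)
 thus "gy (GG (Suc 0) (Suc 0)) ~~ fa_const cq * gY"
  "gy (GG (Suc 0) 0) ~~ fa_const (- \<i>) * gZ" "gy (GG 0 (Suc 0)) ~~ fa_const (- \<i> * cq) * gZ"
  using gy_scale XYZ_OKU by (simp_all only:)
qed (simp add: XYZ_GG)

lemma F_GG:
 assumes "F : FF" "b : gS"
 shows "F (gy (GG 0 0) * b) = F (gX * b)" "F (gy (GG (Suc 0) (Suc 0)) * b) = cq * F (gY * b)"
 "F (gy (GG (Suc 0) 0) * b) = - \<i> * F (gZ * b)" "F (gy (GG 0 (Suc 0)) * b) = - \<i> * cq * F (gZ * b)"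
 using eqvDc(2)[OF gy_GG(2) assms] eqvDc(2)[OF gy_GG(3) assms] eqvDc(2)[OF gy_GG(4) assms] FF_lin[OF assms(1)]
 by (simp_all add: gy_GG(1) mult.assoc linD)

lemma theta_GG:
 assumes F: "F : FF" and b: "be < 2" "de < 2"
 shows "F (gt * gy (GG be de)) = (\<Sum>i<2. \<Sum>j<2. uu i be uK * uu j de uK * F (gy (GG i j) * gt) +
   (uu i be th * uu j de 1 + uu i be uK * uu j de th) * F (gy (GG i j) * 1))"
proof -
 have "F (gt * gy (GG be de)) = (\<Sum>i<2. \<Sum>j<2. F (gy (GG i j) * gk (dract q (D nu) (omult (uu i be) (uu j de)))))"
  using eqvD[OF exchange[OF b, of nu] F] by (simp add: lin_sum[OF FF_lin[OF F]])
 also have "... = (\<Sum>i<2. \<Sum>j<2. uu i be uK * uu j de uK * F (gy (GG i j) * gt) +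
   (uu i be th * uu j de 1 + uu i be uK * uu j de th) * F (gy (GG i j) * 1))"
 proof (intro sum.cong refl)
  fix i j assume ij: "i : {..<2::nat}" "j : {..<2::nat}"
  let ?ph = "omult (uu i be) (uu j de)"
  have phi: "?ph : OU q" "AD (uu i be)" "AD (uu j de)" using ij b by (auto intro: OU_omult OU_uu)
  have v: "?ph uK = uu i be uK * uu j de uK" "?ph th = uu i be th * uu j de 1 + uu i be uK * uu j de th"
   using fun_cong[OF rtr_th_omult[OF phi(2,3)], of 1] by (simp_all add: omult_uK rtr_def)
  have G: "gy (GG i j) : gS" using ij by (auto intro: S_closed GG_OKU)
  have "gk (dract q (D nu) ?ph) ~~ fa_const (?ph uK) * gt + gD (%_. ?ph th)"
   unfolding dract_nu[OF phi(1)] by (rule gD_rels(3))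
  from eqvDc(1)[OF this F G]
  have "F (gy (GG i j) * gk (dract q (D nu) ?ph)) = ?ph uK * F (gy (GG i j) * gt) + F (gy (GG i j) * gD (%_. ?ph th))"
   using FF_lin[OF F] by (simp add: distrib_left linD)
  also have "F (gy (GG i j) * gD (%_. ?ph th)) = ?ph th * F (gy (GG i j) * 1)"
  proof -
   have "F (gy (GG i j) * gD (%m. ?ph th * 1 + 0)) = F (gy (GG i j) * (fa_const (?ph th) * gD (%_. 1) + gD (%_. 0)))"
    by (rule eqvDc(1)[OF gD_rels(3) F G])
   also have "... = ?ph th * F (gy (GG i j) * gD (%_. 1)) + F (gy (GG i j) * gD (%_. 0))"
    using FF_lin[OF F] by (simp add: distrib_left linD)
   also have "F (gy (GG i j) * gD (%_. 0)) = 0"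
    using eqvDc(1)[OF gD_zero F G] FF_lin[OF F] by (simp add: linD)
   also have "F (gy (GG i j) * gD (%_. 1)) = F (gy (GG i j) * 1)" by (rule eqvDc(1)[OF gD_rels(1) F G])
   finally show ?thesis by simp
  qed
  finally show "F (gy (GG i j) * gk (dract q (D nu) ?ph)) = uu i be uK * uu j de uK * F (gy (GG i j) * gt) +
   (uu i be th * uu j de 1 + uu i be uK * uu j de th) * F (gy (GG i j) * 1)"
   by (simp add: v)
 qed
 finally show ?thesis .
qed

lemma theta_rels0:
 assumes F: "F : FF"
 shows "F (gt * gX) = cq * cq * F (gX * gt) - (cq * cq + 1) * F gZ"
  "F (gt * gY) = F (gY * gt) / (cq * cq) + (1 + 1 / (cq * cq)) * F gZ"
  "F (gt * gZ) = F (gZ * gt) + F gY - F gX"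
proof -
 note S2 = numeral_2_eq_2
 have F1: "F (gy (GG 0 0)) = F gX" "F (gy (GG (Suc 0) (Suc 0))) = cq * F gY"
  "F (gy (GG (Suc 0) 0)) = - \<i> * F gZ" "F (gy (GG 0 (Suc 0))) = - \<i> * cq * F gZ"
  using F_GG[OF F, of 1] S_closed by simp_all
 note Ft = F_GG[OF F, of gt, simplified]
 show "F (gt * gX) = cq * cq * F (gX * gt) - (cq * cq + 1) * F gZ"
  using theta_GG[OF F, of 0 0]
  by (simp add: S2 uu_gen uu_1 uu_th F1 Ft gy_GG(1)) (simp add: algebra_simps)
 have e1: "F (gt * gy (GG (Suc 0) (Suc 0))) = cq * F (gt * gY)"
  using eqvDc(1)[OF gy_GG(2) F, of gt] FF_lin[OF F] by (simp add: linD)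
 have "cq * F (gt * gY) = F (gY * gt) / cq + (cq + 1 / cq) * F gZ"
  using theta_GG[OF F, of "Suc 0" "Suc 0"] unfolding e1
  by (simp add: S2 uu_gen uu_1 uu_th F1 Ft gy_GG(1)) (simp add: field_simps)
 thus "F (gt * gY) = F (gY * gt) / (cq * cq) + (1 + 1 / (cq * cq)) * F gZ"
  by (simp add: field_simps)
 have e2: "F (gt * gy (GG (Suc 0) 0)) = - \<i> * F (gt * gZ)"
  using eqvDc(1)[OF gy_GG(3) F, of gt] FF_lin[OF F] by (simp add: linD)
 have "- \<i> * F (gt * gZ) = - \<i> * (F (gZ * gt) + F gY - F gX)"
  using theta_GG[OF F, of "Suc 0" 0] unfolding e2
  by (simp add: S2 uu_gen uu_1 uu_th F1 Ft gy_GG(1)) (simp add: field_simps)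
 thus "F (gt * gZ) = F (gZ * gt) + F gY - F gX" by simp
qed

lemma theta_rels:
 assumes F: "F : FF" and b: "b : gS"
 shows "F (gt * (gX * b)) = cq * cq * F (gX * (gt * b)) - (cq * cq + 1) * F (gZ * b)"
  "F (gt * (gY * b)) = F (gY * (gt * b)) / (cq * cq) + (1 + 1 / (cq * cq)) * F (gZ * b)"
  "F (gt * (gZ * b)) = F (gZ * (gt * b)) + F (gY * b) - F (gX * b)"
 using theta_rels0[OF FF_rtr[OF F b]] by (simp_all add: rtr_def mult.assoc)

lemma podles_rels:
 assumes F: "F : FF" and b: "b : gS"
 shows "F (gX * (gZ * b)) = cq * cq * F (gZ * (gX * b))"
  "F (gZ * (gY * b)) = cq * cq * F (gY * (gZ * b))"
  "F (gX * (gY * b)) = F b - cq * cq * F (gZ * (gZ * b))"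
  "F (gY * (gX * b)) = F b - F (gZ * (gZ * b)) / (cq * cq)"
proof -
 have m: "F (gy f * (gy g * b)) = F (gy (omult f g) * b)" if "f : KU" "g : KU" for f g
  using eqvDc(2)[OF gy_rels(2)[OF that] F b] by (simp add: mult.assoc)
 have sc: "F (gy (%a. z * f a) * b) = z * F (gy f * b)" if "f : KU" for f z
  using eqvDc(2)[OF gy_scale[OF that] F b] FF_lin[OF F] by (simp add: mult.assoc linD)
 have cm: "F (gy (%a. z * f a + g a) * b) = z * F (gy f * b) + F (gy g * b)" if "f : KU" "g : KU" for f g z
  using eqvDc(2)[OF gy_rels(3)[OF that] F b] FF_lin[OF F] by (simp add: mult.assoc linD distrib_right)
 have c1: "F (gy counit * b) = F b" using eqvDc(2)[OF gy_rels(1) F b] by simp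
 note O = XYZ_OKU OKU_omult OKU_counit
 show "F (gX * (gZ * b)) = cq * cq * F (gZ * (gX * b))"
  using O by (simp add: m XZ_rel sc)
 show "F (gZ * (gY * b)) = cq * cq * F (gY * (gZ * b))"
  using O by (simp add: m ZY_rel sc)
 have "omult oXX oYY = (%a. (- (cq * cq)) * omult oZZ oZZ a + counit a)" by (simp add: XY_rel fun_eq_iff)
 thus "F (gX * (gY * b)) = F b - cq * cq * F (gZ * (gZ * b))"
  using cm[of "omult oZZ oZZ" counit "- (cq * cq)"] O by (simp only: m) (simp add: c1)
 have "omult oYY oXX = (%a. (- inverse (cq * cq)) * omult oZZ oZZ a + counit a)" by (simp add: YX_rel fun_eq_iff)
 thus "F (gY * (gX * b)) = F b - F (gZ * (gZ * b)) / (cq * cq)"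
  using cm[of "omult oZZ oZZ" counit "- inverse (cq * cq)"] O by (simp only: m) (simp add: c1 field_simps)
qed

lemma gm_commute_GG:
 assumes "be < 2" "de < 2"
 shows "gm * gy (GG be de) ~~ gy (GG be de) * gm"
proof -
 let ?c = "%m. (-1) powi m :: complex"
 have gm: "gm = gD ?c" by (simp add: minus_one_q_D)
 have G: "D ?c = G (-1)" using minus_one_q_D minus_one_q_G by simp
 have dr: "dract q (D ?c) ph = (%f. G (-1) ph * D ?c f)" if "ph : OU q" for ph
  using that by (auto simp: fun_eq_iff dract_def G G_omult) (simp add: G_def)
 have Gu: "G (-1) (omult (uu i be) (uu j de)) = (if i = be & j = de then 1 else 0)" if "i < 2" "j < 2" for i j
  using that assms G_minus_one(1)[of "uu i be" 1] G_minus_one(1)[of "uu j de" 1] WS_wf[of "[(i, be)]" "{1}"] WS_wf[of "[(j, de)]" "{1}"]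
  by (auto simp: G_omult OU_uu uu_1 omult_counit)
 have "gm * gy (GG be de) ~~ (\<Sum>i<2. \<Sum>j<2. gy (GG i j) * gk (dract q (D ?c) (omult (uu i be) (uu j de))))"
  unfolding gm by (rule exchange[OF assms])
 also have "... ~~ (\<Sum>i<2. \<Sum>j<2. if i = be & j = de then gy (GG i j) * gm else 0)"
 proof (intro eqv_sum)
  fix i j assume ij: "i : {..<2::nat}" "j : {..<2::nat}"
  have O: "omult (uu i be) (uu j de) : OU q" using ij assms by (auto intro: OU_omult OU_uu)
  have S: "gy (GG i j) : gS" using ij by (auto intro: S_closed GG_OKU)
  show "gy (GG i j) * gk (dract q (D ?c) (omult (uu i be) (uu j de))) ~~ (if i = be & j = de then gy (GG i j) * gm else 0)"
  proof (cases "i = be & j = de")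
   case True
   have "dract q (D ?c) (omult (uu i be) (uu j de)) = D ?c"
    unfolding dr[OF O] using ij True by (simp add: Gu)
   thus ?thesis using True S by (simp only: gm if_True simp_thms) (rule eqv_refl, rule free_ring_closed(2)[OF _ gD_S])
  next
   case False
   have "dract q (D ?c) (omult (uu i be) (uu j de)) = D (%_. 0)"
   proof -
    have "D (%_. 0) = (%_. 0)" by (auto simp: D_def fa_lin_def fun_eq_iff)
    thus ?thesis unfolding dr[OF O] using ij False by (auto simp: Gu)
   qed
   thus ?thesis using eqv_multl[OF gD_zero S] False by auto
  qed
 qed
 also have "(\<Sum>i<2. \<Sum>j<2. if i = be & j = de then gy (GG i j) * gm else 0) = gy (GG be de) * gm"
 proof -
  have "{..<2::nat} = {0, Suc 0}" by auto
  thus ?thesis using assms by (auto simp: less_2)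
 qed
 finally show ?thesis .
qed
section \<open>Weight spaces in $\mathcal O'_q(G)$\<close>

definition L3 :: "complex => complex => complex => ggen fa" where
 "L3 a b c = fa_const a * gX + fa_const b * gY + fa_const c * gZ"

definition Ap :: "int => ggen fa" where "Ap n = L3 (qp n) (- qp (- n)) (- hh)"
definition Am :: "int => ggen fa" where "Am n = L3 (qp (- n)) (- qp n) hh"
definition On :: "int => ggen fa" where "On n = L3 (inverse cq) cq (qp n - qp (- n))"
definition Onr :: "int => ggen fa" where "Onr n = L3 cq (inverse cq) (qp n - qp (- n))"

text \<open>The Casimir element.\<close>

definition Om :: "ggen fa" where
 "Om = fa_const (inverse cq) * gX + fa_const cq * gY + fa_const (cq - inverse cq) * (gZ * gt)"

lemma L3_S [simp]: "L3 a b c : gS" "Ap n : gS" "Am n : gS" "On n : gS" "Onr n : gS" "Om : gS"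
 unfolding Ap_def Am_def On_def Onr_def Om_def L3_def by (intro S_closed XYZ_S)+

lemma L3_lin: "L3 a b c + L3 a' b' c' = L3 (a + a') (b + b') (c + c')" "fa_const z * L3 a b c = L3 (z * a) (z * b) (z * c)"
 by (simp_all add: L3_def fa_const_add fa_const_mult distrib_left distrib_right mult.assoc add_ac)

lemma F_L3:
 assumes "F : FF"
 shows "F (L3 a b c * x) = a * F (gX * x) + b * F (gY * x) + c * F (gZ * x)"
  "F (y * (L3 a b c * x)) = a * F (y * (gX * x)) + b * F (y * (gY * x)) + c * F (y * (gZ * x))"
 using FF_lin[OF assms] by (simp_all add: L3_def distrib_left distrib_right linD mult.assoc)

definition Wl :: "int => ggen fa => bool" where
 "Wl m x <-> x : gS & gt * x ~~ fa_const (nu m) * x"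

definition Wr :: "int => ggen fa => bool" where
 "Wr m x <-> x : gS & x * gt ~~ fa_const (nu m) * x"

lemma WlD: "Wl m x ==> x : gS" "Wl m x ==> F : FF ==> F (gt * x) = nu m * F x"
 using eqvD[of "gt * x" "fa_const (nu m) * x" F] linD[OF FF_lin[of F]] by (auto simp: Wl_def)

lemma WlD2: "Wl m x ==> F : FF ==> y : gS ==> F (y * (gt * x)) = nu m * F (y * x)"
 using WlD(2)[of m x "ltr y F"] FF_ltr by (simp add: ltr_def)

lemma WrD: "Wr m x ==> x : gS" "Wr m x ==> F : FF ==> F (x * gt) = nu m * F x"
 using eqvD[of "x * gt" "fa_const (nu m) * x" F] linD[OF FF_lin[of F]] by (auto simp: Wr_def)

lemma WrD2: "Wr m x ==> F : FF ==> y : gS ==> F (x * (gt * y)) = nu m * F (x * y)"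
 using WrD(2)[of m x "rtr y F"] FF_rtr by (simp add: rtr_def mult.assoc)

lemma WlI: "x : gS ==> (!!F. F : FF ==> F (gt * x) = nu m * F x) ==> Wl m x"
 unfolding Wl_def by (auto intro!: eqvI S_closed simp: linD[OF FF_lin])

lemma WrI: "x : gS ==> (!!F. F : FF ==> F (x * gt) = nu m * F x) ==> Wr m x"
 unfolding Wr_def by (auto intro!: eqvI S_closed simp: linD[OF FF_lin])

lemma Wl_eqv: "Wl m x ==> x ~~ y ==> Wl m y"
proof (rule WlI)
 assume W: "Wl m x" and e: "x ~~ y"
 show "y : gS" using e by (rule eqv_S)
 fix F assume F: "F : FF"
 show "F (gt * y) = nu m * F y"
  using WlD(2)[OF W F] eqvDc(1)[OF e F XYZ_S(4)] eqvD[OF e F] by simp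
qed

lemma gD_scale: "gD (%m. z * c m) ~~ fa_const z * gD c"
 using eqv_trans[OF gD_rels(3)[of z c "%_. 0"] eqv_add[OF eqv_refl gD_zero]] by (simp add: S_closed)

lemma gD_ge: "gD c * ge n ~~ fa_const (c n) * ge n" "ge n * gD c ~~ fa_const (c n) * ge n"
proof -
 have e: "(%m. c m * dl n m) = (%m. c n * dl n m)" "(%m. dl n m * c m) = (%m. c n * dl n m)"
  by (auto simp: dl_def)
 show "gD c * ge n ~~ fa_const (c n) * ge n" "ge n * gD c ~~ fa_const (c n) * ge n"
  using eqv_trans[OF gD_rels(2)[of c "dl n"]] eqv_trans[OF gD_rels(2)[of "dl n" c]] gD_scale[of "c n" "dl n"] by (simp_all add: e)
qed

lemma Wl_ge: "Wl n (ge n)" and Wr_ge: "Wr n (ge n)"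
 using gD_ge(1)[of nu n] gD_ge(2)[of n nu] by (auto simp: Wl_def Wr_def)

text \<open>Away from \<open>m\<close> the function \<open>[l] - [m]\<close> is invertible, so that an eigenvector of $\theta$
  for the eigenvalue \<open>[m]\<close> is fixed by \<^term>\<open>ge m\<close>.\<close>

lemma gD_split: "gD (%l. c l * nu l - nu m * c l) ~~ gD c * gt - fa_const (nu m) * gD c"
proof -
 have "gD (%l. (- nu m) * c l + c l * nu l) ~~ fa_const (- nu m) * gD c + gD (%l. c l * nu l)" by (rule gD_rels(3))
 also have "... ~~ fa_const (- nu m) * gD c + gD c * gt"
  by (intro eqv_add eqv_refl eqv_sym[OF gD_rels(2)] S_closed)
 finally show ?thesis by (simp add: fa_const_uminus)
qed

lemma gD_on_weight:
 assumes "Wl m x" shows "gD c * x ~~ fa_const (c m) * x"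
proof (rule eqvI)
 fix F assume F: "F : FF"
 define d where "d l = (if l = m then 0 else (c l - c m) / (nu l - nu m))" for l
 have e: "c = (%l. 1 * (d l * nu l - nu m * d l) + c m * 1)"
  by (auto simp: d_def fun_eq_iff divide_simps) (auto simp: algebra_simps)
 have x: "x : gS" using assms WlD by blast
 have "F (gD c * x) = F ((fa_const 1 * gD (%l. d l * nu l - nu m * d l) + gD (%_. c m * 1)) * x)"
  by (subst e, rule eqvDc(2)[OF gD_rels(3) F x])
 also have "... = F (gD (%l. d l * nu l - nu m * d l) * x) + F (gD (%_. c m * 1) * x)"
  using FF_lin[OF F] by (simp add: distrib_right linD fa_const_1)
 also have "F (gD (%l. d l * nu l - nu m * d l) * x) = F (gD d * (gt * x)) - nu m * F (gD d * x)"
  using eqvDc(2)[OF gD_split F x] FF_lin[OF F] by (simp add: left_diff_distrib linD mult.assoc)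
 also have "... = 0" using WlD2[OF assms F gD_S] by simp
 also have "F (gD (%_. c m * 1) * x) = c m * F x"
  using eqvDc(2)[OF gD_scale F x, of "c m" "%_. 1"] eqvDc(2)[OF gD_rels(1) F x] FF_lin[OF F] by (simp add: linD mult.assoc)
 finally show "F (gD c * x) = F (fa_const (c m) * x)" using FF_lin[OF F] by (simp add: linD)
qed (use WlD(1)[OF assms] in "auto intro!: S_closed")

lemma gD_on_weight_right:
 assumes "Wr m x" shows "x * gD c ~~ fa_const (c m) * x"
proof (rule eqvI)
 fix F assume F: "F : FF"
 define d where "d l = (if l = m then 0 else (c l - c m) / (nu l - nu m))" for l
 have e: "c = (%l. 1 * (nu l * d l - nu m * d l) + c m * 1)"
  by (auto simp: d_def fun_eq_iff divide_simps) (auto simp: algebra_simps)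
 have x: "x : gS" using assms WrD by blast
 have "F (x * gD c) = F (x * (fa_const 1 * gD (%l. nu l * d l - nu m * d l) + gD (%_. c m * 1)))"
  by (subst e, rule eqvDc(1)[OF gD_rels(3) F x])
 also have "... = F (x * gD (%l. nu l * d l - nu m * d l)) + F (x * gD (%_. c m * 1))"
  using FF_lin[OF F] by (simp add: distrib_left linD fa_const_1)
 also have "F (x * gD (%l. nu l * d l - nu m * d l)) = F (x * gD (%l. (- nu m) * d l + nu l * d l))" by (simp add: algebra_simps)
 also have "... = - nu m * F (x * gD d) + F (x * gD (%l. nu l * d l))"
  using eqvDc(1)[OF gD_rels(3) F x, of "- nu m" d "%l. nu l * d l"] FF_lin[OF F] by (simp add: distrib_left linD)
 also have "F (x * gD (%l. nu l * d l)) = F (x * (gt * gD d))" using eqvDc(1)[OF gD_rels(2) F x, of nu d] by simp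
 also have "... = nu m * F (x * gD d)" by (rule WrD2[OF assms F gD_S])
 also have "F (x * gD (%_. c m * 1)) = c m * F x"
  using eqvDc(1)[OF gD_scale F x, of "c m" "%_. 1"] eqvDc(1)[OF gD_rels(1) F x] FF_lin[OF F] by (simp add: linD)
 finally show "F (x * gD c) = F (fa_const (c m) * x)" using FF_lin[OF F] by (simp add: linD)
qed (use WrD(1)[OF assms] in "auto intro!: S_closed")

lemma ge_on_weight: "Wl m x ==> ge m * x ~~ x"
 using gD_on_weight[of m x "dl m"] by (simp add: dl_def fa_const_1)

text \<open>Multiplication by the combinations \<^term>\<open>Ap n\<close>, \<^term>\<open>Am n\<close>, \<^term>\<open>On n\<close> of $X$, $Y$, $Z$
  shifts weights by \<open>2\<close>, \<open>-2\<close>, \<open>0\<close>: these are the eigenvectors of the matrix by which $\theta$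
  acts on the three products.\<close>

lemma theta_L3:
 assumes "Wl n x" "F : FF" "t = nu n"
 shows "F (gt * (L3 a b c * x)) = (cq * cq * t * a - c) * F (gX * x) + (t * b / (cq * cq) + c) * F (gY * x)
   + (t * c - (cq * cq + 1) * a + (1 + 1 / (cq * cq)) * b) * F (gZ * x)"
proof -
 have x: "x : gS" using assms WlD by blast
 show ?thesis
  using theta_rels[OF assms(2) x] WlD2[OF assms(1,2)] assms(3)
  by (simp add: F_L3[OF assms(2)]) (simp add: algebra_simps add_divide_distrib)
qed

lemma theta_L3_right:
 assumes "Wr n x" "F : FF" "t = nu n"
 shows "F (x * (L3 a b c * gt)) = (t * a / (cq * cq) + c) * F (x * gX) + (cq * cq * t * b - c) * F (x * gY)
   + (t * c + (1 + 1 / (cq * cq)) * a - (cq * cq + 1) * b) * F (x * gZ)"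
proof -
 have x: "x : gS" using assms WrD by blast
 note r = theta_rels0[OF FF_ltr[OF assms(2) x]]
 have X: "F (x * (gX * gt)) = t * F (x * gX) / (cq * cq) + (1 + 1 / (cq * cq)) * F (x * gZ)"
  using r(1) WrD2[OF assms(1,2), of gX] assms(3) by (simp add: ltr_def field_simps)
 have Y: "F (x * (gY * gt)) = cq * cq * t * F (x * gY) - (cq * cq + 1) * F (x * gZ)"
  using r(2) WrD2[OF assms(1,2), of gY] assms(3) by (simp add: ltr_def field_simps)
 have Z: "F (x * (gZ * gt)) = t * F (x * gZ) - F (x * gY) + F (x * gX)"
  using r(3) WrD2[OF assms(1,2), of gZ] assms(3) by (simp add: ltr_def)
 show ?thesis
  by (simp add: F_L3[OF assms(2)] X Y Z) (simp add: algebra_simps add_divide_distrib)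
qed

lemma q_rational: "hq = cq / (cq * cq - 1)" "cq * cq - 1 ~= 0" "cq ~= 0" "qp (- n) = 1 / qp n" "inverse cq = 1 / cq"
 "qp (n + 2) = qp n * cq * cq" "qp (n - 2) = qp n / (cq * cq)" "qp (- (n + 2)) = 1 / (qp n * cq * cq)" "qp (- (n - 2)) = cq * cq / qp n"
 "qp (n + 1) = qp n * cq" "qp (n - 1) = qp n / cq" "qp (- n - 1) = 1 / (qp n * cq)" "qp (1 - n) = cq / qp n"
 "qp (- n - 2) = 1 / (qp n * cq * cq)" "qp (2 - n) = cq * cq / qp n" "qp n ~= 0"
 using cq_sq_ne1 by (auto simp: hq_def qp_add qp_diff qp_minus qp_2 field_simps)

lemma weight_shift:
 assumes "Wl n x"
 shows "Wl (n + 2) (Ap n * x)" "Wl (n - 2) (Am n * x)" "Wl n (On n * x)"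
proof -
 have x: "x : gS" using assms WlD by blast
 define u where "u = qp n"
 have ne: "u ~= 0" by (simp add: u_def)
 note nn = q_rational(1,5) q_rational(4,6-16)[of n, folded u_def] u_def[symmetric]
 show "Wl (n + 2) (Ap n * x)"
 proof (rule WlI[OF S_closed(2)[OF L3_S(2) x]])
  fix F assume F: "F : FF"
  show "F (gt * (Ap n * x)) = nu (n + 2) * F (Ap n * x)" using ne q_rational(2,3)
   by (simp add: theta_L3[OF assms F refl] F_L3(1)[OF F] Ap_def nu_eq nn) (simp add: divide_simps ne; simp add: algebra_simps power2_eq_square)
 qed
 show "Wl (n - 2) (Am n * x)"
 proof (rule WlI[OF S_closed(2)[OF L3_S(3) x]])
  fix F assume F: "F : FF"
  show "F (gt * (Am n * x)) = nu (n - 2) * F (Am n * x)" using ne q_rational(2,3)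
   by (simp add: theta_L3[OF assms F refl] F_L3(1)[OF F] Am_def nu_eq nn) (simp add: divide_simps ne; simp add: algebra_simps power2_eq_square)
 qed
 show "Wl n (On n * x)"
 proof (rule WlI[OF S_closed(2)[OF L3_S(4) x]])
  fix F assume F: "F : FF"
  show "F (gt * (On n * x)) = nu n * F (On n * x)" using ne q_rational(2,3)
   by (simp add: theta_L3[OF assms F refl] F_L3(1)[OF F] On_def nu_eq nn) (simp add: divide_simps ne; simp add: algebra_simps power2_eq_square)
 qed
qed

lemma weight_shift_right:
 assumes "Wr n x"
 shows "Wr (n - 2) (x * Ap n)" "Wr (n + 2) (x * Am n)" "Wr n (x * Onr n)"
proof -
 have x: "x : gS" using assms WrD by blast
 have FL: "F (x * L3 a b c) = a * F (x * gX) + b * F (x * gY) + c * F (x * gZ)" if "F : FF" for F a b c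
  using F_L3(2)[OF that, of x a b c 1] by simp
 define u where "u = qp n"
 have ne: "u ~= 0" by (simp add: u_def)
 note nn = q_rational(1,5) q_rational(4,6-16)[of n, folded u_def] u_def[symmetric]
 show "Wr (n - 2) (x * Ap n)"
 proof (rule WrI[OF S_closed(2)[OF x L3_S(2)]])
  fix F assume F: "F : FF"
  show "F ((x * Ap n) * gt) = nu (n - 2) * F (x * Ap n)" using ne q_rational(2,3)
   by (simp add: theta_L3_right[OF assms F refl] FL[OF F] Ap_def nu_eq nn mult.assoc) (simp add: divide_simps ne; simp add: algebra_simps power2_eq_square)
 qed
 show "Wr (n + 2) (x * Am n)"
 proof (rule WrI[OF S_closed(2)[OF x L3_S(3)]])
  fix F assume F: "F : FF"
  show "F ((x * Am n) * gt) = nu (n + 2) * F (x * Am n)" using ne q_rational(2,3)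
   by (simp add: theta_L3_right[OF assms F refl] FL[OF F] Am_def nu_eq nn mult.assoc) (simp add: divide_simps ne; simp add: algebra_simps power2_eq_square)
 qed
 show "Wr n (x * Onr n)"
 proof (rule WrI[OF S_closed(2)[OF x L3_S(5)]])
  fix F assume F: "F : FF"
  show "F ((x * Onr n) * gt) = nu n * F (x * Onr n)" using ne q_rational(2,3)
   by (simp add: theta_L3_right[OF assms F refl] FL[OF F] Onr_def nu_eq nn mult.assoc) (simp add: divide_simps ne; simp add: algebra_simps power2_eq_square)
 qed
qed

text \<open>Two choices of \<open>a\<close>, \<open>b\<close> occur: the weight zero combination differs for left and right
  multiplication. The determinant of the system is $(q+q^{-1})^2+(q^n-q^{-n})^2>0$, up to factors.\<close>

lemma XYZ_decompose:
 assumes "U : {gX, gY, gZ}" and ab: "a + b = hh"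
 shows "EX x1 x2 x3. U = fa_const x1 * Ap n + fa_const x2 * Am n + fa_const x3 * L3 a b (qp n - qp (- n))"
proof -
 define u where "u = qp n"
 have u: "u ~= 0" "cq ~= 0" "qp (- n) = 1 / u" by (simp_all add: u_def q_rational)
 have pos: "u + 1 / u ~= 0" "cq + 1 / cq ~= 0"
  using qp_sum_ne0[of n] qp_sum_ne0[of 1] by (simp_all add: u_def divide_inverse)
 define Dl where "Dl = u - 1 / u"
 have d: "hh * hh + Dl * Dl ~= 0"
 proof -
  define r where "r = (q + inverse q) * (q + inverse q) + (q powi n - inverse (q powi n)) * (q powi n - inverse (q powi n))"
  have "(q + inverse q) > 0" using q_pos by (simp add: add_pos_pos)
  hence "r > 0" unfolding r_def by (intro add_pos_nonneg) auto
  moreover have "hh * hh + Dl * Dl = complex_of_real r"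
   by (simp add: r_def Dl_def u_def qp_def divide_inverse)
  ultimately show ?thesis by (metis less_irrefl of_real_eq_0_iff)
 qed
 define Sp where "Sp = {p. EX x1 x2 x3. p = fa_const x1 * Ap n + fa_const x2 * Am n + fa_const x3 * L3 a b (qp n - qp (- n))}"
 have Sp_lin: "fa_const z * p + p' : Sp" if "p : Sp" "p' : Sp" for z p p'
 proof -
  from that obtain x1 x2 x3 y1 y2 y3 where "p = fa_const x1 * Ap n + fa_const x2 * Am n + fa_const x3 * L3 a b (qp n - qp (- n))"
   "p' = fa_const y1 * Ap n + fa_const y2 * Am n + fa_const y3 * L3 a b (qp n - qp (- n))" unfolding Sp_def by blast
  hence "fa_const z * p + p' = fa_const (z * x1 + y1) * Ap n + fa_const (z * x2 + y2) * Am n + fa_const (z * x3 + y3) * L3 a b (qp n - qp (- n))"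
   by (simp add: fa_const_add fa_const_mult distrib_left distrib_right mult.assoc add_ac)
  thus ?thesis unfolding Sp_def by blast
 qed
 have one: "Ap n : Sp" "Am n : Sp" "L3 a b (qp n - qp (- n)) : Sp"
  unfolding Sp_def
  by (rule CollectI, rule exI[of _ 1], rule exI[of _ 0], rule exI[of _ 0], simp add: fa_const_0 fa_const_1)
   (rule CollectI, rule exI[of _ 0], rule exI[of _ 1], rule exI[of _ 0], simp add: fa_const_0 fa_const_1,
    rule CollectI, rule exI[of _ 0], rule exI[of _ 0], rule exI[of _ 1], simp add: fa_const_0 fa_const_1)
 have zero: "0 : Sp" using Sp_lin[OF one(1,1), of "-1"] by (simp add: fa_const_uminus fa_const_1)
 have sc: "fa_const z * p : Sp" if "p : Sp" for z p using Sp_lin[OF that zero] by simp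
 have L: "Ap n = L3 u (- 1 / u) (- hh)" "Am n = L3 (1 / u) (- u) hh" "L3 a b (qp n - qp (- n)) = L3 a b Dl"
  by (simp_all add: Ap_def Am_def Dl_def u u_def[symmetric] divide_inverse)
 have P: "L3 1 (-1) 0 : Sp"
 proof -
  have "fa_const (1 / (u + 1 / u)) * (fa_const 1 * Ap n + Am n) = L3 1 (-1) 0"
  proof -
   have "1 / (u + 1 / u) * (1 * u + 1 / u) = 1" "1 / (u + 1 / u) * (1 * - hh + hh) = 0" using pos(1) by simp_all
   moreover have "1 / (u + 1 / u) * (1 * (- 1 / u) + - u) = - 1" using pos(1) by (simp add: divide_eq_eq)
   ultimately show ?thesis unfolding L L3_lin by (simp only:)
  qed
  thus ?thesis using sc[OF Sp_lin[OF one(1,2)]] by metis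
 qed
 have HZ: "L3 (- Dl) 0 hh : Sp"
 proof -
  have "fa_const (-1) * Ap n + fa_const (1 / u) * L3 1 (-1) 0 = L3 (- Dl) 0 hh"
   unfolding L L3_lin by (simp add: Dl_def add.commute)
  thus ?thesis using Sp_lin[OF one(1) sc[OF P]] by metis
 qed
 have X: "L3 1 0 0 : Sp"
 proof -
  have "hh * a + (hh * b * 1 + - Dl * - Dl) = hh * (a + b) + Dl * Dl" by (simp add: distrib_left)
  hence 1: "1 / (hh * hh + Dl * Dl) * (hh * a + (hh * b * 1 + - Dl * - Dl)) = 1" using d unfolding ab by simp
  have 2: "1 / (hh * hh + Dl * Dl) * (hh * b + (hh * b * - 1 + - Dl * 0)) = 0"
   "1 / (hh * hh + Dl * Dl) * (hh * Dl + (hh * b * 0 + - Dl * hh)) = 0" by simp_all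
  have "fa_const (1 / (hh * hh + Dl * Dl)) * (fa_const hh * L3 a b Dl + (fa_const (hh * b) * L3 1 (-1) 0 + fa_const (- Dl) * L3 (- Dl) 0 hh)) = L3 1 0 0"
   unfolding L3_lin 1 2 ..
  thus ?thesis using sc[OF Sp_lin[OF one(3) Sp_lin[OF P sc[OF HZ]]]] unfolding L(3) by metis
 qed
 have Y: "L3 0 1 0 : Sp"
  using Sp_lin[OF P X, of "-1"] by (simp add: L3_lin)
 have Z: "L3 0 0 1 : Sp"
 proof -
  have "fa_const (1 / hh) * (fa_const Dl * L3 1 0 0 + L3 (- Dl) 0 hh) = L3 0 0 1"
   unfolding L3_lin using pos(2) by (simp add: divide_inverse)
  thus ?thesis using sc[OF Sp_lin[OF X HZ]] by metis
 qed
 have "U : Sp" using assms X Y Z by (auto simp: L3_def fa_const_0 fa_const_1)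
 thus ?thesis by (simp add: Sp_def)
qed

lemma Om_On:
 assumes "Wl n x" shows "Om * x ~~ On n * x"
proof (rule eqvI)
 have x: "x : gS" using assms WlD by blast
 thus "Om * x : gS" "On n * x : gS" by (auto intro: S_closed)
 fix F assume F: "F : FF"
 have e: "(cq - inverse cq) * nu n = qp n - qp (- n)"
  using cq_diff_ne0 by (simp add: nu_eq hq_def qp_minus)
 have "F (Om * x) = inverse cq * F (gX * x) + cq * F (gY * x) + (cq - inverse cq) * F (gZ * (gt * x))"
  using FF_lin[OF F] by (simp add: Om_def distrib_right linD mult.assoc)
 also have "F (gZ * (gt * x)) = nu n * F (gZ * x)" by (rule WlD2[OF assms F]) simp
 finally show "F (Om * x) = F (On n * x)"
  by (simp add: On_def F_L3[OF F] e[symmetric] mult.assoc)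
qed

text \<open>The relations of the quantum sphere, in terms of weight shifting combinations.\<close>

lemma sphere_identities:
 assumes x: "x : gS"
 shows "On (n + 2) * (Ap n * x) ~~ Ap n * (On n * x)"
  "On (n - 2) * (Am n * x) ~~ Am n * (On n * x)"
  "Am (n + 2) * (Ap n * x) ~~ On n * (On n * x) - fa_const ((qp (n + 1) + qp (- n - 1)) ^ 2) * x"
  "Ap (n - 2) * (Am n * x) ~~ On n * (On n * x) - fa_const ((qp (n - 1) + qp (1 - n)) ^ 2) * x"
proof -
 define u where "u = qp n"
 have ne: "u ~= 0" by (simp add: u_def)
 note nn = q_rational(5) q_rational(4,6-16)[of n, folded u_def] u_def[symmetric]
 have FL: "F (L3 a b c * (L3 a' b' c' * x)) = a * a' * F (gX * (gX * x)) + b * b' * F (gY * (gY * x))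
  + (a * c' * cq * cq + c * a') * F (gZ * (gX * x)) + (c * b' * cq * cq + b * c') * F (gY * (gZ * x))
  + (c * c' - a * b' * cq * cq - b * a' / (cq * cq)) * F (gZ * (gZ * x)) + (a * b' + b * a') * F x"
  if "F : FF" for F a b c a' b' c'
  by (simp add: F_L3[OF that] podles_rels[OF that x]) (simp add: algebra_simps add_divide_distrib)
 note st = x S_closed L3_S
 show "On (n + 2) * (Ap n * x) ~~ Ap n * (On n * x)"
  by (rule eqvI, intro S_closed L3_S x, intro S_closed L3_S x,
   use ne q_rational(3) in "simp add: On_def Ap_def FL nn; simp add: divide_simps ne power2_eq_square; simp add: algebra_simps")
 show "On (n - 2) * (Am n * x) ~~ Am n * (On n * x)"
  by (rule eqvI, intro S_closed L3_S x, intro S_closed L3_S x,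
   use ne q_rational(3) in "simp add: On_def Am_def FL nn; simp add: divide_simps ne power2_eq_square; simp add: algebra_simps")
 show "Am (n + 2) * (Ap n * x) ~~ On n * (On n * x) - fa_const ((qp (n + 1) + qp (- n - 1)) ^ 2) * x"
  by (rule eqvI, intro S_closed L3_S x, intro S_closed L3_S x,
   use ne q_rational(3) in "simp add: On_def Am_def Ap_def FL nn linD[OF FF_lin]; simp add: divide_simps ne power2_eq_square; simp add: algebra_simps")
 show "Ap (n - 2) * (Am n * x) ~~ On n * (On n * x) - fa_const ((qp (n - 1) + qp (1 - n)) ^ 2) * x"
  by (rule eqvI, intro S_closed L3_S x, intro S_closed L3_S x,
   use ne q_rational(3) in "simp add: On_def Am_def Ap_def FL nn linD[OF FF_lin]; simp add: divide_simps ne power2_eq_square; simp add: algebra_simps")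
qed

lemma Om_commute:
 assumes "Wl n x"
 shows "Om * (Ap n * x) ~~ Ap n * (Om * x)" "Om * (Am n * x) ~~ Am n * (Om * x)" "Wl n (Om * x)"
  "Am (n + 2) * (Ap n * x) ~~ Om * (Om * x) - fa_const ((qp (n + 1) + qp (- n - 1)) ^ 2) * x"
  "Ap (n - 2) * (Am n * x) ~~ Om * (Om * x) - fa_const ((qp (n - 1) + qp (1 - n)) ^ 2) * x"
proof -
 have x: "x : gS" using assms WlD by blast
 note O = Om_On[OF assms]
 note si = sphere_identities[OF x]
 note sh = weight_shift[OF assms]
 have A: "a * (On n * x) ~~ a * (Om * x)" if "a : gS" for a by (rule eqv_multl[OF eqv_sym[OF O] that])
 show "Om * (Ap n * x) ~~ Ap n * (Om * x)"
  by (rule eqv_trans[OF Om_On[OF sh(1)] eqv_trans[OF si(1) A]]) simp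
 show "Om * (Am n * x) ~~ Am n * (Om * x)"
  by (rule eqv_trans[OF Om_On[OF sh(2)] eqv_trans[OF si(2) A]]) simp
 show W: "Wl n (Om * x)" by (rule Wl_eqv[OF sh(3) eqv_sym[OF O]])
 have OO: "On n * (On n * x) ~~ Om * (Om * x)"
  by (rule eqv_trans[OF A eqv_sym[OF Om_On[OF W]]]) simp
 have D: "y - z ~~ y' - z" if "y ~~ y'" "z : gS" for y y' z
  using eqv_add[OF that(1) eqv_refl[of "- z"]] that(2) S_closed(3) by simp
 show "Am (n + 2) * (Ap n * x) ~~ Om * (Om * x) - fa_const ((qp (n + 1) + qp (- n - 1)) ^ 2) * x"
  by (rule eqv_trans[OF si(3) D[OF OO]]) (intro S_closed x)
 show "Ap (n - 2) * (Am n * x) ~~ Om * (Om * x) - fa_const ((qp (n - 1) + qp (1 - n)) ^ 2) * x"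
  by (rule eqv_trans[OF si(4) D[OF OO]]) (intro S_closed x)
qed

section \<open>The left ideals generated by the idempotents\<close>

fun upE :: "int => nat => nat => ggen fa" where
 "upE n 0 i = Om ^ i * ge n"
| "upE n (Suc k) i = Ap (n + 2 * int k) * upE n k i"

fun dnE :: "int => nat => nat => ggen fa" where
 "dnE n 0 i = Om ^ i * ge n"
| "dnE n (Suc k) i = Am (n - 2 * int k) * dnE n k i"

lemma upE_weight: "Wl (n + 2 * int k) (upE n k i)"
proof (induction k)
 case 0
 have "Wl n (Om ^ i * ge n)" by (induction i) (use Om_commute(3) in "auto simp: Wl_ge mult.assoc")
 thus ?case by simp
next
 case (Suc k)
 thus ?case using weight_shift(1)[OF Suc] by (simp add: algebra_simps)
qed

lemma dnE_weight: "Wl (n - 2 * int k) (dnE n k i)"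
proof (induction k)
 case 0
 show ?case using upE_weight[of n 0 i] by simp
next
 case (Suc k)
 thus ?case using weight_shift(2)[OF Suc] by (simp add: algebra_simps)
qed

lemma upE_S: "upE n k i : gS" "dnE n k i : gS"
 using upE_weight dnE_weight WlD by blast+

lemma Om_upE: "Om * upE n k i ~~ upE n k (Suc i)"
proof (induction k)
 case 0
 show ?case by (simp add: mult.assoc) (intro eqv_refl S_closed L3_S XYZ_S)
next
 case (Suc k)
 have "Om * upE n (Suc k) i ~~ Ap (n + 2 * int k) * (Om * upE n k i)"
  using Om_commute(1)[OF upE_weight] by simp
 also have "... ~~ upE n (Suc k) (Suc i)" using eqv_multl[OF Suc L3_S(2)] by simp
 finally show ?case .
qed

lemma Om_dnE: "Om * dnE n k i ~~ dnE n k (Suc i)"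
proof (induction k)
 case 0
 show ?case by (simp add: mult.assoc) (intro eqv_refl S_closed L3_S XYZ_S)
next
 case (Suc k)
 have "Om * dnE n (Suc k) i ~~ Am (n - 2 * int k) * (Om * dnE n k i)"
  using Om_commute(2)[OF dnE_weight] by simp
 also have "... ~~ dnE n (Suc k) (Suc i)" using eqv_multl[OF Suc L3_S(3)] by simp
 finally show ?case .
qed

text \<open>\<open>MM n\<close> is the left ideal generated by $e_n$, described by spanning elements.\<close>

inductive_set MM :: "int => ggen fa set" for n where
 zero: "0 : MM n"
| up: "upE n k i : MM n"
| dn: "dnE n k i : MM n"
| comb: "x : MM n ==> y : MM n ==> fa_const c * x + y : MM n"
| eqv: "x : MM n ==> x ~~ y ==> y : MM n"

lemma MM_S: "x : MM n ==> x : gS"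
 by (induction rule: MM.induct) (auto intro: S_closed upE_S eqv_S)

lemma MM_add: "x : MM n ==> y : MM n ==> x + y : MM n"
 using MM.comb[of x n y 1] by (simp add: fa_const_1)

lemma MM_scale: "x : MM n ==> fa_const c * x : MM n"
 using MM.comb[OF _ MM.zero, of x n c] by simp

lemma MM_closed_by_basis:
 assumes b: "b : gS" and "!!k i. b * upE n k i : MM n" "!!k i. b * dnE n k i : MM n" and x: "x : MM n"
 shows "b * x : MM n"
 using x
proof (induction rule: MM.induct)
 case (comb x y c)
 thus ?case using MM.comb[of "b * x" n "b * y" c] by (simp add: distrib_left fa_const_left_commute)
next
 case (eqv x y)
 show ?case by (rule MM.eqv[OF eqv.IH eqv_multl[OF eqv.hyps(2) b]])
qed (use assms MM.zero in auto)

lemma shifts_in_MM: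
 "Ap (n + 2 * int k) * upE n k i : MM n" "Am (n + 2 * int k) * upE n k i : MM n" "On (n + 2 * int k) * upE n k i : MM n"
 "Ap (n - 2 * int k) * dnE n k i : MM n" "Am (n - 2 * int k) * dnE n k i : MM n" "On (n - 2 * int k) * dnE n k i : MM n"
proof -
 have O: "Om * upE n k i : MM n" "Om * dnE n k i : MM n" for k i
  using MM.eqv[OF MM.up eqv_sym[OF Om_upE]] MM.eqv[OF MM.dn eqv_sym[OF Om_dnE]] by auto
 have OO: "Om * (Om * upE n k i) : MM n" "Om * (Om * dnE n k i) : MM n" for k i
  using MM.eqv[OF O(1) eqv_multl[OF eqv_sym[OF Om_upE]]] MM.eqv[OF O(2) eqv_multl[OF eqv_sym[OF Om_dnE]]] by auto
 have sub: "y - fa_const c * z : MM n" if "y : MM n" "z : MM n" for y z c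
  using MM.comb[OF that(2,1), of "- c"] by (simp add: fa_const_uminus)
 show "Ap (n + 2 * int k) * upE n k i : MM n" using MM.up[of n "Suc k" i] by simp
 show "Am (n - 2 * int k) * dnE n k i : MM n" using MM.dn[of n "Suc k" i] by simp
 show "On (n + 2 * int k) * upE n k i : MM n" "On (n - 2 * int k) * dnE n k i : MM n"
  using MM.eqv[OF O(1) Om_On[OF upE_weight]] MM.eqv[OF O(2) Om_On[OF dnE_weight]] by auto
 show "Am (n + 2 * int k) * upE n k i : MM n"
 proof (cases k)
  case 0
  thus ?thesis using MM.dn[of n "Suc 0" i] by simp
 next
  case (Suc l)
  have "Am (n + 2 * int l + 2) * (Ap (n + 2 * int l) * upE n l i) : MM n"
   by (rule MM.eqv[OF _ eqv_sym[OF Om_commute(4)[OF upE_weight]]], rule sub[OF OO(1) MM.up])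
  thus ?thesis by (simp add: Suc algebra_simps)
 qed
 show "Ap (n - 2 * int k) * dnE n k i : MM n"
 proof (cases k)
  case 0
  thus ?thesis using MM.up[of n "Suc 0" i] by simp
 next
  case (Suc l)
  have "Ap (n - 2 * int l - 2) * (Am (n - 2 * int l) * dnE n l i) : MM n"
   by (rule MM.eqv[OF _ eqv_sym[OF Om_commute(5)[OF dnE_weight]]], rule sub[OF OO(2) MM.dn])
  thus ?thesis by (simp add: Suc algebra_simps)
 qed
qed

lemma MM_XYZ:
 assumes "U : {gX, gY, gZ}" "x : MM n"
 shows "U * x : MM n"
proof (rule MM_closed_by_basis[OF _ _ _ assms(2)])
 show "U : gS" using assms(1) by auto
 fix k i
 have c: "(fa_const x1 * a + fa_const x2 * b + fa_const x3 * c) * y : MM n"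
  if "a * y : MM n" "b * y : MM n" "c * y : MM n" for x1 x2 x3 a b c y
  using that by (simp add: distrib_right mult.assoc MM_add MM_scale)
 show "U * upE n k i : MM n"
  using XYZ_decompose[OF assms(1), of "inverse cq" cq "n + 2 * int k"] c shifts_in_MM(1-3)[of n k i] by (fastforce simp: On_def)
 show "U * dnE n k i : MM n"
  using XYZ_decompose[OF assms(1), of "inverse cq" cq "n - 2 * int k"] c shifts_in_MM(4-6)[of n k i] by (fastforce simp: On_def)
qed

lemma OKU_induct [consumes 1, case_names zero one comb mX mY mZ]:
 assumes "y : KU" "P (%a. 0)" "P counit"
  "!!f g c. f : KU ==> g : KU ==> P f ==> P g ==> P (%a. c * f a + g a)"
  "!!f. f : KU ==> P f ==> P (omult oXX f)"
  "!!f. f : KU ==> P f ==> P (omult oYY f)"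
  "!!f. f : KU ==> P f ==> P (omult oZZ f)"
 shows "P y"
 using OKU_PA[OF assms(1)] by (induction rule: PA.induct) (auto intro: assms PA_OKU)

text \<open>Induction over generators, as $X$, $Y$, $Z$ generate $\mathcal O_q(K\backslash U)$.\<close>

lemma gS_induct [consumes 1, case_names eqv scale add mult D X Y Z]:
 assumes b: "b : gS" and eqv: "!!x y. P x ==> x ~~ y ==> P y"
  and scale: "!!c x. x : gS ==> P x ==> P (fa_const c * x)"
  and add: "!!x y. x : gS ==> y : gS ==> P x ==> P y ==> P (x + y)"
  and mult: "!!x y. x : gS ==> y : gS ==> P x ==> P y ==> P (x * y)"
  and D: "!!c. P (gD c)" and X: "P gX" and Y: "P gY" and Z: "P gZ"
 shows "P b"
proof -
 have one: "P 1" by (rule eqv[OF D gD_rels(1)])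
 have y: "P (gy y)" if "y : KU" for y
  using that
 proof (induction rule: OKU_induct)
  case zero
  show ?case by (rule eqv[OF _ eqv_sym[OF gy_zero]]) (use scale[OF _ one, of 0] S_closed in "simp add: fa_const_0")
 next
  case one
  show ?case by (rule eqv[OF `P 1` eqv_sym[OF gy_rels(1)]])
 next
  case (comb f g c)
  show ?case by (rule eqv[OF _ eqv_sym[OF gy_rels(3)]]) (use comb in "auto intro!: add scale S_closed")
 next
  case (mX f)
  show ?case by (rule eqv[OF _ eqv_sym[OF gy_rels(2)]]) (use mX X XYZ_OKU in "auto intro!: mult S_closed")
 next
  case (mY f)
  show ?case by (rule eqv[OF _ eqv_sym[OF gy_rels(2)]]) (use mY Y XYZ_OKU in "auto intro!: mult S_closed")
 next
  case (mZ f)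
  show ?case by (rule eqv[OF _ eqv_sym[OF gy_rels(2)]]) (use mZ Z XYZ_OKU in "auto intro!: mult S_closed")
 qed
 show ?thesis
  using b
 proof (induction rule: free_ring_induct)
  case (gen g x)
  hence "P (fa_gen g)" using D y by (auto simp: G_gens_def OpK_eq)
  moreover have "fa_gen g : gS" using gen by (intro S_closed)
  ultimately show ?case using gen mult by blast
 qed (use one scale add in auto)
qed

lemma MM_mult: "b : gS ==> ALL x:MM n. b * x : MM n"
proof (induction rule: gS_induct)
 case (eqv x y)
 show ?case
 proof
  fix z assume z: "z : MM n"
  show "y * z : MM n" by (rule MM.eqv[OF bspec[OF eqv(1) z] eqv_multr[OF eqv(2) MM_S[OF z]]])
 qed
next
 case (D c)
 have "gD c * y : MM n" if "Wl m y" "y : MM n" for m y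
  by (rule MM.eqv[OF MM_scale[OF that(2)] eqv_sym[OF gD_on_weight[OF that(1)]]])
 note W = this
 show ?case
 proof
  fix x assume "x : MM n"
  thus "gD c * x : MM n"
   by (rule MM_closed_by_basis[OF gD_S W[OF upE_weight MM.up] W[OF dnE_weight MM.dn]])
 qed
next
 case (scale c x)
 thus ?case by (simp add: mult.assoc MM_scale)
next
 case (add x y)
 thus ?case by (simp add: distrib_right MM_add)
next
 case (mult x y)
 thus ?case by (simp add: mult.assoc)
qed (use MM_XYZ in auto)

lemma MM_ge: "b : gS ==> b * ge n : MM n"
 using MM_mult[of b n] MM.up[of n 0 0] by simp

definition eset :: "int set => ggen fa" where "eset M = gD (%m. if m : M then 1 else 0)"

lemma eset_S [simp]: "eset M : gS" by (simp add: eset_def gD_S)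

lemma eset_weight: "Wl m x ==> m : M ==> eset M * x ~~ x"
 unfolding eset_def using gD_on_weight[of m x "%m. if m : M then 1 else 0"] by (simp add: fa_const_1)

lemma eset_weight_right: "Wr m x ==> m : M ==> x * eset M ~~ x"
 unfolding eset_def using gD_on_weight_right[of m x "%m. if m : M then 1 else 0"] by (simp add: fa_const_1)

lemma eset_subset: "M <= N ==> eset M * eset N ~~ eset M" "M <= N ==> eset N * eset M ~~ eset M"
proof -
 assume "M <= N"
 hence "(%m. (if m : M then 1 else 0) * (if m : N then 1 else 0)) = (%m. if m : M then 1 else (0::complex))"
  "(%m. (if m : N then 1 else 0) * (if m : M then 1 else 0)) = (%m. if m : M then 1 else (0::complex))" by (auto simp: fun_eq_iff)
 thus "eset M * eset N ~~ eset M" "eset N * eset M ~~ eset M"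
  unfolding eset_def using gD_rels(2)[of "%m. if m : M then 1 else 0" "%m. if m : N then 1 else 0"]
   gD_rels(2)[of "%m. if m : N then 1 else 0" "%m. if m : M then 1 else 0"] by simp_all
qed

lemma eset_left_mono:
 assumes "eset M * x ~~ x" "M <= N" shows "eset N * x ~~ x"
proof -
 have x: "x : gS" using assms eqv_S by blast
 have "eset N * x ~~ eset N * (eset M * x)" by (rule eqv_multl[OF eqv_sym[OF assms(1)]]) simp
 also have "... ~~ eset M * x" using eqv_multr[OF eset_subset(2)[OF assms(2)] x] by (simp add: mult.assoc)
 also note assms(1)
 finally show ?thesis .
qed

lemma eset_right_mono:
 assumes "x * eset M ~~ x" "M <= N" shows "x * eset N ~~ x"
proof -
 have x: "x : gS" using assms eqv_S by blast
 have "x * eset N ~~ (x * eset M) * eset N" by (rule eqv_multr[OF eqv_sym[OF assms(1)]]) simp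
 also have "... ~~ x * eset M" using eqv_multl[OF eset_subset(1)[OF assms(2)] x] by (simp add: mult.assoc)
 also note assms(1)
 finally show ?thesis .
qed

lemma MM_eset: "x : MM n ==> EX M. finite M & eset M * x ~~ x"
proof (induction rule: MM.induct)
 case zero
 show ?case by (rule exI[of _ "{}"]) (simp add: eqv_refl S_closed)
next
 case (up k i)
 show ?case by (rule exI[of _ "{n + 2 * int k}"]) (simp add: eset_weight[OF upE_weight])
next
 case (dn k i)
 show ?case by (rule exI[of _ "{n - 2 * int k}"]) (simp add: eset_weight[OF dnE_weight])
next
 case (comb x y c)
 then obtain M N where M: "finite M" "eset M * x ~~ x" and N: "finite N" "eset N * y ~~ y" by blast
 have "eset (M \<union> N) * x ~~ x" "eset (M \<union> N) * y ~~ y"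
  using eset_left_mono[OF M(2)] eset_left_mono[OF N(2)] by auto
 from eqv_add[OF eqv_scale[OF this(1), of c] this(2)]
 have "eset (M \<union> N) * (fa_const c * x + y) ~~ fa_const c * x + y" by (simp add: distrib_left fa_const_left_commute)
 thus ?case using M(1) N(1) by blast
next
 case (eqv x y)
 then obtain M where "finite M" "eset M * x ~~ x" by blast
 moreover have "eset M * y ~~ y"
  by (rule eqv_trans[OF eqv_multl[OF eqv_sym[OF eqv.hyps(2)]] eqv_trans[OF `eset M * x ~~ x` eqv.hyps(2)]]) simp
 ultimately show ?case by blast
qed

text \<open>The corner \<^term>\<open>ge n\<close>$\,\mathcal O'_q(G)\,$\<^term>\<open>ge n\<close> consists of polynomials in the Casimir element.\<close>

definition pol :: "complex poly => ggen fa" where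
 "pol p = (\<Sum>i\<le>Polynomial.degree p. fa_const (Polynomial.coeff p i) * Om ^ i)"

lemma pol_bound: "Polynomial.degree p <= N ==> pol p = (\<Sum>i\<le>N. fa_const (Polynomial.coeff p i) * Om ^ i)"
 unfolding pol_def by (rule sum.mono_neutral_left) (auto simp: coeff_eq_0 fa_const_0)

lemma pol_S [simp]: "pol p : gS" unfolding pol_def by (intro S_closed L3_S)

lemma pol_comb: "pol (Polynomial.smult c p + r) = fa_const c * pol p + pol r"
proof -
 let ?N = "max (Polynomial.degree p) (Polynomial.degree r)"
 have "Polynomial.degree (Polynomial.smult c p + r) <= ?N"
  by (rule order.trans[OF degree_add_le_max]) (auto intro: max.coboundedI1 order.trans[OF degree_smult_le])
 thus ?thesis
  by (simp add: pol_bound[of _ ?N] sum_distrib_left sum.distrib fa_const_add fa_const_mult distrib_right mult.assoc)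
qed

lemma pol_simps: "pol 0 = 0" "pol (Polynomial.monom 1 i) = Om ^ i" "pol 1 = 1"
proof -
 show "pol 0 = 0" by (simp add: pol_def fa_const_0)
 have "pol (Polynomial.monom 1 i) = (\<Sum>j\<le>i. fa_const (Polynomial.coeff (Polynomial.monom 1 i) j) * Om ^ j)"
  by (rule pol_bound) (simp add: degree_monom_eq)
 also have "... = (\<Sum>j\<le>i. if j = i then Om ^ i else 0)"
  by (rule sum.cong) (auto simp: fa_const_0 fa_const_1)
 finally show "pol (Polynomial.monom 1 i) = Om ^ i" by (simp add: sum.delta)
 show "pol 1 = 1" by (simp add: pol_def fa_const_1)
qed

lemma pol_pCons: "pol (pCons c p) = fa_const c + Om * pol p"
proof -
 have "pol (pCons c p) = (\<Sum>i\<le>Suc (Polynomial.degree p). fa_const (Polynomial.coeff (pCons c p) i) * Om ^ i)"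
  by (rule pol_bound) (simp add: degree_pCons_le)
 also have "... = fa_const c + (\<Sum>i\<le>Polynomial.degree p. fa_const (Polynomial.coeff p i) * Om ^ Suc i)"
  by (subst sum.atMost_Suc_shift) simp
 finally show ?thesis by (simp add: pol_def sum_distrib_left fa_const_left_commute)
qed

text \<open>Weights leave only the powers of the Casimir element among the spanning elements.\<close>

lemma corner: "x : MM n ==> EX p. ge n * x ~~ pol p * ge n"
proof (induction rule: MM.induct)
 case zero
 show ?case by (rule exI[of _ 0]) (simp add: pol_simps eqv_refl S_closed)
next
 case (up k i)
 show ?case
 proof (cases k)
  case 0
  thus ?thesis using ge_on_weight[OF upE_weight, of n 0 i]
   by (intro exI[of _ "Polynomial.monom 1 i"]) (simp add: pol_simps)
 next
  case (Suc l)
  have "ge n * upE n k i ~~ fa_const (dl n (n + 2 * int k)) * upE n k i" by (rule gD_on_weight[OF upE_weight])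
  thus ?thesis by (intro exI[of _ 0]) (simp add: dl_def Suc pol_simps fa_const_0)
 qed
next
 case (dn k i)
 show ?case
 proof (cases k)
  case 0
  thus ?thesis using ge_on_weight[OF upE_weight, of n 0 i]
   by (intro exI[of _ "Polynomial.monom 1 i"]) (simp add: pol_simps)
 next
  case (Suc l)
  have "ge n * dnE n k i ~~ fa_const (dl n (n - 2 * int k)) * dnE n k i" by (rule gD_on_weight[OF dnE_weight])
  thus ?thesis by (intro exI[of _ 0]) (simp add: dl_def Suc pol_simps fa_const_0)
 qed
next
 case (comb x y c)
 then obtain p r where "ge n * x ~~ pol p * ge n" "ge n * y ~~ pol r * ge n" by blast
 from eqv_add[OF eqv_scale[OF this(1), of c] this(2)]
 have "ge n * (fa_const c * x + y) ~~ pol (Polynomial.smult c p + r) * ge n"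
  by (simp add: pol_comb distrib_left distrib_right fa_const_left_commute mult.assoc)
 thus ?case by blast
next
 case (eqv x y)
 thus ?case using eqv_trans[OF eqv_multl[OF eqv_sym[OF eqv.hyps(2)]]] XYZ_S(5) by blast
qed

text \<open>Sums of right weight vectors. They form a right ideal, which provides local units on the right.\<close>

inductive_set NN :: "ggen fa set" where
 zero: "0 : NN"
| wt: "Wr m x ==> x : NN"
| comb: "x : NN ==> y : NN ==> fa_const c * x + y : NN"
| eqv: "x : NN ==> x ~~ y ==> y : NN"

lemma NN_S: "x : NN ==> x : gS"
 by (induction rule: NN.induct) (auto intro: S_closed WrD eqv_S)

lemma NN_add: "x : NN ==> y : NN ==> x + y : NN" using NN.comb[of x y 1] by (simp add: fa_const_1)
lemma NN_scale: "x : NN ==> fa_const c * x : NN" using NN.comb[OF _ NN.zero, of x c] by simp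

lemma NN_closed_by_basis:
 assumes b: "b : gS" and "!!m x. Wr m x ==> x * b : NN" and x: "x : NN"
 shows "x * b : NN"
 using x
proof (induction rule: NN.induct)
 case (comb x y c)
 thus ?case using NN.comb[of "x * b" "y * b" c] by (simp add: distrib_right mult.assoc)
next
 case (eqv x y)
 show ?case by (rule NN.eqv[OF eqv.IH eqv_multr[OF eqv.hyps(2) b]])
qed (use assms NN.zero in auto)

lemma NN_XYZ:
 assumes "U : {gX, gY, gZ}" "x : NN" shows "x * U : NN"
proof (rule NN_closed_by_basis[OF _ _ assms(2)])
 show "U : gS" using assms(1) by auto
 fix m x assume W: "Wr m x"
 obtain x1 x2 x3 where U: "U = fa_const x1 * Ap m + fa_const x2 * Am m + fa_const x3 * Onr m"
  using XYZ_decompose[OF assms(1), of cq "inverse cq" m] unfolding Onr_def by blast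
 have "x * Ap m : NN" "x * Am m : NN" "x * Onr m : NN"
  using weight_shift_right[OF W] NN.wt by blast+
 thus "x * U : NN" unfolding U by (simp add: distrib_left fa_const_left_commute NN_add NN_scale)
qed

lemma NN_mult: "b : gS ==> ALL x:NN. x * b : NN"
proof (induction rule: gS_induct)
 case (eqv x y)
 show ?case
 proof
  fix z assume z: "z : NN"
  show "z * y : NN" by (rule NN.eqv[OF bspec[OF eqv(1) z] eqv_multl[OF eqv(2) NN_S[OF z]]])
 qed
next
 case (D c)
 have "y * gD c : NN" if "Wr m y" for m y
  by (rule NN.eqv[OF NN_scale[OF NN.wt[OF that]] eqv_sym[OF gD_on_weight_right[OF that]]])
 note W = this
 show ?case
 proof
  fix x assume x: "x : NN"
  show "x * gD c : NN"
   by (rule NN_closed_by_basis[OF gD_S _ x]) (rule W)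
 qed
next
 case (scale c x)
 thus ?case by (simp add: fa_const_left_commute NN_scale)
next
 case (add x y)
 thus ?case by (simp add: distrib_left NN_add)
next
 case (mult x y)
 thus ?case by (simp flip: mult.assoc)
qed (use NN_XYZ in auto)

lemma NN_eset: "x : NN ==> EX M. finite M & x * eset M ~~ x"
proof (induction rule: NN.induct)
 case zero
 show ?case by (rule exI[of _ "{}"]) (simp add: eqv_refl S_closed)
next
 case (wt m x)
 thus ?case by (intro exI[of _ "{m}"]) (simp add: eset_weight_right)
next
 case (comb x y c)
 then obtain M N where M: "finite M" "x * eset M ~~ x" and N: "finite N" "y * eset N ~~ y" by blast
 have "x * eset (M \<union> N) ~~ x" "y * eset (M \<union> N) ~~ y"
  using eset_right_mono[OF M(2)] eset_right_mono[OF N(2)] by auto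
 from eqv_add[OF eqv_scale[OF this(1), of c] this(2)]
 have "(fa_const c * x + y) * eset (M \<union> N) ~~ fa_const c * x + y" by (simp add: distrib_right mult.assoc)
 thus ?case using M(1) N(1) by blast
next
 case (eqv x y)
 then obtain M where "finite M" "x * eset M ~~ x" by blast
 moreover have "y * eset M ~~ y"
  by (rule eqv_trans[OF eqv_multr[OF eqv_sym[OF eqv.hyps(2)]] eqv_trans[OF `x * eset M ~~ x` eqv.hyps(2)]]) simp
 ultimately show ?case by blast
qed
section \<open>The quotient ring and the ideal $R_q(\mathfrak g,K)$\<close>

abbreviation GR :: "gq ring" where "GR \<equiv> OpG q s"
abbreviation gr_mult (infixl "[.]" 70) where "a [.] b \<equiv> mult GR a b"
abbreviation gr_add (infixl "[++]" 65) where "a [++] b \<equiv> add GR a b"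
abbreviation cl :: "ggen fa => gq" where "cl \<equiv> g_cls q s"

lemma cl_hom: "cl : Ring.ring_hom FR GR"
proof -
 interpret ideal gI FR by (rule ideal_gI)
 show ?thesis using rcos_ring_hom by (simp add: OpG_def g_cls_def[abs_def])
qed

lemma ring_GR: "ring GR"
proof -
 interpret ideal gI FR by (rule ideal_gI)
 show ?thesis unfolding OpG_def by (rule quotient_is_ring)
qed

lemma cl_ops:
 "x : gS ==> y : gS ==> cl x [.] cl y = cl (x * y)"
 "x : gS ==> y : gS ==> cl x [++] cl y = cl (x + y)"
 "\<one>\<^bsub>GR\<^esub> = cl 1" "x : gS ==> cl x : carrier GR"
 using ring_hom_mult[OF cl_hom, of x y] ring_hom_add[OF cl_hom, of x y] ring_hom_one[OF cl_hom] ring_hom_closed[OF cl_hom, of x]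
 by simp_all

lemma cl_eq: "x : gS ==> y : gS ==> cl x = cl y <-> x ~~ y"
 using ring.quotient_eq_iff_same_a_r_cos[OF ring_free_ring ideal_gI, of x y] free_ring_a_minus[of x "G_gens q s" y]
 by (auto simp: eqv_def g_cls_def)

lemma eqv_cl: "x ~~ y ==> cl x = cl y"
 using cl_eq eqv_S by blast

lemma carrier_GR: "carrier GR = cl ` gS"
 by (auto simp: OpG_def FactRing_def A_RCOSETS_def' g_cls_def)

lemma zero_GR: "\<zero>\<^bsub>GR\<^esub> = cl 0"
proof -
 interpret ring GR by (rule ring_GR)
 have "cl 0 [++] cl 0 = cl 0" using S_closed(5) by (simp add: cl_ops)
 thus ?thesis using S_closed(5) cl_ops(4) by (metis add.l_cancel_one' zero_closed)
qed

lemma minus_GR: "x : gS ==> \<ominus>\<^bsub>GR\<^esub> cl x = cl (- x)"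
proof -
 interpret ring GR by (rule ring_GR)
 assume x: "x : gS"
 show ?thesis
  by (rule minus_equality) (use x S_closed(3)[OF x] in "auto simp: cl_ops zero_GR")
qed

lemma g_scale_cl: "x : gS ==> g_scale q s c (cl x) = cl (fa_const c * x)"
 by (simp add: g_scale_def g_const_def cl_ops S_closed)

lemma inK_D: "inK q s (D c) = cl (gD c)" by (simp add: inK_def)

lemma inK_e: "inK q s (idem_e q s n) = cl (ge n)" by (simp add: inK_def idem_e_D)

text \<open>Representatives of the elements of $R_q(\mathfrak g,K)$: those fixed on the right by a finite sum of
  the $e_n$.\<close>

definition KS :: "ggen fa set" where
 "KS = {p : gS. EX M. finite M & p * eset M ~~ p}"

lemma KS_S: "p : KS ==> p : gS" by (simp add: KS_def)

lemma eset_insert: "m ~: M ==> eset (insert m M) ~~ ge m + eset M"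
proof -
 assume "m ~: M"
 hence "(%k. if k : insert m M then 1 else 0) = (%k. 1 * dl m k + (if k : M then 1 else 0))"
  by (auto simp: dl_def)
 thus ?thesis using gD_rels(3)[of 1 "dl m" "%k. if k : M then 1 else 0"] by (simp add: eset_def fa_const_1)
qed

lemma eset_empty: "eset {} ~~ 0" using gD_zero by (simp add: eset_def)

lemma eset_single: "eset {n} = ge n"
proof -
 have "(%m. if m : {n} then 1 else 0) = dl n" by (auto simp: dl_def)
 thus ?thesis by (simp add: eset_def)
qed

lemma eset_NN: "finite M ==> eset M : NN"
proof (induction M rule: finite_induct)
 case empty
 show ?case by (rule NN.eqv[OF NN.zero eqv_sym[OF eset_empty]])
next
 case (insert m M)
 show ?case by (rule NN.eqv[OF NN_add[OF NN.wt[OF Wr_ge] insert.IH] eqv_sym[OF eset_insert[OF insert.hyps(2)]]])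
qed

lemma left_fixed: "finite M ==> b : gS ==> EX N. finite N & eset N * (b * eset M) ~~ b * eset M"
proof (induction M rule: finite_induct)
 case empty
 have 1: "b * eset {} ~~ 0" using eqv_multl[OF eset_empty empty] by simp
 have 2: "eset {} * (b * eset {}) ~~ 0" using eqv_multl[OF 1 eset_S] by simp
 show ?case by (intro exI[of _ "{}"] conjI finite.emptyI eqv_trans[OF 2 eqv_sym[OF 1]])
next
 case (insert m M)
 then obtain N where N: "finite N" "eset N * (b * eset M) ~~ b * eset M" by blast
 obtain N' where N': "finite N'" "eset N' * (b * ge m) ~~ b * ge m"
  using MM_eset[OF MM_ge[OF insert.prems, of m]] by blast
 have e: "b * eset (insert m M) ~~ b * ge m + b * eset M"
  using eqv_multl[OF eset_insert[OF insert.hyps(2)] insert.prems] by (simp add: distrib_left)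
 have "eset (N \<union> N') * (b * eset (insert m M)) ~~ eset (N \<union> N') * (b * ge m + b * eset M)" by (rule eqv_multl[OF e eset_S])
 also have "... ~~ b * ge m + b * eset M"
  unfolding distrib_left by (intro eqv_add eset_left_mono[OF N'(2)] eset_left_mono[OF N(2)]) auto
 also note eqv_sym[OF e]
 finally show ?case using N(1) N'(1) by blast
qed

lemma KS_left: "p : KS ==> EX N. finite N & eset N * p ~~ p"
proof -
 assume "p : KS"
 then obtain M where M: "finite M" "p * eset M ~~ p" and p: "p : gS" by (auto simp: KS_def)
 obtain N where N: "finite N" "eset N * (p * eset M) ~~ p * eset M" using left_fixed[OF M(1) p] by blast
 have "eset N * p ~~ eset N * (p * eset M)" by (rule eqv_multl[OF eqv_sym[OF M(2)] eset_S])
 also note N(2)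
 also note M(2)
 finally show ?thesis using N(1) by blast
qed

lemma KS_closed:
 "p : KS ==> r : KS ==> p + r : KS" "p : KS ==> a : gS ==> a * p : KS" "p : KS ==> a : gS ==> p * a : KS"
 "p : KS ==> p ~~ r ==> r : KS" "0 : KS" "finite M ==> eset M : KS" "ge n : KS" "b : gS ==> b * ge n : KS"
proof -
 show add: "p + r : KS" if pr: "p : KS" "r : KS" for p r
 proof -
  obtain M where M: "finite M" "p * eset M ~~ p" using pr(1) by (auto simp: KS_def)
  obtain N where N: "finite N" "r * eset N ~~ r" using pr(2) by (auto simp: KS_def)
  have S: "p : gS" "r : gS" using pr KS_S by auto
  have "(p + r) * eset (M \<union> N) ~~ p + r"
   unfolding distrib_right by (intro eqv_add eset_right_mono[OF M(2)] eset_right_mono[OF N(2)]) auto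
  thus ?thesis using S M(1) N(1) by (auto simp: KS_def intro: S_closed)
 qed
 show left: "a * p : KS" if pa: "p : KS" "a : gS" for a p
 proof -
  obtain M where M: "finite M" "p * eset M ~~ p" and S: "p : gS" using pa by (auto simp: KS_def)
  have "(a * p) * eset M ~~ a * p" using eqv_multl[OF M(2) pa(2)] by (simp add: mult.assoc)
  thus ?thesis using S M(1) pa(2) by (auto simp: KS_def intro: S_closed)
 qed
 show eqv: "r : KS" if pa: "p : KS" "p ~~ r" for p r
 proof -
  obtain M where M: "finite M" "p * eset M ~~ p" using pa by (auto simp: KS_def)
  have "r * eset M ~~ p * eset M" by (rule eqv_multr[OF eqv_sym[OF pa(2)] eset_S])
  also note M(2)
  also note pa(2)
  finally show ?thesis using M(1) eqv_S(2)[OF pa(2)] by (auto simp: KS_def)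
 qed
 show eset: "eset M : KS" if "finite M" for M
  using that eset_subset(1)[of M M] by (auto simp: KS_def)
 show ge: "ge n : KS" for n using eset[of "{n}"] by (simp add: eset_single)
 show "b : gS ==> b * ge n : KS" by (rule left[OF ge])
 show "0 : KS" using eqv[OF eset eset_empty] by simp
 show "p * a : KS" if pa: "p : KS" "a : gS" for a p
 proof -
  obtain M where M: "finite M" "p * eset M ~~ p" and S: "p : gS" using pa by (auto simp: KS_def)
  obtain N where N: "finite N" "(eset M * a) * eset N ~~ eset M * a"
   using NN_eset NN_mult[OF pa(2)] eset_NN[OF M(1)] by blast
  have "eset M * a : KS" using N pa(2) by (auto simp: KS_def intro: S_closed)
  hence "p * (eset M * a) : KS" by (rule left[OF _ S])
  moreover have "p * (eset M * a) ~~ p * a" using eqv_multr[OF M(2) pa(2)] by (simp add: mult.assoc)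
  ultimately show ?thesis by (rule eqv)
 qed
qed

lemma RqK_D: "RqK q s = D ` {c. finite {m. c m ~= 0}}"
proof
 have D0: "D (%_. 0) = (%ph. 0)" by (auto simp: D_def fa_lin_def fun_eq_iff)
 have s: "(%ph. \<Sum>n\<in>A. c n * idem_e q s n ph) = D (%m. \<Sum>n\<in>A. c n * dl n m)" if "finite A" for A c
  using that
 proof (induction A rule: finite_induct)
  case (insert n A)
  thus ?case using D_comb[of "c n" "dl n" "%m. \<Sum>n\<in>A. c n * dl n m", symmetric] by (simp add: fun_eq_iff idem_e_D)
 qed (simp add: D0)
 have d: "(\<Sum>n\<in>A. c n * dl n m) = (if m : A then c m else 0)" if "finite A" for A c m
  using that by (simp add: dl_def if_distrib[of "%x. c _ * x"] sum.delta cong: if_cong)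
 show "RqK q s <= D ` {c. finite {m. c m ~= 0}}"
 proof
  fix x assume "x : RqK q s"
  then obtain A c where A: "finite A" "x = D (%m. \<Sum>n\<in>A. c n * dl n m)" by (auto simp: RqK_def s)
  have "finite {m. (\<Sum>n\<in>A. c n * dl n m) ~= 0}"
   by (rule finite_subset[OF _ A(1)]) (auto simp: d[OF A(1)] split: if_splits)
  thus "x : D ` {c. finite {m. c m ~= 0}}" using A(2) by blast
 qed
 show "D ` {c. finite {m. c m ~= 0}} <= RqK q s"
 proof
  fix x assume "x : D ` {c. finite {m. c m ~= 0}}"
  then obtain c where c: "finite {m. c m ~= 0}" "x = D c" by blast
  have "c = (%m. \<Sum>n\<in>{m. c m ~= 0}. c n * dl n m)" by (auto simp: d[OF c(1)] fun_eq_iff)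
  hence "x = (%ph. \<Sum>n\<in>{m. c m ~= 0}. c n * idem_e q s n ph)" using s[OF c(1), of c] c(2) by simp
  thus "x : RqK q s" using c(1) unfolding RqK_def by blast
 qed
qed

lemma RgK_eq: "RgK q s = cl ` KS"
proof
 interpret ring GR by (rule ring_GR)
 have sub: "inK q s ` RqK q s <= cl ` KS"
 proof
  fix x assume "x : inK q s ` RqK q s"
  then obtain c where c: "finite {m. c m ~= 0}" "x = cl (gD c)" by (auto simp: RqK_D inK_D)
  have "(%m. c m * (if m : {m. c m ~= 0} then 1 else 0)) = c" by auto
  hence "gD c * eset {m. c m ~= 0} ~~ gD c"
   unfolding eset_def using gD_rels(2)[of c "%m. if m : {m. c m ~= 0} then 1 else 0"] by simp
  thus "x : cl ` KS" using c gD_S by (auto simp: KS_def)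
 qed
 have KS_carrier: "cl ` KS <= carrier GR" using KS_S by (auto simp: carrier_GR)
 have I: "ideal (cl ` KS) GR"
 proof (rule idealI[OF ring_GR])
  show "subgroup (cl ` KS) (add_monoid GR)"
  proof (rule group.subgroupI)
   show "Group.group (add_monoid GR)" by (rule add.is_group)
   show "cl ` KS <= carrier (add_monoid GR)" using KS_carrier by simp
   show "cl ` KS ~= {}" using KS_closed(5) by blast
   fix x assume "x : cl ` KS"
   then obtain p where p: "p : KS" "x = cl p" by blast
   have "fa_const (-1) * p : KS" using KS_closed(2)[OF p(1)] S_closed(4) by blast
   hence "- p : KS" by (simp add: fa_const_uminus fa_const_1)
   thus "inv\<^bsub>add_monoid GR\<^esub> x : cl ` KS"
    using minus_GR[OF KS_S[OF p(1)]] p(2) by (auto simp: a_inv_def)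
  next
   fix x y assume "x : cl ` KS" "y : cl ` KS"
   thus "x \<otimes>\<^bsub>add_monoid GR\<^esub> y : cl ` KS" using KS_closed(1) KS_S by (fastforce simp: cl_ops)
  qed
  fix a x assume "a : cl ` KS" "x : carrier GR"
  then obtain p b where pb: "p : KS" "a = cl p" "b : gS" "x = cl b" by (auto simp: carrier_GR)
  show "x [.] a : cl ` KS" "a [.] x : cl ` KS"
   using KS_closed(2,3)[OF pb(1,3)] pb KS_S by (auto simp: cl_ops)
 qed
 show "RgK q s <= cl ` KS" unfolding RgK_def by (rule genideal_minimal[OF I sub])
 have sub': "inK q s ` RqK q s <= carrier GR" using sub KS_carrier by blast
 interpret R: ideal "RgK q s" GR unfolding RgK_def by (rule genideal_ideal[OF sub'])
 show "cl ` KS <= RgK q s"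
 proof
  fix x assume "x : cl ` KS"
  then obtain p M where p: "p : gS" "finite M" "p * eset M ~~ p" "x = cl p" by (auto simp: KS_def)
  have "D (%m. if m : M then 1 else 0) : RqK q s" using p(2) by (auto simp: RqK_D)
  hence "cl (eset M) : RgK q s"
   unfolding RgK_def eset_def using genideal_self[OF sub'] inK_D[of "%m. if m : M then 1 else 0"] by (metis image_eqI subsetD)
  hence "cl p [.] cl (eset M) : RgK q s" by (rule R.I_l_closed) (use p(1) cl_ops(4) in blast)
  thus "x : RgK q s" using p eqv_cl[OF p(3)] by (simp add: cl_ops)
 qed
qed

section \<open>The action on $\mathcal O_q(U)$\<close>

text \<open>For each \<open>t\<close>, the algebra $\mathcal O'_q(G)$ acts on $\mathcal O_q(U)$: elements of
  $\mathcal O'_q(K)$ act by translation, elements of $\mathcal O_q(K\backslash U)$ by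
  multiplication after a translation by \<^term>\<open>G t\<close>. Evaluation at \<open>1\<close> turns matrix
  coefficients of this module into the elements of induced modules.\<close>

fun step :: "complex => ggen => ofun => ofun" where
 "step t (GK x) = lact x"
| "step t (GY y) = omult (ract t y)"

definition pact :: "complex => ggen fa => ofun => ofun" where
 "pact t p ph = (%a. fa_lin (%w. foldr (step t) (letters w) ph a) p)"

lemma lin_pact: "lin (%p. pact t p ph a)"
 unfolding pact_def by (rule lin_fa_lin)

lemma pact_lin: "pact t (p + r) ph = (%a. pact t p ph a + pact t r ph a)"
 "pact t (fa_const c * p) ph = (%a. c * pact t p ph a)" "pact t 0 ph = (%a. 0)" "pact t (- p) ph = (%a. - pact t p ph a)"
 "pact t (p - r) ph = (%a. pact t p ph a - pact t r ph a)" "pact t (sum P A) ph = (%a. \<Sum>i\<in>A. pact t (P i) ph a)"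
 using linD[OF lin_pact[of t ph]] lin_sum[OF lin_pact[of t ph]] by (auto simp: fun_eq_iff)

lemma pact_wd: "pact t (wd xs) ph = foldr (step t) xs ph"
 by (simp add: pact_def wd_def)

lemma pact_1: "pact t 1 ph = ph"
 using pact_wd[of t "[]"] by (simp add: wd_Nil)

lemma GK_OpU: "GK x : G_gens q s ==> x : OpU q" and GY_OKU: "GY y : G_gens q s ==> y : KU"
 by (auto simp: G_gens_def OpK_eq D_OpU)

lemma step_props:
 assumes "g : G_gens q s"
 shows "ph : OU q ==> step t g ph : OU q"
  "ph : OU q ==> py : OU q ==> step t g (%a. c * ph a + py a) = (%a. c * step t g ph a + step t g py a)"
proof -
 show "step t g ph : OU q" if "ph : OU q"
  using assms that by (cases g) (auto intro!: lact_OU OU_omult ract_OU simp: OKU_OU GK_OpU GY_OKU)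
 show "step t g (%a. c * ph a + py a) = (%a. c * step t g ph a + step t g py a)" if "ph : OU q" "py : OU q"
  using assms that by (cases g) (auto simp: lact_comb omult_comb_right dest: GK_OpU)
qed

lemma pact_OU:
 assumes "p : gS" "ph : OU q"
 shows "pact t p ph : OU q & (ALL xs. set xs <= G_gens q s --> pact t (wd xs * p) ph = foldr (step t) xs (pact t p ph))"
 using assms(1)
proof (induction rule: free_ring_induct)
 case one
 show ?case by (simp add: pact_1 pact_wd assms(2))
next
 case (gen g x)
 from gen.IH gen.hyps(1) have e: "pact t (fa_gen g * x) ph = step t g (pact t x ph)"
  by (auto simp: wd_gen[symmetric])
 have "pact t (wd xs * (fa_gen g * x)) ph = foldr (step t) xs (pact t (fa_gen g * x) ph)" if "set xs <= G_gens q s" for xs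
 proof -
  have "pact t (wd (xs @ [g]) * x) ph = foldr (step t) (xs @ [g]) (pact t x ph)" using gen that by auto
  thus ?thesis by (simp add: e wd_snoc mult.assoc)
 qed
 thus ?case using gen e step_props(1) by auto
next
 case (scale c x)
 have l: "foldr (step t) xs (%a. c * py a) = (%a. c * foldr (step t) xs py a) & foldr (step t) xs py : OU q & foldr (step t) xs (%_. 0) = (%_. 0)"
  if "set xs <= G_gens q s" "py : OU q" for xs py
  using that
 proof (induction xs)
  case (Cons g xs)
  hence z: "step t g (%_. 0) = (%_. 0)" using step_props(2)[of g py py t "-1"] by simp
  thus ?case using Cons step_props(1)[of g "foldr (step t) xs py" t]
    step_props(2)[of g "foldr (step t) xs py" "%_. 0" t c] OUD(1) by simp
 qed simp
 thus ?case using scale OUD(3) by (auto simp: pact_lin fa_const_left_commute)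
next
 case (add x y)
 have l: "foldr (step t) xs (%a. py a + om a) = (%a. foldr (step t) xs py a + foldr (step t) xs om a) & foldr (step t) xs py : OU q & foldr (step t) xs om : OU q"
  if "set xs <= G_gens q s" "py : OU q" "om : OU q" for xs py om
  using that
 proof (induction xs)
  case (Cons g xs)
  thus ?case using step_props(1)[of g "foldr (step t) xs py" t] step_props(1)[of g "foldr (step t) xs om" t]
    step_props(2)[of g "foldr (step t) xs py" "foldr (step t) xs om" t 1] by simp
 qed simp
 thus ?case using add OUD(4) by (auto simp: pact_lin distrib_left)
qed

lemma pact_closed: "p : gS ==> ph : OU q ==> pact t p ph : OU q"
 using pact_OU by blast

lemma pact_gen_mult: "g : G_gens q s ==> p : gS ==> ph : OU q ==> pact t (fa_gen g * p) ph = step t g (pact t p ph)"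
 using pact_OU[of p ph t] by (auto simp: wd_gen[symmetric])

lemma pact_gen: "g : G_gens q s ==> pact t (fa_gen g) ph = step t g ph"
 by (simp add: wd_gen[symmetric] pact_wd)

lemma pact_mult: "p : gS ==> r : gS ==> ph : OU q ==> pact t (p * r) ph = pact t p (pact t r ph)"
proof (induction rule: free_ring_induct)
 case (gen g x)
 thus ?case using pact_closed by (simp add: mult.assoc pact_gen_mult S_closed)
qed (simp_all add: pact_1 pact_lin mult.assoc distrib_right)

lemma pact_comb: "p : gS ==> ph : OU q ==> py : OU q ==> pact t p (%a. c * ph a + py a) = (%a. c * pact t p ph a + pact t p py a)"
proof (induction rule: free_ring_induct)
 case one
 show ?case by (simp add: pact_1)
next
 case (gen g x)
 thus ?case using OUD(2) by (simp add: pact_gen_mult step_props pact_closed)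
next
 case (scale c x)
 thus ?case by (simp add: pact_lin algebra_simps)
next
 case (add x y)
 thus ?case by (simp add: pact_lin algebra_simps)
qed

text \<open>The exchange relation holds because the comultiplication of $\mathcal O_q(U)$ is multiplicative.\<close>

lemma pact_rels:
 assumes "p : G_rels q s" "ph : OU q" and t: "t ~= 0"
 shows "pact t p ph = (%_. 0)"
proof -
 have K: "pact t (gk x * p) py = lact x (pact t p py)" "pact t (gk x) py = lact x py" if "x : OpK q s" "p : gS" "py : OU q" for x p py
  using pact_gen_mult[of "GK x" p py t] pact_gen[of "GK x" t py] that by (auto simp: G_gens_def)
 have Y: "pact t (gy y * p) py = omult (ract t y) (pact t p py)" "pact t (gy y) py = omult (ract t y) py" if "y : KU" "p : gS" "py : OU q" for y p py
  using pact_gen_mult[of "GY y" p py t] pact_gen[of "GY y" t py] that by (auto simp: G_gens_def)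
 have KU: "x : OpU q" if "x : OpK q s" for x using that D_OpU by (auto simp: OpK_eq)
 have dK: "dmult q x y : OpK q s" "(%a. c * x a + y a) : OpK q s" if "x : OpK q s" "y : OpK q s" for x y c
  using that by (auto simp: OpK_eq dmult_D D_comb)
 have S: "gk x : gS" if "x : OpK q s" for x using that gD_S by (auto simp: OpK_eq)
 have one: "deval q 1 : OpK q s" by (auto simp: OpK_eq deval_1)
 have OUr: "rtr b f : OU q" "(%b. f (a * b)) : OU q" if "f : OU q" for f a b
  using OU_rtr[OF that] OU_ltr[OF that, of a] by (auto simp: ltr_def)
 consider "p : unital_hom_rels gk (OpK q s) (dmult q) (deval q 1)"
  | "p : unital_hom_rels gy (KU) omult counit" | "p : exchange_rels q s"
  using assms(1) by (auto simp: G_rels_def)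
 thus ?thesis
 proof cases
  case 1
  then consider "p = gk (deval q 1) - 1"
   | x y where "x : OpK q s" "y : OpK q s" "p = gk (dmult q x y) - gk x * gk y"
   | c x y where "x : OpK q s" "y : OpK q s" "p = gk (%a. c * x a + y a) - (fa_const c * gk x + gk y)"
   by (auto simp: unital_hom_rels_def)
  thus ?thesis
  proof cases
   case 1
   have "lact (deval q 1) ph = ph" using OUr(2)[OF assms(2)] by (simp add: lact_def deval_def)
   thus ?thesis using 1 K(2)[OF one S_closed(6) assms(2)] by (simp add: pact_lin pact_1)
  next
   case (2 x y)
   have "lact (dmult q x y) ph = lact x (lact y ph)"
    using OUr(2)[OF assms(2)] by (simp add: lact_def dmult_def mult.assoc)
   thus ?thesis using 2 K(1)[OF 2(1) S[OF 2(2)] assms(2)] K(2)[OF 2(2) S_closed(6) assms(2)] K(2)[OF dK(1)[OF 2(1,2)] S_closed(6) assms(2)] by (simp add: pact_lin)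
  next
   case (3 c x y)
   have "lact (%a. c * x a + y a) ph = (%a. c * lact x ph a + lact y ph a)" by (simp add: lact_def)
   thus ?thesis using 3 K(2)[OF 3(1) S_closed(6) assms(2)] K(2)[OF 3(2) S_closed(6) assms(2)] K(2)[OF dK(2)[OF 3(1,2)] S_closed(6) assms(2)]
    by (simp add: pact_lin)
  qed
 next
  case 2
  then consider "p = gy counit - 1"
   | x y where "x : KU" "y : KU" "p = gy (omult x y) - gy x * gy y"
   | c x y where "x : KU" "y : KU" "p = gy (%a. c * x a + y a) - (fa_const c * gy x + gy y)"
   by (auto simp: unital_hom_rels_def)
  thus ?thesis
  proof cases
   case 1
   thus ?thesis using Y(2)[OF OKU_counit S_closed(6) assms(2)] by (simp add: pact_lin pact_1 ract_counit omult_counit OU_lin assms(2))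
  next
   case (2 x y)
   have "omult (omult (ract t x) (ract t y)) ph = omult (ract t x) (omult (ract t y) ph)"
    by (intro omult_assoc OU_lin[OF ract_OU] OKU_OU 2 OU_lin[OF assms(2)])
   thus ?thesis using 2 Y(1)[OF _ gy_S assms(2)] Y(2)[OF _ S_closed(6) assms(2)] OKU_omult t by (simp add: pact_lin ract_omult OKU_OU)
  next
   case (3 c x y)
   thus ?thesis using Y(2)[OF _ S_closed(6) assms(2)] OKUD(2) by (simp add: pact_lin ract_comb OKU_OU omult_comb_left)
  qed
 next
  case 3
  then obtain x y and n :: nat and y' y'' where p: "p = gk x * gy y - (\<Sum>i<n. gy (y' i) * gk (dract q x (y'' i)))"
   and x: "x : OpK q s" and y: "y : KU" and yy': "ALL i<n. y' i : KU & y'' i : OU q"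
   and cop': "ALL a b. y (a * b) = (\<Sum>i<n. y' i a * y'' i b)"
   unfolding exchange_rels_def mem_Collect_eq by (elim exE conjE)
  hence yy: "!!i. i < n ==> y' i : KU" "!!i. i < n ==> y'' i : OU q"
   and cop: "!!a b. y (a * b) = (\<Sum>i<n. y' i a * y'' i b)" by auto
  obtain k f1 f2 where f: "!!j. j < k ==> f1 j : OU q" "!!j. j < k ==> f2 j : OU q" "!!a b. ph (a * b) = (\<Sum>j<(k::nat). f1 j a * f2 j b)"
   by (rule OU_coprod[OF assms(2)]) (rule that)
  have xU: "x : OpU q" by (rule KU[OF x])
  have d: "dract q x (y'' i) : OpK q s" if "i < n" for i using x yy(2)[OF that] dract_D by (auto simp: OpK_eq)
  have rc: "ract t y (a * b) = (\<Sum>i<n. ract t (y' i) a * y'' i b)" for a b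
   by (rule ract_of_coprod[OF OKU_OU[OF y] _ cop]) (auto intro: OKU_OU yy)
  have "pact t (gk x * gy y) ph = lact x (omult (ract t y) ph)"
   using K(1)[OF x gy_S[OF y] assms(2)] Y(2)[OF y S_closed(6) assms(2)] by simp
  also have "... = (%a. \<Sum>i<n. omult (ract t (y' i)) (lact (dract q x (y'' i)) ph) a)"
  proof
   fix a
   have "lact x (omult (ract t y) ph) a = x (%b. \<Sum>i<n. \<Sum>j<k. omult (ract t (y' i)) (f1 j) a * omult (y'' i) (f2 j) b)"
    unfolding lact_def
    by (intro arg_cong[of _ _ x] ext omult_coprod finite_lessThan conjI)
(auto intro!: rc OU_lin[OF ract_OU[OF OKU_OU[OF y]]] OU_lin[OF assms(2)] OU_lin[OF ract_OU[OF OKU_OU[OF yy(1)]]] OU_lin[OF yy(2)] OU_lin[OF f(1)] OU_lin[OF f(2)] f(3))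
   also have "... = (\<Sum>i<n. \<Sum>j<k. omult (ract t (y' i)) (f1 j) a * x (omult (y'' i) (f2 j)))"
   proof -
    have "x (%b. \<Sum>i<n. \<Sum>j<k. omult (ract t (y' i)) (f1 j) a * omult (y'' i) (f2 j) b)
     = (\<Sum>i<n. x (%b. \<Sum>j<k. omult (ract t (y' i)) (f1 j) a * omult (y'' i) (f2 j) b))"
     by (rule OpU_sum'[OF xU]) (auto intro!: csub_sum[OF OU_csub] OUD(3) OU_omult yy f)
    also have "... = (\<Sum>i<n. \<Sum>j<k. omult (ract t (y' i)) (f1 j) a * x (omult (y'' i) (f2 j)))"
     by (intro sum.cong refl OpU_sum[OF xU]) (auto intro!: OU_omult yy f)
    finally show ?thesis .
   qed
   also have "... = (\<Sum>i<n. omult (ract t (y' i)) (lact (dract q x (y'' i)) ph) a)"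
   proof (intro sum.cong refl)
    fix i assume i: "i : {..<n}"
    have "lact (dract q x (y'' i)) ph = (%a. \<Sum>j<k. dract q x (y'' i) (f2 j) * f1 j a)"
     by (rule lact_coprod[OF KU[OF d]]) (use i f in auto)
    also have "... = (%a. \<Sum>j<k. x (omult (y'' i) (f2 j)) * f1 j a)"
     using f(2) by (auto simp: dract_def fun_eq_iff)
    finally have l: "lact (dract q x (y'' i)) ph = (%a. \<Sum>j<k. x (omult (y'' i) (f2 j)) * f1 j a)" .
    show "(\<Sum>j<k. omult (ract t (y' i)) (f1 j) a * x (omult (y'' i) (f2 j))) = omult (ract t (y' i)) (lact (dract q x (y'' i)) ph) a"
     unfolding l omult_sum(2) omult_scale(2) by (simp add: mult.commute)
   qed
   finally show "lact x (omult (ract t y) ph) a = (\<Sum>i<n. omult (ract t (y' i)) (lact (dract q x (y'' i)) ph) a)" .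
  qed
  also have "... = pact t (\<Sum>i<n. gy (y' i) * gk (dract q x (y'' i))) ph"
   unfolding pact_lin
  proof (intro ext sum.cong refl)
   fix a i assume i: "i : {..<n}"
   show "omult (ract t (y' i)) (lact (dract q x (y'' i)) ph) a = pact t (gy (y' i) * gk (dract q x (y'' i))) ph a"
    using Y(1)[OF yy(1) S[OF d] assms(2)] K(2)[OF d S_closed(6) assms(2)] i by simp
  qed
  finally show ?thesis by (simp add: p pact_lin)
 qed
qed

lemma pact_gI:
 assumes "p : gI" "ph : OU q" and t: "t ~= 0"
 shows "pact t p ph = (%_. 0)"
proof -
 interpret ring FR by (rule ring_free_ring)
 let ?I = "{p : gS. ALL ph:OU q. pact t p ph = (%_. 0)}"
 have z: "pact t p (%_. 0) = (%_. 0)" if "p : gS" for p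
  using pact_comb[OF that OUD(1) OUD(1), of t "-1"] by simp
 have "ideal ?I FR"
 proof (rule idealI[OF ring_free_ring])
  show "subgroup ?I (add_monoid FR)"
  proof (rule group.subgroupI)
   show "Group.group (add_monoid FR)" by (rule add.is_group)
   show "?I <= carrier (add_monoid FR)" by auto
   show "?I ~= {}" using S_closed(5) by (auto simp: pact_lin intro!: exI[of _ 0])
   fix x assume x: "x : ?I"
   have "\<ominus>\<^bsub>FR\<^esub> x = - x" by (rule minus_equality) (use x S_closed(3) in auto)
   hence "inv\<^bsub>add_monoid FR\<^esub> x = - x" by (simp add: a_inv_def)
   thus "inv\<^bsub>add_monoid FR\<^esub> x : ?I" using x S_closed(3) by (auto simp: pact_lin)
  next
   fix x y assume "x : ?I" "y : ?I"
   thus "x \<otimes>\<^bsub>add_monoid FR\<^esub> y : ?I" using S_closed(1) by (auto simp: pact_lin)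
  qed
  fix a x assume "a : ?I" "x : gS"
  thus "x \<otimes>\<^bsub>FR\<^esub> a : ?I" "a \<otimes>\<^bsub>FR\<^esub> x : ?I"
   using S_closed(2) pact_closed z by (auto simp: pact_mult)
 qed
 moreover have "G_rels q s <= ?I" using G_rels_S pact_rels[OF _ _ t] by auto
 ultimately have "gI <= ?I" unfolding G_ideal_def by (rule genideal_minimal)
 thus ?thesis using assms by auto
qed

lemma pact_eqv: "x ~~ y ==> ph : OU q ==> t ~= 0 ==> pact t x ph = pact t y ph"
 using pact_gI[of "x - y" ph t] by (auto simp: eqv_def pact_lin fun_eq_iff)

lemma pact_D: "pact t (gD c) ph = lact (D c) ph" and pact_y: "y : KU ==> pact t (gy y) ph = omult (ract t y) ph"
 using pact_gen[of "GK (D c)" t ph] pact_gen[of "GY y" t ph] by (auto simp: G_gens_def OpK_eq)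
section \<open>The subalgebra $R_q(\mathfrak p,M)$ and its characters\<close>

lemma gm_D: "gm = gD (%m. (-1) powi m)" by (simp add: minus_one_q_D)

lemma gm_square: "gm * gm ~~ 1"
proof -
 have "(%m::int. (-1::complex) powi m * (-1) powi m) = (%_. 1)" by (simp flip: power_int_mult_distrib)
 thus ?thesis using gD_rels(1) unfolding gm_D by (intro eqv_trans[OF gD_rels(2)]) simp
qed

lemma gm_central: "b : gS ==> gm * b ~~ b * gm"
proof (induction rule: gS_induct)
 case (eqv x y)
 show ?case by (rule eqv_trans[OF eqv_multl[OF eqv_sym[OF eqv(2)]] eqv_trans[OF eqv(1) eqv_multr[OF eqv(2)]]]) simp_all
next
 case (scale c x)
 thus ?case using eqv_scale[OF scale(2), of c] by (simp add: fa_const_left_commute mult.assoc)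
next
 case (add x y)
 thus ?case using eqv_add by (simp add: distrib_left distrib_right)
next
 case (mult x y)
 have "gm * (x * y) ~~ x * gm * y" using eqv_multr[OF mult(3,2)] by (simp add: mult.assoc)
 also have "... ~~ x * (y * gm)" using eqv_multl[OF mult(4,1)] by (simp add: mult.assoc)
 finally show ?case by (simp add: mult.assoc)
next
 case (D c)
 have e: "(%m::int. (-1) powi m * c m) = (%m. c m * (-1) powi m)" by (auto simp: mult.commute)
 show ?case unfolding gm_D
  by (rule eqv_trans[OF gD_rels(2)], unfold e, rule eqv_sym[OF gD_rels(2)])
next
 case X
 show ?case using gm_commute_GG[of 0 0] by (simp add: gy_GG)
next
 case Y
 show ?case
 proof (rule eqvI)
  fix F assume F: "F : FF"
  have "cq * F (gm * gY) = cq * F (gY * gm)"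
   using eqvD[OF gm_commute_GG[of "Suc 0" "Suc 0"] F] eqvDc(1)[OF gy_GG(2) F XYZ_S(6)] eqvDc(2)[OF gy_GG(2) F XYZ_S(6)]
   by (simp add: linD[OF FF_lin[OF F]] mult.assoc)
  thus "F (gm * gY) = F (gY * gm)" by simp
 qed (intro S_closed XYZ_S)+
next
 case Z
 show ?case
 proof (rule eqvI)
  fix F assume F: "F : FF"
  have "- \<i> * F (gm * gZ) = - \<i> * F (gZ * gm)"
   using eqvD[OF gm_commute_GG[of "Suc 0" 0] F] eqvDc(1)[OF gy_GG(3) F XYZ_S(6)] eqvDc(2)[OF gy_GG(3) F XYZ_S(6)]
   by (simp add: linD[OF FF_lin[OF F]] mult.assoc)
  thus "F (gm * gZ) = F (gZ * gm)" by simp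
 qed (intro S_closed XYZ_S)+
qed

text \<open>As $(-1)_q$ is central and squares to 1, elements of $R_q(\mathfrak p,M)$ are of this form.\<close>

definition pmE :: "ofun => ofun => ggen fa" where "pmE f g = gy f + gy g * gm"

lemma pmE_S: "f : KU ==> g : KU ==> pmE f g : gS"
 unfolding pmE_def by (intro S_closed XYZ_S)

lemma pmE_ops:
 assumes "f : KU" "g : KU" "f' : KU" "g' : KU"
 shows "pmE (%a. c * f a + f' a) (%a. c * g a + g' a) ~~ fa_const c * pmE f g + pmE f' g'"
  "pmE (%a. omult f f' a + omult g g' a) (%a. omult f g' a + omult g f' a) ~~ pmE f g * pmE f' g'"
proof -
 note S = assms[THEN gy_S]
 show "pmE (%a. c * f a + f' a) (%a. c * g a + g' a) ~~ fa_const c * pmE f g + pmE f' g'"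
  using eqv_add[OF gy_rels(3)[OF assms(1,3)] eqv_multr[OF gy_rels(3)[OF assms(2,4)] XYZ_S(6)], of c c]
  by (simp add: pmE_def algebra_simps)
 show "pmE (%a. omult f f' a + omult g g' a) (%a. omult f g' a + omult g f' a) ~~ pmE f g * pmE f' g'"
 proof (rule eqvI)
  show "pmE (%a. omult f f' a + omult g g' a) (%a. omult f g' a + omult g f' a) : gS" "pmE f g * pmE f' g' : gS"
   using assms by (auto intro!: pmE_S OKUD(4) OKU_omult S_closed)
  fix F assume F: "F : FF"
  note L = linD[OF FF_lin[OF F]]
  have y2: "F (gy (%a. omult u v a + omult u' v' a) * b) = F (gy u * (gy v * b)) + F (gy u' * (gy v' * b))"
   if uv: "u : KU" "v : KU" "u' : KU" "v' : KU" and b: "b : gS" for u v u' v' b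
  proof -
   have "F (gy (%a. 1 * omult u v a + omult u' v' a) * b) = F (gy (omult u v) * b) + F (gy (omult u' v') * b)"
    using eqvDc(2)[OF gy_rels(3)[OF OKU_omult OKU_omult] F b, of u v u' v' 1] uv by (simp add: fa_const_1 distrib_right L)
   thus ?thesis
    using eqvDc(2)[OF gy_rels(2) F b, of u v] eqvDc(2)[OF gy_rels(2) F b, of u' v'] uv by (simp add: mult.assoc)
  qed
  have m: "F (x * (gm * (gy u * b))) = F (x * (gy u * (gm * b)))" if "u : KU" "x : gS" "b : gS" for u b x
   using eqvDc(1)[OF eqv_multr[OF gm_central[OF gy_S[OF that(1)]] that(3)] F that(2)] by (simp add: mult.assoc)
  have mm: "F (x * (gm * gm)) = F x" if "x : gS" for x
   using eqvDc(1)[OF gm_square F that] by simp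
  have "F (pmE f g * pmE f' g') = F (gy f * gy f') + F (gy f * (gy g' * gm)) + F (gy g * (gm * (gy f' * 1))) + F (gy g * (gm * (gy g' * gm)))"
   by (simp add: pmE_def algebra_simps L)
  also have "F (gy g * (gm * (gy f' * 1))) = F (gy g * (gy f' * gm))" using m[OF assms(3) S(2), of 1] S_closed(6) by simp
  also have "F (gy g * (gm * (gy g' * gm))) = F (gy g * gy g')"
   using m[OF assms(4) S(2) XYZ_S(6)] mm[of "gy g * gy g'"] S by (simp add: S_closed mult.assoc)
  finally show "F (pmE (%a. omult f f' a + omult g g' a) (%a. omult f g' a + omult g f' a)) = F (pmE f g * pmE f' g')"
   using y2[OF assms(1,3,2,4) S_closed(6)] y2[OF assms(1,4,2,3) XYZ_S(6)] by (simp add: pmE_def L)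
 qed
qed

lemma pmE_gens:
 "f : KU ==> pmE f (%_. 0) ~~ gy f" "pmE (%_. 0) counit ~~ gm" "pmE (%a. c * counit a) (%_. 0) ~~ fa_const c"
proof -
 show y: "pmE f (%_. 0) ~~ gy f" if "f : KU" for f
  using eqv_add[OF eqv_refl[OF gy_S[OF that]] eqv_multr[OF gy_zero XYZ_S(6)]] by (simp add: pmE_def)
 show "pmE (%_. 0) counit ~~ gm"
  using eqv_add[OF gy_zero eqv_multr[OF gy_rels(1) XYZ_S(6)]] by (simp add: pmE_def)
 show "pmE (%a. c * counit a) (%_. 0) ~~ fa_const c"
  using eqv_trans[OF y eqv_trans[OF gy_scale[OF OKU_counit] eqv_scale[OF gy_rels(1)]]] OKUD(3)[OF OKU_counit] by simp
qed

lemma RpM_gens: "range (g_const q s) \<union> inY q s ` KU \<union> {inK q s (minus_one_q q s)} <= carrier GR"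
 by (auto simp: g_const_def inY_def inK_def intro: cl_ops(4) S_closed XYZ_S)

lemma RpM_eq: "RpM q s = {cl (pmE f g) | f g. f : KU & g : OKU q s}"
proof
 interpret ring GR by (rule ring_GR)
 have I: "h : {cl (pmE f g) | f g. f : KU & g : OKU q s}"
  if "f : KU" "g : KU" "cl (pmE f g) = h" for f g h using that by blast
 show "RpM q s <= {cl (pmE f g) | f g. f : KU & g : OKU q s}"
 proof
  fix x assume "x : RpM q s"
  thus "x : {cl (pmE f g) | f g. f : KU & g : OKU q s}"
   unfolding RpM_def
  proof (induction rule: generate_ring.induct)
   case one
   have "cl 1 = cl (pmE counit (%_. 0))"
    using eqv_cl[OF eqv_sym[OF pmE_gens(3)[of 1]]] by (simp add: fa_const_1)
   thus ?case using OKU_counit OKUD(1) by (auto simp: cl_ops(3))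
  next
   case (incl h)
   then consider c where "h = cl (fa_const c)" | f where "f : KU" "h = cl (gy f)" | "h = cl gm"
    by (auto simp: g_const_def inY_def inK_def)
   thus ?case
   proof cases
    case (1 c)
    thus ?thesis using eqv_cl[OF pmE_gens(3)[of c]] OKUD(3)[OF OKU_counit, of c] OKUD(1) by blast
   next
    case (2 f)
    thus ?thesis using eqv_cl[OF pmE_gens(1)] OKUD(1) by blast
   next
    case 3
    thus ?thesis using eqv_cl[OF pmE_gens(2)] OKU_counit OKUD(1) by blast
   qed
  next
   case (a_inv h)
   then obtain f g where fg: "f : KU" "g : KU" "h = cl (pmE f g)" by blast
   have "pmE (%a. (-1) * f a + 0) (%a. (-1) * g a + 0) ~~ fa_const (-1) * pmE f g + pmE (%_. 0) (%_. 0)"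
    by (rule pmE_ops) (use fg OKUD(1) in auto)
   also have "... ~~ fa_const (-1) * pmE f g + 0"
    by (intro eqv_add eqv_refl S_closed pmE_S fg eqv_trans[OF pmE_gens(1)[OF OKUD(1)] gy_zero])
   finally have "cl (pmE (%a. - f a) (%a. - g a)) = \<ominus>\<^bsub>GR\<^esub> h"
    using eqv_cl pmE_S[OF fg(1,2)] minus_GR by (fastforce simp: fg(3) fa_const_uminus fa_const_1)
   moreover have "(%a. - f a) : KU" "(%a. - g a) : KU"
    using OKUD(3)[OF fg(1), of "-1"] OKUD(3)[OF fg(2), of "-1"] by simp_all
   ultimately show ?case by (intro I)
  next
   case (eng_add h1 h2)
   then obtain f g f' g' where fg: "f : KU" "g : KU" "h1 = cl (pmE f g)" "f' : KU" "g' : KU" "h2 = cl (pmE f' g')" by blast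
   have "cl (pmE (%a. 1 * f a + f' a) (%a. 1 * g a + g' a)) = h1 [++] h2"
    using eqv_cl[OF pmE_ops(1)[OF fg(1,2,4,5), of 1]] fg by (simp add: cl_ops pmE_S fa_const_1)
   thus ?case by (rule I[OF OKUD(2)[OF fg(1,4)] OKUD(2)[OF fg(2,5)]])
  next
   case (eng_mult h1 h2)
   then obtain f g f' g' where fg: "f : KU" "g : KU" "h1 = cl (pmE f g)" "f' : KU" "g' : KU" "h2 = cl (pmE f' g')" by blast
   have "cl (pmE (%a. omult f f' a + omult g g' a) (%a. omult f g' a + omult g f' a)) = h1 [.] h2"
    using eqv_cl[OF pmE_ops(2)[OF fg(1,2,4,5)]] fg by (simp add: cl_ops pmE_S)
   thus ?case by (rule I[OF OKUD(4)[OF OKU_omult[OF fg(1,4)] OKU_omult[OF fg(2,5)]] OKUD(4)[OF OKU_omult[OF fg(1,5)] OKU_omult[OF fg(2,4)]]])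
  qed
 qed
 show "{cl (pmE f g) | f g. f : KU & g : OKU q s} <= RpM q s"
 proof clarify
  fix f g assume fg: "f : KU" "g : KU"
  have "cl (gy f) : RpM q s" "cl (gy g) : RpM q s" "cl gm : RpM q s"
   unfolding RpM_def using fg by (intro generate_ring.incl; simp add: inY_def inK_def)+
  hence "cl (gy f) [++] (cl (gy g) [.] cl gm) : RpM q s"
   unfolding RpM_def by (intro generate_ring.eng_add generate_ring.eng_mult)
  thus "cl (pmE f g) : RpM q s" using fg by (simp add: pmE_def cl_ops S_closed)
 qed
qed

lemma lact_D_weight:
 assumes "f : OU q" "rtr th f = (%a. nu n * f a)"
 shows "lact (D c) f = (%a. c n * f a)"
proof
 fix a
 have O: "ltr a f : OU q" by (rule OU_ltr[OF assms(1)])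
 have "rtr th (ltr a f) = (%b. nu n * ltr a f b)" by (simp add: rtr_ltr assms(2) ltr_scale)
 from kth_eigen[OF this] have "D c (ltr a f) = c n * f a" using O by (simp add: D_def ltr_def mult.commute)
 thus "lact (D c) f a = c n * f a" by (simp add: lact_def ltr_def)
qed

lemma pact_D_psi: "pact t (gD c) (psi n) = (%a. c n * psi n a)"
 unfolding pact_D by (rule lact_D_weight[OF psi_OU psi(2)])

lemma lact_G_weight:
 assumes "f : OU q" "rtr uK f = (%a. qp m * f a)"
 shows "lact (G t) f = (%a. t powi m * f a)"
proof
 fix a
 have "rtr uK (ltr a f) = (%b. qp m * ltr a f b)" by (simp add: rtr_ltr assms(2) ltr_scale)
 from G_weight[OF OU_ltr[OF assms(1)] this] show "lact (G t) f a = t powi m * f a" by (simp add: lact_def ltr_def)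
qed

lemma lact_G_XYZ: "lact (G t) oXX = (%a. t powi 2 * oXX a)" "lact (G t) oYY = (%a. t powi (-2) * oYY a)" "lact (G t) oZZ = oZZ" "lact (G t) counit = counit"
proof -
 note w = rtr_XYZ(7-9)
 show "lact (G t) oXX = (%a. t powi 2 * oXX a)" "lact (G t) oYY = (%a. t powi (-2) * oYY a)" "lact (G t) oZZ = oZZ"
  using lact_G_weight[OF OKU_OU[OF XYZ_OKU(1)] w(1)] lact_G_weight[OF OKU_OU[OF XYZ_OKU(2)] w(3)]
   lact_G_weight[OF OKU_OU[OF XYZ_OKU(3)] w(2)] by simp_all
 have "rtr uK counit = (%a. qp 0 * counit a)" by simp
 from lact_G_weight[OF OU_counit this] show "lact (G t) counit = counit" by simp
qed

lemma G_XYZ: "G t oXX = t powi 2" "G t oYY = t powi (-2)" "G t oZZ = 0"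
 using G_weight[OF OKU_OU[OF XYZ_OKU(1)] rtr_XYZ(7)] G_weight[OF OKU_OU[OF XYZ_OKU(2)] rtr_XYZ(9)]
  G_weight[OF OKU_OU[OF XYZ_OKU(3)] rtr_XYZ(8)] by (simp_all add: XYZ_1)

lemma lact_zero: "x : OpU q ==> lact x (%_. 0) = (%_. 0)"
 by (simp add: lact_def OpU_lin)

text \<open>Both sides are multiplicative in \<open>y\<close>, so that $X$, $Y$, $Z$ suffice.\<close>

lemma G_translate:
 assumes "y : KU" "t ~= 0" "r ~= 0"
 shows "lact (G r) (lact (G t) y) = lact (G (r * t)) y" "G r (lact (G t) y) = G (r * t) y"
proof -
 have c: "lact (G t) f : KU" if "f : KU" for f t by (rule OKU_lact[OF G_OpU that])
 note O = OKU_OU OKU_OU[OF c] G_OpU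
 have m: "lact (G r) (lact (G t) (omult f g)) = lact (G (r * t)) (omult f g)"
  if "f : KU" "g : KU" "lact (G r) (lact (G t) f) = lact (G (r * t)) f" "lact (G r) (lact (G t) g) = lact (G (r * t)) g" for f g
  using that assms by (simp add: lact_G_omult O)
 have sc: "lact (G r) (%a. c * f a) = (%a. c * lact (G r) f a)" if "f : KU" for c f
  using lact_comb[OF G_OpU OKU_OU[OF that] OUD(1), of r c] by (simp add: lact_zero G_OpU)
 have g: "lact (G r) (lact (G t) f) = lact (G (r * t)) f" if "f : {oXX, oYY, oZZ}" for f
  using that by (auto simp: lact_G_XYZ(1) lact_G_XYZ(2) lact_G_XYZ(3) sc[OF XYZ_OKU(1)] sc[OF XYZ_OKU(2)] simp del: power_int_numeral)
   (auto simp: power_int_mult_distrib mult_ac simp del: power_int_numeral)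
 show l: "lact (G r) (lact (G t) y) = lact (G (r * t)) y"
  using assms(1)
 proof (induction rule: OKU_induct)
  case zero
  show ?case by (simp add: lact_zero G_OpU)
 next
  case one
  show ?case by (simp add: lact_G_XYZ)
 next
  case (comb f g c)
  thus ?case by (simp add: lact_comb O)
 qed (use m g XYZ_OKU in auto)
 have "G r (lact (G t) y) = lact (G r) (lact (G t) y) 1" "G (r * t) y = lact (G (r * t)) y 1" by (simp_all add: lact_def)
 thus "G r (lact (G t) y) = G (r * t) y" using l by simp
qed

lemma lact_G1: "y : KU ==> lact (G 1) y = y"
 using G_1 OU_ltr[OF OKU_OU] by (simp add: lact_def ltr_def)

lemma pact_pmE:
 assumes "f : KU" "g : KU" "ph : OU q" "lact (minus_one_q q s) ph = (%a. e * ph a)"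
 shows "pact t (pmE f g) ph = (%a. omult (ract t f) ph a + e * omult (ract t g) ph a)"
proof -
 have "pact t (gy g * gm) ph = omult (ract t g) (lact (minus_one_q q s) ph)"
  using pact_mult[OF gy_S[OF assms(2)] XYZ_S(6) assms(3), of t] pact_y[OF assms(2)]
  by (simp add: gm_D pact_D) (simp add: minus_one_q_D)
 thus ?thesis unfolding pmE_def pact_lin pact_y[OF assms(1)] assms(4) omult_scale by simp
qed

lemma minus_one_psi: "lact (minus_one_q q s) (psi n) = (%a. (-1) powi n * psi n a)"
 unfolding minus_one_q_D by (rule lact_D_weight[OF psi_OU psi(2)])

text \<open>Each element of $R_q(\mathfrak p,M)$ has a unique form \<^term>\<open>pmE f g\<close>: multiplication by
  \<open>f + g\<close> is seen on the counit, multiplication by \<open>f - g\<close> on the entries of \<open>u\<close>, and some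
  products of such entries add up to the counit.\<close>

lemma omult_uu_cancel:
 assumes d: "d : OU q" and z: "!!al be. al < 2 ==> be < 2 ==> omult d (uu al be) = (%_. 0)"
 shows "d = (%_. 0)"
proof -
 have l: "lin d" by (rule OU_lin[OF d])
 have GGz: "omult d (GG be de) = (%_. 0)" if "be < 2" "de < 2" for be de
 proof -
  have "omult d (omult (uu al be) (uu al de)) = (%_. 0)" if "al < 2" for al
   using omult_assoc[OF l lin_uu lin_uu, of al be al de] z[OF that `be < 2`] by simp
  from this[of 0] this[of "Suc 0"] show ?thesis by (simp add: GG_def omult_add omult_scale)
 qed
 have zz: "omult d oXX = (%_. 0)" "omult d oZZ = (%_. 0)"
  unfolding XYZ_GG omult_scale using GGz by simp_all
 have "counit = (%a. omult oXX oYY a + (cq * cq) * omult oZZ oZZ a)" by (simp add: XY_rel)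
 hence "omult d counit = (%a. omult d (omult oXX oYY) a + (cq * cq) * omult d (omult oZZ oZZ) a)"
  by (metis omult_add(2) omult_scale(2))
 also have "... = (%_. 0)"
  unfolding omult_assoc[OF l AD_lin[OF XYZ_AD(1)] AD_lin[OF XYZ_AD(2)], symmetric] omult_assoc[OF l AD_lin[OF XYZ_AD(3)] AD_lin[OF XYZ_AD(3)], symmetric] zz
  by simp
 finally show ?thesis using omult_counit(2)[OF l] by simp
qed

lemma minus_one_uu: "al < 2 ==> be < 2 ==> lact (minus_one_q q s) (uu al be) = (%a. (-1) * uu al be a)"
proof -
 assume ab: "al < 2" "be < 2"
 have "lact (minus_one_q q s) (uu al be) = (%a. \<Sum>ga\<in>{0, Suc 0}. minus_one_q q s (uu ga be) * uu al ga a)"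
 proof (rule lact_coprod)
  show "minus_one_q q s : OpU q" by (simp add: minus_one_q_D D_OpU)
 qed (use ab in "auto simp: uu_mult OU_uu")
 also have "... = (%a. \<Sum>ga\<in>{0, Suc 0}. (if ga = be then - 1 else 0) * uu al ga a)"
 proof (intro ext sum.cong refl)
  fix ga a assume "ga : {0, Suc 0}"
  hence "ga < 2" by auto
  thus "minus_one_q q s (uu ga be) * uu al ga a = (if ga = be then - 1 else 0) * uu al ga a"
   using G_minus_one(1)[of "uu ga be" 1] WS_wf[of "[(ga, be)]" "{1}"] ab by (auto simp: minus_one_q_G uu_1 omult_counit)
 qed
 also have "... = (%a. (-1) * uu al be a)" using ab by (auto simp: less_2)
 finally show ?thesis .
qed

lemma pmE_unique:
 assumes "f : KU" "g : KU" "f' : KU" "g' : KU" "cl (pmE f g) = cl (pmE f' g')"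
 shows "f = f'" "g = g'"
proof -
 have e: "pmE f g ~~ pmE f' g'" using assms cl_eq pmE_S by blast
 note O = assms(1-4)[THEN OKU_OU]
 have m1: "lact (minus_one_q q s) counit = (%a. 1 * counit a)"
  using lact_D_weight[OF OU_counit, of 0 "%m. (-1) powi m"] by (simp add: minus_one_q_D)
 have "pact 1 (pmE f g) counit = pact 1 (pmE f' g') counit" by (rule pact_eqv[OF e OU_counit]) simp
 hence sum: "f a + g a = f' a + g' a" for a
  using pact_pmE[OF assms(1,2) OU_counit m1, of 1] pact_pmE[OF assms(3,4) OU_counit m1, of 1] O
  by (simp add: ract_1 omult_counit OU_lin fun_eq_iff)
 have "omult (%a. (f a - g a) - (f' a - g' a)) (uu al be) = (%_. 0)" if "al < 2" "be < 2" for al be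
 proof -
  have "pact 1 (pmE f g) (uu al be) = pact 1 (pmE f' g') (uu al be)" by (rule pact_eqv[OF e OU_uu[OF that]]) simp
  thus ?thesis
   using pact_pmE[OF assms(1,2) OU_uu[OF that] minus_one_uu[OF that], of 1]
    pact_pmE[OF assms(3,4) OU_uu[OF that] minus_one_uu[OF that], of 1] O
   by (simp add: ract_1 omult_minus fun_eq_iff)
 qed
 moreover have "(%a. (f a - g a) - (f' a - g' a)) : OU q" using O by (intro OUD(5))
 ultimately have "(%a. (f a - g a) - (f' a - g' a)) = (%_. 0)" using omult_uu_cancel by blast
 hence dif: "f a - g a = f' a - g' a" for a by (simp add: fun_eq_iff)
 show "f = f'"
 proof
  fix a show "f a = f' a" using arg_cong2[OF sum[of a] dif[of a], of "(+)"] by simp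
 qed
 thus "g = g'" using sum by (auto simp: fun_eq_iff)
qed

lemma RpM_ops:
 assumes "f : KU" "g : KU"
 shows "cl (pmE f g) : RpM q s"
  "f' : KU ==> g' : KU ==> cl (pmE f g) [.] cl (pmE f' g') = cl (pmE (%a. omult f f' a + omult g g' a) (%a. omult f g' a + omult g f' a))"
  "f' : KU ==> g' : KU ==> cl (pmE f g) [++] cl (pmE f' g') = cl (pmE (%a. f a + f' a) (%a. g a + g' a))"
  "g_scale q s c (cl (pmE f g)) = cl (pmE (%a. c * f a) (%a. c * g a))"
  "inY q s f = cl (pmE f (%_. 0))" "inK q s (minus_one_q q s) = cl (pmE (%_. 0) counit)"
  "\<one>\<^bsub>GR\<^esub> = cl (pmE counit (%_. 0))"
  "cl (pmE f g) = inY q s f [++] inY q s g [.] inK q s (minus_one_q q s)"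
proof -
 show "cl (pmE f g) : RpM q s" using assms by (auto simp: RpM_eq)
 show "f' : KU ==> g' : KU ==> cl (pmE f g) [.] cl (pmE f' g') = cl (pmE (%a. omult f f' a + omult g g' a) (%a. omult f g' a + omult g f' a))"
  using eqv_cl[OF pmE_ops(2)[OF assms]] assms by (simp add: cl_ops pmE_S)
 show "f' : KU ==> g' : KU ==> cl (pmE f g) [++] cl (pmE f' g') = cl (pmE (%a. f a + f' a) (%a. g a + g' a))"
  using eqv_cl[OF pmE_ops(1)[OF assms, of f' g' 1]] assms by (simp add: cl_ops pmE_S fa_const_1)
 have z: "pmE (%_. 0) (%_. 0) ~~ 0" by (rule eqv_trans[OF pmE_gens(1)[OF OKUD(1)] gy_zero])
 have "pmE (%a. c * f a + 0) (%a. c * g a + 0) ~~ fa_const c * pmE f g + 0"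
  by (rule eqv_trans[OF pmE_ops(1)[OF assms OKUD(1) OKUD(1)] eqv_add[OF eqv_refl z]]) (intro S_closed pmE_S assms)
 thus "g_scale q s c (cl (pmE f g)) = cl (pmE (%a. c * f a) (%a. c * g a))"
  using eqv_cl by (simp add: g_scale_cl pmE_S assms)
 show "inY q s f = cl (pmE f (%_. 0))" using eqv_cl[OF pmE_gens(1)[OF assms(1)]] by (simp add: inY_def)
 show "inK q s (minus_one_q q s) = cl (pmE (%_. 0) counit)" using eqv_cl[OF pmE_gens(2)] by (simp add: inK_def)
 show "\<one>\<^bsub>GR\<^esub> = cl (pmE counit (%_. 0))" using eqv_cl[OF pmE_gens(3)[of 1]] by (simp add: cl_ops fa_const_1)
 show "cl (pmE f g) = inY q s f [++] inY q s g [.] inK q s (minus_one_q q s)"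
  using assms by (simp add: pmE_def inY_def inK_def cl_ops S_closed XYZ_S)
qed

lemma RpM_times: "x : RpM q s ==> y : RpM q s ==> x [.] y : RpM q s"
 unfolding RpM_def by (rule generate_ring.eng_mult)

text \<open>Functions on $R_q(\mathfrak p,M)$ defined through the unique form of its elements.\<close>

definition rpm :: "(ofun => ofun => 'z) => gq => 'z" where
 "rpm F = (\<lambda>a\<in>RpM q s. case (SOME (f, g). f : KU & g : KU & a = cl (pmE f g)) of (f, g) => F f g)"

lemma rpm_eq: "f : KU ==> g : KU ==> rpm F (cl (pmE f g)) = F f g"
proof -
 assume fg: "f : KU" "g : KU"
 let ?P = "%x. case x of (f', g') => f' : KU & g' : KU & cl (pmE f g) = cl (pmE f' g')"
 have "(SOME x. ?P x) = (f, g)"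
 proof (rule some_equality)
  show "?P (f, g)" using fg by simp
  show "x = (f, g)" if "?P x" for x using that pmE_unique[OF fg] by (cases x) auto
 qed
 thus ?thesis using RpM_ops(1)[OF fg] by (simp add: rpm_def)
qed

lemma rpm_ext: "rpm F : extensional (RpM q s)" by (simp add: rpm_def)

lemma RpM_cases: "a : RpM q s ==> (!!f g. f : KU ==> g : KU ==> a = cl (pmE f g) ==> thesis) ==> thesis"
 by (auto simp: RpM_eq)

lemma G_lin: "f : KU ==> g : KU ==> G t (%a. f a + g a) = G t f + G t g" "f : KU ==> G t (%a. c * f a) = c * G t f"
 "G t (%_. 0) = 0" "t ~= 0 ==> f : KU ==> g : KU ==> G t (omult f g) = G t f * G t g"
 using OpU_lin[OF G_OpU] G_omult OKU_OU by auto

lemma complex_ring_simps [simp]: "carrier complex_ring = UNIV" "mult complex_ring = (*)" "one complex_ring = 1"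
 "ring.zero complex_ring = 0" "add complex_ring = (+)"
 by (simp_all add: complex_ring_def)

text \<open>With $t^2=\lambda$, the functional \<open>G t\<close> takes the values $\lambda$, $\lambda^{-1}$, 0 at $X$, $Y$, $Z$.\<close>

lemma char_RpM_eq:
 assumes "t ~= 0" "(e::int) : {1, -1}" "lam = t\<^sup>2"
 shows "char_RpM q s e lam = rpm (%f g. G t f + of_int e * G t g)"
 unfolding char_RpM_def
proof (rule the_equality)
 have ee: "complex_of_int e * of_int e = 1" using assms(2) by auto
 let ?ch = "rpm (%f g. G t f + of_int e * G t g)"
 note [simp] = rpm_eq G_lin(1,2,3) G_lin(4)[OF assms(1)] G_counit OKUD OKU_omult OKU_counit XYZ_OKU
 show "?ch : extensional (RpM q s) & ?ch : Ring.ring_hom (RpM_ring q s) complex_ring &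
   (ALL c. ALL a:RpM q s. ?ch (g_scale q s c a) = c * ?ch a) & ?ch (inK q s (minus_one_q q s)) = of_int e &
   ?ch (inY q s oXX) = lam & ?ch (inY q s oYY) = inverse lam & ?ch (inY q s oZZ) = 0"
 proof (intro conjI ballI allI)
  show "?ch : Ring.ring_hom (RpM_ring q s) complex_ring"
  proof (rule ring_hom_memI)
   fix x y assume "x : carrier (RpM_ring q s)" "y : carrier (RpM_ring q s)"
   then obtain f g f' g' where *: "f : KU" "g : KU" "x = cl (pmE f g)" "f' : KU" "g' : KU" "y = cl (pmE f' g')"
    by (auto elim!: RpM_cases)
   have "G t f * G t f' + G t g * G t g' + of_int e * (G t f * G t g' + G t g * G t f')
    = (G t f + of_int e * G t g) * (G t f' + of_int e * G t g')"
   proof -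
    have "(G t f + of_int e * G t g) * (G t f' + of_int e * G t g')
     = G t f * G t f' + of_int e * of_int e * (G t g * G t g') + of_int e * (G t f * G t g' + G t g * G t f')"
     by (simp add: algebra_simps)
    thus ?thesis by (simp add: ee)
   qed
   thus "?ch (x \<otimes>\<^bsub>RpM_ring q s\<^esub> y) = ?ch x \<otimes>\<^bsub>complex_ring\<^esub> ?ch y" using * by (simp add: RpM_ops(1-4))
   show "?ch (x \<oplus>\<^bsub>RpM_ring q s\<^esub> y) = ?ch x \<oplus>\<^bsub>complex_ring\<^esub> ?ch y" using * by (simp add: RpM_ops(1-4) algebra_simps)
  qed (use RpM_ops(7)[OF OKU_counit OKU_counit] in simp_all)
  fix c a assume "a : RpM q s"
  thus "?ch (g_scale q s c a) = c * ?ch a" by (auto elim!: RpM_cases simp: RpM_ops(1-4) algebra_simps)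
 next
  show "?ch (inK q s (minus_one_q q s)) = of_int e" using RpM_ops(6)[OF OKU_counit OKU_counit] by simp
  show "?ch (inY q s oXX) = lam" "?ch (inY q s oYY) = inverse lam" "?ch (inY q s oZZ) = 0"
   using RpM_ops(5)[OF XYZ_OKU(1) OKU_counit] RpM_ops(5)[OF XYZ_OKU(2) OKU_counit] RpM_ops(5)[OF XYZ_OKU(3) OKU_counit] assms
   by (simp_all add: G_XYZ power_int_minus)
 qed (rule rpm_ext)
 fix ch assume ch: "ch : extensional (RpM q s) & ch : Ring.ring_hom (RpM_ring q s) complex_ring &
   (ALL c. ALL a:RpM q s. ch (g_scale q s c a) = c * ch a) & ch (inK q s (minus_one_q q s)) = of_int e &
   ch (inY q s oXX) = lam & ch (inY q s oYY) = inverse lam & ch (inY q s oZZ) = 0"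
 hence hom: "ch : Ring.ring_hom (RpM_ring q s) complex_ring" by blast
 have ops: "ch (x [.] y) = ch x * ch y" "ch (x [++] y) = ch x + ch y" if "x : RpM q s" "y : RpM q s" for x y
  using ring_hom_mult[OF hom, of x y] ring_hom_add[OF hom, of x y] that by simp_all
 have one: "ch \<one>\<^bsub>GR\<^esub> = 1" using ring_hom_one[OF hom] by simp
 have Y: "inY q s f : RpM q s" if "f : KU" for f using RpM_ops(1,5)[OF that OKUD(1)] by simp
 have K: "inK q s (minus_one_q q s) : RpM q s" using RpM_ops(1,6)[OF OKUD(1) OKU_counit] by simp
 have mul: "inY q s (omult f g) = inY q s f [.] inY q s g" if "f : KU" "g : KU" for f g
  using that by (simp add: RpM_ops(5)[OF _ OKUD(1)] RpM_ops(2))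
 have yv: "ch (inY q s f) = G t f" if "f : KU" for f
  using that
 proof (induction rule: OKU_induct)
  case zero
  have "g_scale q s 0 (inY q s (%_. 0)) = inY q s (%_. 0)" by (simp add: RpM_ops(5)[OF OKUD(1) OKUD(1)] RpM_ops(4)[OF OKUD(1) OKUD(1)])
  hence "ch (inY q s (%_. 0)) = 0 * ch (inY q s (%_. 0))" using ch Y[OF OKUD(1)] by metis
  thus ?case by simp
 next
  case one
  show ?case using `ch \<one>\<^bsub>GR\<^esub> = 1` RpM_ops(7)[OF OKU_counit OKU_counit] RpM_ops(5)[OF OKU_counit OKU_counit] by simp
 next
  case (comb f g c)
  have sc: "g_scale q s c (inY q s f) = inY q s (%a. c * f a)"
   using comb by (simp add: RpM_ops(5)[OF _ OKUD(1)] RpM_ops(4)[OF _ OKUD(1)])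
  have "inY q s (%a. c * f a + g a) = g_scale q s c (inY q s f) [++] inY q s g"
   using comb by (simp add: sc) (simp add: RpM_ops(5)[OF _ OKUD(1)] RpM_ops(3))
  moreover have "g_scale q s c (inY q s f) : RpM q s" unfolding sc by (rule Y) (simp add: comb)
  ultimately have "ch (inY q s (%a. c * f a + g a)) = c * ch (inY q s f) + ch (inY q s g)"
   using ch Y[OF comb(1)] Y[OF comb(2)] ops(2) by metis
  thus ?case using comb by simp
 qed (use ch in "auto simp: mul ops Y G_XYZ assms power_int_minus")
 show "ch = ?ch"
 proof (rule extensionalityI[of _ "RpM q s"])
  fix a assume "a : RpM q s"
  then obtain f g where fg: "f : KU" "g : KU" "a = cl (pmE f g)" by (rule RpM_cases)
  have "ch a = ch (inY q s f) + ch (inY q s g) * ch (inK q s (minus_one_q q s))"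
   by (simp add: fg(3) RpM_ops(8)[OF fg(1,2)] ops(2)[OF Y[OF fg(1)] RpM_times[OF Y[OF fg(2)] K]] ops(1)[OF Y[OF fg(2)] K])
  thus "ch a = ?ch a" using fg ch by (simp add: yv)
 qed (use ch rpm_ext in auto)
qed

lemma lact_G_OKU: "f : KU ==> lact (G t) f : KU"
 by (rule OKU_lact[OF G_OpU])

lemma lact_G_lin: "f : KU ==> g : KU ==> lact (G t) (%a. f a + g a) = (%a. lact (G t) f a + lact (G t) g a)"
 "f : KU ==> lact (G t) (%a. c * f a) = (%a. c * lact (G t) f a)"
 using lact_comb[OF G_OpU, of f g t 1] lact_comb[OF G_OpU _ OUD(1), of f t c] OKU_OU by (simp_all add: lact_zero G_OpU)

lemma J_aut_eq: "J_aut q s = rpm (%f g. cl (pmE (lact (G cs) f) (lact (G cs) g)))"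
 unfolding J_aut_def k_half_G
proof (rule the_equality)
 let ?J = "%t. rpm (%f g. cl (pmE (lact (G t) f) (lact (G t) g)))"
 note [simp] = rpm_eq lact_G_OKU lact_G_lin lact_G_omult[OF _ OKU_OU OKU_OU] lact_G_XYZ(4) lact_zero[OF G_OpU] OKUD(1,3,4) OKU_omult OKU_counit
 have inv: "?J (inverse t) (?J t a) = a" "?J t a : RpM q s" if a: "a : RpM q s" and t: "t ~= 0" for a t
 proof -
  obtain f g where fg: "f : KU" "g : KU" "a = cl (pmE f g)" using a by (rule RpM_cases)
  have i: "lact (G (inverse t)) (lact (G t) h) = h" if "h : KU" for h
   using G_translate(1)[OF that t, of "inverse t"] lact_G1[OF that] t by simp
  note O = lact_G_OKU[OF fg(1), of t] lact_G_OKU[OF fg(2), of t]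
  show "?J (inverse t) (?J t a) = a" "?J t a : RpM q s"
   unfolding fg(3) rpm_eq[OF fg(1,2)] rpm_eq[OF O] i[OF fg(1)] i[OF fg(2)] by (rule refl, rule RpM_ops(1)[OF O])
 qed
 have cs: "cs ~= 0" "inverse cs ~= 0" by simp_all
 show "?J cs : extensional (RpM q s) & ?J cs : ring_iso (RpM_ring q s) (RpM_ring q s) &
   (ALL c. ALL a:RpM q s. ?J cs (g_scale q s c a) = g_scale q s c (?J cs a)) &
   ?J cs (inK q s (minus_one_q q s)) = inK q s (minus_one_q q s) &
   (ALL y:OKU q s. ?J cs (inY q s y) = inY q s (lact (G cs) y))"
 proof (intro conjI ballI allI)
  have hom: "?J cs : Ring.ring_hom (RpM_ring q s) (RpM_ring q s)"
  proof (rule ring_hom_memI)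
   fix x y assume "x : carrier (RpM_ring q s)" "y : carrier (RpM_ring q s)"
   then obtain f g f' g' where *: "f : KU" "g : KU" "x = cl (pmE f g)" "f' : KU" "g' : KU" "y = cl (pmE f' g')"
    by (auto elim!: RpM_cases)
   thus "?J cs (x \<otimes>\<^bsub>RpM_ring q s\<^esub> y) = ?J cs x \<otimes>\<^bsub>RpM_ring q s\<^esub> ?J cs y" by (simp add: RpM_ops(1-4))
   show "?J cs (x \<oplus>\<^bsub>RpM_ring q s\<^esub> y) = ?J cs x \<oplus>\<^bsub>RpM_ring q s\<^esub> ?J cs y" using * by (simp add: RpM_ops(1-4))
  qed (use RpM_ops(7)[OF OKU_counit OKU_counit] inv(2) cs in simp_all)
  have "bij_betw (?J cs) (RpM q s) (RpM q s)"
   by (rule bij_betw_byWitness[of _ "?J (inverse cs)"]) (use inv[of _ cs] inv[of _ "inverse cs"] cs in auto)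
  thus "?J cs : ring_iso (RpM_ring q s) (RpM_ring q s)" using hom by (simp add: ring_iso_def)
  fix c a assume "a : RpM q s"
  thus "?J cs (g_scale q s c a) = g_scale q s c (?J cs a)" by (auto elim!: RpM_cases simp: RpM_ops(1-4))
 next
  show "?J cs (inK q s (minus_one_q q s)) = inK q s (minus_one_q q s)" using RpM_ops(6)[OF OKU_counit OKU_counit] by simp
  fix y assume "y : KU"
  thus "?J cs (inY q s y) = inY q s (lact (G cs) y)"
   by (simp add: RpM_ops(5)[OF _ OKU_counit])
 qed (rule rpm_ext)
 fix j assume j: "j : extensional (RpM q s) & j : ring_iso (RpM_ring q s) (RpM_ring q s) &
   (ALL c. ALL a:RpM q s. j (g_scale q s c a) = g_scale q s c (j a)) &
   j (inK q s (minus_one_q q s)) = inK q s (minus_one_q q s) & (ALL y:OKU q s. j (inY q s y) = inY q s (lact (G cs) y))"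
 hence hom: "j : Ring.ring_hom (RpM_ring q s) (RpM_ring q s)" by (simp add: ring_iso_def)
 have ops: "j (x [.] y) = j x [.] j y" "j (x [++] y) = j x [++] j y" if "x : RpM q s" "y : RpM q s" for x y
  using ring_hom_mult[OF hom, of x y] ring_hom_add[OF hom, of x y] that by simp_all
 have Y: "inY q s f : RpM q s" if "f : KU" for f using RpM_ops(1,5)[OF that OKUD(1)] by simp
 have K: "inK q s (minus_one_q q s) : RpM q s" using RpM_ops(1,6)[OF OKUD(1) OKU_counit] by simp
 show "j = ?J cs"
 proof (rule extensionalityI[of _ "RpM q s"])
  fix a assume "a : RpM q s"
  then obtain f g where fg: "f : KU" "g : KU" "a = cl (pmE f g)" by (rule RpM_cases)
  have "j a = j (inY q s f) [++] j (inY q s g) [.] j (inK q s (minus_one_q q s))"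
   by (simp add: fg(3) RpM_ops(8)[OF fg(1,2)] ops(2)[OF Y[OF fg(1)] RpM_times[OF Y[OF fg(2)] K]] ops(1)[OF Y[OF fg(2)] K])
  thus "j a = ?J cs a" using fg j by (simp add: RpM_ops(8)[OF lact_G_OKU lact_G_OKU])
 qed (use j rpm_ext in auto)
qed

lemma RgK_cases: "a : RgK q s ==> (!!p. p : KS ==> a = cl p ==> thesis) ==> thesis"
 by (auto simp: RgK_eq)

lemma cl_RgK: "p : KS ==> cl p : RgK q s" by (auto simp: RgK_eq)

lemma MM_KS: "x : MM n ==> x : KS"
proof (induction rule: MM.induct)
 case (up k i)
 show ?case
 proof (induction k)
  case 0
  show ?case by (simp add: KS_closed(8) S_closed)
 next
  case (Suc k)
  thus ?case using KS_closed(2) by simp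
 qed
next
 case (dn k i)
 show ?case
 proof (induction k)
  case 0
  show ?case by (simp add: KS_closed(8) S_closed)
 next
  case (Suc k)
  thus ?case using KS_closed(2) by simp
 qed
next
 case (comb x y c)
 thus ?case using KS_closed(1,2) S_closed(4) by blast
qed (use KS_closed in auto)

end

section \<open>Induced modules\<close>

text \<open>The functional \<open>G T\<close> is the twist by $J$ of the one attached to $\lambda$, as $J$ translates by
  $k^{1/2}$; hence the factor $q$ in $T^2=\lambda q$.\<close>

locale induced = quantum +
 fixes ep :: int and lam T :: complex
 assumes eps: "ep : {1, -1}" and T: "T ~= 0" "T\<^sup>2 = lam * complex_of_real q"
begin

abbreviation HH where "HH \<equiv> Hom_mod q s (twist_J q s (char_mod (char_RpM q s ep lam)))"

lemma lam0: "lam ~= 0" using T by auto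

lemma char_J: "f : KU ==> g : KU ==> char_RpM q s ep lam (J_aut q s (cl (pmE f g))) = G T f + of_int ep * G T g"
proof -
 assume fg: "f : KU" "g : KU"
 define t where "t = T / cs"
 have t: "t ~= 0" "lam = t\<^sup>2" using T cs2 by (auto simp: t_def power2_eq_square field_simps)
 have "cs * t = T" "t * cs = T" by (simp_all add: t_def)
 thus ?thesis
  unfolding char_RpM_eq[OF t(1) eps t(2)] J_aut_eq using fg t by (simp add: rpm_eq lact_G_OKU G_translate)
qed

lemma HC_iff: "f : carrier HH <-> f : extensional (RgK q s) &
  (ALL p:KS. ALL r:KS. f (cl (p + r)) = f (cl p) + f (cl r)) & (ALL c. ALL p:KS. f (cl (fa_const c * p)) = c * f (cl p)) &
  (ALL y:OKU q s. ALL z:OKU q s. ALL p:KS. f (cl (pmE y z * p)) = (G T y + of_int ep * G T z) * f (cl p))"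
proof -
 have 1: "(ALL a:RgK q s. ALL b:RgK q s. f (a [++] b) = f a + f b) <-> (ALL p:KS. ALL r:KS. f (cl (p + r)) = f (cl p) + f (cl r))"
  by (simp add: RgK_eq cl_ops KS_S)
 have 2: "(ALL c. ALL a:RgK q s. f (g_scale q s c a) = c * f a) <-> (ALL c. ALL p:KS. f (cl (fa_const c * p)) = c * f (cl p))"
  by (simp add: RgK_eq g_scale_cl KS_S)
 have "(ALL x:RpM q s. ALL a:RgK q s. f (x [.] a) = char_RpM q s ep lam (J_aut q s x) * f a)
  <-> (ALL y:OKU q s. ALL z:OKU q s. ALL p:KS. f (cl (pmE y z) [.] cl p) = char_RpM q s ep lam (J_aut q s (cl (pmE y z))) * f (cl p))"
  unfolding RpM_eq RgK_eq by blast
 also have "... <-> (ALL y:OKU q s. ALL z:OKU q s. ALL p:KS. f (cl (pmE y z * p)) = (G T y + of_int ep * G T z) * f (cl p))"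
  by (simp add: char_J cl_ops KS_S pmE_S cong: ball_cong)
 finally show ?thesis
  by (simp add: Hom_mod_def twist_J_def char_mod_def 1 2 PiE_def)
qed

lemma HC_D:
 assumes "f : carrier HH"
 shows "f : extensional (RgK q s)" "p : KS ==> r : KS ==> f (cl (p + r)) = f (cl p) + f (cl r)"
  "p : KS ==> f (cl (fa_const c * p)) = c * f (cl p)"
  "y : KU ==> z : KU ==> p : KS ==> f (cl (pmE y z * p)) = (G T y + of_int ep * G T z) * f (cl p)"
 using assms unfolding HC_iff by blast+

lemma HC_0: "f : carrier HH ==> f (cl 0) = 0"
 using HC_D(3)[of f 0 0] KS_closed(5) by simp

definition chA :: "int => complex" where "chA n = qp (n + 1) * lam - inverse (qp (n + 1) * lam)"
definition chM :: "int => complex" where "chM n = qp (1 - n) * lam - inverse (qp (1 - n) * lam)"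

lemma HC_L3: "f : carrier HH ==> p : KS ==> f (cl (L3 a b c * p)) = (a * (lam * cq) + b * inverse (lam * cq)) * f (cl p)"
proof -
 assume f: "f : carrier HH" and p: "p : KS"
 have y: "f (cl (gy y * p)) = G T y * f (cl p)" if "y : KU" for y
  using HC_D(4)[OF f that OKUD(1) p] eqv_cl[OF eqv_multr[OF pmE_gens(1)[OF that] KS_S[OF p]]] by (simp add: G_lin)
 have k: "fa_const z * (gy y * p) : KS" "gy y * p : KS" if "y : KU" for y z
  using KS_closed(2)[OF p gy_S[OF that]] KS_closed(2) S_closed(4) by blast+
 have "L3 a b c * p = fa_const a * (gX * p) + fa_const b * (gY * p) + fa_const c * (gZ * p)"
  by (simp add: L3_def distrib_right mult.assoc)
 thus ?thesis
  using k XYZ_OKU by (simp add: HC_D(2,3)[OF f] KS_closed(1) y G_XYZ T(2)[symmetric] power_int_minus) (simp add: algebra_simps)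
qed

lemma HC_shift:
 assumes f: "f : carrier HH" and p: "p : KS"
 shows "f (cl (Ap n * p)) = chA n * f (cl p)" "f (cl (Am n * p)) = chM n * f (cl p)"
  "Wl n p ==> f (cl (Om * p)) = (lam + inverse lam) * f (cl p)"
proof -
 show "f (cl (Ap n * p)) = chA n * f (cl p)" "f (cl (Am n * p)) = chM n * f (cl p)"
  using lam0 by (simp_all add: HC_L3[OF f p] Ap_def Am_def chA_def chM_def qp_add qp_diff qp_minus field_simps)
 show "f (cl (Om * p)) = (lam + inverse lam) * f (cl p)" if "Wl n p"
  using lam0 by (simp add: eqv_cl[OF Om_On[OF that]] HC_L3[OF f p] On_def field_simps)
qed

text \<open>Up to the factors of \<open>HC_shift\<close>, the value at each spanning element of a left ideal
  \<open>MM n\<close> is the value at $e_n$.\<close>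

lemma HC_determined:
 assumes f: "f : carrier HH" and g: "g : carrier HH" and fg: "!!m. f (cl (ge m)) = g (cl (ge m))"
 shows "f = g"
proof -
 have O: "f (cl (Om ^ i * ge n)) = g (cl (Om ^ i * ge n))" for n i
 proof (induction i)
  case (Suc i)
  have "Om ^ i * ge n : KS" "Wl n (Om ^ i * ge n)" using upE_weight[of n 0 i] by (auto intro: KS_closed(8) S_closed L3_S)
  thus ?case using Suc HC_shift(3)[OF f] HC_shift(3)[OF g] by (simp add: mult.assoc)
 qed (simp add: fg)
 have u: "f (cl (upE n k i)) = g (cl (upE n k i))" for n k i
 proof (induction k)
  case (Suc k)
  thus ?case using HC_shift(1)[OF f MM_KS[OF MM.up]] HC_shift(1)[OF g MM_KS[OF MM.up]] by simp
 qed (simp add: O)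
 have d: "f (cl (dnE n k i)) = g (cl (dnE n k i))" for n k i
 proof (induction k)
  case (Suc k)
  thus ?case using HC_shift(2)[OF f MM_KS[OF MM.dn]] HC_shift(2)[OF g MM_KS[OF MM.dn]] by simp
 qed (simp add: O)
 have M: "f (cl x) = g (cl x)" if "x : MM n" for x n
  using that
 proof (induction rule: MM.induct)
  case (comb x y c)
  thus ?case using MM_KS KS_closed(2) S_closed(4) by (simp add: HC_D(2,3)[OF f] HC_D(2,3)[OF g])
 next
  case (eqv x y)
  thus ?case using eqv_cl by metis
 qed (simp_all add: u d HC_0 f g)
 have E: "f (cl (p * eset M)) = g (cl (p * eset M))" if "finite M" "p : gS" for M p
  using that
 proof (induction M rule: finite_induct)
  case empty
  have "cl (p * eset {}) = cl 0" using eqv_cl[OF eqv_multl[OF eset_empty empty]] by simp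
  thus ?case by (simp add: HC_0 f g)
 next
  case (insert m M)
  have "cl (p * eset (insert m M)) = cl (p * ge m + p * eset M)"
   using eqv_cl[OF eqv_multl[OF eset_insert[OF insert.hyps(2)] insert.prems]] by (simp add: distrib_left)
  moreover have "p * ge m : KS" "p * eset M : KS" using insert KS_closed(2,6,7) by blast+
  ultimately show ?case using insert M[OF MM_ge[OF insert.prems]] by (simp add: HC_D(2)[OF f] HC_D(2)[OF g])
 qed
 show ?thesis
 proof (rule extensionalityI[OF HC_D(1)[OF f] HC_D(1)[OF g]])
  fix a assume "a : RgK q s"
  then obtain p where p: "p : KS" "a = cl p" by (rule RgK_cases)
  then obtain M where "finite M" "p * eset M ~~ p" by (auto simp: KS_def)
  thus "f a = g a" using E[of M p] KS_S[OF p(1)] eqv_cl p(2) by metis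
 qed
qed

lemma parity: "n : Zpar ep <-> (-1) powi n = complex_of_int ep"
 using eps by (auto simp: Zpar_def power_int_minus_left)

lemma HC_parity:
 assumes f: "f : carrier HH" and "f (cl (ge m)) ~= 0" shows "m : Zpar ep"
proof -
 have "pmE (%_. 0) counit * ge m ~~ gm * ge m" by (rule eqv_multr[OF pmE_gens(2)]) simp
 also have "... ~~ fa_const ((-1) powi m) * ge m" unfolding gm_D by (rule gD_ge)
 finally have "cl (pmE (%_. 0) counit * ge m) = cl (fa_const ((-1) powi m) * ge m)" by (rule eqv_cl)
 hence "(-1) powi m * f (cl (ge m)) = of_int ep * f (cl (ge m))"
  using HC_D(4)[OF f OKUD(1) OKU_counit KS_closed(7), of m] HC_D(3)[OF f KS_closed(7), of "(-1) powi m" m] by (simp add: G_lin G_counit)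
 hence "(-1) powi m = complex_of_int ep" using assms(2) by auto
 thus ?thesis by (simp add: parity)
qed

text \<open>The element $\zeta_n$, as a matrix coefficient of the action on $\mathcal O_q(U)$.\<close>

definition zet :: "int => gq => complex" where
 "zet n = (\<lambda>a\<in>RgK q s. pact T (SOME p. p : KS & cl p = a) (psi n) 1)"

lemma zet_cl: "p : KS ==> zet n (cl p) = pact T p (psi n) 1"
proof -
 assume p: "p : KS"
 define r where "r = (SOME r. r : KS & cl r = cl p)"
 have r: "r : KS & cl r = cl p" unfolding r_def by (rule someI[of _ p]) (simp add: p)
 hence "r ~~ p" using cl_eq KS_S p by blast
 thus ?thesis using pact_eqv[OF _ psi_OU T(1)] cl_RgK[OF p] by (simp add: zet_def r_def)
qed

lemma zet_ge: "zet n (cl (ge m)) = (if m = n then 1 else 0)"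
 by (simp add: zet_cl KS_closed(7) pact_D_psi psi(3)) (simp add: dl_def)

lemma zet_HC: "n : Zpar ep ==> zet n : carrier HH"
 unfolding HC_iff
proof (intro conjI ballI allI)
 assume n: "n : Zpar ep"
 show "zet n : extensional (RgK q s)" by (simp add: zet_def)
 fix p assume p: "p : KS"
 note pS = KS_S[OF p]
 show "zet n (cl (p + r)) = zet n (cl p) + zet n (cl r)" if "r : KS" for r
  using p that by (simp add: zet_cl KS_closed(1) pact_lin)
 show "zet n (cl (fa_const c * p)) = c * zet n (cl p)" for c
  using p by (simp add: zet_cl KS_closed(2) S_closed pact_lin)
 fix y z assume yz: "y : KU" "z : KU"
 let ?ph = "pact T p (psi n)"
 have "lact (minus_one_q q s) ?ph = pact T (gm * p) (psi n)"
  using pact_mult[OF XYZ_S(6) pS psi_OU, of T n] by (simp add: gm_D pact_D) (simp add: minus_one_q_D)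
 also have "... = pact T (p * gm) (psi n)" by (rule pact_eqv[OF gm_central[OF pS] psi_OU T(1)])
 also have "... = pact T p (%a. of_int ep * psi n a + 0)"
  using pact_mult[OF pS XYZ_S(6) psi_OU, of T n] n by (simp add: gm_D pact_D_psi parity)
 also have "... = (%a. of_int ep * ?ph a)"
  using pact_comb[OF pS psi_OU OUD(1), of T "of_int ep" n] pact_comb[OF pS OUD(1) OUD(1), of T "-1"] by simp
 finally have m: "lact (minus_one_q q s) ?ph = (%a. of_int ep * ?ph a)" .
 have "zet n (cl (pmE y z * p)) = pact T (pmE y z) ?ph 1"
  using p yz by (simp add: zet_cl KS_closed(2) pmE_S pact_mult[OF pmE_S[OF yz] pS psi_OU])
 also have "... = (G T y + of_int ep * G T z) * ?ph 1"
  unfolding pact_pmE[OF yz pact_closed[OF pS psi_OU] m] by (simp add: ract_at_1 algebra_simps)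
 finally show "zet n (cl (pmE y z * p)) = (G T y + of_int ep * G T z) * zet n (cl p)" by (simp add: zet_cl p)
qed

end

section \<open>Simple modules are determined by one weight vector\<close>

lemma cring_complex_ring: "cring complex_ring"
proof (rule cringI)
 show "abelian_group complex_ring"
 proof (rule abelian_groupI)
  fix x :: complex
  show "EX y:carrier complex_ring. y \<oplus>\<^bsub>complex_ring\<^esub> x = \<zero>\<^bsub>complex_ring\<^esub>"
   by (intro bexI[of _ "- x"]) (simp_all add: complex_ring_def)
 qed (simp_all add: complex_ring_def)
 show "Group.comm_monoid complex_ring"
  by (rule Group.comm_monoidI) (simp_all add: complex_ring_def)
qed (simp_all add: complex_ring_def distrib_right)

lemma minus_complex_ring: "\<ominus>\<^bsub>complex_ring\<^esub> z = - z"
proof -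
 interpret cring complex_ring by (rule cring_complex_ring)
 show ?thesis by (rule minus_equality) (simp_all add: complex_ring_def)
qed

lemma submodule_iff:
 fixes V :: "(complex, 'v, 'z) module_scheme"
 assumes "Module.module complex_ring V"
 shows "submodule W complex_ring V <-> W <= carrier V & \<zero>\<^bsub>V\<^esub> : W & (ALL v:W. ALL w:W. v \<oplus>\<^bsub>V\<^esub> w : W) & (ALL c. ALL w:W. c \<odot>\<^bsub>V\<^esub> w : W)"
proof -
 interpret Module.module complex_ring V by (rule assms)
 have a: "\<ominus>\<^bsub>V\<^esub> v = (-1) \<odot>\<^bsub>V\<^esub> v" if "v : carrier V" for v
 proof -
  have "1 \<odot>\<^bsub>V\<^esub> v = v" using smult_one[OF that] unfolding complex_ring_def by simp
  thus ?thesis using smult_l_minus[of 1 v] that by (simp add: minus_complex_ring) (simp add: complex_ring_def)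
 qed
 show ?thesis
 proof
  assume W: "submodule W complex_ring V"
  then obtain w where "w : W" using submoduleE(2) by blast
  hence "0 \<odot>\<^bsub>V\<^esub> w : W" using submoduleE(4)[OF W, of 0] by (simp add: complex_ring_def)
  moreover have "0 \<odot>\<^bsub>V\<^esub> w = \<zero>\<^bsub>V\<^esub>" using smult_l_null[of w] `w : W` submoduleE(1)[OF W] by (auto simp: complex_ring_def)
  ultimately show "W <= carrier V & \<zero>\<^bsub>V\<^esub> : W & (ALL v:W. ALL w:W. v \<oplus>\<^bsub>V\<^esub> w : W) & (ALL c. ALL w:W. c \<odot>\<^bsub>V\<^esub> w : W)"
   using submoduleE(1,4,5)[OF W] by (simp add: complex_ring_def)
 next
  assume *: "W <= carrier V & \<zero>\<^bsub>V\<^esub> : W & (ALL v:W. ALL w:W. v \<oplus>\<^bsub>V\<^esub> w : W) & (ALL c. ALL w:W. c \<odot>\<^bsub>V\<^esub> w : W)"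
  show "submodule W complex_ring V" by (rule submoduleI) (use * a in auto)
 qed
qed

locale gk_mod = quantum +
 fixes V :: "(gq, 'v) amod" (structure)
 assumes gk: "gk_module q s V"
begin

abbreviation ac :: "ggen fa => 'v => 'v" where "ac p v \<equiv> act V (cl p) v"

lemma modV: "Module.module complex_ring V"
 using gk by (simp add: gk_module_def rep_of_def)

sublocale M: Module.module complex_ring V by (rule modV)

lemma ops:
 "p : KS ==> v : carrier V ==> ac p v : carrier V"
 "p : KS ==> v : carrier V ==> w : carrier V ==> ac p (v \<oplus> w) = ac p v \<oplus> ac p w"
 "p : KS ==> v : carrier V ==> ac p (c \<odot> v) = c \<odot> ac p v"
 "p : KS ==> r : KS ==> v : carrier V ==> ac (p + r) v = ac p v \<oplus> ac r v"
 "p : KS ==> v : carrier V ==> ac (fa_const c * p) v = c \<odot> ac p v"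
 "p : KS ==> r : KS ==> v : carrier V ==> ac (p * r) v = ac p (ac r v)"
 "p ~~ r ==> ac p v = ac r v"
proof -
 have R: "rep_of q s (RgK q s) V" using gk by (simp add: gk_module_def)
 have k: "cl p : RgK q s" if "p : KS" for p by (rule cl_RgK[OF that])
 show "p : KS ==> v : carrier V ==> ac p v : carrier V"
  "p : KS ==> v : carrier V ==> w : carrier V ==> ac p (v \<oplus> w) = ac p v \<oplus> ac p w"
  "p : KS ==> v : carrier V ==> ac p (c \<odot> v) = c \<odot> ac p v"
  using R k unfolding rep_of_def by blast+
 show "p : KS ==> r : KS ==> v : carrier V ==> ac (p + r) v = ac p v \<oplus> ac r v"
  using R k[of p] k[of r] cl_ops(2)[of p r] KS_S unfolding rep_of_def by metis
 show "p : KS ==> v : carrier V ==> ac (fa_const c * p) v = c \<odot> ac p v"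
  using R k[of p] g_scale_cl[of p c] KS_S unfolding rep_of_def by metis
 show "p : KS ==> r : KS ==> v : carrier V ==> ac (p * r) v = ac p (ac r v)"
  using R k[of p] k[of r] cl_ops(1)[of p r] KS_S unfolding rep_of_def by metis
 show "p ~~ r ==> ac p v = ac r v" using eqv_cl by simp
qed

lemma smult_props:
 assumes "v : carrier V"
 shows "0 \<odot> v = \<zero>" "1 \<odot> v = v" "c \<odot> (d \<odot> v) = (c * d) \<odot> v" "c \<odot> v : carrier V"
  "(c + d) \<odot> v = c \<odot> v \<oplus> d \<odot> v" "c \<odot> v = \<zero> <-> c = 0 \<or> v = \<zero>"
  "c \<odot> \<zero> = \<zero>"
proof -
 show 1: "0 \<odot> v = \<zero>" "1 \<odot> v = v" "c \<odot> (d \<odot> v) = (c * d) \<odot> v" "c \<odot> v : carrier V"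
  "(c + d) \<odot> v = c \<odot> v \<oplus> d \<odot> v" "c \<odot> \<zero> = \<zero>" for c d
  using M.smult_l_null[OF assms] M.smult_one[OF assms] M.smult_assoc1[of c d v] M.smult_closed[of c v] M.smult_l_distr[of c d v]
   M.smult_r_null[of c] assms by (simp_all add: complex_ring_def)
 show "c \<odot> v = \<zero> <-> c = 0 \<or> v = \<zero>"
  using 1(1,2,6) 1(3)[of "inverse c" c] by (cases "c = 0") auto
qed

lemma ac_zero: "v : carrier V ==> ac 0 v = \<zero>" "p : KS ==> ac p \<zero> = \<zero>"
 using ops(5)[OF KS_closed(5), of v 0] ops(1)[OF KS_closed(5), of v] smult_props(1)
  ops(3)[of p "\<zero>" 0] ops(1)[of p "\<zero>"] smult_props(1)[OF M.zero_closed] M.zero_closed by simp_all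

lemma ac_diff:
 assumes "p : KS" "r : KS" "v : carrier V"
 shows "ac (p + fa_const (-1) * r) v = \<zero> <-> ac p v = ac r v"
proof -
 have c: "ac p v : carrier V" "ac r v : carrier V" using ops(1) assms by auto
 have "fa_const (-1) * r : KS" using KS_closed(2)[OF assms(2) S_closed(4)] .
 moreover have "ac r v \<oplus> (-1) \<odot> ac r v = \<zero>"
  using smult_props(5)[OF c(2), of 1 "-1"] smult_props(1,2)[OF c(2)] by simp
 ultimately show ?thesis
  using c ops(4)[OF assms(1) _ assms(3)] ops(5)[OF assms(2,3), of "-1"] smult_props(4)[OF c(2), of "-1"] by (metis M.add.r_cancel)
qed

lemma ac_eset_mono:
 assumes "v : carrier V" "ac (eset M) v = v" "M <= N" "finite N" shows "ac (eset N) v = v"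
proof -
 have k: "eset M : KS" "eset N : KS" using assms finite_subset by (auto intro: KS_closed(6))
 have "ac (eset N) (ac (eset M) v) = ac (eset M) v"
  using ops(6)[OF k(2,1) assms(1)] ops(7)[OF eset_subset(2)[OF assms(3)]] by simp
 thus ?thesis using assms(2) by simp
qed

text \<open>Non-degeneracy gives every vector a local unit.\<close>

lemma local_unit: "v : carrier V ==> EX M. finite M & ac (eset M) v = v"
proof -
 let ?W = "{v : carrier V. EX M. finite M & ac (eset M) v = v}"
 have W: "submodule ?W complex_ring V"
  unfolding submodule_iff[OF modV]
 proof (intro conjI ballI allI)
  show "\<zero> : ?W" using ac_zero(2)[OF KS_closed(6)[OF finite.emptyI]] by auto
 next
  fix v w assume "v : ?W" "w : ?W"
  then obtain M N where *: "v : carrier V" "w : carrier V" "finite M" "finite N" "ac (eset M) v = v" "ac (eset N) w = w" by auto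
  have "ac (eset (M \<union> N)) (v \<oplus> w) = v \<oplus> w"
   using ops(2)[OF KS_closed(6)[of "M \<union> N"] *(1,2)] ac_eset_mono[OF *(1,5), of "M \<union> N"] ac_eset_mono[OF *(2,6), of "M \<union> N"] *(3,4) by simp
  thus "v \<oplus> w : ?W" using *(3,4) M.a_closed[OF *(1,2)] by blast
 next
  fix c v assume "v : ?W"
  then obtain M where *: "v : carrier V" "finite M" "ac (eset M) v = v" by auto
  have "ac (eset M) (c \<odot> v) = c \<odot> v" using ops(3)[OF KS_closed(6)[OF *(2)] *(1)] *(3) by simp
  thus "c \<odot> v : ?W" using *(2) smult_props(4)[OF *(1)] by blast
 qed auto
 have "{act V a v | a v. a : RgK q s & v : carrier V} <= ?W"
 proof clarify
  fix a v assume a: "a : RgK q s" and v: "v : carrier V"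
  obtain p where p: "p : KS" "a = cl p" using a by (rule RgK_cases)
  obtain N where N: "finite N" "eset N * p ~~ p" using KS_left[OF p(1)] by blast
  have "ac (eset N) (ac p v) = ac p v" using ops(6)[OF KS_closed(6)[OF N(1)] p(1) v] ops(7)[OF N(2)] by simp
  thus "act V a v : carrier V & (EX M. finite M & ac (eset M) (act V a v) = act V a v)"
   using ops(1)[OF p(1) v] N(1) p(2) by auto
 qed
 hence "span_in V {act V a v | a v. a : RgK q s & v : carrier V} <= ?W"
  unfolding span_in_def using W by blast
 thus "v : carrier V ==> EX M. finite M & ac (eset M) v = v"
  using gk by (auto simp: gk_module_def)
qed

lemma weight_component:
 assumes v: "v : carrier V" "v ~= \<zero>"
 shows "EX n. ac (ge n) v ~= \<zero>"
proof (rule ccontr)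
 assume z: "~ ?thesis"
 have "ac (eset M) v = \<zero>" if "finite M" for M
  using that
 proof (induction M rule: finite_induct)
  case empty
  show ?case using ops(7)[OF eset_empty] ac_zero(1)[OF v(1)] by simp
 next
  case (insert m M)
  thus ?case using ops(7)[OF eset_insert[OF insert.hyps(2)]] ops(4)[OF KS_closed(7) KS_closed(6)[OF insert.hyps(1)] v(1)] z by simp
 qed
 moreover obtain M where "finite M" "ac (eset M) v = v" using local_unit[OF v(1)] by blast
 ultimately show False using v(2) by simp
qed

lemma ge_idem: "v : carrier V ==> ac (ge n) (ac (ge n) v) = ac (ge n) v"
proof -
 have "ge n * ge n ~~ ge n" using gD_ge(1)[of "dl n" n] by (simp add: dl_def fa_const_1)
 thus "v : carrier V ==> ?thesis" using ops(6)[OF KS_closed(7) KS_closed(7), of v n n] ops(7)[of "ge n * ge n" "ge n" v] by simp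
qed

end

context quantum
begin

text \<open>Equivalent modules have the same set of pairs, and two simple modules are equivalent as soon as
  they have a pair in common.\<close>

definition gspec :: "(gq, 'v) amod => (int \<times> complex) set" where
 "gspec V = {(n, om). EX v:carrier V. v ~= \<zero>\<^bsub>V\<^esub> & act V (cl (ge n)) v = v & act V (cl (Om * ge n)) v = om \<odot>\<^bsub>V\<^esub> v}"

lemma OmK: "Om * ge n : KS" "pol P * ge n : KS"
 by (simp_all add: KS_closed(8))

lemma Wl_lin: "Wl n x ==> Wl n y ==> Wl n (fa_const c * x + y)"
 by (rule WlI) (auto simp: distrib_left fa_const_left_commute WlD linD[OF FF_lin] algebra_simps intro!: S_closed)

lemma pol_weight: "Wl n (pol P * ge n)"
proof (induction P rule: pCons_induct)
 case 0
 show ?case by (rule WlI) (simp_all add: pol_simps S_closed linD[OF FF_lin])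
next
 case (pCons c P)
 have "pol (pCons c P) * ge n = fa_const c * ge n + Om * (pol P * ge n)"
  by (simp add: pol_pCons distrib_right mult.assoc)
 thus ?case using Wl_lin[OF Wl_ge Om_commute(3)[OF pCons.IH]] by simp
qed

end

context gk_mod
begin

lemma ac_pol_pCons:
 assumes "v : carrier V" "ac (ge n) v = v"
 shows "ac (pol (pCons c P) * ge n) v = c \<odot> v \<oplus> ac (Om * ge n) (ac (pol P * ge n) v)"
proof -
 have "Om * (pol P * ge n) ~~ (Om * ge n) * (pol P * ge n)"
  using eqv_multl[OF eqv_sym[OF ge_on_weight[OF pol_weight]] L3_S(6)] by (simp add: mult.assoc)
 hence "pol (pCons c P) * ge n ~~ fa_const c * ge n + (Om * ge n) * (pol P * ge n)"
  unfolding pol_pCons distrib_right mult.assoc by (intro eqv_add eqv_refl S_closed XYZ_S) (simp add: mult.assoc)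
 thus ?thesis
  using assms by (simp add: ops(7) ops(4)[OF KS_closed(2)[OF KS_closed(7) S_closed(4)] KS_closed(2)[OF OmK(2)]] ops(5)[OF KS_closed(7)] ops(6)[OF OmK] S_closed)
qed

lemma ac_pol_0: "v : carrier V ==> ac (pol 0 * ge n) v = \<zero>"
 by (simp add: pol_simps ac_zero)

lemma ac_pol_eigen:
 assumes "v : carrier V" "ac (ge n) v = v" "ac (Om * ge n) v = om \<odot> v"
 shows "ac (pol P * ge n) v = poly P om \<odot> v"
proof (induction P rule: pCons_induct)
 case 0
 thus ?case using assms by (simp add: ac_pol_0 smult_props)
next
 case (pCons c P)
 thus ?case
  using assms by (simp add: ac_pol_pCons ops(3)[OF OmK(1)] smult_props mult.commute)
qed

text \<open>A polynomial in the Casimir element that kills a vector of weight \<open>n\<close> splits into linear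
  factors, one of which kills a nonzero vector of weight \<open>n\<close>.\<close>

lemma eigenvector_exists:
 assumes "P ~= 0" "v : carrier V" "v ~= \<zero>" "ac (ge n) v = v" "ac (pol P * ge n) v = \<zero>"
 shows "EX om. (n, om) : gspec V"
 using assms
proof (induction "Polynomial.degree P" arbitrary: P rule: less_induct)
 case less
 show ?case
 proof (cases "Polynomial.degree P = 0")
  case True
  then obtain c where c: "P = [:c:]" using degree_eq_zeroE by blast
  hence "ac (pol P * ge n) v = c \<odot> v"
   using less.prems by (simp add: ac_pol_pCons ac_pol_0 ac_zero(2)[OF OmK(1)] smult_props)
  thus ?thesis using less.prems c smult_props(6) by auto
 next
  case False
  then obtain om where "poly P om = 0" using fundamental_theorem_of_algebra[of P] constant_degree[of P] by auto
  then obtain R where R: "P = [:- om, 1:] * R" using poly_eq_0_iff_dvd by blast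
  hence R0: "R ~= 0" using less.prems(1) by auto
  hence "Polynomial.degree R < Polynomial.degree P" unfolding R by (subst degree_mult_eq) auto
  note IH = less.hyps[OF this R0 less.prems(2-4)]
  define u where "u = ac (pol R * ge n) v"
  have uV: "u : carrier V" unfolding u_def by (rule ops(1)[OF OmK(2) less.prems(2)])
  have ug: "ac (ge n) u = u"
   unfolding u_def using ops(6)[OF KS_closed(7) OmK(2) less.prems(2), symmetric] ops(7)[OF ge_on_weight[OF pol_weight]] by simp
  have Pe: "P = Polynomial.smult (- om) R + pCons 0 R" by (simp add: R)
  have "pol P * ge n = fa_const (- om) * (pol R * ge n) + pol (pCons 0 R) * ge n"
   by (subst Pe) (simp only: pol_comb distrib_right mult.assoc)
  hence "\<zero> = (- om) \<odot> u \<oplus> (0 \<odot> v \<oplus> ac (Om * ge n) u)"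
   using less.prems ops(4)[OF KS_closed(2)[OF OmK(2) S_closed(4)] OmK(2) less.prems(2)]
   by (simp add: ops(5)[OF OmK(2)] ac_pol_pCons u_def)
  also have "... = (- om) \<odot> u \<oplus> ac (Om * ge n) u"
   using smult_props(1)[OF less.prems(2)] ops(1)[OF OmK(1) uV] by simp
  finally have e: "(- om) \<odot> u \<oplus> ac (Om * ge n) u = \<zero>" ..
  have "om \<odot> u \<oplus> (- om) \<odot> u = \<zero>"
   using smult_props(5)[OF uV, of om "- om"] smult_props(1)[OF uV] by simp
  hence "ac (Om * ge n) u = (om \<odot> u \<oplus> (- om) \<odot> u) \<oplus> ac (Om * ge n) u"
   using M.l_zero[OF ops(1)[OF OmK(1) uV]] by simp
  also have "... = om \<odot> u"
   using e smult_props(4)[OF uV] ops(1)[OF OmK(1) uV] by (simp add: M.a_assoc)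
  finally have eig: "ac (Om * ge n) u = om \<odot> u" .
  show ?thesis
  proof (cases "u = \<zero>")
   case True
   thus ?thesis using IH u_def by simp
  next
   case False
   thus ?thesis using uV ug eig by (auto simp: gspec_def)
  qed
 qed
qed

end

locale gk_simple_mod = gk_mod +
 assumes simple: "gk_simple q s V"
begin

lemma submodule_cases: "gk_submodule q s W V ==> W = {\<zero>} \<or> W = carrier V"
 using simple by (auto simp: gk_simple_def)

lemma nontrivial: "EX v:carrier V. v ~= \<zero>"
proof -
 have "{\<zero>} ~= carrier V" using simple unfolding gk_simple_def by blast
 thus ?thesis using M.zero_closed by blast
qed

lemma cyclic:
 assumes v: "v : carrier V" "v ~= \<zero>" and u: "u : carrier V"
 shows "EX p:KS. ac p v = u"
proof -
 let ?W = "(%p. ac p v) ` KS"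
 have "submodule ?W complex_ring V"
  unfolding submodule_iff[OF modV]
 proof (intro conjI ballI allI)
  show "?W <= carrier V" using ops(1) v by auto
  show "\<zero> : ?W" using ac_zero(1)[OF v(1)] KS_closed(5) by (metis imageI)
 next
  fix x y assume "x : ?W" "y : ?W"
  thus "x \<oplus> y : ?W" using ops(4)[OF _ _ v(1)] KS_closed(1) by (auto simp: image_iff) metis
 next
  fix c x assume "x : ?W"
  thus "c \<odot> x : ?W" using ops(5)[OF _ v(1)] KS_closed(2) S_closed(4) by (auto simp: image_iff) metis
 qed
 moreover have "act V a x : ?W" if ax: "a : RgK q s" "x : ?W" for a x
 proof -
  obtain p where p: "p : KS" "a = cl p" using `a : RgK q s` by (rule RgK_cases)
  obtain r where r: "r : KS" "x = ac r v" using ax(2) by blast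
  have "act V a x = ac (p * r) v" using ops(6)[OF p(1) r(1) v(1)] p r by simp
  thus ?thesis using KS_closed(3)[OF p(1) KS_S[OF r(1)]] by blast
 qed
 ultimately have "gk_submodule q s ?W V" by (simp add: gk_submodule_def)
 moreover have "v : ?W" using local_unit[OF v(1)] KS_closed(6) by (metis image_eqI)
 ultimately have "?W = carrier V" using submodule_cases v(2) by blast
 thus ?thesis using u by (metis (no_types, lifting) imageE)
qed

text \<open>In a simple module some vector of weight \<open>n\<close> is an eigenvector of the Casimir element:
  since that vector can be recovered from its image under the Casimir element, a nonzero
  polynomial kills it.\<close>

lemma gspec_nonempty: "EX x. x : gspec V"
proof -
 obtain v0 n where v0: "v0 : carrier V" "ac (ge n) v0 ~= \<zero>" using nontrivial weight_component by blast
 define v where "v = ac (ge n) v0"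
 have v: "v : carrier V" "v ~= \<zero>" "ac (ge n) v = v"
  using v0 ops(1)[OF KS_closed(7) v0(1)] ge_idem[OF v0(1)] by (auto simp: v_def)
 define u where "u = ac (Om * ge n) v"
 have uV: "u : carrier V" unfolding u_def by (rule ops(1)[OF OmK(1) v(1)])
 show ?thesis
 proof (cases "u = \<zero>")
  case True
  hence "(n, 0) : gspec V" using v smult_props(1)[OF v(1)] by (auto simp: gspec_def u_def)
  thus ?thesis by blast
 next
  case False
  obtain p where p: "p : KS" "ac p u = v" using cyclic[OF uV False v(1)] by blast
  have pg: "p * ge n : KS" using KS_closed(8) KS_S[OF p(1)] by blast
  obtain P where P: "ge n * (p * ge n) ~~ pol P * ge n" using corner[OF MM_ge[OF KS_S[OF p(1)]]] by blast
  have gu: "ac (ge n) u = u"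
   unfolding u_def using ops(6)[OF KS_closed(7) OmK(1) v(1), symmetric] ops(7)[OF ge_on_weight[OF Om_commute(3)[OF Wl_ge]]] by simp
  have "ac (pol P * ge n) u = ac (ge n * (p * ge n)) u" using ops(7)[OF P] by simp
  also have "... = v" using ops(6)[OF KS_closed(7) pg uV] ops(6)[OF p(1) KS_closed(7) uV] gu p(2) v(3) by simp
  finally have Pu: "ac (pol P * ge n) u = v" .
  have comm: "ac (pol R * ge n) (ac (Om * ge n) v) = ac (Om * ge n) (ac (pol R * ge n) v)" for R
  proof (induction R rule: pCons_induct)
   case 0
   show ?case using ac_pol_0 uV v(1) ac_zero(2)[OF OmK(1)] by (simp add: u_def)
  next
   case (pCons c R)
   have w: "ac (pol R * ge n) v : carrier V" by (rule ops(1)[OF OmK(2) v(1)])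
   show ?case
    using ac_pol_pCons[OF uV gu, of c R] pCons.IH ac_pol_pCons[OF v(1,3), of c R] v w uV ops(1)[OF OmK(1) w]
    by (simp add: u_def ops(2)[OF OmK(1)] ops(3)[OF OmK(1)] smult_props(4))
  qed
  have "ac (pol (pCons (-1) P) * ge n) v = (-1) \<odot> v \<oplus> v"
   using ac_pol_pCons[OF v(1,3), of "-1" P] comm[of P] Pu by (simp add: u_def)
  also have "... = (-1 + 1) \<odot> v" using smult_props(5)[OF v(1), of "-1" 1] smult_props(2)[OF v(1)] by simp
  finally have "ac (pol (pCons (-1) P) * ge n) v = \<zero>" using smult_props(1)[OF v(1)] by simp
  thus ?thesis using eigenvector_exists[of "pCons (-1) P"] v by auto
 qed
qed

end

lemma gk_simple_modI: "quantum q s ==> gk_simple q s V ==> gk_simple_mod q s V"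
 by (simp add: gk_simple_mod_def gk_mod_def gk_mod_axioms_def gk_simple_mod_axioms_def gk_simple_def)

text \<open>The annihilator of an eigenvector of weight \<open>n\<close> in a simple module depends only on \<open>n\<close> and
  on the eigenvalue of the Casimir element, as the corner $e_nR_q(\mathfrak g,K)e_n$ acts on the
  vector through polynomials in that eigenvalue.\<close>

lemma annihilator_le:
 assumes "gk_mod q s V" "gk_simple_mod q s W"
  and v: "v : carrier V" "v ~= \<zero>\<^bsub>V\<^esub>" "act V (g_cls q s (gk (quantum.D q s (quantum.dl n)))) v = v"
   "act V (g_cls q s (quantum.Om q s * gk (quantum.D q s (quantum.dl n)))) v = om \<odot>\<^bsub>V\<^esub> v"
  and w: "w : carrier W" "act W (g_cls q s (gk (quantum.D q s (quantum.dl n)))) w = w"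
   "act W (g_cls q s (quantum.Om q s * gk (quantum.D q s (quantum.dl n)))) w = om \<odot>\<^bsub>W\<^esub> w"
  and p: "p : quantum.KS q s" "act V (g_cls q s p) v = \<zero>\<^bsub>V\<^esub>"
 shows "act W (g_cls q s p) w = \<zero>\<^bsub>W\<^esub>"
proof (rule ccontr)
 interpret V: gk_mod q s V by (rule assms(1))
 interpret W: gk_simple_mod q s W by (rule assms(2))
 assume nz: "W.ac p w ~= \<zero>\<^bsub>W\<^esub>"
 obtain r where r: "r : V.KS" "W.ac r (W.ac p w) = w"
  using W.cyclic[OF W.ops(1)[OF p(1) w(1)] nz w(1)] by blast
 have rp: "r * p : V.KS" using V.KS_closed(3)[OF r(1) V.KS_S[OF p(1)]] .
 have rpg: "(r * p) * V.ge n : V.KS" using V.KS_closed(8) V.KS_S[OF rp] by blast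
 obtain P where P: "V.eqv (V.ge n * ((r * p) * V.ge n)) (V.pol P * V.ge n)"
  using V.corner[OF V.MM_ge[OF V.KS_S[OF rp]]] by blast
 have "W.ac (V.pol P * V.ge n) w = W.ac (V.ge n) (W.ac (r * p) (W.ac (V.ge n) w))"
  by (simp only: W.ops(7)[OF P, symmetric] W.ops(6)[OF V.KS_closed(7) rpg w(1)] W.ops(6)[OF rp V.KS_closed(7) w(1)])
 hence "poly P om \<odot>\<^bsub>W\<^esub> w = w"
  using W.ac_pol_eigen[OF w] W.ops(6)[OF r(1) p(1) w(1)] r(2) w(2) by simp
 hence ne: "poly P om ~= 0"
  using W.smult_props(1)[OF w(1)] nz W.ac_zero(2)[OF p(1)] by auto
 have "V.ac (V.pol P * V.ge n) v = V.ac (V.ge n) (V.ac (r * p) (V.ac (V.ge n) v))"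
  by (simp only: V.ops(7)[OF P, symmetric] V.ops(6)[OF V.KS_closed(7) rpg v(1)] V.ops(6)[OF rp V.KS_closed(7) v(1)])
 hence "poly P om \<odot>\<^bsub>V\<^esub> v = \<zero>\<^bsub>V\<^esub>"
  using V.ac_pol_eigen[OF v(1,3,4)] V.ops(6)[OF r(1) p(1) v(1)] p(2) v(3) V.ac_zero(2)[OF r(1)] V.ac_zero(2)[OF V.KS_closed(7)] by simp
 thus False using V.smult_props(6)[OF v(1)] v(2) ne by simp
qed

context quantum
begin

text \<open>Both modules are quotients of $R_q(\mathfrak g,K)$ by the same left ideal.\<close>

lemma simple_equiv:
 fixes V :: "(gq, 'v) amod" and W :: "(gq, 'w) amod"
 assumes V: "gk_simple q s V" and W: "gk_simple q s W" and x: "(n, om) : gspec V" "(n, om) : gspec W"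
 shows "gk_equiv q s V W"
proof -
 interpret V: gk_simple_mod q s V by (rule gk_simple_modI[OF quantum_axioms V])
 interpret W: gk_simple_mod q s W by (rule gk_simple_modI[OF quantum_axioms W])
 obtain v where v: "v : carrier V" "v ~= \<zero>\<^bsub>V\<^esub>" "V.ac (ge n) v = v" "V.ac (Om * ge n) v = om \<odot>\<^bsub>V\<^esub> v"
  using x(1) by (auto simp: gspec_def)
 obtain w where w: "w : carrier W" "w ~= \<zero>\<^bsub>W\<^esub>" "W.ac (ge n) w = w" "W.ac (Om * ge n) w = om \<odot>\<^bsub>W\<^esub> w"
  using x(2) by (auto simp: gspec_def)
 have ann: "V.ac p v = \<zero>\<^bsub>V\<^esub> <-> W.ac p w = \<zero>\<^bsub>W\<^esub>" if "p : KS" for p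
  using annihilator_le[OF V.gk_mod_axioms W.gk_simple_mod_axioms v w(1,3,4) that]
   annihilator_le[OF W.gk_mod_axioms V.gk_simple_mod_axioms w v(1,3,4) that] by blast
 have dK: "p + fa_const (-1) * r : KS" if "p : KS" "r : KS" for p r
  using that KS_closed(1,2) S_closed(4) by blast
 have eq: "V.ac p v = V.ac r v <-> W.ac p w = W.ac r w" if "p : KS" "r : KS" for p r
  using V.ac_diff[OF that v(1)] W.ac_diff[OF that w(1)] ann[OF dK[OF that]] by simp
 define h where "h u = W.ac (SOME p. p : KS & V.ac p v = u) w" for u
 have h: "h (V.ac p v) = W.ac p w" if "p : KS" for p
 proof -
  have "(SOME r. r : KS & V.ac r v = V.ac p v) : KS & V.ac (SOME r. r : KS & V.ac r v = V.ac p v) v = V.ac p v"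
   by (rule someI[of _ p]) (simp add: that)
  thus ?thesis unfolding h_def using eq that by blast
 qed
 have cV: "EX p:KS. u = V.ac p v" if "u : carrier V" for u using V.cyclic[OF v(1,2) that] by blast
 have cW: "EX p:KS. u = W.ac p w" if "u : carrier W" for u using W.cyclic[OF w(1,2) that] by blast
 show ?thesis
  unfolding gk_equiv_def
 proof (intro exI[of _ h] conjI ballI allI)
  show "bij_betw h (carrier V) (carrier W)"
   unfolding bij_betw_def
  proof
   show "inj_on h (carrier V)"
   proof (rule inj_onI)
    fix x y assume a: "x : carrier V" "y : carrier V" "h x = h y"
    obtain p r where "p : KS" "x = V.ac p v" "r : KS" "y = V.ac r v" using cV[OF a(1)] cV[OF a(2)] by blast
    thus "x = y" using a(3) h eq by simp
   qed
   show "h ` carrier V = carrier W"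
   proof
    show "h ` carrier V <= carrier W" using cV h W.ops(1)[OF _ w(1)] by force
    show "carrier W <= h ` carrier V"
    proof
     fix y assume "y : carrier W"
     then obtain p where "p : KS" "y = W.ac p w" using cW by blast
     thus "y : h ` carrier V" using h[of p] V.ops(1)[OF _ v(1), of p] by (metis imageI)
    qed
   qed
  qed
  fix x assume "x : carrier V"
  then obtain p where p: "p : KS" "x = V.ac p v" using cV by blast
  show "h (x \<oplus>\<^bsub>V\<^esub> y) = h x \<oplus>\<^bsub>W\<^esub> h y" if "y : carrier V" for y
  proof -
   obtain r where r: "r : KS" "y = V.ac r v" using cV[OF `y : carrier V`] by blast
   show ?thesis using h[OF KS_closed(1)[OF p(1) r(1)]] p r h by (simp add: V.ops(4) W.ops(4) v(1) w(1))
  qed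
  have "fa_const c * p : KS" for c using KS_closed(2)[OF p(1) S_closed(4)] .
  thus "h (c \<odot>\<^bsub>V\<^esub> x) = c \<odot>\<^bsub>W\<^esub> h x" for c using h[of "fa_const c * p"] p h by (simp add: V.ops(5) W.ops(5) v(1) w(1))
  show "h (act V a x) = act W a (h x)" if "a : RgK q s" for a
  proof -
   obtain r where r: "r : KS" "a = cl r" using `a : RgK q s` by (rule RgK_cases)
   show ?thesis using h[OF KS_closed(3)[OF r(1) KS_S[OF p(1)]]] p r h by (simp add: V.ops(6) W.ops(6) v(1) w(1))
  qed
 qed
qed

lemma gspec_invariant:
 fixes V :: "(gq, 'v) amod" and W :: "(gq, 'w) amod"
 assumes V: "gk_simple q s V" and W: "gk_simple q s W" and e: "gk_equiv q s V W"
 shows "gspec V = gspec W"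
proof -
 interpret V: gk_simple_mod q s V by (rule gk_simple_modI[OF quantum_axioms V])
 interpret W: gk_simple_mod q s W by (rule gk_simple_modI[OF quantum_axioms W])
 obtain h where b: "bij_betw h (carrier V) (carrier W)"
  and sc: "!!c v. v : carrier V ==> h (c \<odot>\<^bsub>V\<^esub> v) = c \<odot>\<^bsub>W\<^esub> h v"
  and ac: "!!a v. a : RgK q s ==> v : carrier V ==> h (act V a v) = act W a (h v)"
  using e unfolding gk_equiv_def by blast
 have im: "h v : carrier W" if "v : carrier V" for v using bij_betwE[OF b] that by blast
 have inj: "h v = h u <-> v = u" if "v : carrier V" "u : carrier V" for v u
  by (rule inj_on_eq_iff[OF bij_betw_imp_inj_on[OF b] that])
 have z: "h \<zero>\<^bsub>V\<^esub> = \<zero>\<^bsub>W\<^esub>"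
  using sc[OF V.M.zero_closed, of 0] V.smult_props(1)[OF V.M.zero_closed] W.smult_props(1)[OF im[OF V.M.zero_closed]] by simp
 have k: "cl (ge n) : RgK q s" "cl (Om * ge n) : RgK q s" for n by (auto intro!: cl_RgK KS_closed(7) OmK)
 have P: "(v ~= \<zero>\<^bsub>V\<^esub> & V.ac (ge n) v = v & V.ac (Om * ge n) v = om \<odot>\<^bsub>V\<^esub> v) <->
   (h v ~= \<zero>\<^bsub>W\<^esub> & W.ac (ge n) (h v) = h v & W.ac (Om * ge n) (h v) = om \<odot>\<^bsub>W\<^esub> h v)" if v: "v : carrier V" for v n om
  using inj[OF v V.M.zero_closed] z inj[OF V.ops(1)[OF KS_closed(7) v] v, of n]
   inj[OF V.ops(1)[OF OmK(1) v] V.smult_props(4)[OF v], of n om] by (simp add: ac[OF k(1) v] ac[OF k(2) v] sc[OF v])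
 have "gspec V = {(n, om). EX v:carrier V. h v ~= \<zero>\<^bsub>W\<^esub> & W.ac (ge n) (h v) = h v & W.ac (Om * ge n) (h v) = om \<odot>\<^bsub>W\<^esub> h v}"
  unfolding gspec_def using P by blast
 also have "... = {(n, om). EX w:h ` carrier V. w ~= \<zero>\<^bsub>W\<^esub> & W.ac (ge n) w = w & W.ac (Om * ge n) w = om \<odot>\<^bsub>W\<^esub> w}" by blast
 also have "h ` carrier V = carrier W" using b by (simp add: bij_betw_def)
 finally show ?thesis by (simp add: gspec_def)
qed

end

section \<open>Submodules of the induced modules\<close>

context induced
begin

abbreviation hadd (infixl "[+]" 65) where "f [+] g \<equiv> f \<oplus>\<^bsub>HH\<^esub> g"
abbreviation hsmult (infixr "[*]" 70) where "c [*] f \<equiv> c \<odot>\<^bsub>HH\<^esub> f"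
abbreviation hzero where "hzero \<equiv> \<zero>\<^bsub>HH\<^esub>"

text \<open>The support of \<open>f\<close>; by \<open>HC_determined\<close> it is empty only for \<open>f = 0\<close>.\<close>

definition hs :: "(gq => complex) => int set" where "hs f = {m. f (cl (ge m)) ~= 0}"

definition FM :: "int set => (gq => complex) set" where
 "FM A = {f : carrier HH. finite (hs f) & hs f <= A}"

abbreviation IM :: "int set => (gq, gq => complex) amod" where
 "IM A \<equiv> HH\<lparr>carrier := FM A\<rparr>"

lemma HH_ops:
 "f [+] g = (\<lambda>a\<in>RgK q s. f a + g a)" "c [*] f = (\<lambda>a\<in>RgK q s. c * f a)"
 "hzero = (\<lambda>a\<in>RgK q s. 0)" "act HH b f = (\<lambda>a\<in>RgK q s. f (a [.] b))"
 by (simp_all add: Hom_mod_def twist_J_def char_mod_def)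

lemma HH_val:
 "p : KS ==> (f [+] g) (cl p) = f (cl p) + g (cl p)" "p : KS ==> (c [*] f) (cl p) = c * f (cl p)"
 "p : KS ==> hzero (cl p) = 0" "p : KS ==> r : gS ==> act HH (cl r) f (cl p) = f (cl (p * r))"
 by (simp_all add: HH_ops cl_RgK cl_ops KS_S)

lemma HH_ext [simp]: "f [+] g : extensional (RgK q s)" "c [*] f : extensional (RgK q s)"
 "hzero : extensional (RgK q s)" "act HH b f : extensional (RgK q s)"
 by (simp_all add: HH_ops)

lemma HH_closed:
 assumes f: "f : carrier HH"
 shows "g : carrier HH ==> f [+] g : carrier HH" "c [*] f : carrier HH" "hzero : carrier HH"
  "r : KS ==> act HH (cl r) f : carrier HH"
proof -
 note cK = KS_closed(1) KS_closed(2)[OF _ S_closed(4)] KS_closed(2)[OF _ pmE_S]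
 show "f [+] g : carrier HH" if g: "g : carrier HH"
  unfolding HC_iff by (intro conjI ballI allI; simp add: HH_val cK HC_D(2-4)[OF f] HC_D(2-4)[OF g] algebra_simps)
 show "c [*] f : carrier HH"
  unfolding HC_iff by (intro conjI ballI allI; simp add: HH_val cK HC_D(2-4)[OF f] algebra_simps)
 show "hzero : carrier HH"
  unfolding HC_iff by (intro conjI ballI allI; simp add: HH_val cK)
 show "act HH (cl r) f : carrier HH" if r: "r : KS"
 proof -
  note rS = KS_S[OF r] and rK = KS_closed(3)[OF _ KS_S[OF r]]
  show ?thesis
   unfolding HC_iff
   by (intro conjI ballI allI; simp add: HH_val cK rS rK distrib_right mult.assoc HC_D(2-4)[OF f])
 qed
qed

lemma HH_eqI: "f : carrier HH ==> g : carrier HH ==> (!!p. p : KS ==> f (cl p) = g (cl p)) ==> f = g"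
 by (rule HC_determined) (auto intro: KS_closed(7))

lemma module_HH: "C <= carrier HH ==> hzero : C ==> (!!f g. f : C ==> g : C ==> f [+] g : C) ==> (!!c f. f : C ==> c [*] f : C) ==>
 Module.module complex_ring (HH\<lparr>carrier := C\<rparr>)"
proof -
 assume C: "C <= carrier HH" "hzero : C" "!!f g. f : C ==> g : C ==> f [+] g : C" "!!c f. f : C ==> c [*] f : C"
 have x: "f a = undefined" if "f : C" "a ~: RgK q s" for f a
  using HC_D(1)[OF subsetD[OF C(1) that(1)]] that(2) by (simp add: extensional_def)
 show ?thesis
 proof (rule moduleI[OF cring_complex_ring])
  show "abelian_group (HH\<lparr>carrier := C\<rparr>)"
  proof (rule abelian_groupI)
   fix f assume "f : carrier (HH\<lparr>carrier := C\<rparr>)"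
   hence "(-1) [*] f : C" "(-1) [*] f [+] f = hzero"
    by (simp add: C(4)) (simp add: HH_ops fun_eq_iff)
   thus "EX g:carrier (HH\<lparr>carrier := C\<rparr>). g \<oplus>\<^bsub>HH\<lparr>carrier := C\<rparr>\<^esub> f = \<zero>\<^bsub>HH\<lparr>carrier := C\<rparr>\<^esub>" by auto
  qed (use C in "auto simp: HH_ops fun_eq_iff intro: x x[symmetric]")
 qed (use C(4) in "auto simp: HH_ops fun_eq_iff distrib_left distrib_right intro: x x[symmetric]")
qed

lemma hs_ops: "hs (f [+] g) <= hs f \<union> hs g" "hs (c [*] f) <= hs f" "hs hzero = {}"
 by (auto simp: hs_def HH_val KS_closed(7))

lemma FM_closed: "hzero : FM A" "f : FM A ==> g : FM A ==> f [+] g : FM A" "f : FM A ==> c [*] f : FM A"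
proof -
 have "(if ep = 1 then 0 else 1) : Zpar ep" by (simp add: Zpar_def)
 from HH_closed(3)[OF zet_HC[OF this]] show "hzero : FM A" by (simp add: FM_def hs_ops(3))
 show "f [+] g : FM A" if fg: "f : FM A" "g : FM A"
 proof -
  have *: "f : carrier HH" "g : carrier HH" "finite (hs f \<union> hs g)" "hs f \<union> hs g <= A" using fg by (auto simp: FM_def)
  show ?thesis
   unfolding FM_def using HH_closed(1)[OF *(1,2)] finite_subset[OF hs_ops(1) *(3)] subset_trans[OF hs_ops(1) *(4)] by simp
 qed
 show "c [*] f : FM A" if fg: "f : FM A"
 proof -
  have *: "f : carrier HH" "finite (hs f)" "hs f <= A" using fg by (auto simp: FM_def)
  show ?thesis
   unfolding FM_def using HH_closed(2)[OF *(1)] finite_subset[OF hs_ops(2) *(2)] subset_trans[OF hs_ops(2) *(3)] by simp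
 qed
qed

lemma FM_HC: "f : FM A ==> f : carrier HH" by (simp add: FM_def)

lemma module_IM: "Module.module complex_ring (IM A)" "Module.module complex_ring HH"
proof -
 show "Module.module complex_ring (IM A)" by (rule module_HH) (auto simp: FM_closed FM_HC)
 have "hzero : carrier HH" by (rule FM_HC[OF FM_closed(1)])
 from module_HH[OF order.refl this] show "Module.module complex_ring HH"
  using HH_closed(1,2) by simp
qed

lemma HH_act:
 assumes f: "f : carrier HH"
 shows "p : KS ==> r : KS ==> act HH (cl (p * r)) f = act HH (cl p) (act HH (cl r) f)"
  "p : KS ==> r : KS ==> act HH (cl (p + r)) f = act HH (cl p) f [+] act HH (cl r) f"
  "p : KS ==> act HH (cl (fa_const c * p)) f = c [*] act HH (cl p) f"
  "g : carrier HH ==> p : KS ==> act HH (cl p) (f [+] g) = act HH (cl p) f [+] act HH (cl p) g"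
  "p : KS ==> act HH (cl p) (c [*] f) = c [*] act HH (cl p) f"
proof -
 note kc = KS_closed(1) KS_closed(2)[OF _ S_closed(4)] KS_closed(3)[OF _ KS_S]
 note hc = HH_closed[OF f] HH_closed(1,2,4)
 note [simp] = HH_val kc KS_S HC_D(2,3)[OF f] S_closed(1) S_closed(2)[OF KS_S KS_S] S_closed(2)[OF S_closed(4) KS_S]
 show "p : KS ==> r : KS ==> act HH (cl (p * r)) f = act HH (cl p) (act HH (cl r) f)"
  by (rule HH_eqI) (auto intro!: hc f simp: mult.assoc[symmetric])
 show "p : KS ==> r : KS ==> act HH (cl (p + r)) f = act HH (cl p) f [+] act HH (cl r) f"
  by (rule HH_eqI) (auto intro!: hc f simp: distrib_left)
 show "p : KS ==> act HH (cl (fa_const c * p)) f = c [*] act HH (cl p) f"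
  by (rule HH_eqI) (auto intro!: hc f simp: fa_const_left_commute)
 show "g : carrier HH ==> p : KS ==> act HH (cl p) (f [+] g) = act HH (cl p) f [+] act HH (cl p) g"
  by (rule HH_eqI) (auto intro!: hc f)
 show "p : KS ==> act HH (cl p) (c [*] f) = c [*] act HH (cl p) f"
  by (rule HH_eqI) (auto intro!: hc f)
qed

lemma act_zero: "r : KS ==> act HH (cl r) hzero = hzero"
 by (rule HH_eqI[OF HH_closed(4)[OF FM_HC[OF FM_closed(1)]] FM_HC[OF FM_closed(1)]])
  (simp_all add: HH_val KS_S KS_closed(3))

lemma act_eqv: "x ~~ y ==> act HH (cl x) f = act HH (cl y) f"
 using eqv_cl by simp

lemma hs_act: "f : carrier HH ==> p : KS ==> finite (hs (act HH (cl p) f))"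
proof -
 assume f: "f : carrier HH" and p: "p : KS"
 obtain N where N: "finite N" "eset N * p ~~ p" using KS_left[OF p] by blast
 have "f (cl (ge m * p)) = 0" if "m ~: N" for m
 proof -
  have "(%k. dl m k * (if k : N then 1 else 0)) = (%_. 0)" using that by (auto simp: dl_def)
  hence "ge m * eset N ~~ 0"
   unfolding eset_def using eqv_trans[OF gD_rels(2)[of "dl m" "%k. if k : N then 1 else 0"]] gD_zero by simp
  from eqv_multr[OF this KS_S[OF p]] have "ge m * (eset N * p) ~~ 0" by (simp add: mult.assoc)
  hence "ge m * p ~~ 0" by (rule eqv_trans[OF eqv_multl[OF eqv_sym[OF N(2)] XYZ_S(5)]])
  thus ?thesis using eqv_cl HC_0[OF f] by metis
 qed
 hence "hs (act HH (cl p) f) <= N" by (auto simp: hs_def HH_val KS_closed(7) KS_S[OF p])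
 thus ?thesis by (rule finite_subset[OF _ N(1)])
qed

lemma act_ge: "f : carrier HH ==> n : Zpar ep ==> act HH (cl (ge n)) f = f (cl (ge n)) [*] zet n"
proof -
 assume f: "f : carrier HH" and n: "n : Zpar ep"
 show ?thesis
 proof (rule HC_determined)
  show "act HH (cl (ge n)) f : carrier HH" "f (cl (ge n)) [*] zet n : carrier HH"
   using HH_closed(4)[OF f] HH_closed(2)[OF zet_HC[OF n]] KS_closed(7) by auto
  fix m
  have "ge m * ge n ~~ fa_const (dl m n) * ge n" by (rule gD_ge(1))
  hence "f (cl (ge m * ge n)) = dl m n * f (cl (ge n))"
   using eqv_cl HC_D(3)[OF f KS_closed(7)] by metis
  thus "act HH (cl (ge n)) f (cl (ge m)) = (f (cl (ge n)) [*] zet n) (cl (ge m))"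
   by (simp add: HH_val KS_closed(7) zet_ge) (simp add: dl_def)
 qed
qed

lemma shift_act:
 assumes W: "Wl k (U * ge n)" and U: "U : gS" and n: "n : Zpar ep" "k : Zpar ep"
  and v: "!!f. f : carrier HH ==> f (cl (U * ge n)) = c * f (cl (ge n))"
 shows "act HH (cl (U * ge n)) (zet n) = c [*] zet k"
proof (rule HC_determined)
 have UK: "U * ge n : KS" by (rule KS_closed(8)[OF U])
 show "act HH (cl (U * ge n)) (zet n) : carrier HH" "c [*] zet k : carrier HH"
  using HH_closed(4)[OF zet_HC[OF n(1)] UK] HH_closed(2)[OF zet_HC[OF n(2)]] by auto
 fix m
 have "ge m * (U * ge n) ~~ fa_const (dl m k) * (U * ge n)" by (rule gD_on_weight[OF W])
 hence "zet n (cl (ge m * (U * ge n))) = dl m k * zet n (cl (U * ge n))"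
  using eqv_cl HC_D(3)[OF zet_HC[OF n(1)] UK] by metis
 also have "zet n (cl (U * ge n)) = c" using v[OF zet_HC[OF n(1)]] by (simp add: zet_ge)
 finally show "act HH (cl (U * ge n)) (zet n) (cl (ge m)) = (c [*] zet k) (cl (ge m))"
  using KS_S[OF UK] by (simp add: HH_val KS_closed(7) zet_ge) (simp add: dl_def)
qed

lemma Zpar_shift [simp]: "n + 2 : Zpar ep <-> n : Zpar ep" "n - 2 : Zpar ep <-> n : Zpar ep"
 by (auto simp: Zpar_def)

lemma zet_act:
 assumes "n : Zpar ep"
 shows "act HH (cl (Ap n * ge n)) (zet n) = chA n [*] zet (n + 2)"
  "act HH (cl (Am n * ge n)) (zet n) = chM n [*] zet (n - 2)"
  "act HH (cl (Om * ge n)) (zet n) = (lam + inverse lam) [*] zet n"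
proof -
 show "act HH (cl (Ap n * ge n)) (zet n) = chA n [*] zet (n + 2)"
  by (rule shift_act[OF weight_shift(1)[OF Wl_ge] L3_S(2) assms]) (simp_all add: assms HC_shift KS_closed(7))
 show "act HH (cl (Am n * ge n)) (zet n) = chM n [*] zet (n - 2)"
  by (rule shift_act[OF weight_shift(2)[OF Wl_ge] L3_S(3) assms]) (simp_all add: assms HC_shift KS_closed(7))
 show "act HH (cl (Om * ge n)) (zet n) = (lam + inverse lam) [*] zet n"
  by (rule shift_act[OF Om_commute(3)[OF Wl_ge] L3_S(6) assms assms]) (simp add: HC_shift(3)[OF _ KS_closed(7) Wl_ge])
qed

text \<open>The span of the \<open>\<zeta>\<^sub>n\<close> with \<open>n \<in> A\<close> is stable when the coefficients by which one leaves
  \<open>A\<close> vanish, and simple when those that lead from one element of \<open>A\<close> to another do not.\<close>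

definition stable_set :: "int set => bool" where
 "stable_set A <-> A <= Zpar ep & (ALL n:A. (n + 2 : A <-> chA n ~= 0) & (n - 2 : A <-> chM n ~= 0))
  & (ALL m:A. ALL n:A. ALL k. m <= k & k <= n & even (k - m) --> k : A)"

lemma hs_zet: "hs (zet n) = {n}" by (auto simp: hs_def zet_ge)

lemma zet_FM: "n : A ==> A <= Zpar ep ==> zet n : FM A"
 using zet_HC by (auto simp: FM_def hs_zet)

lemma FM_act:
 assumes A: "stable_set A" and p: "p : KS" and f: "f : FM A"
 shows "act HH (cl p) f : FM A"
proof -
 have AZ: "A <= Zpar ep" using A by (simp add: stable_set_def)
 note fH = FM_HC[OF f]
 have aH: "act HH (cl r) g : carrier HH" if "r : KS" "g : carrier HH" for r g by (rule HH_closed(4)[OF that(2,1)])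
 have ge: "act HH (cl (ge n)) g = (if n : A then g (cl (ge n)) [*] zet n else hzero)" if g: "g : FM A" for g n
 proof (cases "n : A")
  case True
  thus ?thesis using act_ge[OF FM_HC[OF g]] AZ by auto
 next
  case False
  hence "g (cl (ge n)) = 0" using g by (auto simp: FM_def hs_def)
  have "act HH (cl (ge n)) g = hzero"
  proof (rule HC_determined[OF aH[OF KS_closed(7) FM_HC[OF g]] FM_HC[OF FM_closed(1)]])
   fix m
   show "act HH (cl (ge n)) g (cl (ge m)) = hzero (cl (ge m))"
    using eqv_cl[OF gD_ge(1)[of "dl m" n]] HC_D(3)[OF FM_HC[OF g] KS_closed(7)] `g (cl (ge n)) = 0`
    by (simp add: HH_val KS_closed(7))
  qed
  thus ?thesis using False by simp
 qed
 have geFM: "act HH (cl (ge n)) g : FM A" if g: "g : FM A" for g n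
  unfolding ge[OF g] using FM_closed(1) FM_closed(3)[OF zet_FM[OF _ AZ]] by simp
 have U: "act HH (cl (V * x)) f : FM A"
  if V: "V : gS" and x: "x : KS" "Wl n x" "act HH (cl x) f : FM A"
   and z: "n : A ==> act HH (cl (V * ge n)) (zet n) : FM A" for V n x
 proof -
  have "V * x ~~ (V * ge n) * x" using eqv_multl[OF eqv_sym[OF ge_on_weight[OF x(2)]] V] by (simp add: mult.assoc)
  hence "act HH (cl (V * x)) f = act HH (cl (V * ge n)) (act HH (cl x) f)"
   using act_eqv HH_act(1)[OF fH KS_closed(8)[OF V] x(1)] by metis
  also have "V * ge n * ge n ~~ V * ge n"
   using eqv_multl[OF ge_on_weight[OF Wl_ge[of n]] V] by (simp add: mult.assoc)
  hence "act HH (cl (V * ge n)) (act HH (cl x) f) = act HH (cl (V * ge n)) (act HH (cl (ge n)) (act HH (cl x) f))"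
   using act_eqv HH_act(1)[OF FM_HC[OF x(3)] KS_closed(8)[OF V] KS_closed(7)] by metis
  also have "... : FM A"
  proof (cases "n : A")
   case True
   have "zet n : carrier HH" using True AZ zet_HC by auto
   thus ?thesis unfolding ge[OF x(3)] using True z by (simp add: HH_act(5) KS_closed(8)[OF V] FM_closed(3))
  next
   case False
   have "act HH (cl (V * ge n)) hzero = hzero" by (rule act_zero[OF KS_closed(8)[OF V]])
   thus ?thesis unfolding ge[OF x(3)] using False FM_closed(1) by simp
  qed
  finally show ?thesis .
 qed
 have zA: "act HH (cl (Ap n * ge n)) (zet n) : FM A" "act HH (cl (Am n * ge n)) (zet n) : FM A" "act HH (cl (Om * ge n)) (zet n) : FM A"
  if n: "n : A" for n
 proof -
  have nZ: "n : Zpar ep" using n AZ by auto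
  have 0: "0 [*] g = hzero" for g by (simp add: HH_ops)
  have io: "n + 2 : A <-> chA n ~= 0" "n - 2 : A <-> chM n ~= 0" using A n unfolding stable_set_def by blast+
  have c: "c [*] zet k : FM A" if "k : A <-> c ~= 0" for c k
  proof (cases "c = 0")
   case True
   thus ?thesis using FM_closed(1) by (simp only: 0)
  next
   case False
   thus ?thesis using that by (intro FM_closed(3) zet_FM AZ) simp
  qed
  have "chA n [*] zet (n + 2) : FM A" "chM n [*] zet (n - 2) : FM A" by (rule c[OF io(1)], rule c[OF io(2)])
  thus "act HH (cl (Ap n * ge n)) (zet n) : FM A" "act HH (cl (Am n * ge n)) (zet n) : FM A" "act HH (cl (Om * ge n)) (zet n) : FM A"
   unfolding zet_act[OF nZ] using FM_closed(3)[OF zet_FM[OF n AZ]] by auto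
 qed
 have O: "act HH (cl (Om ^ i * ge n)) f : FM A" for n i
 proof (induction i)
  case 0
  show ?case using geFM[OF f] by simp
 next
  case (Suc i)
  show ?case
   using U[OF L3_S(6), of "Om ^ i * ge n" n] Suc zA(3)[of n] MM_KS[OF MM.up[of n 0 i]] upE_weight[of n 0 i] by (simp add: mult.assoc)
 qed
 have up: "act HH (cl (upE n k i)) f : FM A" for n k i
 proof (induction k)
  case (Suc k)
  show ?case using U[OF L3_S(2) MM_KS[OF MM.up] upE_weight Suc zA(1)] by simp
 qed (simp add: O)
 have dn: "act HH (cl (dnE n k i)) f : FM A" for n k i
 proof (induction k)
  case (Suc k)
  show ?case using U[OF L3_S(3) MM_KS[OF MM.dn] dnE_weight Suc zA(2)] by simp
 qed (simp add: O)
 have z: "act HH (cl 0) f : FM A"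
  using HH_act(3)[OF fH KS_closed(5), of 0] FM_closed(1)[of A] by (simp add: HH_ops(2,3))
 have MM: "act HH (cl x) f : FM A" if "x : MM n" for x n
  using that
 proof (induction rule: MM.induct)
  case (comb x y c)
  thus ?case
   using MM_KS KS_closed(2)[OF MM_KS S_closed(4)] FM_closed(2,3) by (simp add: HH_act(2,3)[OF fH])
 next
  case (eqv x y)
  thus ?case using act_eqv by metis
 qed (use z up dn in auto)
 have E: "act HH (cl (r * eset M)) f : FM A" if "finite M" "r : gS" for r M
  using that
 proof (induction M rule: finite_induct)
  case empty
  show ?case using act_eqv[OF eqv_multl[OF eset_empty empty]] z by simp
 next
  case (insert m M)
  have e: "r * eset (insert m M) ~~ r * ge m + r * eset M"
   using eqv_multl[OF eset_insert[OF insert.hyps(2)] insert.prems] by (simp add: distrib_left)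
  have "r * ge m : KS" "r * eset M : KS" using insert KS_closed(2,6,7) by blast+
  thus ?case
   using act_eqv[OF e] HH_act(2)[OF fH] MM[OF MM_ge[OF insert.prems]] insert FM_closed(2) by simp
 qed
 obtain M where "finite M" "p * eset M ~~ p" using p by (auto simp: KS_def)
 thus ?thesis using E[of M p] KS_S[OF p] act_eqv by metis
qed

text \<open>Finitely supported elements are combinations of the \<open>\<zeta>\<^sub>n\<close>.\<close>

lemma FM_span:
 assumes A: "A <= Zpar ep" and W: "hzero : W" "!!f g. f : W ==> g : W ==> f [+] g : W" "!!c f. f : W ==> c [*] f : W"
  and z: "!!n. n : A ==> zet n : W"
 shows "FM A <= W"
proof -
 have "f : FM A ==> hs f <= B ==> f : W" if "finite B" for B f
  using that
 proof (induction B arbitrary: f rule: finite_induct)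
  case empty
  have "f = hzero"
   by (rule HC_determined[OF FM_HC[OF empty(1)] FM_HC[OF FM_closed(1)]]) (use empty(2) in "auto simp: hs_def HH_val KS_closed(7)")
  thus ?case using W(1) by simp
 next
  case (insert m B)
  show ?case
  proof (cases "m : hs f")
   case False
   thus ?thesis using insert by blast
  next
   case True
   hence m: "m : A" using insert.prems(1) by (auto simp: FM_def)
   define g where "g = f [+] (- f (cl (ge m))) [*] zet m"
   have g: "g : FM A" unfolding g_def by (intro FM_closed insert.prems(1) zet_FM[OF m A])
   have "hs g <= B"
    using insert.prems(2) by (auto simp: hs_def g_def HH_val KS_closed(7) zet_ge split: if_splits)
   hence "g : W" using insert.IH[OF g] by simp
   have "f = g [+] f (cl (ge m)) [*] zet m"
   proof (rule HC_determined)
    show "g [+] f (cl (ge m)) [*] zet m : carrier HH"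
     by (intro FM_HC[of _ A] FM_closed g zet_FM[OF m A])
   qed (auto simp: g_def HH_val KS_closed(7) FM_HC[OF insert.prems(1)])
   thus ?thesis by (rule back_subst[of "%x. x : W", OF W(2)[OF `g : W` W(3)[OF z[OF m]]] sym])
  qed
 qed
 thus ?thesis by (auto simp: FM_def)
qed

lemma local_unit_HH:
 assumes f: "f : carrier HH" "finite (hs f)"
 shows "act HH (cl (eset (hs f))) f = f"
proof (rule HC_determined[OF HH_closed(4)[OF f(1) KS_closed(6)[OF f(2)]] f(1)])
 fix m
 have "(%k. dl m k * (if k : hs f then 1 else 0)) = (%k. (if m : hs f then 1 else 0) * dl m k + 0)" by (auto simp: dl_def)
 hence "ge m * eset (hs f) ~~ gD (%k. (if m : hs f then 1 else 0) * dl m k)"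
  unfolding eset_def using gD_rels(2)[of "dl m" "%k. if k : hs f then 1 else 0"] by simp
 from eqv_cl[OF eqv_trans[OF this gD_scale]] have "f (cl (ge m * eset (hs f))) = (if m : hs f then 1 else 0) * f (cl (ge m))"
  by (simp only: HC_D(3)[OF f(1) KS_closed(7)])
 thus "act HH (cl (eset (hs f))) f (cl (ge m)) = f (cl (ge m))"
  by (auto simp: HH_val KS_closed(7) hs_def)
qed

lemma IM_gk_module:
 assumes A: "stable_set A" shows "gk_module q s (IM A)"
proof -
 have R: "rep_of q s (RgK q s) (IM A)"
  unfolding rep_of_def RgK_eq
 proof (intro conjI ballI allI)
  fix a f assume "a : cl ` KS" and f: "f : carrier (IM A)"
  then obtain p where p: "p : KS" "a = cl p" by blast
  have fA: "f : FM A" and fH: "f : carrier HH" using f FM_HC by auto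
  show "act (IM A) a f : carrier (IM A)" using FM_act[OF A p(1) fA] p by simp
  show "act (IM A) (g_scale q s c a) f = c \<odot>\<^bsub>IM A\<^esub> act (IM A) a f" for c
   using HH_act(3)[OF fH p(1)] by (simp add: p(2) g_scale_cl KS_S[OF p(1)])
  show "act (IM A) a (c \<odot>\<^bsub>IM A\<^esub> f) = c \<odot>\<^bsub>IM A\<^esub> act (IM A) a f" for c
   using HH_act(5)[OF fH p(1)] by (simp add: p(2))
  show "act (IM A) a (f \<oplus>\<^bsub>IM A\<^esub> g) = act (IM A) a f \<oplus>\<^bsub>IM A\<^esub> act (IM A) a g" if "g : carrier (IM A)" for g
   using HH_act(4)[OF fH FM_HC p(1)] that by (simp add: p(2))
  fix b assume "b : cl ` KS"
  then obtain r where r: "r : KS" "b = cl r" by blast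
  show "act (IM A) (a [++] b) f = act (IM A) a f \<oplus>\<^bsub>IM A\<^esub> act (IM A) b f"
   using HH_act(2)[OF fH p(1) r(1)] by (simp add: p(2) r(2) cl_ops KS_S p(1) r(1))
  show "act (IM A) (a [.] b) f = act (IM A) a (act (IM A) b f)"
   using HH_act(1)[OF fH p(1) r(1)] by (simp add: p(2) r(2) cl_ops KS_S p(1) r(1))
 qed (rule module_IM(1))
 moreover have "span_in (IM A) {act (IM A) a v | a v. a : RgK q s & v : carrier (IM A)} = carrier (IM A)"
 proof
  have "submodule (carrier (IM A)) complex_ring (IM A)"
   unfolding submodule_iff[OF module_IM(1)] using FM_closed by simp
  moreover have "{act (IM A) a v | a v. a : RgK q s & v : carrier (IM A)} <= carrier (IM A)"
   using FM_act[OF A] by (auto elim!: RgK_cases)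
  ultimately show "span_in (IM A) {act (IM A) a v | a v. a : RgK q s & v : carrier (IM A)} <= carrier (IM A)"
   unfolding span_in_def by blast
  have "f : {act (IM A) a v | a v. a : RgK q s & v : carrier (IM A)}" if f: "f : FM A" for f
  proof -
   have fin: "finite (hs f)" using f by (simp add: FM_def)
   have "f = act (IM A) (cl (eset (hs f))) f" using local_unit_HH[OF FM_HC[OF f] fin] by simp
   thus ?thesis using f cl_RgK[OF KS_closed(6)[OF fin]] by auto
  qed
  thus "carrier (IM A) <= span_in (IM A) {act (IM A) a v | a v. a : RgK q s & v : carrier (IM A)}"
   unfolding span_in_def by auto
 qed
 ultimately show ?thesis by (simp add: gk_module_def)
qed

end

context induced
begin

text \<open>A nonzero submodule contains some $\zeta_n$ (apply $e_n$), and from there all others.\<close>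

lemma IM_simple:
 assumes A: "stable_set A" and ne: "A ~= {}" shows "gk_simple q s (IM A)"
proof -
 have AZ: "A <= Zpar ep" using A by (simp add: stable_set_def)
 have io: "n + 2 : A <-> chA n ~= 0" "n - 2 : A <-> chM n ~= 0" if "n : A" for n
  using A that unfolding stable_set_def by blast+
 have conv: "k : A" if "m : A" "n : A" "m <= k" "k <= n" "even (k - m)" for k m n
  using A that unfolding stable_set_def by blast
 have par: "even (m - n)" if "m : A" "n : A" for m n
  using AZ that by (auto simp: Zpar_def split: if_splits)
 have "W = {hzero} \<or> W = FM A" if sub: "gk_submodule q s W (IM A)" for W
 proof (cases "W <= {hzero}")
  case True
  thus ?thesis using sub by (auto simp: gk_submodule_def submodule_iff[OF module_IM(1)])
 next
  case False
  have W: "W <= FM A" "hzero : W" "!!f g. f : W ==> g : W ==> f [+] g : W" "!!c f. f : W ==> c [*] f : W"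
   "!!p f. p : KS ==> f : W ==> act HH (cl p) f : W"
   using sub by (auto simp: gk_submodule_def submodule_iff[OF module_IM(1)] cl_RgK)
  have div: "f : W" if "c [*] f : W" "c ~= 0" "f : carrier HH" for c f
  proof -
   have "inverse c [*] (c [*] f) = f"
    by (rule HH_eqI) (use that(2,3) HH_closed(2) in "auto simp: HH_val")
   thus ?thesis using W(4)[OF that(1), of "inverse c"] by simp
  qed
  obtain f where f: "f : W" "f ~= hzero" using False by blast
  hence fA: "f : FM A" using W(1) by blast
  have "EX n. f (cl (ge n)) ~= 0"
  proof (rule ccontr)
   assume "~ ?thesis"
   hence "f = hzero"
    by (intro HC_determined FM_HC[OF fA] FM_HC[OF FM_closed(1)]) (simp add: HH_val KS_closed(7))
   thus False using f(2) by simp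
  qed
  then obtain n where n: "f (cl (ge n)) ~= 0" by blast
  hence nA: "n : A" using fA by (auto simp: FM_def hs_def)
  have zH: "zet k : carrier HH" if "k : A" for k using zet_HC that AZ by auto
  have "zet n : W"
   using div[OF _ n zH[OF nA]] W(5)[OF KS_closed(7) f(1), of n] act_ge[OF FM_HC[OF fA]] nA AZ by auto
  have up: "zet (k + 2) : W" if "k : A" "k + 2 : A" "zet k : W" for k
proof -
   have "k : Zpar ep" using that(1) AZ by auto
   from zet_act(1)[OF this] have "chA k [*] zet (k + 2) : W"
    using W(5)[OF KS_closed(8)[OF L3_S(2)] that(3), of k k] by simp
   moreover have "chA k ~= 0" using io(1)[OF that(1)] that(2) by blast
   ultimately show ?thesis by (rule div[OF _ _ zH[OF that(2)]])
  qed
  have down: "zet (k - 2) : W" if "k : A" "k - 2 : A" "zet k : W" for k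
proof -
   have "k : Zpar ep" using that(1) AZ by auto
   from zet_act(2)[OF this] have "chM k [*] zet (k - 2) : W"
    using W(5)[OF KS_closed(8)[OF L3_S(3)] that(3), of k k] by simp
   moreover have "chM k ~= 0" using io(2)[OF that(1)] that(2) by blast
   ultimately show ?thesis by (rule div[OF _ _ zH[OF that(2)]])
  qed
  have ups: "n + 2 * int j : A --> zet (n + 2 * int j) : W" for j
  proof (induction j)
   case (Suc j)
   show ?case
   proof
    assume a: "n + 2 * int (Suc j) : A"
    have "n + 2 * int j : A" by (rule conv[OF nA a]) auto
    thus "zet (n + 2 * int (Suc j)) : W" using up[of "n + 2 * int j"] Suc a by (simp add: algebra_simps)
   qed
  qed (simp add: `zet n : W`)
  have downs: "n - 2 * int j : A --> zet (n - 2 * int j) : W" for j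
  proof (induction j)
   case (Suc j)
   show ?case
   proof
    assume a: "n - 2 * int (Suc j) : A"
    have "n - 2 * int j : A" by (rule conv[OF a nA]) auto
    thus "zet (n - 2 * int (Suc j)) : W" using down[of "n - 2 * int j"] Suc a by (simp add: algebra_simps)
   qed
  qed (simp add: `zet n : W`)
  have "zet k : W" if k: "k : A" for k
  proof -
   obtain d where d: "k - n = 2 * d" using par[OF k nA] by (rule evenE)
   show ?thesis
   proof (cases "d \<ge> 0")
    case True
    thus ?thesis using ups[of "nat d"] d k by (simp add: algebra_simps)
   next
    case False
    hence "k = n - 2 * int (nat (- d))" using d by simp
    thus ?thesis using downs[of "nat (- d)"] k by metis
   qed
  qed
  hence "FM A <= W" by (intro FM_span[OF AZ W(2-4)])
  thus ?thesis using W(1) by blast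
 qed
 moreover have "gk_submodule q s {hzero} (IM A)"
 proof -
  have "hzero [+] hzero = hzero" "c [*] hzero = hzero" for c by (auto simp: HH_ops)
  thus ?thesis
   unfolding gk_submodule_def submodule_iff[OF module_IM(1)] using FM_closed(1) act_zero by (auto elim!: RgK_cases)
 qed
 moreover have "{hzero} ~= FM A"
 proof -
  obtain n where n: "n : A" using ne by blast
  have "zet n (cl (ge n)) ~= hzero (cl (ge n))" by (simp add: zet_ge HH_val KS_closed(7))
  thus ?thesis using zet_FM[OF n AZ] by (metis singletonD)
 qed
 ultimately show ?thesis
  using IM_gk_module[OF A] unfolding gk_simple_def by auto
qed

lemma IM_gspec:
 assumes A: "A <= Zpar ep" shows "gspec (IM A) = A \<times> {lam + inverse lam}"
proof (rule equalityI; rule subsetI)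
 fix x assume "x : gspec (IM A)"
 then obtain n om f where x: "x = (n, om)" and f: "f : FM A" "f ~= hzero" "act HH (cl (ge n)) f = f" "act HH (cl (Om * ge n)) f = om [*] f"
  by (auto simp: gspec_def)
 note fH = FM_HC[OF f(1)]
 have ne: "f (cl (ge n)) ~= 0"
 proof
  assume z: "f (cl (ge n)) = 0"
  have "f = hzero"
  proof (rule HC_determined[OF fH FM_HC[OF FM_closed(1)]])
   fix m
   have "f (cl (ge m)) = f (cl (ge m * ge n))" using f(3) HH_val(4)[OF KS_closed(7) XYZ_S(5), of n f m] by simp
   also have "... = 0" using eqv_cl[OF gD_ge(1)[of "dl m" n]] HC_D(3)[OF fH KS_closed(7)] z by simp
   finally show "f (cl (ge m)) = hzero (cl (ge m))" by (simp add: HH_val KS_closed(7))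
  qed
  thus False using f(2) by simp
 qed
 hence "n : A" using f(1) by (auto simp: FM_def hs_def)
 moreover have "om * f (cl (ge n)) = (lam + inverse lam) * f (cl (ge n))"
 proof -
  have "om * f (cl (ge n)) = act HH (cl (Om * ge n)) f (cl (ge n))" unfolding f(4) by (simp add: HH_val KS_closed(7))
  also have "... = f (cl (ge n * (Om * ge n)))" by (rule HH_val(4)[OF KS_closed(7) KS_S[OF OmK(1)]])
  also have "... = f (cl (Om * ge n))" using eqv_cl[OF ge_on_weight[OF Om_commute(3)[OF Wl_ge]]] by simp
  also have "... = (lam + inverse lam) * f (cl (ge n))" by (rule HC_shift(3)[OF fH KS_closed(7) Wl_ge])
  finally show ?thesis .
 qed
 ultimately show "x : A \<times> {lam + inverse lam}" using ne x by simp
next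
 fix x assume "x : A \<times> {lam + inverse lam}"
 then obtain n where x: "x = (n, lam + inverse lam)" "n : A" by auto
 have nZ: "n : Zpar ep" using x(2) A by auto
 have "zet n ~= hzero"
 proof
  assume "zet n = hzero"
  hence "zet n (cl (ge n)) = hzero (cl (ge n))" by simp
  thus False by (simp add: zet_ge HH_val KS_closed(7))
 qed
 moreover have "1 [*] zet n = zet n"
  by (rule HH_eqI[OF HH_closed(2)[OF zet_HC[OF nZ]] zet_HC[OF nZ]]) (simp add: HH_val)
 hence "act HH (cl (ge n)) (zet n) = zet n"
  using act_ge[OF zet_HC[OF nZ] nZ] by (simp add: zet_ge)
 ultimately show "x : gspec (IM A)"
  using zet_FM[OF x(2) A] zet_act(3)[OF nZ] by (auto simp: gspec_def x(1) intro!: bexI[of _ "zet n"])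
qed

lemma FM_Zpar: "FM (Zpar ep) = FM UNIV"
 using HC_parity by (auto simp: FM_def hs_def)

lemma Ind_char_IM: "Ind_char q s ep lam = IM (Zpar ep)"
proof -
 let ?S = "{act HH a f | a f. a : RgK q s & f : carrier HH}"
 have "span_in HH ?S = FM UNIV"
 proof
  have "submodule (FM UNIV) complex_ring HH"
   unfolding submodule_iff[OF module_IM(2)] using FM_closed FM_HC by auto
  moreover have "?S <= FM UNIV" using hs_act HH_closed(4) by (auto simp: FM_def elim!: RgK_cases)
  ultimately show "span_in HH ?S <= FM UNIV" unfolding span_in_def by blast
  have "f : ?S" if f: "f : FM UNIV" for f
  proof -
   have fin: "finite (hs f)" using f by (simp add: FM_def)
   have "f = act HH (cl (eset (hs f))) f" using local_unit_HH[OF FM_HC[OF f] fin] by simp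
   thus ?thesis using FM_HC[OF f] cl_RgK[OF KS_closed(6)[OF fin]] by blast
  qed
  thus "FM UNIV <= span_in HH ?S" unfolding span_in_def by auto
 qed
 thus ?thesis by (simp add: Ind_char_def Ind_def Let_def FM_Zpar)
qed

lemma zeta_zet: "n : Zpar ep ==> zeta q s ep lam n = zet n"
 unfolding zeta_def Ind_char_IM inK_e
proof (rule the_equality)
 assume n: "n : Zpar ep"
 show "zet n : carrier (IM (Zpar ep)) & (ALL m. zet n (cl (ge m)) = (if m = n then 1 else 0))"
  using zet_FM[OF n order.refl] by (simp add: zet_ge)
 fix f assume f: "f : carrier (IM (Zpar ep)) & (ALL m. f (cl (ge m)) = (if m = n then 1 else 0))"
 thus "f = zet n" by (intro HC_determined zet_HC[OF n]) (auto simp: zet_ge FM_HC)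
qed

lemma zeta_span_IM: "A <= Zpar ep ==> zeta_span q s ep lam A = IM A"
proof -
 assume A: "A <= Zpar ep"
 have z: "zeta q s ep lam ` A = zet ` A" using zeta_zet A by (intro image_cong) auto
 have "span_in (IM (Zpar ep)) (zet ` A) = FM A"
 proof
  have "submodule (FM A) complex_ring (IM (Zpar ep))"
   unfolding submodule_iff[OF module_IM(1)] using FM_closed A by (auto simp: FM_def)
  thus "span_in (IM (Zpar ep)) (zet ` A) <= FM A"
   unfolding span_in_def using zet_FM[OF _ A] by blast
  show "FM A <= span_in (IM (Zpar ep)) (zet ` A)"
   unfolding span_in_def
  proof (rule Inter_greatest)
   fix W assume "W : {W. submodule W complex_ring (IM (Zpar ep)) & zet ` A <= W}"
   thus "FM A <= W" by (intro FM_span[OF A]) (auto simp: submodule_iff[OF module_IM(1)])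
  qed
 qed
 thus ?thesis by (simp add: zeta_span_def Ind_char_IM z)
qed

text \<open>Zeros of the coefficients.\<close>

lemma ch_zero: "chA n = 0 <-> lam = qp (- n - 1) \<or> lam = - qp (- n - 1)" "chM n = 0 <-> lam = qp (n - 1) \<or> lam = - qp (n - 1)"
proof -
 have sq: "x - inverse x = 0 <-> x = 1 \<or> x = -1" if "x ~= 0" for x :: complex
  using that by (metis eq_iff_diff_eq_0 inverse_eq_1_iff inverse_minus_eq inverse_unique mult_eq_1_iff square_eq_1_iff right_inverse)
 have d: "qp k * lam = z <-> lam = z * qp (- k)" for k z by (auto simp: qp_minus field_simps)
 have e: "- (n + 1) = - n - 1" "- (1 - n) = n - 1" by simp_all
 show "chA n = 0 <-> lam = qp (- n - 1) \<or> lam = - qp (- n - 1)"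
  using sq[of "qp (n + 1) * lam"] lam0 d[of "n + 1" 1] d[of "n + 1" "-1"] unfolding chA_def e by simp
 show "chM n = 0 <-> lam = qp (n - 1) \<or> lam = - qp (n - 1)"
  using sq[of "qp (1 - n) * lam"] lam0 d[of "1 - n" 1] d[of "1 - n" "-1"] unfolding chM_def e by simp
qed

end

section \<open>The classification\<close>

context quantum
begin

text \<open>The parameters $\lambda$ for which no coefficient vanishes.\<close>

definition generic :: "int => complex => bool" where
 "generic e lam <-> lam ~= 0 & (ALL n:Zpar (- e). lam ~= qp n & lam ~= - qp n)"

text \<open>The set of indices and the eigenvalue of the Casimir element of the module of a label.\<close>

fun supp :: "label => int set" where
 "supp (L_Ind e lam) = Zpar e"
| "supp (L_Dplus sg n) = {m. odd (m - int n) & m > int n}"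
| "supp (L_Dminus sg n) = {m. odd (m - int n) & m < - int n}"
| "supp (L_Q sg n) = {m. odd (m - int n) & \<bar>m\<bar> < int n}"

fun casimir :: "label => complex" where
 "casimir (L_Ind e lam) = lam + inverse lam"
| "casimir (L_Dplus sg n) = of_int sg * (qp (int n) + inverse (qp (int n)))"
| "casimir (L_Dminus sg n) = of_int sg * (qp (int n) + inverse (qp (int n)))"
| "casimir (L_Q sg n) = of_int sg * (qp (int n) + inverse (qp (int n)))"

lemma inducedI: "e : {1, -1} ==> lam ~= 0 ==> EX T. induced q s e lam T"
 by (rule exI[of _ "csqrt (lam * cq)"])
  (auto simp: induced_def induced_axioms_def quantum_axioms)

lemma induced_label:
 assumes e: "e : {1, -1}" "lam ~= 0" and A: "A <= Zpar e" "A ~= {}"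
  and up: "!!n. n : A ==> n + 2 : A <-> ~ (lam = qp (- n - 1) \<or> lam = - qp (- n - 1))"
  and dn: "!!n. n : A ==> n - 2 : A <-> ~ (lam = qp (n - 1) \<or> lam = - qp (n - 1))"
  and conv: "!!m n k. m : A ==> n : A ==> m <= k ==> k <= n ==> even (k - m) ==> k : A"
 shows "gk_simple q s (zeta_span q s e lam A)" "gspec (zeta_span q s e lam A) = A \<times> {lam + inverse lam}"
  "A = Zpar e ==> zeta_span q s e lam A = Ind_char q s e lam"
proof -
 obtain T where "induced q s e lam T" using inducedI[OF e] by blast
 then interpret I: induced q s e lam T .
 have "I.stable_set A" unfolding I.stable_set_def I.ch_zero using A(1) up dn conv by blast
 thus "gk_simple q s (zeta_span q s e lam A)" "gspec (zeta_span q s e lam A) = A \<times> {lam + inverse lam}"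
  "A = Zpar e ==> zeta_span q s e lam A = Ind_char q s e lam"
  using I.zeta_span_IM[OF A(1)] I.IM_simple[OF _ A(2)] I.IM_gspec[OF A(1)] I.Ind_char_IM by simp_all
qed

lemma qp_pos: "EX r>0. qp n = complex_of_real r"
 using q_pos by (intro exI[of _ "q powi n"]) (simp add: qp_def)

lemma qp_ne_minus: "qp m ~= - qp n"
proof
 assume e: "qp m = - qp n"
 obtain r r' where "r > 0" "r' > 0" "qp m = of_real r" "qp n = of_real r'" using qp_pos by metis
 hence "complex_of_real (r + r') = 0" using e by simp
 thus False using `r > 0` `r' > 0` by (simp only: of_real_eq_0_iff)
qed

lemma sigma_qp_eq: "sg : {-1, 1} ==> sg' : {-1, 1} ==> of_int sg * qp m = of_int sg' * qp n <-> sg = sg' & m = n"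
 using qp_ne_minus[of m n] qp_ne_minus[of n m] by auto

lemma generic_iff: "generic e lam <-> lam ~= 0 & (ALL n:Zpar (- e). ALL sg:{-1, 1}. lam ~= of_int sg * qp n)"
 by (auto simp: generic_def)

lemma cmod_qp: "cmod (of_int sg * qp n) = 1 <-> n = 0" if "sg : {-1, 1}" for sg
proof -
 have "cmod (of_int sg * qp n) = q powi n" using that q_pos by (auto simp: qp_def norm_mult norm_power_int)
 thus ?thesis using q_powi_inj[of n 0] by auto
qed

text \<open>On the unit circle, the parameters \<open>\<plusminus>q\<^sup>n\<close> are \<open>\<plusminus>1\<close>.\<close>

lemma Ind_labels: "L_Ind e lam : labels q <-> e : {-1, 1} & generic e lam & (cmod lam < 1 \<or> cmod lam = 1 & Im lam \<ge> 0)"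
proof -
 have g: "generic e lam <-> lam ~= 0 & (ALL n:Zpar (- e). lam ~= of_real (q powi n) & lam ~= - of_real (q powi n))"
  by (simp add: generic_def qp_def)
 have 1: "generic 1 lam" if "cmod lam = 1"
  unfolding generic_iff
 proof (intro conjI ballI notI)
  fix n and sg :: int assume "n : Zpar (- 1)" "sg : {-1, 1}" "lam = of_int sg * qp n"
  thus False using that cmod_qp[of sg n] by (auto simp: Zpar_def)
 qed (use that in auto)
 have 2: "generic (-1) lam <-> Im lam ~= 0" if "cmod lam = 1"
 proof
  assume "generic (-1) lam"
  hence "lam ~= qp 0" "lam ~= - qp 0" unfolding generic_def by (auto simp: Zpar_def simp del: qp_0)
  moreover have "lam = 1 \<or> lam = -1" if "Im lam = 0"
  proof -
   have "\<bar>Re lam\<bar> = 1" using `cmod lam = 1` that by (simp add: cmod_def)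
   hence "Re lam = 1 \<or> Re lam = -1" by auto
   thus ?thesis using that by (auto simp: complex_eq_iff)
  qed
  ultimately show "Im lam ~= 0" by auto
 next
  assume "Im lam ~= 0"
  thus "generic (-1) lam" unfolding generic_def by (auto simp: qp_def simp flip: of_real_power_int)
 qed
 have L: "L_Ind e lam : labels q <-> (e : {-1, 1} & generic e lam & cmod lam < 1)
   \<or> (e = 1 & cmod lam = 1 & Im lam \<ge> 0) \<or> (e = -1 & cmod lam = 1 & Im lam > 0)"
  unfolding g labels_def by simp
 show ?thesis
 proof (cases "cmod lam = 1")
  case True
  hence "(e = 1 & Im lam \<ge> 0) \<or> (e = -1 & Im lam > 0) <-> e : {-1, 1} & generic e lam & Im lam \<ge> 0"
  proof (cases "e = 1")
   case False
   thus ?thesis using 2[OF True] by (cases "e = -1") auto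
  qed (simp add: 1[OF True])
  thus ?thesis using L True by auto
 qed (simp add: L)
qed

lemma D_labels: "L_Dplus sg n : labels q <-> sg : {-1, 1}" "L_Dminus sg n : labels q <-> sg : {-1, 1}"
 "L_Q sg n : labels q <-> sg : {-1, 1} & n > 0"
 by (auto simp: labels_def)

lemma Zpar_power: "m : Zpar ((-1) ^ (n + 1)) <-> odd (m - int n)"
 by (cases "even n") (auto simp: Zpar_def)

lemma special_mod:
 assumes sg: "sg : {-1, 1}" and ne: "A ~= {}" and par: "!!m. m : A ==> odd (m - int n)" and k: "ka = int n \<or> ka = - int n"
  and up: "!!m. m : A ==> m + 2 : A <-> - m - 1 ~= ka" and dn: "!!m. m : A ==> m - 2 : A <-> m - 1 ~= ka"
  and conv: "!!i j m. i : A ==> j : A ==> i <= m ==> m <= j ==> even (m - i) ==> m : A"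
 shows "gk_simple q s (zeta_span q s ((-1) ^ (n + 1)) (of_int sg * qp ka) A) &
  gspec (zeta_span q s ((-1) ^ (n + 1)) (of_int sg * qp ka) A) = A \<times> {of_int sg * (qp (int n) + inverse (qp (int n)))}"
proof -
 let ?lam = "of_int sg * qp ka"
 have e: "(-1::int) ^ (n + 1) : {1, -1}" by (cases "even n") auto
 have AZ: "A <= Zpar ((-1) ^ (n + 1))" using par Zpar_power by blast
 have sq: "?lam = qp i \<or> ?lam = - qp i <-> i = ka" for i
  using sigma_qp_eq[OF sg, of 1 ka i] sigma_qp_eq[OF sg, of "-1" ka i] sg by auto
 have l0: "?lam ~= 0" using sg by auto
 have io: "m + 2 : A <-> ~ (?lam = qp (- m - 1) \<or> ?lam = - qp (- m - 1))"
  "m - 2 : A <-> ~ (?lam = qp (m - 1) \<or> ?lam = - qp (m - 1))" if "m : A" for m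
  unfolding sq using up[OF that] dn[OF that] by simp_all
 have "?lam + inverse ?lam = of_int sg * (qp (int n) + inverse (qp (int n)))"
  using sg k by (auto simp: qp_minus)
 moreover have "gk_simple q s (zeta_span q s ((-1) ^ (n + 1)) ?lam A)"
  by (rule induced_label(1)[OF e l0 AZ ne], erule io(1), erule io(2), rule conv)
 moreover have "gspec (zeta_span q s ((-1) ^ (n + 1)) ?lam A) = A \<times> {?lam + inverse ?lam}"
  by (rule induced_label(2)[OF e l0 AZ ne], erule io(1), erule io(2), rule conv)
 ultimately show ?thesis by simp
qed

lemma label_mod:
 assumes "l : labels q"
 shows "gk_simple q s (label_mod q s l) & gspec (label_mod q s l) = supp l \<times> {casimir l}"
proof (cases l)
 case (L_Ind e lam)
 hence l: "e : {1, -1}" "generic e lam" using assms by (auto simp: Ind_labels)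
 have ne: "(if e = 1 then 0 else 1) : Zpar e" by (simp add: Zpar_def)
 have l0: "lam ~= 0" using l(2) by (simp add: generic_def)
 have sh: "n + 2 : Zpar e" "n - 2 : Zpar e" if "n : Zpar e" for n using that by (auto simp: Zpar_def)
 have ex: "~ (lam = qp (- n - 1) \<or> lam = - qp (- n - 1))" "~ (lam = qp (n - 1) \<or> lam = - qp (n - 1))" if "n : Zpar e" for n
 proof -
  have "- n - 1 : Zpar (- e)" "n - 1 : Zpar (- e)" using that l(1) by (auto simp: Zpar_def)
  thus "~ (lam = qp (- n - 1) \<or> lam = - qp (- n - 1))" "~ (lam = qp (n - 1) \<or> lam = - qp (n - 1))"
   using l(2) unfolding generic_def by blast+
 qed
 have cv: "k : Zpar e" if "m : Zpar e" "n : Zpar e" "m <= k" "k <= n" "even (k - m)" for m n k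
  using that(1,5) by (auto simp: Zpar_def split: if_splits)
 have nE: "Zpar e ~= {}" using ne by blast
 have io: "n + 2 : Zpar e <-> ~ (lam = qp (- n - 1) \<or> lam = - qp (- n - 1))" "n - 2 : Zpar e <-> ~ (lam = qp (n - 1) \<or> lam = - qp (n - 1))"
  if "n : Zpar e" for n using sh[OF that] ex[OF that] by blast+
 have "zeta_span q s e lam (Zpar e) = Ind_char q s e lam"
  by (rule induced_label(3)[OF l(1) l0 order.refl nE], erule io(1), erule io(2), rule cv, assumption+, rule refl)
 moreover have "gk_simple q s (zeta_span q s e lam (Zpar e))"
  by (rule induced_label(1)[OF l(1) l0 order.refl nE], erule io(1), erule io(2), rule cv)
 moreover have "gspec (zeta_span q s e lam (Zpar e)) = Zpar e \<times> {lam + inverse lam}"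
  by (rule induced_label(2)[OF l(1) l0 order.refl nE], erule io(1), erule io(2), rule cv)
 ultimately show ?thesis by (simp add: L_Ind)
next
 case (L_Dplus sg n)
 hence sg: "sg : {-1, 1}" using assms by (simp_all add: D_labels)
 have "{m : Zpar ((-1) ^ (n + 1)). m > int n} = supp l" using Zpar_power L_Dplus by auto
 hence "label_mod q s l = zeta_span q s ((-1) ^ (n + 1)) (of_int sg * qp (int n)) (supp l)"
  by (simp only: L_Dplus label_mod.simps D_plus_def Let_def) (simp add: qp_nat)
 moreover have "int n + 1 : supp l" using L_Dplus sg by simp
 hence "supp l ~= {}" by blast
 hence "gk_simple q s (zeta_span q s ((-1) ^ (n + 1)) (of_int sg * qp (int n)) (supp l)) &
   gspec (zeta_span q s ((-1) ^ (n + 1)) (of_int sg * qp (int n)) (supp l)) = supp l \<times> {casimir l}"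
  unfolding L_Dplus casimir.simps
  by (intro special_mod[OF sg]; unfold supp.simps mem_Collect_eq; presburger?)
 ultimately show ?thesis by simp
next
 case (L_Dminus sg n)
 hence sg: "sg : {-1, 1}" using assms by (simp_all add: D_labels)
 have "{m : Zpar ((-1) ^ (n + 1)). m < - int n} = supp l" using Zpar_power L_Dminus by auto
 hence "label_mod q s l = zeta_span q s ((-1) ^ (n + 1)) (of_int sg * qp (int n)) (supp l)"
  by (simp only: L_Dminus label_mod.simps D_minus_def Let_def) (simp add: qp_nat)
 moreover have "- int n - 1 : supp l" using L_Dminus sg by simp
 hence "supp l ~= {}" by blast
 hence "gk_simple q s (zeta_span q s ((-1) ^ (n + 1)) (of_int sg * qp (int n)) (supp l)) &
   gspec (zeta_span q s ((-1) ^ (n + 1)) (of_int sg * qp (int n)) (supp l)) = supp l \<times> {casimir l}"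
  unfolding L_Dminus casimir.simps
  by (intro special_mod[OF sg]; unfold supp.simps mem_Collect_eq; presburger?)
 ultimately show ?thesis by simp
next
 case (L_Q sg n)
 hence sg: "sg : {-1, 1}" "n > 0" using assms by (simp_all add: D_labels)
 have "{m : Zpar ((-1) ^ (n + 1)). \<bar>m\<bar> < int n} = supp l" using Zpar_power L_Q by auto
 hence "label_mod q s l = zeta_span q s ((-1) ^ (n + 1)) (of_int sg * qp (- int n)) (supp l)"
  by (simp only: L_Q label_mod.simps Q_mod_def Let_def) (simp add: qp_def)
 moreover have "int n - 1 : supp l" using L_Q sg by simp
 hence "supp l ~= {}" by blast
 hence "gk_simple q s (zeta_span q s ((-1) ^ (n + 1)) (of_int sg * qp (- int n)) (supp l)) &
   gspec (zeta_span q s ((-1) ^ (n + 1)) (of_int sg * qp (- int n)) (supp l)) = supp l \<times> {casimir l}"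
  unfolding L_Q casimir.simps
  by (intro special_mod[OF sg(1)]; unfold supp.simps mem_Collect_eq abs_less_iff; presburger?)
 ultimately show ?thesis by simp
qed

lemma unit_inverse: "cmod x = 1 ==> inverse x = cnj x"
 by (rule inverse_unique) (simp flip: complex_norm_square)

lemma two_roots:
 fixes x y :: complex
 assumes "x ~= 0" "y ~= 0" "x + inverse x = y + inverse y" shows "x = y \<or> x = inverse y"
proof -
 have "(x - y) * (x - inverse y) = 0" using assms by (simp add: field_simps) algebra
 thus ?thesis by auto
qed

text \<open>Solve $\lambda+\lambda^{-1}=\omega$ with $|\lambda|\le1$. If $\lambda=\pm q^{k}$ is not generic, then \<open>m\<close> and \<open>k\<close> have
  opposite parity, and the position of \<open>m\<close> relative to \<open>|k|\<close> selects the label.\<close>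

lemma label_exists: "EX l:labels q. m : supp l & casimir l = om"
proof -
 define d where "d = csqrt (om\<^sup>2 / 4 - 1)"
 define x where "x = om / 2 + d"
 have "x * (om - x) = 1"
 proof -
  have "x * (om - x) = om\<^sup>2 / 4 - d\<^sup>2" by (simp add: x_def power2_eq_square field_simps)
  thus ?thesis by (simp add: d_def)
 qed
 hence x: "x ~= 0" "inverse x = om - x" by (auto simp: inverse_unique)
 define y where "y = (if cmod x < 1 \<or> cmod x = 1 & Im x \<ge> 0 then x else inverse x)"
 have "inverse (om - x) = x" by (simp flip: x(2))
 hence y: "y ~= 0" "y + inverse y = om" using x by (auto simp: y_def)
 have "cmod y < 1 \<or> cmod y = 1 & Im y \<ge> 0"
 proof (cases "cmod x < 1 \<or> cmod x = 1 & Im x \<ge> 0")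
  case False
  hence "cmod x > 1 \<or> cmod x = 1 & Im x < 0" by auto
  thus ?thesis
  proof
   assume "cmod x > 1"
   thus ?thesis using False by (simp add: y_def norm_inverse inverse_less_1_iff)
  next
   assume a: "cmod x = 1 & Im x < 0"
   hence "inverse x = cnj x" by (simp add: unit_inverse)
   thus ?thesis using a by (simp add: y_def)
  qed
 qed (simp add: y_def)
 note yn = this
 define e :: int where "e = (if even m then 1 else -1)"
 have e: "e : {-1, 1}" "m : Zpar e" by (auto simp: e_def Zpar_def)
 show ?thesis
 proof (cases "generic e y")
  case True
  thus ?thesis using yn y(2) e by (intro bexI[of _ "L_Ind e y"]) (auto simp: Ind_labels)
 next
  case False
  then obtain k sg where k: "k : Zpar (- e)" and sg: "sg : {-1, 1}" and yk: "y = of_int sg * qp k"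
   using y(1) unfolding generic_iff by blast
  define n where "n = nat \<bar>k\<bar>"
  have om: "om = of_int sg * (qp (int n) + inverse (qp (int n)))"
  proof -
   have "int n = k \<or> int n = - k" unfolding n_def by linarith
   hence "qp (int n) + inverse (qp (int n)) = qp k + inverse (qp k)" by (elim disjE) (simp_all add: qp_minus add.commute)
   moreover have "inverse y = of_int sg * inverse (qp k)" using sg unfolding yk by auto
   ultimately show ?thesis unfolding y(2)[symmetric] by (simp add: yk distrib_left)
  qed
  have "odd (m - k)" using k by (cases "even m") (simp_all add: Zpar_def e_def)
  hence od: "odd (m - int n)" unfolding n_def by (cases "k \<ge> 0") simp_all
  consider "m > int n" | "m < - int n" | "\<bar>m\<bar> <= int n" by linarith
  thus ?thesis
  proof cases
   case 1
   hence "m : supp (L_Dplus sg n)" using od by simp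
   moreover have "L_Dplus sg n : labels q" unfolding D_labels using sg by simp
   moreover have "casimir (L_Dplus sg n) = om" using om by simp
   ultimately show ?thesis by blast
  next
   case 2
   hence "m : supp (L_Dminus sg n)" using od by simp
   moreover have "L_Dminus sg n : labels q" unfolding D_labels using sg by simp
   moreover have "casimir (L_Dminus sg n) = om" using om by simp
   ultimately show ?thesis by blast
  next
   case 3
   have "\<bar>m\<bar> ~= int n"
   proof
    assume "\<bar>m\<bar> = int n"
    hence "m = int n \<or> m = - int n" by linarith
    thus False using od by (elim disjE) simp_all
   qed
   hence "\<bar>m\<bar> < int n" using 3 by linarith
   hence "m : supp (L_Q sg n)" using od by simp
   moreover have "L_Q sg n : labels q" unfolding D_labels using sg `\<bar>m\<bar> < int n` by auto
   moreover have "casimir (L_Q sg n) = om" using om by simp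
   ultimately show ?thesis by blast
  qed
 qed
qed

lemma special_casimir:
 assumes "sg : {-1, 1}" "sg' : {-1, 1}"
  "of_int sg * (qp (int n) + inverse (qp (int n))) = of_int sg' * (qp (int n') + inverse (qp (int n')))"
 shows "sg = sg' & n = n'"
proof -
 have i: "inverse (of_int \<tau> * qp k) = of_int \<tau> * qp (- k)" if "\<tau> : {-1, 1}" for \<tau> k using that by (auto simp: qp_minus)
 have "of_int sg * qp (int n) + inverse (of_int sg * qp (int n)) = of_int sg' * qp (int n') + inverse (of_int sg' * qp (int n'))"
  using assms(3) unfolding i[OF assms(1)] i[OF assms(2)] by (simp add: qp_minus distrib_left)
 from two_roots[OF _ _ this] have "of_int sg * qp (int n) = of_int sg' * qp (int n') \<or> of_int sg * qp (int n) = of_int sg' * qp (- int n')"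
  using assms(1,2) i[OF assms(2)] by auto
 thus ?thesis unfolding sigma_qp_eq[OF assms(1,2)] by auto
qed

text \<open>The parameter $\lambda$ is determined by $\omega$ up to inversion, and inversion is excluded by the bound
  on $|\lambda|$ or, on the unit circle, by the sign of the imaginary part.\<close>

lemma label_unique:
 assumes "l : labels q" "l' : labels q" "m : supp l" "m : supp l'" "casimir l = casimir l'"
 shows "l = l'"
proof -
 have mixed: False
  if g: "L_Ind e lam : labels q" "m : Zpar e" "sg : {-1, 1}" "odd (m - int n)"
   "lam + inverse lam = of_int sg * (qp (int n) + inverse (qp (int n)))" for e lam sg n
 proof -
  have ge: "e : {-1, 1}" "generic e lam" using g(1) by (auto simp: Ind_labels)
  have i: "inverse (of_int sg * qp (int n)) = of_int sg * qp (- int n)" using g(3) by (auto simp: qp_minus)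
  have "lam + inverse lam = of_int sg * qp (int n) + inverse (of_int sg * qp (int n))"
   unfolding i g(5) by (simp add: qp_minus distrib_left)
  from two_roots[OF _ _ this] have "lam = of_int sg * qp (int n) \<or> lam = of_int sg * qp (- int n)"
   using ge(2) g(3) i by (auto simp: generic_def)
  moreover have "int n : Zpar (- e)" "- int n : Zpar (- e)" using g(2,4) ge(1) by (auto simp: Zpar_def)
  ultimately show False using ge(2) g(3) unfolding generic_iff by blast
 qed
 have ind: "L_Ind e lam = L_Ind e' lam'"
  if g: "L_Ind e lam : labels q" "L_Ind e' lam' : labels q" "m : Zpar e" "m : Zpar e'" "lam + inverse lam = lam' + inverse lam'" for e lam e' lam'
 proof -
  have e: "e : {-1, 1}" "e' : {-1, 1}" "lam ~= 0" "lam' ~= 0" using g(1,2) by (auto simp: Ind_labels generic_def)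
  have n: "cmod lam < 1 \<or> cmod lam = 1 & Im lam \<ge> 0" "cmod lam' < 1 \<or> cmod lam' = 1 & Im lam' \<ge> 0" using g(1,2) by (auto simp: Ind_labels)
  have ee: "e = e'" using e(1,2) g(3,4) by (auto simp: Zpar_def)
  show ?thesis
  proof (cases "lam = lam'")
   case False
   hence li: "lam = inverse lam'" using two_roots[OF e(3,4) g(5)] by simp
   hence p: "cmod lam * cmod lam' = 1" using e(4) by (simp flip: norm_mult)
   have "cmod lam = 1 & cmod lam' = 1"
   proof -
    have "cmod lam <= 1" "cmod lam' <= 1" "0 < cmod lam" "0 < cmod lam'" using n e by auto
    moreover have "cmod lam * cmod lam' <= cmod lam * 1" "cmod lam * cmod lam' <= 1 * cmod lam'"
     using calculation by (auto intro: mult_left_mono mult_right_mono)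
    ultimately show ?thesis using p by auto
   qed
   hence u: "cmod lam' = 1" "Im lam \<ge> 0" "Im lam' \<ge> 0" using n by auto
   have "lam = cnj lam'" unfolding li using u(1) by (rule unit_inverse)
   hence "Im lam' = 0" using u by simp
   thus ?thesis using `lam = cnj lam'` False by (simp add: complex_eq_iff)
  qed (simp add: ee)
 qed
 let ?special = "%l. ALL e lam. l ~= L_Ind e lam"
 have S: "EX sg n. sg : {-1, 1} & odd (m - int n) & casimir k = of_int sg * (qp (int n) + inverse (qp (int n))) &
   k = (if m > int n then L_Dplus sg n else if m < - int n then L_Dminus sg n else L_Q sg n)"
  if "k : labels q" "m : supp k" "?special k" for k
 proof (cases k)
  case (L_Ind e lam)
  thus ?thesis using that(3) by blast
 next
  case (L_Dplus sg n)
  thus ?thesis using that(1,2) by (intro exI[of _ sg] exI[of _ n]) (simp add: D_labels)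
 next
  case (L_Dminus sg n)
  thus ?thesis using that(1,2) by (intro exI[of _ sg] exI[of _ n]) (simp add: D_labels)
 next
  case (L_Q sg n)
  moreover have "~ m > int n" "~ m < - int n" using that(2) L_Q by auto
  ultimately show ?thesis using that(1,2) by (intro exI[of _ sg] exI[of _ n]) (simp add: D_labels)
 qed
 have IS: False if g: "L_Ind e lam : labels q" "m : Zpar e" "k : labels q" "m : supp k" "?special k" "casimir k = lam + inverse lam" for e lam k
 proof -
  obtain sg n where "sg : {-1, 1}" "odd (m - int n)" "casimir k = of_int sg * (qp (int n) + inverse (qp (int n)))"
   using S[OF g(3-5)] by blast
  thus ?thesis using mixed[OF g(1,2), of sg n] g(6) by simp
 qed
 consider e lam e' lam' where "l = L_Ind e lam" "l' = L_Ind e' lam'" | e lam where "l = L_Ind e lam" "?special l'"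
  | e lam where "l' = L_Ind e lam" "?special l" | "?special l" "?special l'" by blast
 thus ?thesis
 proof cases
  case (1 e lam e' lam')
  thus ?thesis using ind assms by simp
 next
  case (2 e lam)
  thus ?thesis using IS[of e lam l'] assms by simp
 next
  case (3 e lam)
  thus ?thesis using IS[of e lam l] assms by simp
 next
  case 4
  obtain sg n where a: "sg : {-1, 1}" "casimir l = of_int sg * (qp (int n) + inverse (qp (int n)))"
   "l = (if m > int n then L_Dplus sg n else if m < - int n then L_Dminus sg n else L_Q sg n)"
   using S[OF assms(1,3) 4(1)] by blast
  obtain sg' n' where b: "sg' : {-1, 1}" "casimir l' = of_int sg' * (qp (int n') + inverse (qp (int n')))"
   "l' = (if m > int n' then L_Dplus sg' n' else if m < - int n' then L_Dminus sg' n' else L_Q sg' n')"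
   using S[OF assms(2,4) 4(2)] by blast
  have "sg = sg' & n = n'" using assms(5) unfolding a(2) b(2) by (rule special_casimir[OF a(1) b(1)])
  thus ?thesis using a(3) b(3) by simp
 qed
qed

end

theorem theorem7p3:
  fixes q s :: real
  assumes "q > 0" and "q \<noteq> 1" and "s ^ 2 = q"
  shows "(\<forall>l\<in>labels q. gk_simple q s (label_mod q s l)) \<and>
    (\<forall>V :: (gq, 'v) amod. gk_simple q s V \<longrightarrow>
       (\<exists>!l. l \<in> labels q \<and> gk_equiv q s V (label_mod q s l)))"
proof -
 interpret quantum q s using assms by unfold_locales
 note L = label_mod[THEN conjunct1] and G = label_mod[THEN conjunct2]
 show ?thesis
 proof (intro conjI ballI allI impI)
  show "gk_simple q s (label_mod q s l)" if "l : labels q" for l by (rule L[OF that])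
  fix V :: "(gq, 'v) amod" assume V: "gk_simple q s V"
  interpret V: gk_simple_mod q s V by (rule gk_simple_modI[OF quantum_axioms V])
  obtain m om where mo: "(m, om) : gspec V" using V.gspec_nonempty by auto
  obtain l where l: "l : labels q" "m : supp l" "casimir l = om" using label_exists by blast
  show "EX! l. l : labels q & gk_equiv q s V (label_mod q s l)"
  proof (rule ex1I[of _ l])
   have "(m, om) : gspec (label_mod q s l)" using G[OF l(1)] l by simp
   thus "l : labels q & gk_equiv q s V (label_mod q s l)"
    using simple_equiv[OF V L[OF l(1)] mo] l(1) by simp
   fix l' assume l': "l' : labels q & gk_equiv q s V (label_mod q s l')"
   hence "gspec V = supp l' \<times> {casimir l'}"
    using gspec_invariant[OF V L] G by blast
   hence "m : supp l'" "casimir l' = om" using mo by auto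
   thus "l' = l" using label_unique l l' by blast
  qed
 qed
qed

end
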